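(* Let $RW(r,s)$ be the free $\bigwedge[\boldsymbol\partial]$-module with even generators $a_1,\dots,a_r$ and odd generators $a_{r+1},\dots,a_{r+s}$, all of degree $-2$, with $\boldsymbol\lambda$-bracket given by $$[{a_i}_{\boldsymbol\lambda}a_j]=(\partial_i+\lambda_i)a_j+a_i\lambda_j,\qquad i,j=1,\dots,r+s,$$ and extended to all of $RW(r,s)$ by the sesquilinearity rules $[(\partial_ia)_{\boldsymbol\lambda}b]=-\lambda_i[a_{\boldsymbol\lambda}b]$ and $[a_{\boldsymbol\lambda}(b\partial_i)]=[a_{\boldsymbol\lambda}b](\partial_i+\lambda_i)$. Then $RW(r,s)$ is a $\mathbb Z$-graded Lie conformal superalgebra of type $(r,s)$ satisfying conditions (1)–(4) of the context.
   Context: Conventions. $\mathbb F$ is an algebraically closed field of characteristic $0$; $r,s\ge0$ are integers. In every set of variables $\lambda_1,\dots,\lambda_{r+s}$, $\mu_i$, $\partial_i$, $y_i$, those with index $\le r$ are even ($p_i=0$), those with index $>r$ are odd ($p_i=1$); bold letters denote the whole set. $\bigwedge[\boldsymbol\lambda]=\mathbb F[\lambda_1,\dots,\lambda_r]\otimes\bigwedge(\lambda_{r+1},\dots,\lambda_{r+s})$, similarly for the other sets; $\bigwedge[[\boldsymbol y]]$ is the completion (power series). $p(\cdot)$ is parity; the Koszul sign rule is used throughout, e.g. $a\lambda_i=(-1)^{p_ip(a)}\lambda_ia$. A Lie conformal superalgebra of type $(r,s)$ is a $\mathbb Z/2$-graded $\bigwedge[\boldsymbol\partial]$-bimodule $R$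 with $a\partial_i=(-1)^{p_ip(a)}\partial_ia$ and a $\mathbb Z/2$-graded linear $\boldsymbol\lambda$-bracket $R\otimes R\to\bigwedge[\boldsymbol\lambda]\otimes R$ with $[(\partial_ia)_{\boldsymbol\lambda}b]=-\lambda_i[a_{\boldsymbol\lambda}b]$, $[a_{\boldsymbol\lambda}(b\partial_i)]=[a_{\boldsymbol\lambda}b](\partial_i+\lambda_i)$, $[b_{\boldsymbol\lambda}a]=-(-1)^{p(a)p(b)}[a_{-\boldsymbol\lambda-\boldsymbol\partial}b]$, $[a_{\boldsymbol\lambda}[b_{\boldsymbol\mu}c]]=[[a_{\boldsymbol\lambda}b]_{\boldsymbol\lambda+\boldsymbol\mu}c]+(-1)^{p(a)p(b)}[b_{\boldsymbol\mu}[a_{\boldsymbol\lambda}c]]$. For a finite sequence $K=(k_1,\dots,k_t)$ in $\{1,\dots,r+s\}$: $\ell(K)=t$, $\lambda_K=\lambda_{k_1}\cdots\lambda_{k_t}$ (similarly $y_K$, $(\partial_{\boldsymbol y})_K$), $p_K=\sum p_{k_j}$, $f(K)=\prod_i m_i(K)!$ with $m_i(K)$ the multiplicity of $i$; $S_{r,s}$ is a set of representatives of sequences up to permutation. The products $(a_Kb)$ are determined by $(a_Kb)=0$ if $\lambda_K=0$, $\lambda_J(a_Jb)=\lambda_K(a_Kb)$ if $J$ is a permutation of $K$, and $[a_{\boldsymbol\lambda}b]=\sum_{K\in S_{r,s}}\frac{\lambda_K}{f(K)}(a_Kb)$. Annihilation algebra: $\mathcal A(R)=\tilde R/\sum_i(\partial_i+\partial_{y_i})\tilde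 R$, $\tilde R=R\otimes\bigwedge[[\boldsymbol y]]$, with (continuous) bracket $[y_Ma,by_N]=\sum_{J\in S_{r,s}}\frac1{f(J)}(y_M(\partial_{\boldsymbol y})_J)(a_Jb)y_N$, where derivatives act on $y_M$ from the right: $y_M\partial_{y_i}=(-1)^{p_ip_M}\partial_{y_i}(y_M)$. $R$ is $\mathbb Z$-graded if $\bigwedge[\boldsymbol\lambda]\otimes R=\bigoplus_{d\in\mathbb Z}(\bigwedge[\boldsymbol\lambda]\otimes R)_d$ with $\deg(\lambda_ia)=\deg(\partial_ia)=\deg a-2$ and $\deg[a_{\boldsymbol\lambda}b]=\deg a+\deg b$; then $\mathcal A(R)$ is $\mathbb Z$-graded by $\deg(ay_M)=\deg a+2\ell(M)$. Conditions: (1) $R$ is $\mathbb Z$-graded; (2) the induced gradation of $\mathcal A(R)$ has depth at most $3$; (3) $\mathcal A(R)_{-1}$ and $\mathcal A(R)_{-3}$ are purely odd; (4) $\mathrm{ad}:\mathcal A(R)_{-2}\to\mathrm{der}(\mathcal A(R))$ is injective with image $D=\langle\partial_{y_1},\dots,\partial_{y_{r+s}}\rangle$ (span of the derivations of $\mathcal A(R)$ induced by $\partial_{y_i}$). *)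

theory Defs
  imports
    "HOL-Computational_Algebra.Polynomial"
    "HOL-Library.Multiset"
    "HOL-Library.FuncSet"
    "HOL-Library.Function_Algebras"
    "HOL-Library.Set_Algebras"
    "HOL-Library.Groups_Big_Fun"
begin

section \<open>Supercommutative monomials\<close>

text \<open>
  The variables are indexed by \<open>1, \<dots>, r + s\<close>; those with index \<open>\<le> r\<close> are even, the others odd.
  A sequence of indices up to permutation is a multiset \<open>K\<close>, its chosen representative is the
  sorted list of \<open>K\<close>, and the monomial \<open>\<lambda>\<^bsub>K\<^esub>\<close> is the product of the variables in this order.
  Parities are natural numbers read modulo 2, and \<open>sg n x\<close> is \<open>(-1)\<^sup>n x\<close>.
\<close>

type_synonym mono = "nat multiset"

definition par :: "nat \<Rightarrow> nat \<Rightarrow> nat" where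
  "par r i = (if i \<le> r then 0 else 1)"

definition mpar :: "nat \<Rightarrow> mono \<Rightarrow> nat" where
  "mpar r K = (\<Sum>i\<in>#K. par r i)"

text \<open>\<open>adm r s K\<close>: \<open>K\<close> consists of indices of variables, and \<open>\<lambda>\<^bsub>K\<^esub> \<noteq> 0\<close>.\<close>

definition adm :: "nat \<Rightarrow> nat \<Rightarrow> mono \<Rightarrow> bool" where
  "adm r s K \<longleftrightarrow> set_mset K \<subseteq> {1..r+s} \<and> (\<forall>i. r < i \<longrightarrow> count K i \<le> 1)"

definition sg :: "nat \<Rightarrow> 'v \<Rightarrow> 'v::ab_group_add" where
  "sg n x = (if even n then x else - x)"

text \<open>\<open>\<lambda>\<^bsub>M\<^esub> \<lambda>\<^bsub>N\<^esub> = (-1)\<^bsup>inv_cnt M N\<^esup> \<lambda>\<^bsub>M+N\<^esub>\<close> if \<open>M + N\<close> is admissible, and \<open>0\<close> otherwise.\<close>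

definition inv_cnt :: "nat \<Rightarrow> mono \<Rightarrow> mono \<Rightarrow> nat" where
  "inv_cnt r M N = (\<Sum>i\<in>#M. \<Sum>j\<in>#N. if j < i then par r i * par r j else 0)"

text \<open>
  An element \<open>\<Sum>\<^sub>K \<lambda>\<^bsub>K\<^esub> \<otimes> v\<^bsub>K\<^esub>\<close> of \<open>\<And>[\<lambda>] \<otimes> V\<close> is the finitely supported function \<open>K \<mapsto> v\<^bsub>K\<^esub>\<close>
  on admissible multisets. Since \<open>V\<close> is arbitrary, \<open>\<And>[\<lambda>] \<otimes> \<And>[\<mu>] \<otimes> V\<close> is obtained by iteration
  (outer argument: \<open>\<lambda>\<close>, inner argument: \<open>\<mu>\<close>). Elements of \<open>\<And>[[y]]\<close> are all functions
  from admissible multisets to scalars.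
\<close>

definition polys :: "nat \<Rightarrow> nat \<Rightarrow> 'v set \<Rightarrow> (mono \<Rightarrow> 'v::zero) set" where
  "polys r s V = {F. finite {K. F K \<noteq> 0} \<and> (\<forall>K. F K \<in> V) \<and> (\<forall>K. \<not> adm r s K \<longrightarrow> F K = 0)}"

definition fscale :: "('f \<Rightarrow> 'v \<Rightarrow> 'v) \<Rightarrow> 'f \<Rightarrow> ('i \<Rightarrow> 'v) \<Rightarrow> ('i \<Rightarrow> 'v)" where
  "fscale sc c F = (\<lambda>K. sc c (F K))"

text \<open>\<open>1 \<otimes> v\<close>.\<close>

definition const :: "'v \<Rightarrow> mono \<Rightarrow> 'v::zero" where
  "const v = (\<lambda>K. if K = {#} then v else 0)"

text \<open>Left multiplication by \<open>\<lambda>\<^sub>i\<close> on \<open>\<And>[\<lambda>] \<otimes> V\<close>.\<close>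

definition lmul :: "nat \<Rightarrow> nat \<Rightarrow> nat \<Rightarrow> (mono \<Rightarrow> 'v) \<Rightarrow> (mono \<Rightarrow> 'v::ab_group_add)" where
  "lmul r s i F = (\<lambda>K. if i \<in># K \<and> adm r s K
     then sg (inv_cnt r {#i#} (K - {#i#})) (F (K - {#i#})) else 0)"

text \<open>
  For an operator \<open>T\<close> on \<open>V\<close> of the parity of the index \<open>i\<close>, the operator \<open>1 \<otimes> T\<close> on \<open>\<And>[\<lambda>] \<otimes> V\<close>:
  \<open>\<lambda>\<^bsub>K\<^esub> \<otimes> v \<mapsto> (-1)\<^bsup>p\<^sub>i p\<^sub>K\<^esup> \<lambda>\<^bsub>K\<^esub> \<otimes> T v\<close>.
\<close>

definition lift :: "nat \<Rightarrow> nat \<Rightarrow> ('v \<Rightarrow> 'v) \<Rightarrow> (mono \<Rightarrow> 'v) \<Rightarrow> (mono \<Rightarrow> 'v::ab_group_add)" where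
  "lift r i T F = (\<lambda>K. sg (par r i * mpar r K) (T (F K)))"

text \<open>\<open>T\<^bsub>K\<^esub> x = T\<^bsub>k1\<^esub> (T\<^bsub>k2\<^esub> (\<dots> x))\<close> for \<open>K = (k1 \<le> k2 \<le> \<dots>)\<close>.\<close>

definition ops :: "(nat \<Rightarrow> 'v \<Rightarrow> 'v) \<Rightarrow> mono \<Rightarrow> 'v \<Rightarrow> 'v" where
  "ops T K x = foldr T (sorted_list_of_multiset K) x"


section \<open>Lie conformal superalgebras of type \<open>(r, s)\<close>\<close>

text \<open>
  The underlying superspace is the sum of two subspaces \<open>ev_part\<close> and \<open>od_part\<close> of an ambient
  vector space (the full type). \<open>dleft i x\<close> and \<open>dright i x\<close> are \<open>\<partial>\<^sub>i x\<close> and \<open>x \<partial>\<^sub>i\<close>.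
  \<open>lbr a b K\<close> is the coefficient of \<open>\<lambda>\<^bsub>K\<^esub>\<close> in the \<open>\<lambda>\<close>-bracket of \<open>a\<close> and \<open>b\<close>, so that
  the product \<open>(a\<^bsub>K\<^esub> b)\<close> is \<open>f(K)\<close> times it.
\<close>

record ('f, 'v) lcs =
  scl :: "'f \<Rightarrow> 'v \<Rightarrow> 'v"
  ev_part :: "'v set"
  od_part :: "'v set"
  dleft :: "nat \<Rightarrow> 'v \<Rightarrow> 'v"
  dright :: "nat \<Rightarrow> 'v \<Rightarrow> 'v"
  lbr :: "'v \<Rightarrow> 'v \<Rightarrow> mono \<Rightarrow> 'v"

definition hom_part :: "('f, 'v) lcs \<Rightarrow> nat \<Rightarrow> 'v set" where
  "hom_part R p = (if even p then ev_part R else od_part R)"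

definition carr :: "('f, 'v::ab_group_add) lcs \<Rightarrow> 'v set" where
  "carr R = {x + y | x y. x \<in> ev_part R \<and> y \<in> od_part R}"

definition super_space :: "('f::field, 'v::ab_group_add) lcs \<Rightarrow> bool" where
  "super_space R \<longleftrightarrow> vector_space (scl R) \<and>
     module.subspace (scl R) (ev_part R) \<and> module.subspace (scl R) (od_part R) \<and>
     ev_part R \<inter> od_part R = {0}"

definition linear_on_set ::
  "'v set \<Rightarrow> ('f \<Rightarrow> 'v \<Rightarrow> 'v) \<Rightarrow> ('f \<Rightarrow> 'w \<Rightarrow> 'w) \<Rightarrow> ('v::ab_group_add \<Rightarrow> 'w::ab_group_add) \<Rightarrow> bool" where
  "linear_on_set S sc1 sc2 f \<longleftrightarrow>
     (\<forall>x\<in>S. \<forall>y\<in>S. f (x + y) = f x + f y) \<and> (\<forall>c. \<forall>x\<in>S. f (sc1 c x) = sc2 c (f x))"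

definition super_bimodule :: "nat \<Rightarrow> nat \<Rightarrow> ('f::field, 'v::ab_group_add) lcs \<Rightarrow> bool" where
  "super_bimodule r s R \<longleftrightarrow> super_space R \<and>
     (\<forall>i\<in>{1..r+s}.
        linear_on_set (carr R) (scl R) (scl R) (dleft R i) \<and>
        linear_on_set (carr R) (scl R) (scl R) (dright R i) \<and>
        (\<forall>p. \<forall>x\<in>hom_part R p. dleft R i x \<in> hom_part R (p + par r i) \<and>
               dright R i x \<in> hom_part R (p + par r i) \<and>
               dright R i x = sg (par r i * p) (dleft R i x))) \<and>
     (\<forall>i\<in>{1..r+s}. \<forall>j\<in>{1..r+s}. \<forall>x\<in>carr R.
        dleft R i (dleft R j x) = sg (par r i * par r j) (dleft R j (dleft R i x)) \<and>
        dright R j (dright R i x) = sg (par r i * par r j) (dright R i (dright R j x)) \<and>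
        dright R j (dleft R i x) = dleft R i (dright R j x))"

definition bracket_bilinear :: "nat \<Rightarrow> nat \<Rightarrow> ('f::field, 'v::ab_group_add) lcs \<Rightarrow> bool" where
  "bracket_bilinear r s R \<longleftrightarrow>
     (\<forall>a\<in>carr R. \<forall>b\<in>carr R. lbr R a b \<in> polys r s (carr R)) \<and>
     (\<forall>a\<in>carr R. linear_on_set (carr R) (scl R) (fscale (scl R)) (\<lambda>b. lbr R a b)) \<and>
     (\<forall>b\<in>carr R. linear_on_set (carr R) (scl R) (fscale (scl R)) (\<lambda>a. lbr R a b)) \<and>
     (\<forall>p q. \<forall>a\<in>hom_part R p. \<forall>b\<in>hom_part R q. \<forall>K. lbr R a b K \<in> hom_part R (p + q + mpar r K))"

text \<open>
  In the second rule the right factor \<open>\<partial>\<^sub>i\<close> acts on the coefficients in \<open>R\<close>, and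
  \<open>F \<lambda>\<^sub>i = (-1)\<^bsup>p\<^sub>i p(F)\<^esup> \<lambda>\<^sub>i F\<close>.
\<close>

definition sesquilinear :: "nat \<Rightarrow> nat \<Rightarrow> ('f::field, 'v::ab_group_add) lcs \<Rightarrow> bool" where
  "sesquilinear r s R \<longleftrightarrow> (\<forall>i\<in>{1..r+s}.
     (\<forall>a\<in>carr R. \<forall>b\<in>carr R. lbr R (dleft R i a) b = - lmul r s i (lbr R a b)) \<and>
     (\<forall>p q. \<forall>a\<in>hom_part R p. \<forall>b\<in>hom_part R q.
        lbr R a (dright R i b) =
          (\<lambda>K. dright R i (lbr R a b K)) + sg (par r i * (p + q)) (lmul r s i (lbr R a b))))"

text \<open>The bracket of \<open>a\<close> and \<open>b\<close> with \<open>\<lambda>\<close> replaced by \<open>-\<lambda> - \<partial>\<close>, where \<open>\<partial>\<close> acts from the left on the coefficients.\<close>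

definition bracket_neg :: "nat \<Rightarrow> nat \<Rightarrow> ('f, 'v::ab_group_add) lcs \<Rightarrow> 'v \<Rightarrow> 'v \<Rightarrow> mono \<Rightarrow> 'v" where
  "bracket_neg r s R a b =
     (\<Sum>K | lbr R a b K \<noteq> 0.
        ops (\<lambda>i F. - lmul r s i F - lift r i (dleft R i) F) K (const (lbr R a b K)))"

definition skew_symmetric :: "nat \<Rightarrow> nat \<Rightarrow> ('f::field, 'v::ab_group_add) lcs \<Rightarrow> bool" where
  "skew_symmetric r s R \<longleftrightarrow>
     (\<forall>p q. \<forall>a\<in>hom_part R p. \<forall>b\<in>hom_part R q. lbr R b a = - sg (p * q) (bracket_neg r s R a b))"

text \<open>
  The three terms of the Jacobi identity, as elements of \<open>\<And>[\<lambda>] \<otimes> \<And>[\<mu>] \<otimes> R\<close>. For \<open>a\<close> of parity \<open>p\<close>,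
  \<open>[a\<^sub>\<lambda> (\<mu>\<^bsub>L\<^esub> c)] = (-1)\<^bsup>p p\<^sub>L\<^esup> \<mu>\<^bsub>L\<^esub> [a\<^sub>\<lambda> c]\<close>, and a further sign \<open>(-1)\<^bsup>p\<^sub>K p\<^sub>L\<^esup>\<close> arises from moving
  \<open>\<mu>\<^bsub>L\<^esub>\<close> to the right of \<open>\<lambda>\<^bsub>K\<^esub>\<close>; for \<open>b\<close> of parity \<open>q\<close>,
  \<open>[b\<^sub>\<mu> (\<lambda>\<^bsub>K\<^esub> c)] = (-1)\<^bsup>q p\<^sub>K\<^esup> \<lambda>\<^bsub>K\<^esub> [b\<^sub>\<mu> c]\<close>; and \<open>[(\<lambda>\<^bsub>K\<^esub> x)\<^sub>\<nu> c] = \<lambda>\<^bsub>K\<^esub> [x\<^sub>\<nu> c]\<close>.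
\<close>

definition jac_a_bc :: "nat \<Rightarrow> ('f, 'v::ab_group_add) lcs \<Rightarrow> nat \<Rightarrow> 'v \<Rightarrow> 'v \<Rightarrow> 'v \<Rightarrow> mono \<Rightarrow> mono \<Rightarrow> 'v" where
  "jac_a_bc r R p a b c = (\<lambda>K L. sg (mpar r L * (p + mpar r K)) (lbr R a (lbr R b c L) K))"

definition jac_b_ac :: "nat \<Rightarrow> ('f, 'v::ab_group_add) lcs \<Rightarrow> nat \<Rightarrow> 'v \<Rightarrow> 'v \<Rightarrow> 'v \<Rightarrow> mono \<Rightarrow> mono \<Rightarrow> 'v" where
  "jac_b_ac r R q a b c = (\<lambda>K L. sg (mpar r K * q) (lbr R b (lbr R a c K) L))"

definition bracket_plus :: "nat \<Rightarrow> nat \<Rightarrow> ('f, 'v::ab_group_add) lcs \<Rightarrow> 'v \<Rightarrow> 'v \<Rightarrow> mono \<Rightarrow> mono \<Rightarrow> 'v" where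
  "bracket_plus r s R x c =
     (\<Sum>J | lbr R x c J \<noteq> 0.
        ops (\<lambda>i F. lmul r s i F + lift r i (lmul r s i) F) J (const (const (lbr R x c J))))"

definition jac_ab_c :: "nat \<Rightarrow> nat \<Rightarrow> ('f, 'v::ab_group_add) lcs \<Rightarrow> 'v \<Rightarrow> 'v \<Rightarrow> 'v \<Rightarrow> mono \<Rightarrow> mono \<Rightarrow> 'v" where
  "jac_ab_c r s R a b c =
     (\<Sum>K | lbr R a b K \<noteq> 0. ops (lmul r s) K (bracket_plus r s R (lbr R a b K) c))"

definition jacobi :: "nat \<Rightarrow> nat \<Rightarrow> ('f::field, 'v::ab_group_add) lcs \<Rightarrow> bool" where
  "jacobi r s R \<longleftrightarrow>
     (\<forall>p q. \<forall>a\<in>hom_part R p. \<forall>b\<in>hom_part R q. \<forall>c\<in>carr R.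
        jac_a_bc r R p a b c = jac_ab_c r s R a b c + sg (p * q) (jac_b_ac r R q a b c))"

definition lie_conformal_superalgebra :: "nat \<Rightarrow> nat \<Rightarrow> ('f::field, 'v::ab_group_add) lcs \<Rightarrow> bool" where
  "lie_conformal_superalgebra r s R \<longleftrightarrow>
     super_bimodule r s R \<and> bracket_bilinear r s R \<and> sesquilinear r s R \<and>
     skew_symmetric r s R \<and> jacobi r s R"


section \<open>Gradations\<close>

definition direct_decomp :: "('f::field \<Rightarrow> 'v \<Rightarrow> 'v) \<Rightarrow> 'v set \<Rightarrow> (int \<Rightarrow> 'v::ab_group_add set) \<Rightarrow> bool" where
  "direct_decomp sc C G \<longleftrightarrow>
     (\<forall>d. module.subspace sc (G d) \<and> G d \<subseteq> C) \<and>
     (\<forall>x\<in>C. \<exists>!f. (\<forall>d. f d \<in> G d) \<and> finite {d. f d \<noteq> 0} \<and> x = Sum_any f)"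

text \<open>
  \<open>G d\<close> is the homogeneous component of degree \<open>d\<close> of \<open>R\<close>; the component of \<open>\<And>[\<lambda>] \<otimes> R\<close> is then
  determined by \<open>deg (\<lambda>\<^sub>i a) = deg a - 2\<close>. The components are graded subspaces with respect to parity.
\<close>

definition poly_grade :: "nat \<Rightarrow> nat \<Rightarrow> ('f, 'v::ab_group_add) lcs \<Rightarrow> (int \<Rightarrow> 'v set) \<Rightarrow> int \<Rightarrow> (mono \<Rightarrow> 'v) set" where
  "poly_grade r s R G d = {F \<in> polys r s (carr R). \<forall>K. F K \<in> G (d + 2 * int (size K))}"

definition z_graded :: "nat \<Rightarrow> nat \<Rightarrow> ('f::field, 'v::ab_group_add) lcs \<Rightarrow> (int \<Rightarrow> 'v set) \<Rightarrow> bool" where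
  "z_graded r s R G \<longleftrightarrow>
     direct_decomp (fscale (scl R)) (polys r s (carr R)) (poly_grade r s R G) \<and>
     (\<forall>d. module.subspace (scl R) (G d) \<and>
          G d = {x + y | x y. x \<in> G d \<inter> ev_part R \<and> y \<in> G d \<inter> od_part R}) \<and>
     (\<forall>i\<in>{1..r+s}. \<forall>d. \<forall>x\<in>G d. dleft R i x \<in> G (d - 2)) \<and>
     (\<forall>d e. \<forall>x\<in>G d. \<forall>y\<in>G e. lbr R x y \<in> poly_grade r s R G (d + e))"


section \<open>The annihilation algebra\<close>

text \<open>
  The algebraic tensor product \<open>R \<otimes> \<And>[[y]]\<close>: a family \<open>M \<mapsto> a\<^bsub>M\<^esub>\<close>, standing for \<open>\<Sum>\<^sub>M a\<^bsub>M\<^esub> y\<^bsub>M\<^esub>\<close>,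
  lies in it if and only if the \<open>a\<^bsub>M\<^esub>\<close> span a finite-dimensional subspace of \<open>R\<close>.
\<close>

definition tilde :: "nat \<Rightarrow> nat \<Rightarrow> ('f::field, 'v::ab_group_add) lcs \<Rightarrow> (mono \<Rightarrow> 'v) set" where
  "tilde r s R = {F. (\<forall>M. F M \<in> carr R) \<and> (\<forall>M. \<not> adm r s M \<longrightarrow> F M = 0) \<and>
     (\<exists>B. finite B \<and> B \<subseteq> carr R \<and> range F \<subseteq> module.span (scl R) B)}"

text \<open>\<open>(-1)\<^bsup>n p(x)\<^esup> x\<close>, extended linearly to non-homogeneous \<open>x\<close>.\<close>

definition twist :: "('f, 'v::ab_group_add) lcs \<Rightarrow> nat \<Rightarrow> 'v \<Rightarrow> 'v" where
  "twist R n x = (if even n then x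
     else (THE z. \<exists>u\<in>ev_part R. \<exists>v\<in>od_part R. x = u + v \<and> z = u - v))"

definition kprod :: "('f::field, 'v) lcs \<Rightarrow> 'v \<Rightarrow> mono \<Rightarrow> 'v \<Rightarrow> 'v" where
  "kprod R a K b = scl R (of_nat (\<Prod>i\<in>set_mset K. fact (count K i))) (lbr R a b K)"

definition ymono :: "mono \<Rightarrow> mono \<Rightarrow> 'f::field" where
  "ymono M = (\<lambda>P. if P = M then 1 else 0)"

text \<open>
  The left derivation \<open>\<partial>\<^bsub>y\<^sub>i\<^esub>\<close> of \<open>\<And>[[y]]\<close>:
  \<open>\<partial>\<^bsub>y\<^sub>i\<^esub> y\<^bsub>M\<^esub> = m\<^sub>i(M) (-1)\<^bsup>inv_cnt {i} (M - i)\<^esup> y\<^bsub>M - i\<^esub>\<close>;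
  and the right action \<open>y\<^bsub>M\<^esub> \<partial>\<^bsub>y\<^sub>i\<^esub> = (-1)\<^bsup>p\<^sub>i p\<^sub>M\<^esup> \<partial>\<^bsub>y\<^sub>i\<^esub> y\<^bsub>M\<^esub>\<close>.
\<close>

definition ldery :: "nat \<Rightarrow> nat \<Rightarrow> nat \<Rightarrow> (mono \<Rightarrow> 'f::field) \<Rightarrow> mono \<Rightarrow> 'f" where
  "ldery r s i \<phi> = (\<lambda>P. if adm r s (P + {#i#})
     then of_nat (count (P + {#i#}) i) * sg (inv_cnt r {#i#} P) (\<phi> (P + {#i#})) else 0)"

definition rdery :: "nat \<Rightarrow> nat \<Rightarrow> nat \<Rightarrow> (mono \<Rightarrow> 'f::field) \<Rightarrow> mono \<Rightarrow> 'f" where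
  "rdery r s i \<phi> = ldery r s i (\<lambda>M. sg (par r i * mpar r M) (\<phi> M))"

text \<open>\<open>\<phi> (\<partial>\<^bsub>y\<^esub>)\<^bsub>J\<^esub> = ((\<phi> \<partial>\<^bsub>y\<^sub>j\<^sub>1\<^esub>) \<partial>\<^bsub>y\<^sub>j\<^sub>2\<^esub>) \<dots>\<close> for \<open>J = (j1 \<le> j2 \<le> \<dots>)\<close>.\<close>

definition rderys :: "nat \<Rightarrow> nat \<Rightarrow> mono \<Rightarrow> (mono \<Rightarrow> 'f::field) \<Rightarrow> mono \<Rightarrow> 'f" where
  "rderys r s J \<phi> = fold (rdery r s) (sorted_list_of_multiset J) \<phi>"

text \<open>
  The element \<open>\<phi> c \<psi>\<close> of \<open>R \<otimes> \<And>[[y]]\<close>, for \<open>c\<close> in \<open>R\<close> and \<open>\<phi>\<close>, \<open>\<psi>\<close> in \<open>\<And>[[y]]\<close>;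
  here \<open>y\<^bsub>M\<^esub> c y\<^bsub>N\<^esub> = (-1)\<^bsup>p\<^sub>M p(c)\<^esup> c y\<^bsub>M\<^esub> y\<^bsub>N\<^esub>\<close>.
\<close>

definition sandwich :: "nat \<Rightarrow> nat \<Rightarrow> ('f::field, 'v::ab_group_add) lcs \<Rightarrow>
    (mono \<Rightarrow> 'f) \<Rightarrow> 'v \<Rightarrow> (mono \<Rightarrow> 'f) \<Rightarrow> mono \<Rightarrow> 'v" where
  "sandwich r s R \<phi> c \<psi> = (\<lambda>P. if adm r s P
     then (\<Sum>M | M \<subseteq># P. scl R (\<phi> M * \<psi> (P - M)) (sg (inv_cnt r M (P - M)) (twist R (mpar r M) c)))
     else 0)"

text \<open>\<open>[y\<^bsub>M\<^esub> a, b y\<^bsub>N\<^esub>]\<close>.\<close>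

definition mono_bracket :: "nat \<Rightarrow> nat \<Rightarrow> ('f::field, 'v::ab_group_add) lcs \<Rightarrow>
    mono \<Rightarrow> 'v \<Rightarrow> 'v \<Rightarrow> mono \<Rightarrow> mono \<Rightarrow> 'v" where
  "mono_bracket r s R M a b N =
     (\<Sum>J | lbr R a b J \<noteq> 0.
        fscale (scl R) (1 / of_nat (\<Prod>i\<in>set_mset J. fact (count J i)))
          (sandwich r s R (rderys r s J (ymono M)) (kprod R a J b) (ymono N)))"

text \<open>
  The continuous bilinear extension, computed coefficientwise from \<open>a y\<^bsub>M\<^esub> = (-1)\<^bsup>p(a) p\<^sub>M\<^esup> y\<^bsub>M\<^esub> a\<close>.
  For \<open>F\<close> and \<open>G\<close> in \<open>R \<otimes> \<And>[[y]]\<close> only finitely many pairs \<open>(M, N)\<close> contribute to the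
  coefficient of a given \<open>y\<^bsub>P\<^esub>\<close>.
\<close>

definition tilde_bracket :: "nat \<Rightarrow> nat \<Rightarrow> ('f::field, 'v::ab_group_add) lcs \<Rightarrow>
    (mono \<Rightarrow> 'v) \<Rightarrow> (mono \<Rightarrow> 'v) \<Rightarrow> mono \<Rightarrow> 'v" where
  "tilde_bracket r s R F G =
     (\<lambda>P. Sum_any (\<lambda>(M, N). mono_bracket r s R M (twist R (mpar r M) (F M)) (G N) N P))"

text \<open>\<open>\<partial>\<^bsub>y\<^sub>i\<^esub> (a y\<^bsub>M\<^esub>) = (-1)\<^bsup>p\<^sub>i p(a)\<^esup> a (\<partial>\<^bsub>y\<^sub>i\<^esub> y\<^bsub>M\<^esub>)\<close> and \<open>\<partial>\<^sub>i (a y\<^bsub>M\<^esub>) = (\<partial>\<^sub>i a) y\<^bsub>M\<^esub>\<close>.\<close>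

definition dery :: "nat \<Rightarrow> nat \<Rightarrow> ('f::field, 'v::ab_group_add) lcs \<Rightarrow> nat \<Rightarrow> (mono \<Rightarrow> 'v) \<Rightarrow> mono \<Rightarrow> 'v" where
  "dery r s R i F = (\<lambda>P. if adm r s (P + {#i#})
     then scl R (of_nat (count (P + {#i#}) i))
            (sg (inv_cnt r {#i#} P) (twist R (par r i) (F (P + {#i#})))) else 0)"

definition tilde_null :: "nat \<Rightarrow> nat \<Rightarrow> ('f::field, 'v::ab_group_add) lcs \<Rightarrow> (mono \<Rightarrow> 'v) set" where
  "tilde_null r s R =
     {(\<Sum>i\<in>{1..r+s}. (\<lambda>M. dleft R i (F i M)) + dery r s R i (F i)) | F. \<forall>i\<in>{1..r+s}. F i \<in> tilde r s R}"

text \<open>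
  Elements of the annihilation algebra are cosets of \<open>tilde_null\<close>; maps and operations on
  \<open>R \<otimes> \<And>[[y]]\<close> are passed to the quotient by taking the union over all representatives.
  The sum of two cosets is their elementwise sum, and \<open>F +o N\<close> is the coset of \<open>F\<close>.
\<close>

definition ann :: "nat \<Rightarrow> nat \<Rightarrow> ('f::field, 'v::ab_group_add) lcs \<Rightarrow> (mono \<Rightarrow> 'v) set set" where
  "ann r s R = {F +o tilde_null r s R | F. F \<in> tilde r s R}"

definition quot_map :: "nat \<Rightarrow> nat \<Rightarrow> ('f::field, 'v::ab_group_add) lcs \<Rightarrow>
    ((mono \<Rightarrow> 'v) \<Rightarrow> (mono \<Rightarrow> 'v)) \<Rightarrow> (mono \<Rightarrow> 'v) set \<Rightarrow> (mono \<Rightarrow> 'v) set" where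
  "quot_map r s R T = (\<lambda>X\<in>ann r s R. \<Union>F\<in>X. T F +o tilde_null r s R)"

definition ann_scale :: "nat \<Rightarrow> nat \<Rightarrow> ('f::field, 'v::ab_group_add) lcs \<Rightarrow>
    'f \<Rightarrow> (mono \<Rightarrow> 'v) set \<Rightarrow> (mono \<Rightarrow> 'v) set" where
  "ann_scale r s R c = quot_map r s R (fscale (scl R) c)"

definition ann_bracket :: "nat \<Rightarrow> nat \<Rightarrow> ('f::field, 'v::ab_group_add) lcs \<Rightarrow>
    (mono \<Rightarrow> 'v) set \<Rightarrow> (mono \<Rightarrow> 'v) set \<Rightarrow> (mono \<Rightarrow> 'v) set" where
  "ann_bracket r s R X Y = (\<Union>F\<in>X. \<Union>G\<in>Y. tilde_bracket r s R F G +o tilde_null r s R)"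

definition ann_parity :: "nat \<Rightarrow> nat \<Rightarrow> ('f::field, 'v::ab_group_add) lcs \<Rightarrow> nat \<Rightarrow> (mono \<Rightarrow> 'v) set set" where
  "ann_parity r s R p =
     {F +o tilde_null r s R | F. F \<in> tilde r s R \<and> (\<forall>M. F M \<in> hom_part R (p + mpar r M))}"

text \<open>The induced gradation: \<open>deg (a y\<^bsub>M\<^esub>) = deg a + 2 \<ell>(M)\<close>.\<close>

definition ann_grade :: "nat \<Rightarrow> nat \<Rightarrow> ('f::field, 'v::ab_group_add) lcs \<Rightarrow>
    (int \<Rightarrow> 'v set) \<Rightarrow> int \<Rightarrow> (mono \<Rightarrow> 'v) set set" where
  "ann_grade r s R G d =
     {F +o tilde_null r s R | F. F \<in> tilde r s R \<and> (\<forall>M. F M \<in> G (d - 2 * int (size M)))}"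

definition ann_ad :: "nat \<Rightarrow> nat \<Rightarrow> ('f::field, 'v::ab_group_add) lcs \<Rightarrow>
    (mono \<Rightarrow> 'v) set \<Rightarrow> (mono \<Rightarrow> 'v) set \<Rightarrow> (mono \<Rightarrow> 'v) set" where
  "ann_ad r s R X = (\<lambda>Y\<in>ann r s R. ann_bracket r s R X Y)"

definition ann_superder :: "nat \<Rightarrow> nat \<Rightarrow> ('f::field, 'v::ab_group_add) lcs \<Rightarrow> nat \<Rightarrow>
    ((mono \<Rightarrow> 'v) set \<Rightarrow> (mono \<Rightarrow> 'v) set) \<Rightarrow> bool" where
  "ann_superder r s R p \<delta> \<longleftrightarrow>
     \<delta> \<in> ann r s R \<rightarrow>\<^sub>E ann r s R \<and>
     (\<forall>X\<in>ann r s R. \<forall>Y\<in>ann r s R. \<delta> (X + Y) = \<delta> X + \<delta> Y) \<and>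
     (\<forall>c. \<forall>X\<in>ann r s R. \<delta> (ann_scale r s R c X) = ann_scale r s R c (\<delta> X)) \<and>
     (\<forall>q. \<forall>X\<in>ann_parity r s R q. \<delta> X \<in> ann_parity r s R (p + q)) \<and>
     (\<forall>q. \<forall>X\<in>ann_parity r s R q. \<forall>Y\<in>ann r s R.
        \<delta> (ann_bracket r s R X Y) =
          ann_bracket r s R (\<delta> X) Y + ann_scale r s R ((-1) ^ (p * q)) (ann_bracket r s R X (\<delta> Y)))"

definition ann_der :: "nat \<Rightarrow> nat \<Rightarrow> ('f::field, 'v::ab_group_add) lcs \<Rightarrow>
    ((mono \<Rightarrow> 'v) set \<Rightarrow> (mono \<Rightarrow> 'v) set) set" where
  "ann_der r s R = {(\<lambda>X\<in>ann r s R. \<delta>0 X + \<delta>1 X) | \<delta>0 \<delta>1.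
     ann_superder r s R 0 \<delta>0 \<and> ann_superder r s R 1 \<delta>1}"

text \<open>
  The span of the maps induced by the \<open>\<partial>\<^bsub>y\<^sub>i\<^esub>\<close>; linear combinations are formed on \<open>R \<otimes> \<And>[[y]]\<close>.
\<close>

definition ann_D :: "nat \<Rightarrow> nat \<Rightarrow> ('f::field, 'v::ab_group_add) lcs \<Rightarrow>
    ((mono \<Rightarrow> 'v) set \<Rightarrow> (mono \<Rightarrow> 'v) set) set" where
  "ann_D r s R = {quot_map r s R (\<lambda>F. \<Sum>i\<in>{1..r+s}. fscale (scl R) (c i) (dery r s R i F)) | c. True}"


section \<open>The conditions on the annihilation algebra\<close>

definition ann_depth_le :: "nat \<Rightarrow> nat \<Rightarrow> ('f::field, 'v::ab_group_add) lcs \<Rightarrow> (int \<Rightarrow> 'v set) \<Rightarrow> int \<Rightarrow> bool" where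
  "ann_depth_le r s R G h \<longleftrightarrow> (\<forall>d < - h. ann_grade r s R G d = {tilde_null r s R})"

definition ann_purely_odd :: "nat \<Rightarrow> nat \<Rightarrow> ('f::field, 'v::ab_group_add) lcs \<Rightarrow> (int \<Rightarrow> 'v set) \<Rightarrow> int \<Rightarrow> bool" where
  "ann_purely_odd r s R G d \<longleftrightarrow> ann_grade r s R G d \<subseteq> ann_parity r s R 1"

definition ann_ad_iso_D :: "nat \<Rightarrow> nat \<Rightarrow> ('f::field, 'v::ab_group_add) lcs \<Rightarrow> (int \<Rightarrow> 'v set) \<Rightarrow> bool" where
  "ann_ad_iso_D r s R G \<longleftrightarrow>
     ann_ad r s R ` ann_grade r s R G (-2) \<subseteq> ann_der r s R \<and>
     inj_on (ann_ad r s R) (ann_grade r s R G (-2)) \<and>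
     ann_ad r s R ` ann_grade r s R G (-2) = ann_D r s R"


section \<open>The Lie conformal superalgebra \<open>RW(r, s)\<close>\<close>

text \<open>
  The free \<open>\<And>[\<partial>]\<close>-module with basis \<open>a\<^sub>1, \<dots>, a\<^bsub>r+s\<^esub>\<close>: the function \<open>K j \<mapsto> x\<^bsub>K,j\<^esub>\<close> stands for
  \<open>\<Sum> x\<^bsub>K,j\<^esub> \<partial>\<^bsub>K\<^esub> a\<^sub>j\<close>. The element \<open>\<partial>\<^bsub>K\<^esub> a\<^sub>j\<close> has parity \<open>p\<^sub>K + p\<^sub>j\<close> and degree \<open>-2 - 2 \<ell>(K)\<close>.
\<close>

type_synonym 'f rw = "mono \<Rightarrow> nat \<Rightarrow> 'f"

definition RW_carrier :: "nat \<Rightarrow> nat \<Rightarrow> 'f::field rw set" where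
  "RW_carrier r s = polys r s {v. \<forall>j. j \<notin> {1..r+s} \<longrightarrow> v j = 0}"

definition RW_parity :: "nat \<Rightarrow> nat \<Rightarrow> nat \<Rightarrow> 'f::field rw set" where
  "RW_parity r s p =
     {x \<in> RW_carrier r s. \<forall>K j. x K j \<noteq> 0 \<longrightarrow> even (mpar r K + par r j + p)}"

definition RW_scale :: "'f::field \<Rightarrow> 'f rw \<Rightarrow> 'f rw" where
  "RW_scale c x = (\<lambda>K j. c * x K j)"

definition RW_gen :: "nat \<Rightarrow> 'f::field rw" where
  "RW_gen j = const (\<lambda>k. if k = j then 1 else 0)"

text \<open>\<open>x \<partial>\<^sub>i = (-1)\<^bsup>p\<^sub>i p(x)\<^esup> \<partial>\<^sub>i x\<close>.\<close>

definition RW_dright :: "nat \<Rightarrow> nat \<Rightarrow> nat \<Rightarrow> 'f::field rw \<Rightarrow> 'f rw" where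
  "RW_dright r s i x = lmul r s i (\<lambda>K j. sg (par r i * (mpar r K + par r j)) (x K j))"

text \<open>\<open>(\<partial>\<^sub>i + \<lambda>\<^sub>i) a\<^sub>j + a\<^sub>i \<lambda>\<^sub>j\<close>, where \<open>a\<^sub>i \<lambda>\<^sub>j = (-1)\<^bsup>p\<^sub>i p\<^sub>j\<^esup> \<lambda>\<^sub>j a\<^sub>i\<close>.\<close>

definition RW_gen_bracket :: "nat \<Rightarrow> nat \<Rightarrow> nat \<Rightarrow> nat \<Rightarrow> mono \<Rightarrow> 'f::field rw" where
  "RW_gen_bracket r s i j =
     const (lmul r s i (RW_gen j)) + lmul r s i (const (RW_gen j))
     + sg (par r i * par r j) (lmul r s j (const (RW_gen i)))"

text \<open>
  The extension by sesquilinearity. As \<open>b \<partial>\<^sub>k = (-1)\<^bsup>p\<^sub>k p(b)\<^esup> \<partial>\<^sub>k b\<close>, the second sesquilinearity rule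
  reads \<open>[a\<^sub>\<lambda> (\<partial>\<^sub>k b)] = (-1)\<^bsup>p\<^sub>k p(a)\<^esup> (\<partial>\<^sub>k + \<lambda>\<^sub>k) [a\<^sub>\<lambda> b]\<close>; hence
  \<open>[(\<partial>\<^bsub>K\<^esub> a\<^sub>i)\<^sub>\<lambda> (\<partial>\<^bsub>L\<^esub> a\<^sub>j)] = (-1)\<^bsup>p\<^sub>L p\<^sub>i\<^esup> (-\<lambda>)\<^bsub>K\<^esub> (\<partial> + \<lambda>)\<^bsub>L\<^esub> [a\<^sub>i\<^sub>\<lambda> a\<^sub>j]\<close>.
\<close>

definition RW_bracket :: "nat \<Rightarrow> nat \<Rightarrow> 'f::field rw \<Rightarrow> 'f rw \<Rightarrow> mono \<Rightarrow> 'f rw" where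
  "RW_bracket r s x y =
     (\<Sum>K | x K \<noteq> 0. \<Sum>i\<in>{1..r+s}. \<Sum>L | y L \<noteq> 0. \<Sum>j\<in>{1..r+s}.
        fscale RW_scale (x K i * y L j)
          (sg (mpar r L * par r i)
            (ops (\<lambda>k F. - lmul r s k F) K
              (ops (\<lambda>k F. lift r k (lmul r s k) F + lmul r s k F) L (RW_gen_bracket r s i j)))))"

definition RW :: "nat \<Rightarrow> nat \<Rightarrow> ('f::field, 'f rw) lcs" where
  "RW r s = \<lparr> scl = RW_scale, ev_part = RW_parity r s 0, od_part = RW_parity r s 1,
     dleft = lmul r s, dright = RW_dright r s, lbr = RW_bracket r s \<rparr>"

definition RW_grade :: "nat \<Rightarrow> nat \<Rightarrow> int \<Rightarrow> 'f::field rw set" where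
  "RW_grade r s d = {x \<in> RW_carrier r s. \<forall>K. x K \<noteq> 0 \<longrightarrow> d = - 2 - 2 * int (size K)}"

lemma RW_bracket_gen:
  assumes "i \<in> {1..r+s}" and "j \<in> {1..r+s}"
  shows "RW_bracket r s (RW_gen i) (RW_gen j) = (RW_gen_bracket r s i j :: mono \<Rightarrow> 'f::field rw)"
proof -
  have supp: "{K. RW_gen k K \<noteq> (0 :: nat \<Rightarrow> 'f)} = {{#}}" for k
    by (auto simp: RW_gen_def const_def fun_eq_iff)
  have gen: "RW_gen k {#} l = (if l = k then 1 else 0 :: 'f)" for k l
    by (simp add: RW_gen_def const_def)
  have scale: "fscale RW_scale c F = (\<lambda>K L l. c * F K L l)" for c :: 'f and F :: "mono \<Rightarrow> 'f rw"
    by (simp add: fscale_def RW_scale_def)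
  have "RW_bracket r s (RW_gen i) (RW_gen j) =
      (\<Sum>k\<in>{1..r+s}. \<Sum>l\<in>{1..r+s}. if k = i then (if l = j then RW_gen_bracket r s i j else 0)
         else (0 :: mono \<Rightarrow> 'f rw))"
    unfolding RW_bracket_def supp
    by (simp add: gen scale ops_def mpar_def sg_def)
      (intro sum.cong refl, auto simp: fun_eq_iff)
  also have "\<dots> = (\<Sum>k\<in>{1..r+s}. if k = i then RW_gen_bracket r s i j else 0)"
    using assms(2) by (intro sum.cong) (auto simp: sum.delta)
  also have "\<dots> = RW_gen_bracket r s i j"
    using assms(1) by (auto simp: sum.delta)
  finally show ?thesis .
qed

end

theory Submission
  imports Defs
begin

text \<open>
  Sesquilinearity makes the \<open>\<lambda>\<close>-bracket of \<open>\<partial>\<^bsub>K\<^esub> a\<^sub>i\<close> and \<open>\<partial>\<^bsub>L\<^esub> a\<^sub>j\<close> the image of \<open>[a\<^sub>i\<^sub>\<lambda> a\<^sub>j]\<close> under products of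
  the operators \<open>-\<lambda>\<^sub>k\<close> and \<open>\<lambda>\<^sub>k + \<partial>\<^sub>k\<close>, which supercommute; all signs come from this supercommutation. Both sides of
  skew-symmetry, and the three terms of the Jacobi identity, transform in the same way when a
  \<open>\<partial>\<^sub>k\<close> is applied to one of the arguments, so both identities need only be checked on generators.

  On \<open>R \<otimes> \<And>[[y]]\<close> the bracket of \<open>b \<phi>\<close> and \<open>c \<psi>\<close> is a finite sum of products
  \<open>(\<phi> \<partial>\<^bsub>J\<^esub>) (b\<^bsub>J\<^esub>c) \<psi>\<close>; since \<open>\<phi> \<partial>\<^bsub>J\<^esub> \<partial>\<^sub>i\<close> matches the sesquilinearity rules and \<open>\<partial>\<^bsub>y\<^sub>i\<^esub>\<close> satisfies the
  Leibniz rule, the sum of the images of the \<open>\<partial>\<^sub>i + \<partial>\<^bsub>y\<^sub>i\<^esub>\<close> is an ideal, and the \<open>\<partial>\<^bsub>y\<^sub>i\<^esub>\<close> induce superderivations of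
  the quotient. For \<open>RW(r, s)\<close> every element of the quotient is represented by some
  \<open>\<Sum> a\<^sub>j \<phi>\<^sub>j\<close>, whence the degrees are even and at least \<open>-2\<close>, and degree \<open>-2\<close> is spanned by the \<open>a\<^sub>j\<close>.
  The constant term of \<open>[a\<^sub>j\<^sub>\<lambda> b]\<close> is \<open>\<partial>\<^sub>j b\<close>, so \<open>ad a\<^sub>j = \<partial>\<^sub>j = -\<partial>\<^bsub>y\<^sub>j\<^esub>\<close> on the quotient. Injectivity follows by
  applying these derivations to \<open>a\<^sub>i y\<^sub>i\<close>, as \<open>a\<^sub>i\<close> is nonzero in the quotient.
\<close>

section \<open>Signs and supercommutative monomials\<close>

text \<open>The obstacle is sign bookkeeping. Monomials are multisets with a sorted representative,
  so multiplying by one variable costs a reordering sign and gives 0 when an odd variable repeats.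
  Products of supercommuting operators whose odd members square to 0 obey the same insertion law.
  Replacing variables by such operators is therefore compatible with multiplication by a variable,
  and this handles \<open>-\<lambda> - \<partial>\<close>, \<open>\<lambda> + \<mu>\<close> and the
  double bracket alike. On generators the Jacobi identity becomes an identity between three
  supercommuting families, valid in any abelian group. In \<open>R \<otimes> \<And>[[y]]\<close>
  every element is a finite sum of homogeneous vectors times whole power series. Bilinearity then
  reduces statements to single products, and no limits occur. That \<open>a\<^sub>i\<close> survives
  in the quotient needs an invariant: a linear functional that kills \<open>tilde_null\<close>. Its
  weights are forced, because the contributions of \<open>\<partial>\<^sub>k\<close> and of the
  derivative along \<open>y\<^sub>k\<close> have to cancel.\<close>

lemma sum_apply: "(\<Sum>i\<in>A. f i) x = (\<Sum>i\<in>A. f i x)"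
  by (induction A rule: infinite_finite_induct) auto

lemma sg_0 [simp]: "sg 0 x = x"
  by (simp add: sg_def)

lemma sg_zero [simp]: "sg n 0 = 0"
  by (simp add: sg_def)

lemma sg_eq_0_iff [simp]: "sg n x = 0 \<longleftrightarrow> x = 0"
  by (simp add: sg_def)

lemma sg_sg [simp]: "sg m (sg n x) = sg (m + n) x"
  by (simp add: sg_def)

lemma sg_add: "sg n (x + y) = sg n x + sg n y"
  by (simp add: sg_def)

lemma sg_minus: "sg n (- x) = - sg n x"
  by (simp add: sg_def)

lemma sg_diff: "sg n (x - y) = sg n x - sg n y"
  by (simp add: sg_def)

lemma sg_sum: "sg n (\<Sum>i\<in>A. f i) = (\<Sum>i\<in>A. sg n (f i))"
  by (simp add: sg_def sum_negf)

lemma sg_fun: "sg n F = (\<lambda>K. sg n (F K))"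
  by (simp add: sg_def fun_eq_iff)

lemma sg_apply: "sg n F K = sg n (F K)"
  by (simp add: sg_def)

lemma sg_eqI: "(even m \<longleftrightarrow> even n) \<Longrightarrow> x = y \<Longrightarrow> sg m x = sg n y"
  by (simp add: sg_def)

lemma sg_mult: "sg n (x * y) = sg n x * y" "sg n (x * y) = x * sg n (y :: 'a :: ring)"
  by (simp_all add: sg_def)

lemma sg_additive:
  fixes f :: "'a :: ab_group_add \<Rightarrow> 'b :: ab_group_add"
  assumes "\<And>x y. f (x + y) = f x + f y"
  shows "f (sg n x) = sg n (f x)"
proof -
  have 0: "f 0 = 0" using assms[of 0 0] by simp
  have "f (- x) = - f x" using assms[of x "- x"] 0 by (simp add: eq_neg_iff_add_eq_0 add.commute)
  then show ?thesis by (simp add: sg_def)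
qed

lemma mpar_empty [simp]: "mpar r {#} = 0"
  and mpar_add_mset [simp]: "mpar r (add_mset i K) = par r i + mpar r K"
  and mpar_union [simp]: "mpar r (K + L) = mpar r K + mpar r L"
  by (simp_all add: mpar_def)

lemma inv_cnt_empty [simp]: "inv_cnt r {#} N = 0" "inv_cnt r M {#} = 0"
  by (simp_all add: inv_cnt_def)

lemma inv_cnt_union_left: "inv_cnt r (M + M') N = inv_cnt r M N + inv_cnt r M' N"
  and inv_cnt_union_right: "inv_cnt r M (N + N') = inv_cnt r M N + inv_cnt r M N'"
  by (simp_all add: inv_cnt_def sum_mset.distrib)

lemma inv_cnt_add_mset_left: "NO_MATCH {#} M \<Longrightarrow>
    inv_cnt r (add_mset i M) N = inv_cnt r {#i#} N + inv_cnt r M N"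
  and inv_cnt_add_mset_right: "NO_MATCH {#} N \<Longrightarrow>
    inv_cnt r M (add_mset i N) = inv_cnt r M {#i#} + inv_cnt r M N"
  by (simp_all add: inv_cnt_def sum_mset.distrib)

lemmas inv_cnt_simps =
  inv_cnt_union_left inv_cnt_union_right inv_cnt_add_mset_left inv_cnt_add_mset_right

text \<open>A pair of distinct indices is an inversion in exactly one of the two orders, so it is
  counted once. A pair of equal indices is counted in neither order; admissibility of
  \<open>M + N\<close> forces such an index to be even, so its product of parities is 0 as
  well.\<close>

lemma inv_cnt_swap:
  assumes "adm r s (M + N)"
  shows "inv_cnt r M N + inv_cnt r N M = mpar r M * mpar r N"
proof -
  have "inv_cnt r N M = (\<Sum>i\<in>#M. \<Sum>j\<in>#N. if i < j then par r i * par r j else 0)"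
    unfolding inv_cnt_def by (subst sum_mset.swap) (simp add: mult.commute cong: if_cong)
  then have "inv_cnt r M N + inv_cnt r N M =
      (\<Sum>i\<in>#M. \<Sum>j\<in>#N. (if j < i then par r i * par r j else 0) + (if i < j then par r i * par r j else 0))"
    by (simp add: inv_cnt_def sum_mset.distrib)
  also have "\<dots> = (\<Sum>i\<in>#M. \<Sum>j\<in>#N. par r i * par r j)"
  proof (intro arg_cong[where f = sum_mset] image_mset_cong)
    fix i j assume ij: "i \<in># M" "j \<in># N"
    have "par r i * par r i = 0" if "i = j"
    proof -
      have "count M i + count N i \<ge> 2"
        using ij that by (metis add_mono count_greater_eq_one_iff one_add_one)
      then have "\<not> r < i" using assms by (auto simp: adm_def)
      then show ?thesis by (simp add: par_def)
    qed
    then show "(if j < i then par r i * par r j else 0) + (if i < j then par r i * par r j else 0) = par r i * par r j"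
      by (cases i j rule: linorder_cases) auto
  qed
  also have "\<dots> = mpar r M * mpar r N"
    by (simp add: mpar_def sum_mset_product)
  finally show ?thesis .
qed

lemma even_inv_cnt_swap:
  "adm r s (M + N) \<Longrightarrow> even (inv_cnt r N M) \<longleftrightarrow> (even (inv_cnt r M N) \<longleftrightarrow> even (mpar r M * mpar r N))"
  by (metis inv_cnt_swap even_add)

lemma even_inv_cnt_single: "i \<noteq> j \<Longrightarrow>
    even (inv_cnt r {#i#} {#j#}) \<longleftrightarrow> (even (inv_cnt r {#j#} {#i#}) \<longleftrightarrow> even (par r i * par r j))"
  by (cases i j rule: linorder_cases) (auto simp: inv_cnt_def)

lemma adm_subset: "adm r s K \<Longrightarrow> L \<subseteq># K \<Longrightarrow> adm r s L"
  unfolding adm_def by (meson le_trans mset_subset_eqD mset_subset_eq_count subsetD subsetI)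

lemma adm_add_msetD: "adm r s (add_mset i K) \<Longrightarrow> adm r s K"
  by (erule adm_subset) simp

lemma adm_empty [simp]: "adm r s {#}"
  by (simp add: adm_def)

lemma adm_single: "adm r s {#i#} \<longleftrightarrow> i \<in> {1..r+s}"
  by (auto simp: adm_def)

lemma adm_add_mset_iff:
  "adm r s (add_mset i K) \<longleftrightarrow> i \<in> {1..r+s} \<and> adm r s K \<and> (r < i \<longrightarrow> i \<notin># K)"
proof -
  have "Suc (count K i) \<le> 1 \<longleftrightarrow> i \<notin># K" by (simp add: not_in_iff)
  moreover have "i \<notin># K \<Longrightarrow> count K i \<le> 1" by (simp add: not_in_iff)
  ultimately show ?thesis
    unfolding adm_def by (auto split: if_splits)
qed

lemma par_cases: "par r i = 0 \<or> par r i = 1"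
  by (simp add: par_def)

lemma par_odd_iff [simp]: "odd (par r i) \<longleftrightarrow> r < i" "even (par r i) \<longleftrightarrow> i \<le> r"
  by (auto simp: par_def)


section \<open>Supercommuting families of operators\<close>

definition additive_map :: "('a::ab_group_add \<Rightarrow> 'b::ab_group_add) \<Rightarrow> bool" where
  "additive_map f \<longleftrightarrow> (\<forall>x y. f (x + y) = f x + f y)"

lemma additive_mapD:
  assumes "additive_map f"
  shows "f (x + y) = f x + f y" "f 0 = 0" "f (- x) = - f x" "f (sg n x) = sg n (f x)"
    "f (\<Sum>i\<in>A. h i) = (\<Sum>i\<in>A. f (h i))" "f (x - y) = f x - f y"
proof -
  show add: "f (x + y) = f x + f y" for x y using assms by (simp add: additive_map_def)
  show 0: "f 0 = 0" using add[of 0 0] by simp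
  show minus: "f (- x) = - f x" for x using add[of x "- x"] 0 by (simp add: eq_neg_iff_add_eq_0 add.commute)
  show "f (sg n x) = sg n (f x)" by (rule sg_additive) (rule add)
  show "f (\<Sum>i\<in>A. h i) = (\<Sum>i\<in>A. f (h i))"
    by (induction A rule: infinite_finite_induct) (auto simp: add 0)
  show "f (x - y) = f x - f y" using add[of x "- y"] by (simp add: minus)
qed

text \<open>The condition ranges over all natural numbers as indices. For \<open>lmul\<close> this
  costs nothing: an index outside \<open>{1..r+s}\<close> gives the zero operator.\<close>

definition supercommute :: "nat \<Rightarrow> (nat \<Rightarrow> 'v \<Rightarrow> 'v) \<Rightarrow> (nat \<Rightarrow> 'v \<Rightarrow> 'v::ab_group_add) \<Rightarrow> bool" where
  "supercommute r T U \<longleftrightarrow> (\<forall>i j x. T i (U j x) = sg (par r i * par r j) (U j (T i x)))"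

text \<open>The vanishing of odd squares is a separate requirement: supercommutation only gives
  \<open>T i (T i x) = - T i (T i x)\<close>, which does not force 0 in an arbitrary abelian
  group.\<close>

definition super_family :: "nat \<Rightarrow> (nat \<Rightarrow> 'v \<Rightarrow> 'v::ab_group_add) \<Rightarrow> bool" where
  "super_family r T \<longleftrightarrow> (\<forall>i. additive_map (T i)) \<and> supercommute r T T \<and> (\<forall>i x. r < i \<longrightarrow> T i (T i x) = 0)"

lemma supercommuteD: "supercommute r T U \<Longrightarrow> T i (U j x) = sg (par r i * par r j) (U j (T i x))"
  by (simp add: supercommute_def)

lemma supercommute_sym: "supercommute r T U \<Longrightarrow> supercommute r U T"
  by (auto simp: supercommute_def mult.commute intro!: sg_eqI[of _ 0, simplified, symmetric])

lemma super_familyD: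
  assumes "super_family r T"
  shows "additive_map (T i)" "supercommute r T T" "r < i \<Longrightarrow> T i (T i x) = 0"
  using assms by (auto simp: super_family_def)

lemma additive_map_plus: "additive_map f \<Longrightarrow> additive_map g \<Longrightarrow> additive_map (\<lambda>x. f x + g x)"
  by (simp add: additive_map_def algebra_simps)

lemma additive_map_minus: "additive_map f \<Longrightarrow> additive_map (\<lambda>x. - f x)"
  by (simp add: additive_map_def)

lemma supercommute_plus:
  assumes "\<And>i. additive_map (T i)" "supercommute r T U" "supercommute r T V"
  shows "supercommute r T (\<lambda>i x. U i x + V i x)"
  using assms by (auto simp: supercommute_def additive_mapD sg_add)

lemma supercommute_minus:
  assumes "\<And>i. additive_map (T i)" "supercommute r T U"
  shows "supercommute r T (\<lambda>i x. - U i x)"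
  using assms by (auto simp: supercommute_def additive_mapD sg_minus)

text \<open>In the square of an odd member the cross terms are
  \<open>T i (U i x) + U i (T i x)\<close>; they cancel because the two families supercommute with
  each other.\<close>

lemma super_family_plus:
  assumes T: "super_family r T" and U: "super_family r U" and TU: "supercommute r T U"
  shows "super_family r (\<lambda>i x. T i x + U i x)"
proof -
  note add = super_familyD(1)[OF T] super_familyD(1)[OF U]
  have add': "additive_map (\<lambda>x. T i x + U i x)" for i
    by (intro additive_map_plus add)
  have "supercommute r (\<lambda>i x. T i x + U i x) (\<lambda>i x. T i x + U i x)"
    unfolding supercommute_def
  proof (intro allI)
    fix i j x
    have "T i (T j x + U j x) + U i (T j x + U j x) = T i (T j x) + U i (U j x) + (T i (U j x) + U i (T j x))"
      by (simp add: additive_mapD(1)[OF add(1)] additive_mapD(1)[OF add(2)])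
    moreover have "T i (T j x) = sg (par r i * par r j) (T j (T i x))"
      by (rule supercommuteD[OF super_familyD(2)[OF T]])
    moreover have "U i (U j x) = sg (par r i * par r j) (U j (U i x))"
      by (rule supercommuteD[OF super_familyD(2)[OF U]])
    moreover have "T i (U j x) = sg (par r i * par r j) (U j (T i x))"
      by (rule supercommuteD[OF TU])
    moreover have "U i (T j x) = sg (par r i * par r j) (T j (U i x))"
      by (rule supercommuteD[OF supercommute_sym[OF TU]])
    ultimately show "T i (T j x + U j x) + U i (T j x + U j x)
        = sg (par r i * par r j) (T j (T i x + U i x) + U j (T i x + U i x))"
      by (simp add: additive_mapD(1)[OF add(1)] additive_mapD(1)[OF add(2)] sg_add)
  qed
  moreover have "T i (T i x + U i x) + U i (T i x + U i x) = 0" if i: "r < i" for i x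
  proof -
    have "T i (U i x) = - U i (T i x)"
      using supercommuteD[OF TU, of i i x] i by (simp add: par_def sg_def)
    then show ?thesis
      using super_familyD(3)[OF T i] super_familyD(3)[OF U i]
      by (simp add: additive_mapD(1)[OF add(1)] additive_mapD(1)[OF add(2)])
  qed
  ultimately show ?thesis using add' by (auto simp: super_family_def)
qed

lemma super_family_minus:
  assumes T: "super_family r T"
  shows "super_family r (\<lambda>i x. - T i x)"
proof -
  note add = super_familyD(1)[OF T]
  have "- T i (- T j x) = sg (par r i * par r j) (- T j (- T i x))" for i j x
    using supercommuteD[OF super_familyD(2)[OF T], of i j x] by (simp add: additive_mapD(3)[OF add])
  then have "supercommute r (\<lambda>i x. - T i x) (\<lambda>i x. - T i x)"
    unfolding supercommute_def by blast
  then show ?thesis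
    using super_familyD(3)[OF T]
    by (simp add: super_family_def additive_map_minus[OF add] additive_mapD(3)[OF add])
qed

section \<open>Ordered products of supercommuting operators\<close>

lemma foldr_additive: "(\<And>i. additive_map (T i)) \<Longrightarrow> additive_map (foldr T xs)"
  by (induction xs) (auto simp: additive_map_def)

lemma fold_additive: "(\<And>i. additive_map (T i)) \<Longrightarrow> additive_map (fold T xs)"
  by (induction xs) (auto simp: additive_map_def)

lemma ops_additive: "(\<And>i. additive_map (T i)) \<Longrightarrow> additive_map (ops T K)"
  unfolding ops_def[abs_def] by (rule foldr_additive)

lemma ops_empty [simp]: "ops T {#} x = x"
  by (simp add: ops_def)

lemma inv_cnt_mset_Cons: "inv_cnt r {#i#} (mset (x # xs)) = (if x < i then par r i * par r x else 0) + inv_cnt r {#i#} (mset xs)"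
  by (simp add: inv_cnt_def)

text \<open>The operator \<open>T i\<close> is carried to the right past the smaller entries until
  it reaches its place in the sorted list; each entry passed contributes one summand of
  \<open>inv_cnt\<close>. An odd \<open>i\<close> that is already present meets its own copy, and
  the product is 0.\<close>

lemma foldr_insort:
  assumes T: "super_family r T" and "sorted xs"
  shows "T i (foldr T xs x) =
    (if r < i \<and> i \<in> set xs then 0 else sg (inv_cnt r {#i#} (mset xs)) (foldr T (insort i xs) x))"
  using assms(2)
proof (induction xs)
  case (Cons y ys)
  have inv0: "inv_cnt r {#i#} (mset (y # ys)) = 0" if "i \<le> y"
    using that Cons.prems by (auto simp: inv_cnt_def not_less intro!: sum_mset.neutral)
  show ?case
  proof (cases "i \<le> y")
    case True
    show ?thesis
    proof (cases "r < i \<and> i = y")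
      case True
      then show ?thesis by (simp add: super_familyD(3)[OF T])
    next
      case False
      with True Cons.prems have "\<not> (r < i \<and> i \<in> set (y # ys))" by auto
      with True show ?thesis by (simp only: inv0[OF True]) auto
    qed
  next
    case False
    have "T i (foldr T (y # ys) x) = sg (par r i * par r y) (T y (T i (foldr T ys x)))"
      by (simp add: supercommuteD[OF super_familyD(2)[OF T], of i y])
    also have "\<dots> = (if r < i \<and> i \<in> set ys then 0 else
       sg (par r i * par r y + inv_cnt r {#i#} (mset ys)) (T y (foldr T (insort i ys) x)))"
      using Cons by (auto simp: additive_mapD[OF super_familyD(1)[OF T]])
    also have "\<dots> = (if r < i \<and> i \<in> set (y # ys) then 0 else
       sg (inv_cnt r {#i#} (mset (y # ys))) (foldr T (insort i (y # ys)) x))"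
      using False unfolding inv_cnt_mset_Cons by auto
    finally show ?thesis .
  qed
qed auto

text \<open>The multiplication law of \<open>\<lambda>\<^sub>i \<lambda>\<^sub>K\<close> transferred
  to operators. For \<open>i\<close> in range and admissible \<open>K\<close>, the sign and the
  vanishing case are those of \<open>lmul\<close>; the substitution calculus rests on this
  agreement.\<close>

lemma ops_insert:
  assumes "super_family r T"
  shows "T i (ops T K x) = (if r < i \<and> i \<in># K then 0 else sg (inv_cnt r {#i#} K) (ops T (add_mset i K) x))"
  using foldr_insort[OF assms, of "sorted_list_of_multiset K" i x]
  by (simp add: ops_def)

text \<open>Mirror image of \<open>foldr_insort\<close>: with \<open>fold\<close> the first entry
  acts first, as for operators written to the right of their argument. It serves the right
  derivatives of power series.\<close>

lemma fold_insort:
  assumes T: "super_family r T" and "sorted xs"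
  shows "fold T xs (T i x) =
    (if r < i \<and> i \<in> set xs then 0 else sg (inv_cnt r {#i#} (mset xs)) (fold T (insort i xs) x))"
  using assms(2)
proof (induction xs arbitrary: x)
  case (Cons y ys)
  note add = additive_mapD[OF fold_additive[OF super_familyD(1)[OF T]]]
  have inv0: "inv_cnt r {#i#} (mset (y # ys)) = 0" if "i \<le> y"
    using that Cons.prems by (auto simp: inv_cnt_def not_less intro!: sum_mset.neutral)
  show ?case
  proof (cases "i \<le> y")
    case True
    show ?thesis
    proof (cases "r < i \<and> i = y")
      case True
      then show ?thesis by (simp add: super_familyD(3)[OF T] add)
    next
      case False
      with True Cons.prems have "\<not> (r < i \<and> i \<in> set (y # ys))" by auto
      with True show ?thesis by (simp only: inv0[OF True]) auto
    qed
  next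
    case False
    have "fold T (y # ys) (T i x) = sg (par r y * par r i) (fold T ys (T i (T y x)))"
      by (simp add: supercommuteD[OF super_familyD(2)[OF T], of y i] add)
    also have "\<dots> = (if r < i \<and> i \<in> set ys then 0 else
       sg (par r y * par r i + inv_cnt r {#i#} (mset ys)) (fold T (insort i ys) (T y x)))"
      using Cons by auto
    also have "\<dots> = (if r < i \<and> i \<in> set (y # ys) then 0 else
       sg (inv_cnt r {#i#} (mset (y # ys))) (fold T (insort i (y # ys)) x))"
      using False unfolding inv_cnt_mset_Cons by (auto simp: mult.commute)
    finally show ?thesis .
  qed
qed auto

lemma ops_supercommute:
  assumes "\<And>j. additive_map (U j)" "supercommute r T U"
  shows "T i (ops U K x) = sg (par r i * mpar r K) (ops U K (T i x))"
proof -
  have "T i (foldr U xs x) = sg (par r i * mpar r (mset xs)) (foldr U xs (T i x))" for xs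
    by (induction xs) (auto simp: supercommuteD[OF assms(2)] additive_mapD[OF assms(1)] algebra_simps)
  from this[of "sorted_list_of_multiset K"] show ?thesis by (simp add: ops_def)
qed

section \<open>Multiplication by a variable and operators on the coefficients\<close>

lemma lmul_add_mset:
  "lmul r s i F (add_mset i K) = (if adm r s (add_mset i K) then sg (inv_cnt r {#i#} K) (F K) else 0)"
  by (simp add: lmul_def)

lemma lmul_notin: "i \<notin># K \<Longrightarrow> lmul r s i F K = 0"
  by (simp add: lmul_def)

lemma additive_lmul: "additive_map (lmul r s i)"
  by (auto simp: additive_map_def lmul_def fun_eq_iff sg_add)

lemma additive_lift: "additive_map T \<Longrightarrow> additive_map (lift r i T)"
  by (auto simp: additive_map_def lift_def fun_eq_iff sg_add)

text \<open>For distinct indices the two orders of insertion differ only in \<open>inv_cnt\<close>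
  of the two single indices, hence by the product of their parities. For equal odd indices both
  sides are 0, because an admissible monomial contains an odd index at most once.\<close>

lemma supercommute_lmul: "supercommute r (lmul r s) (lmul r s)"
  unfolding supercommute_def
proof (intro allI ext)
  fix i j and F :: "mono \<Rightarrow> 'a" and K
  show "lmul r s i (lmul r s j F) K = sg (par r i * par r j) (lmul r s j (lmul r s i F)) K"
  proof (cases "i = j")
    case True
    have "\<not> (adm r s K \<and> i \<in># K \<and> i \<in># K - {#i#})" if "r < i"
    proof
      assume *: "adm r s K \<and> i \<in># K \<and> i \<in># K - {#i#}"
      then have "count K i \<ge> 2" by (metis One_nat_def Suc_1 Suc_leI count_diff count_greater_zero_iff count_single le_diff_conv not_less_eq_eq plus_1_eq_Suc zero_less_diff add.commute)
      with * that show False by (auto simp: adm_def)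
    qed
    then have "lmul r s i (lmul r s i F) K = 0" if "r < i"
      using that by (auto simp: lmul_def)
    with True show ?thesis by (cases "r < i") (auto simp: par_def sg_apply)
  next
    case False
    show ?thesis
    proof (cases "i \<in># K \<and> j \<in># K")
      case True
      then obtain L where K: "K = add_mset i (add_mset j L)"
        using False by (metis insert_DiffM insert_noteq_member)
      have K': "K = add_mset j (add_mset i L)" by (simp add: K add_mset_commute)
      have adm: "adm r s (add_mset j L)" "adm r s (add_mset i L)" if "adm r s K"
        using that K K' adm_add_msetD by metis+
      have "lmul r s i (lmul r s j F) K = (if adm r s K then sg (inv_cnt r {#i#} {#j#} + inv_cnt r {#i#} L + inv_cnt r {#j#} L) (F L) else 0)"
        using adm unfolding K by (auto simp: lmul_add_mset inv_cnt_simps ac_simps)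
      moreover have "lmul r s j (lmul r s i F) K = (if adm r s K then sg (inv_cnt r {#j#} {#i#} + inv_cnt r {#i#} L + inv_cnt r {#j#} L) (F L) else 0)"
        using adm unfolding K' by (auto simp: lmul_add_mset inv_cnt_simps ac_simps)
      ultimately show ?thesis
        using even_inv_cnt_single[OF False, of r] by (auto simp: sg_apply intro!: sg_eqI)
    next
      case F: False
      then show ?thesis using False by (auto simp: lmul_def sg_apply dest: in_diffD)
    qed
  qed
qed

lemma super_family_lmul: "super_family r (lmul r s)"
proof -
  have "lmul r s i (lmul r s i F) = 0" if "r < i" for i and F :: "mono \<Rightarrow> 'a"
  proof
    fix K
    show "lmul r s i (lmul r s i F) K = 0 K"
    proof (cases "\<exists>L. K = add_mset i (add_mset i L)")
      case True
      then show ?thesis using that by (auto simp: lmul_add_mset adm_add_mset_iff)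
    next
      case False
      then show ?thesis by (auto simp: lmul_def) (metis insert_DiffM)
    qed
  qed
  then show ?thesis
    by (simp add: super_family_def additive_lmul supercommute_lmul)
qed

text \<open>Multiplying by \<open>\<lambda>\<^sub>i\<close> raises the parity of the monomial by
  \<open>par r i\<close>, so the sign attached by \<open>lift\<close> changes by exactly the product
  of the two parities.\<close>

lemma supercommute_lmul_lift:
  assumes "\<And>i. additive_map (T i)"
  shows "supercommute r (lmul r s) (\<lambda>i. lift r i (T i))"
  unfolding supercommute_def
proof (intro allI ext)
  fix i j F K
  show "lmul r s i (lift r j (T j) F) K = sg (par r i * par r j) (lift r j (T j) (lmul r s i F)) K"
  proof (cases "i \<in># K")
    case True
    then obtain L where K: "K = add_mset i L" by (metis insert_DiffM)
    show ?thesis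
      by (auto simp: K lmul_add_mset lift_def sg_apply additive_mapD[OF assms] intro!: sg_eqI)
  next
    case False
    then show ?thesis by (simp add: lmul_notin lift_def sg_apply additive_mapD[OF assms])
  qed
qed

lemma supercommute_lift:
  assumes "\<And>i. additive_map (T i)" "\<And>i. additive_map (U i)" "supercommute r T U"
  shows "supercommute r (\<lambda>i. lift r i (T i)) (\<lambda>i. lift r i (U i))"
  using assms by (auto simp: supercommute_def lift_def sg_apply additive_mapD fun_eq_iff intro!: sg_eqI)

lemma super_family_lift:
  assumes "super_family r T"
  shows "super_family r (\<lambda>i. lift r i (T i))"
  using supercommute_lift[OF super_familyD(1)[OF assms] super_familyD(1)[OF assms] super_familyD(2)[OF assms]]
    super_familyD[OF assms]
  by (auto simp: super_family_def additive_lift lift_def additive_mapD fun_eq_iff)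

lemma const_apply: "const v K = (if K = {#} then v else 0)"
  by (simp add: const_def)

lemma lift_const: "additive_map T \<Longrightarrow> lift r i T (const v) = const (T v)"
  by (auto simp: lift_def const_def fun_eq_iff additive_mapD)

section \<open>Finite supports, and substitution of operators for variables\<close>

lemma finite_supp_lmul:
  assumes "finite {K. F K \<noteq> 0}"
  shows "finite {K. lmul r s i F K \<noteq> 0}"
proof (rule finite_subset)
  show "{K. lmul r s i F K \<noteq> 0} \<subseteq> add_mset i ` {K. F K \<noteq> 0}"
    by (auto simp: lmul_def image_iff split: if_splits) (metis insert_DiffM)
qed (use assms in simp)

lemma finite_supp_lift:
  assumes "finite {K. F K \<noteq> 0}" "T 0 = 0"
  shows "finite {K. lift r i T F K \<noteq> 0}"
  by (rule finite_subset[OF _ assms(1)]) (auto simp: lift_def assms(2))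

lemma finite_supp_const [simp]: "finite {K. const v K \<noteq> 0}"
  by (rule finite_subset[of _ "{{#}}"]) (auto simp: const_def)

lemma finite_supp_sg: "finite {K. sg n F K \<noteq> 0} \<longleftrightarrow> finite {K. F K \<noteq> 0}"
  by (simp add: sg_apply)

lemma finite_supp_add: "finite {K. F K \<noteq> 0} \<Longrightarrow> finite {K. G K \<noteq> 0} \<Longrightarrow> finite {K. (F + G) K \<noteq> (0::'a::ab_group_add)}"
  by (rule finite_subset[of _ "{K. F K \<noteq> 0} \<union> {K. G K \<noteq> 0}"]) auto

text \<open>Reindexing along \<open>add_mset i\<close>: the product with the variable lives on
  multisets containing \<open>i\<close>, and removing one copy of \<open>i\<close> recovers the
  exponent in \<open>F\<close>.\<close>

lemma sum_lmul:
  fixes h :: "mono \<Rightarrow> 'v::ab_group_add \<Rightarrow> 'w::ab_group_add"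
  assumes "finite {K. F K \<noteq> 0}" "\<And>K. h K 0 = 0"
  shows "(\<Sum>K | lmul r s i F K \<noteq> 0. h K (lmul r s i F K)) =
    (\<Sum>K | F K \<noteq> 0. if adm r s (add_mset i K) then h (add_mset i K) (sg (inv_cnt r {#i#} K) (F K)) else 0)"
proof -
  have "(\<Sum>K | lmul r s i F K \<noteq> 0. h K (lmul r s i F K)) = (\<Sum>K\<in>add_mset i ` {K. F K \<noteq> 0}. h K (lmul r s i F K))"
  proof (rule sum.mono_neutral_left)
    show "{K. lmul r s i F K \<noteq> 0} \<subseteq> add_mset i ` {K. F K \<noteq> 0}"
      by (auto simp: lmul_def image_iff split: if_splits) (metis insert_DiffM)
  qed (use assms in auto)
  also have "\<dots> = (\<Sum>K | F K \<noteq> 0. h (add_mset i K) (lmul r s i F (add_mset i K)))"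
    by (subst sum.reindex) (auto simp: inj_on_def)
  finally show ?thesis by (simp add: lmul_add_mset assms(2) if_distrib cong: if_cong)
qed

text \<open>Substitution: the monomial \<open>\<lambda>\<^sub>K\<close> becomes the operator product
  \<open>T\<^sub>K\<close> and a coefficient \<open>v\<close> becomes \<open>g v\<close>. It is used
  for \<open>-\<lambda> - \<partial>\<close> in skew-symmetry, for \<open>\<lambda> + \<mu>\<close>
  in the Jacobi identity, and for the double bracket, where \<open>g\<close> itself is a
  bracket.\<close>

definition subst_ops :: "(nat \<Rightarrow> 'w \<Rightarrow> 'w) \<Rightarrow> ('v \<Rightarrow> 'w) \<Rightarrow> (mono \<Rightarrow> 'v::ab_group_add) \<Rightarrow> 'w::ab_group_add" where
  "subst_ops T g F = (\<Sum>K | F K \<noteq> 0. ops T K (g (F K)))"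

lemma subst_ops_superset:
  assumes "finite S" "\<And>K. K \<notin> S \<Longrightarrow> F K = 0" "\<And>i. additive_map (T i)" "g 0 = 0"
  shows "subst_ops T g F = (\<Sum>K\<in>S. ops T K (g (F K)))"
  unfolding subst_ops_def
  by (rule sum.mono_neutral_left) (use assms additive_mapD(2)[OF ops_additive[OF assms(3)]] in auto)

lemma subst_ops_add:
  assumes "finite {K. F K \<noteq> 0}" "finite {K. G K \<noteq> 0}" "\<And>i. additive_map (T i)" "g 0 = 0"
    "\<And>K. g (F K + G K) = g (F K) + g (G K)"
  shows "subst_ops T g (F + G) = subst_ops T g F + subst_ops T g G"
proof -
  let ?S = "{K. F K \<noteq> 0} \<union> {K. G K \<noteq> 0}"
  have *: "subst_ops T g H = (\<Sum>K\<in>?S. ops T K (g (H K)))" if "H \<in> {F, G, F + G}" for H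
    by (rule subst_ops_superset) (use that assms in auto)
  show ?thesis
    by (simp add: * assms(5) additive_mapD[OF ops_additive[OF assms(3)]] sum.distrib)
qed

lemma subst_ops_const: "(\<And>i. additive_map (T i)) \<Longrightarrow> g 0 = 0 \<Longrightarrow> subst_ops T g (const v) = g v"
  by (subst subst_ops_superset[of "{{#}}"]) (auto simp: const_def)

text \<open>By \<open>ops_insert\<close> the products of the \<open>T i\<close> absorb a further
  factor as monomials absorb a variable. With \<open>i\<close> in range and \<open>F\<close>
  supported on admissible multisets, the vanishing case there is the same as inadmissibility of
  \<open>add_mset i K\<close>. The map \<open>g\<close> has to respect signs only on the
  coefficients of \<open>F\<close>, since the maps used later are shown to be additive only on the
  carrier.\<close>

lemma subst_ops_lmul:
  assumes T: "super_family r T" and "finite {K. F K \<noteq> 0}" "g 0 = 0" "\<And>K n. g (sg n (F K)) = sg n (g (F K))"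
    and "i \<in> {1..r+s}" "\<And>K. \<not> adm r s K \<Longrightarrow> F K = 0"
  shows "subst_ops T g (lmul r s i F) = T i (subst_ops T g F)"
proof -
  note add = super_familyD(1)[OF T]
  note add' = additive_mapD[OF ops_additive[OF add]]
  have "subst_ops T g (lmul r s i F) =
    (\<Sum>K | F K \<noteq> 0. if adm r s (add_mset i K) then ops T (add_mset i K) (g (sg (inv_cnt r {#i#} K) (F K))) else 0)"
    unfolding subst_ops_def by (rule sum_lmul) (use assms add' in auto)
  also have "\<dots> = (\<Sum>K | F K \<noteq> 0. T i (ops T K (g (F K))))"
  proof (rule sum.cong)
    fix K assume "K \<in> {K. F K \<noteq> 0}"
    with assms have "adm r s K" by auto
    then show "(if adm r s (add_mset i K) then ops T (add_mset i K) (g (sg (inv_cnt r {#i#} K) (F K))) else 0)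
        = T i (ops T K (g (F K)))"
      using assms(5) by (simp add: ops_insert[OF T] assms(4) add' adm_add_mset_iff)
  qed simp
  finally show ?thesis by (simp add: subst_ops_def additive_mapD[OF add])
qed

text \<open>An operator on the coefficients, carried by \<open>g\<close> into \<open>E i\<close>,
  comes out in front of the substitution: moving \<open>E i\<close> across \<open>T\<^sub>K\<close>
  produces the sign of parities of \<open>i\<close> and \<open>K\<close> that \<open>lift\<close>
  has built in.\<close>

lemma subst_ops_lift:
  assumes "\<And>i. additive_map (T i)" "\<And>i. additive_map (E i)" and fin: "finite {K. F K \<noteq> 0}" and "g 0 = 0" "D 0 = 0"
    and "\<And>K. g (sg n (D (F K))) = sg n (E i (g (F K)))"
    and ET: "supercommute r E T"
    and "\<And>K. g (sg (par r i * mpar r K) (D (F K))) = sg (par r i * mpar r K) (E i (g (F K)))"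
  shows "subst_ops T g (lift r i D F) = E i (subst_ops T g F)"
proof -
  note add' = additive_mapD[OF ops_additive[OF assms(1)]]
  have "subst_ops T g (lift r i D F) = (\<Sum>K | F K \<noteq> 0. ops T K (g (lift r i D F K)))"
    by (rule subst_ops_superset) (use assms in \<open>auto simp: lift_def\<close>)
  also have "\<dots> = (\<Sum>K | F K \<noteq> 0. E i (ops T K (g (F K))))"
    by (simp add: lift_def assms(8) ops_supercommute[OF assms(1) ET] add')
  finally show ?thesis by (simp add: subst_ops_def additive_mapD[OF assms(2)])
qed

section \<open>The superspace of \<open>RW(r, s)\<close>\<close>

lemma RW_scale_apply [simp]: "RW_scale c x K j = c * x K j"
  by (simp add: RW_scale_def)

lemma RW_carrier_iff:
  "x \<in> RW_carrier r s \<longleftrightarrow> finite {K. x K \<noteq> 0} \<and> (\<forall>K j. x K j \<noteq> 0 \<longrightarrow> adm r s K \<and> j \<in> {1..r+s})"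
  by (auto simp: RW_carrier_def polys_def fun_eq_iff)

lemma RW_parity_iff:
  "x \<in> RW_parity r s p \<longleftrightarrow> x \<in> RW_carrier r s \<and> (\<forall>K j. x K j \<noteq> 0 \<longrightarrow> even (mpar r K + par r j + p))"
  by (simp add: RW_parity_def)

lemma RW_parity_carrier: "x \<in> RW_parity r s p \<Longrightarrow> x \<in> RW_carrier r s"
  by (simp add: RW_parity_iff)

lemma RW_parity_cong: "even (p + q) \<Longrightarrow> RW_parity r s p = RW_parity r s q"
  by (auto simp: RW_parity_def)

lemma RW_carrier_finite: "x \<in> RW_carrier r s \<Longrightarrow> finite {K. x K \<noteq> 0}"
  by (simp add: RW_carrier_iff)

lemma RW_carrier_zero [simp]: "0 \<in> RW_carrier r s"
  by (simp add: RW_carrier_iff)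

lemma RW_carrier_add: "x \<in> RW_carrier r s \<Longrightarrow> y \<in> RW_carrier r s \<Longrightarrow> x + y \<in> RW_carrier r s"
  using finite_supp_add[of x y] by (auto simp: RW_carrier_iff) (metis add_0_left)+

lemma RW_carrier_scale: "x \<in> RW_carrier r s \<Longrightarrow> RW_scale c x \<in> RW_carrier r s"
  by (auto simp: RW_carrier_iff RW_scale_def fun_eq_iff elim: rev_finite_subset)

lemma RW_parity_zero [simp]: "0 \<in> RW_parity r s p"
  by (simp add: RW_parity_iff)

lemma RW_parity_add: "x \<in> RW_parity r s p \<Longrightarrow> y \<in> RW_parity r s p \<Longrightarrow> x + y \<in> RW_parity r s p"
  by (auto simp: RW_parity_iff RW_carrier_add) (metis add_0_left)+

lemma RW_parity_scale: "x \<in> RW_parity r s p \<Longrightarrow> RW_scale c x \<in> RW_parity r s p"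
  by (auto simp: RW_parity_iff RW_carrier_scale)

lemma RW_scale_minus1: "RW_scale (- 1) x = - x"
  by (simp add: RW_scale_def fun_eq_iff)

lemma RW_scale_0 [simp]: "RW_scale 0 x = 0"
  by (simp add: RW_scale_def fun_eq_iff)

lemma additive_RW_scale: "additive_map (RW_scale c)"
  by (simp add: additive_map_def RW_scale_def fun_eq_iff algebra_simps)

lemma RW_parity_sg: "x \<in> RW_parity r s p \<Longrightarrow> sg n x \<in> RW_parity r s p"
  using RW_parity_scale[of x r s p "- 1"] by (simp add: sg_def RW_scale_minus1)

lemma RW_carrier_sg: "x \<in> RW_carrier r s \<Longrightarrow> sg n x \<in> RW_carrier r s"
  using RW_carrier_scale[of x r s "- 1"] by (simp add: sg_def RW_scale_minus1)

lemma RW_parity_lmul: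
  assumes "x \<in> RW_parity r s p"
  shows "lmul r s k x \<in> RW_parity r s (par r k + p)"
proof -
  have fin: "finite {K. lmul r s k x K \<noteq> 0}"
    using assms by (intro finite_supp_lmul) (simp add: RW_parity_iff RW_carrier_iff)
  have nz: "adm r s K \<and> j \<in> {1..r+s} \<and> even (mpar r K + par r j + (par r k + p))"
    if "lmul r s k x K j \<noteq> 0" for K j
  proof -
    have "k \<in># K" "adm r s K" "x (K - {#k#}) j \<noteq> 0"
      using that by (auto simp: lmul_def sg_apply split: if_splits)
    then obtain L where "K = add_mset k L" "adm r s K" "x L j \<noteq> 0" by (metis insert_DiffM add_mset_remove_trivial)
    with assms show ?thesis by (auto simp: RW_parity_iff RW_carrier_iff)
  qed
  show ?thesis using fin nz by (auto simp: RW_parity_iff RW_carrier_iff)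
qed

section \<open>The monomial basis of RW(r, s) and its induction principles\<close>

definition RW_mon :: "mono \<Rightarrow> nat \<Rightarrow> 'f::field rw" where
  "RW_mon K i = (\<lambda>L j. if L = K \<and> j = i then 1 else 0)"

lemma RW_gen_eq_mon: "RW_gen i = RW_mon {#} i"
  by (auto simp: RW_gen_def RW_mon_def const_def fun_eq_iff)

lemma RW_mon_parity: "adm r s K \<Longrightarrow> i \<in> {1..r+s} \<Longrightarrow> even (mpar r K + par r i + p) \<Longrightarrow> RW_mon K i \<in> RW_parity r s p"
  by (auto simp: RW_parity_iff RW_carrier_iff RW_mon_def fun_eq_iff elim!: rev_finite_subset[of "{K}", OF _ subsetI, simplified])

lemma RW_gen_parity: "i \<in> {1..r+s} \<Longrightarrow> RW_gen i \<in> RW_parity r s (par r i)"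
  by (simp add: RW_gen_eq_mon RW_mon_parity)

lemma lmul_RW_mon:
  "lmul r s k (RW_mon K i) = (if adm r s (add_mset k K) then sg (inv_cnt r {#k#} K) (RW_mon (add_mset k K) i) else 0)"
proof
  fix L
  show "lmul r s k (RW_mon K i) L = (if adm r s (add_mset k K) then sg (inv_cnt r {#k#} K) (RW_mon (add_mset k K) i) else 0) L"
  proof (cases "k \<in># L")
    case True
    then obtain L' where L: "L = add_mset k L'" by (metis insert_DiffM)
    show ?thesis by (auto simp: L lmul_add_mset RW_mon_def fun_eq_iff sg_apply)
  next
    case False
    then show ?thesis by (auto simp: lmul_notin RW_mon_def fun_eq_iff sg_apply)
  qed
qed

lemma sum_closed:
  assumes "\<And>a. a \<in> A \<Longrightarrow> f a \<in> S" "0 \<in> S" "\<And>x y. x \<in> S \<Longrightarrow> y \<in> S \<Longrightarrow> x + y \<in> S"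
  shows "(\<Sum>a\<in>A. f a) \<in> S"
  using assms(1) by (induction A rule: infinite_finite_induct) (auto intro: assms)

lemma RW_expand:
  assumes "x \<in> RW_carrier r s"
  shows "x = (\<Sum>K | x K \<noteq> 0. \<Sum>i\<in>{1..r+s}. RW_scale (x K i) (RW_mon K i))"
proof (intro ext)
  fix K j
  have "(\<Sum>L | x L \<noteq> 0. \<Sum>i\<in>{1..r+s}. RW_scale (x L i) (RW_mon L i)) K j =
    (\<Sum>L | x L \<noteq> 0. \<Sum>i\<in>{1..r+s}. if i = j then (if L = K then x L i else 0) else 0)"
    by (simp add: sum_apply RW_mon_def if_distrib conj_commute cong: if_cong) (intro sum.cong refl, auto)
  also have "\<dots> = (\<Sum>L | x L \<noteq> 0. if L = K then (if j \<in> {1..r+s} then x L j else 0) else 0)"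
    by (intro sum.cong refl) (simp add: sum.delta)
  also have "\<dots> = x K j"
    using assms by (subst sum.delta) (auto simp: RW_carrier_iff)
  finally show "x K j = (\<Sum>L | x L \<noteq> 0. \<Sum>i\<in>{1..r+s}. RW_scale (x L i) (RW_mon L i)) K j" by simp
qed

lemma RW_mon_induct [consumes 1, case_names zero add scale mon]:
  assumes x: "x \<in> RW_parity r s p"
    and zero: "P 0"
    and add: "\<And>x y. x \<in> RW_parity r s p \<Longrightarrow> y \<in> RW_parity r s p \<Longrightarrow> P x \<Longrightarrow> P y \<Longrightarrow> P (x + y)"
    and scale: "\<And>c x. x \<in> RW_parity r s p \<Longrightarrow> P x \<Longrightarrow> P (RW_scale c x)"
    and mon: "\<And>K i. adm r s K \<Longrightarrow> i \<in> {1..r+s} \<Longrightarrow> even (mpar r K + par r i + p) \<Longrightarrow> P (RW_mon K i)"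
  shows "P x"
proof -
  have "(\<Sum>K | x K \<noteq> 0. \<Sum>i\<in>{1..r+s}. RW_scale (x K i) (RW_mon K i)) \<in> {y \<in> RW_parity r s p. P y}"
  proof (intro sum_closed)
    fix K i assume "i \<in> {1..r+s}"
    show "RW_scale (x K i) (RW_mon K i) \<in> {y \<in> RW_parity r s p. P y}"
    proof (cases "x K i = 0")
      case False
      then have "adm r s K" "even (mpar r K + par r i + p)"
        using x by (auto simp: RW_parity_iff RW_carrier_iff)
      then show ?thesis using \<open>i \<in> {1..r+s}\<close> by (simp add: RW_mon_parity RW_parity_scale scale mon)
    qed (simp add: zero)
  qed (auto simp: zero add RW_parity_add)
  then show ?thesis using RW_expand[OF RW_parity_carrier[OF x]] by simp
qed

text \<open>Homogeneous elements are reached from the generators by applying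
  \<open>\<partial>\<^sub>k\<close>. The parity is an argument of \<open>P\<close> because each such
  step changes it. The case \<open>cong\<close> is present since parities are natural numbers read
  modulo 2: the one computed along a monomial agrees with the given one only modulo 2.\<close>

lemma RW_hom_induct [consumes 1, case_names cong zero add scale gen lmul]:
  fixes x :: "'f::field rw"
  assumes x: "x \<in> RW_parity r s p"
    and cong: "\<And>q q' x. even (q + q') \<Longrightarrow> P q x \<Longrightarrow> P q' x"
    and zero: "\<And>q. P q 0"
    and add: "\<And>q x y. x \<in> RW_parity r s q \<Longrightarrow> y \<in> RW_parity r s q \<Longrightarrow> P q x \<Longrightarrow> P q y \<Longrightarrow> P q (x + y)"
    and scale: "\<And>q c x. x \<in> RW_parity r s q \<Longrightarrow> P q x \<Longrightarrow> P q (RW_scale c x)"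
    and gen: "\<And>i. i \<in> {1..r+s} \<Longrightarrow> P (par r i) (RW_gen i)"
    and lmul: "\<And>q k x. k \<in> {1..r+s} \<Longrightarrow> x \<in> RW_parity r s q \<Longrightarrow> P q x \<Longrightarrow> P (par r k + q) (lmul r s k x)"
  shows "P p x"
proof -
  have mon: "P (mpar r K + par r i) (RW_mon K i)" if "adm r s K" "i \<in> {1..r+s}" for K i
    using that(1)
  proof (induction K)
    case empty
    then show ?case using gen[OF that(2)] by (simp add: RW_gen_eq_mon)
  next
    case (add k K)
    have adm: "adm r s K" "k \<in> {1..r+s}" using add.prems by (auto simp: adm_add_mset_iff)
    let ?n = "inv_cnt r {#k#} K"
    have mem: "RW_mon K i \<in> RW_parity r s (mpar r K + par r i)"
      using adm that by (simp add: RW_mon_parity)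
    have "P (par r k + (mpar r K + par r i)) (lmul r s k (RW_mon K i))"
      using adm add.IH mem by (intro lmul) auto
    \<comment> \<open>Applying \<open>\<partial>\<^sub>k\<close> to the basis element yields the
      next one only up to the reordering sign, which this scalar cancels.\<close>
    then have "P (par r k + (mpar r K + par r i)) (RW_scale ((-1) ^ ?n) (lmul r s k (RW_mon K i)))"
      by (rule scale[OF RW_parity_lmul[OF mem]])
    moreover have "RW_scale ((-1) ^ ?n) (lmul r s k (RW_mon K i)) = (RW_mon (add_mset k K) i :: 'f rw)"
      using add.prems by (auto simp: lmul_RW_mon sg_def RW_scale_def fun_eq_iff)
    ultimately show ?case by (simp only: mpar_add_mset add.assoc)
  qed
  show ?thesis
    using x
  proof (induction rule: RW_mon_induct)
    case (mon K i)
    show ?case by (rule cong[OF _ \<open>\<And>K i. adm r s K \<Longrightarrow> i \<in> {1..r+s} \<Longrightarrow> P (mpar r K + par r i) (RW_mon K i)\<close>]) (use mon in auto)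
  qed (blast intro: zero add scale)+
qed

lemma RW_split:
  assumes "x \<in> RW_carrier r s"
  obtains y z where "y \<in> RW_parity r s 0" "z \<in> RW_parity r s 1" "x = y + z"
proof
  let ?y = "(\<lambda>K j. if even (mpar r K + par r j) then x K j else 0) :: 'a rw"
  let ?z = "(\<lambda>K j. if even (mpar r K + par r j) then 0 else x K j) :: 'a rw"
  have "finite {K. ?y K \<noteq> 0}" "finite {K. ?z K \<noteq> 0}"
    by (rule finite_subset[OF _ RW_carrier_finite[OF assms]]; auto simp: fun_eq_iff)+
  then show "?y \<in> RW_parity r s 0" "?z \<in> RW_parity r s 1"
    using assms by (auto simp: RW_parity_iff RW_carrier_iff split: if_splits)
  show "x = ?y + ?z" by (auto simp: fun_eq_iff)
qed

lemma RW_carrier_induct [consumes 1, case_names add hom]: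
  assumes "x \<in> RW_carrier r s"
    and add: "\<And>x y. x \<in> RW_carrier r s \<Longrightarrow> y \<in> RW_carrier r s \<Longrightarrow> P x \<Longrightarrow> P y \<Longrightarrow> P (x + y)"
    and hom: "\<And>p x. x \<in> RW_parity r s p \<Longrightarrow> P x"
  shows "P x"
  using RW_split[OF assms(1)] by (metis add hom RW_parity_carrier)

lemma RW_linear_induct [consumes 1, case_names zero add scale mon]:
  assumes "x \<in> RW_carrier r s"
    and zero: "P 0"
    and add: "\<And>x y. x \<in> RW_carrier r s \<Longrightarrow> y \<in> RW_carrier r s \<Longrightarrow> P x \<Longrightarrow> P y \<Longrightarrow> P (x + y)"
    and scale: "\<And>c x. x \<in> RW_carrier r s \<Longrightarrow> P x \<Longrightarrow> P (RW_scale c x)"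
    and mon: "\<And>K i. adm r s K \<Longrightarrow> i \<in> {1..r+s} \<Longrightarrow> P (RW_mon K i)"
  shows "P x"
  using assms(1)
proof (induction rule: RW_carrier_induct)
  case (hom p x)
  then show ?case
    by (induction rule: RW_mon_induct) (blast intro: zero add scale mon RW_parity_carrier)+
qed (rule add)

lemma RW_carrier_lmul: "x \<in> RW_carrier r s \<Longrightarrow> lmul r s k x \<in> RW_carrier r s"
proof (induction rule: RW_carrier_induct)
  case (add x y)
  then show ?case by (simp only: additive_mapD(1)[OF additive_lmul] RW_carrier_add)
qed (auto intro: RW_parity_lmul RW_parity_carrier)

lemma RW_simps [simp]:
  "scl (RW r s) = RW_scale" "ev_part (RW r s) = RW_parity r s 0" "od_part (RW r s) = RW_parity r s 1"
  "dleft (RW r s) = lmul r s" "dright (RW r s) = RW_dright r s" "lbr (RW r s) = RW_bracket r s"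
  by (simp_all add: RW_def)

lemma carr_RW [simp]: "carr (RW r s) = RW_carrier r s"
proof -
  have "\<exists>y z. x = y + z \<and> y \<in> RW_parity r s 0 \<and> z \<in> RW_parity r s 1" if "x \<in> RW_carrier r s" for x :: "'a rw"
    using RW_split[OF that] by blast
  then show ?thesis by (force simp: carr_def intro: RW_carrier_add RW_parity_carrier)
qed

lemma hom_part_RW [simp]: "hom_part (RW r s) p = RW_parity r s p"
  using RW_parity_cong[of p 0 r s] RW_parity_cong[of p 1 r s] by (auto simp: hom_part_def)

lemma vector_space_RW: "vector_space (RW_scale :: 'f::field \<Rightarrow> _)"
  by standard (auto simp: RW_scale_def fun_eq_iff algebra_simps)

lemma subspace_RW_iff:
  "module.subspace (RW_scale :: 'f::field \<Rightarrow> _) S \<longleftrightarrow> 0 \<in> S \<and> (\<forall>x\<in>S. \<forall>y\<in>S. x + y \<in> S) \<and> (\<forall>c. \<forall>x\<in>S. RW_scale c x \<in> S)"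
  by (rule module.subspace_def[OF vector_space_RW[folded module_iff_vector_space]])

lemmas pointwise = plus_fun_apply zero_fun_apply uminus_apply minus_apply RW_scale_apply

\<comment> \<open>As simp rules these would turn sums of functions into \<open>\<lambda>\<close>-abstractions, on which no other rule matches.\<close>
declare pointwise [simp del]

section \<open>The bracket of \<open>RW(r, s)\<close>\<close>

lemma super_family_lift_lmul: "super_family r (\<lambda>k. lift r k (lmul r s k))"
  by (rule super_family_lift[OF super_family_lmul])

lemma supercommute_lift_lmul: "supercommute r (\<lambda>k. lift r k (lmul r s k)) (lmul r s)"
  by (rule supercommute_sym[OF supercommute_lmul_lift[OF additive_lmul]])

lemma super_family_shift: "super_family r (\<lambda>k F. lift r k (lmul r s k) F + lmul r s k F)"
  by (rule super_family_plus[OF super_family_lift_lmul super_family_lmul supercommute_lift_lmul])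

lemma super_family_neg_lmul: "super_family r (\<lambda>k F. - lmul r s k F)"
  by (rule super_family_minus[OF super_family_lmul])

lemma supercommute_shift_neg_lmul:
  "supercommute r (\<lambda>k F. lift r k (lmul r s k) F + lmul r s k F) (\<lambda>k F. - lmul r s k F)"
  by (rule supercommute_minus[OF super_familyD(1)[OF super_family_shift]
        supercommute_sym[OF supercommute_plus[OF additive_lmul supercommute_lmul_lift[OF additive_lmul] supercommute_lmul]]])

lemma fscale_RW_scale: "fscale RW_scale c F = (\<lambda>K L j. c * F K L j)"
  by (simp add: fscale_def RW_scale_def)

section \<open>Bilinearity of the bracket\<close>

definition RW_mon_bracket :: "nat \<Rightarrow> nat \<Rightarrow> mono \<Rightarrow> nat \<Rightarrow> mono \<Rightarrow> nat \<Rightarrow> mono \<Rightarrow> 'f::field rw" where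
  "RW_mon_bracket r s K i L j = sg (mpar r L * par r i)
     (ops (\<lambda>k F. - lmul r s k F) K
       (ops (\<lambda>k F. lift r k (lmul r s k) F + lmul r s k F) L (RW_gen_bracket r s i j)))"

text \<open>The sums in \<open>RW_bracket\<close> run over the supports of the arguments, which
  change under addition and scaling. Over common finite supersets both sides of a linearity claim
  can be compared term by term.\<close>

lemma RW_bracket_superset:
  assumes "finite S" "\<And>K. K \<notin> S \<Longrightarrow> x K = 0" "finite S'" "\<And>K. K \<notin> S' \<Longrightarrow> y K = 0"
  shows "RW_bracket r s x y = (\<Sum>K\<in>S. \<Sum>i\<in>{1..r+s}. \<Sum>L\<in>S'. \<Sum>j\<in>{1..r+s}.
    fscale RW_scale (x K i * y L j) (RW_mon_bracket r s K i L j))"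
proof -
  have "RW_bracket r s x y = (\<Sum>K | x K \<noteq> 0. \<Sum>i\<in>{1..r+s}. \<Sum>L\<in>S'. \<Sum>j\<in>{1..r+s}.
    fscale RW_scale (x K i * y L j) (RW_mon_bracket r s K i L j))"
    unfolding RW_bracket_def RW_mon_bracket_def
    by (intro sum.cong refl sum.mono_neutral_left) (use assms in \<open>auto simp: fscale_RW_scale fun_eq_iff sum_apply pointwise\<close>)
  also have "\<dots> = (\<Sum>K\<in>S. \<Sum>i\<in>{1..r+s}. \<Sum>L\<in>S'. \<Sum>j\<in>{1..r+s}.
    fscale RW_scale (x K i * y L j) (RW_mon_bracket r s K i L j))"
    by (intro sum.mono_neutral_left) (use assms in \<open>auto simp: fscale_RW_scale fun_eq_iff sum_apply pointwise\<close>)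
  finally show ?thesis .
qed

lemma RW_bracket_apply:
  assumes "finite S" "\<And>K. K \<notin> S \<Longrightarrow> x K = 0" "finite S'" "\<And>K. K \<notin> S' \<Longrightarrow> y K = 0"
  shows "RW_bracket r s x y J M m = (\<Sum>K\<in>S. \<Sum>i\<in>{1..r+s}. \<Sum>L\<in>S'. \<Sum>j\<in>{1..r+s}.
    x K i * y L j * RW_mon_bracket r s K i L j J M m)"
  by (simp add: RW_bracket_superset[OF assms] sum_apply fscale_RW_scale pointwise)

lemma RW_bracket_add_left:
  assumes "x \<in> RW_carrier r s" "x' \<in> RW_carrier r s" "y \<in> RW_carrier r s"
  shows "RW_bracket r s (x + x') y = RW_bracket r s x y + RW_bracket r s x' y"
proof (intro ext)
  fix J M m
  let ?S = "{K. x K \<noteq> 0} \<union> {K. x' K \<noteq> 0}" and ?S' = "{K. y K \<noteq> 0}"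
  have *: "RW_bracket r s z y J M m = (\<Sum>K\<in>?S. \<Sum>i\<in>{1..r+s}. \<Sum>L\<in>?S'. \<Sum>j\<in>{1..r+s}.
    z K i * y L j * RW_mon_bracket r s K i L j J M m)" if "z \<in> {x, x', x + x'}" for z
    by (rule RW_bracket_apply) (use that assms in \<open>auto dest: RW_carrier_finite simp: pointwise\<close>)
  show "RW_bracket r s (x + x') y J M m = (RW_bracket r s x y + RW_bracket r s x' y) J M m"
    by (simp add: * sum.distrib algebra_simps pointwise)
qed

lemma RW_bracket_add_right:
  assumes "x \<in> RW_carrier r s" "y \<in> RW_carrier r s" "y' \<in> RW_carrier r s"
  shows "RW_bracket r s x (y + y') = RW_bracket r s x y + RW_bracket r s x y'"
proof (intro ext)
  fix J M m
  let ?S = "{K. x K \<noteq> 0}" and ?S' = "{K. y K \<noteq> 0} \<union> {K. y' K \<noteq> 0}"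
  have *: "RW_bracket r s x z J M m = (\<Sum>K\<in>?S. \<Sum>i\<in>{1..r+s}. \<Sum>L\<in>?S'. \<Sum>j\<in>{1..r+s}.
    x K i * z L j * RW_mon_bracket r s K i L j J M m)" if "z \<in> {y, y', y + y'}" for z
    by (rule RW_bracket_apply) (use that assms in \<open>auto dest: RW_carrier_finite simp: pointwise\<close>)
  show "RW_bracket r s x (y + y') J M m = (RW_bracket r s x y + RW_bracket r s x y') J M m"
    by (simp add: * sum.distrib algebra_simps pointwise)
qed

lemma RW_bracket_scale_left:
  assumes "x \<in> RW_carrier r s" "y \<in> RW_carrier r s"
  shows "RW_bracket r s (RW_scale c x) y = fscale RW_scale c (RW_bracket r s x y)"
proof (intro ext)
  fix J M m
  have *: "RW_bracket r s z y J M m = (\<Sum>K | x K \<noteq> 0. \<Sum>i\<in>{1..r+s}. \<Sum>L | y L \<noteq> 0. \<Sum>j\<in>{1..r+s}.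
    z K i * y L j * RW_mon_bracket r s K i L j J M m)" if "z \<in> {x, RW_scale c x}" for z
    by (rule RW_bracket_apply) (use that assms in \<open>auto dest: RW_carrier_finite simp: RW_scale_def fun_eq_iff pointwise\<close>)
  show "RW_bracket r s (RW_scale c x) y J M m = fscale RW_scale c (RW_bracket r s x y) J M m"
    by (simp add: * fscale_RW_scale pointwise sum_distrib_left mult.assoc)
qed

lemma RW_bracket_scale_right:
  assumes "x \<in> RW_carrier r s" "y \<in> RW_carrier r s"
  shows "RW_bracket r s x (RW_scale c y) = fscale RW_scale c (RW_bracket r s x y)"
proof (intro ext)
  fix J M m
  have *: "RW_bracket r s x z J M m = (\<Sum>K | x K \<noteq> 0. \<Sum>i\<in>{1..r+s}. \<Sum>L | y L \<noteq> 0. \<Sum>j\<in>{1..r+s}.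
    x K i * z L j * RW_mon_bracket r s K i L j J M m)" if "z \<in> {y, RW_scale c y}" for z
    by (rule RW_bracket_apply) (use that assms in \<open>auto dest: RW_carrier_finite simp: RW_scale_def fun_eq_iff pointwise\<close>)
  show "RW_bracket r s x (RW_scale c y) J M m = fscale RW_scale c (RW_bracket r s x y) J M m"
    by (simp add: * fscale_RW_scale pointwise sum_distrib_left mult.assoc mult.left_commute)
qed

lemma fscale_RW_scale_simps:
  "fscale RW_scale (-1) F = - F" "fscale RW_scale 0 F = 0" "fscale RW_scale c 0 = 0"
  "fscale RW_scale c (F + G) = fscale RW_scale c F + fscale RW_scale c G"
  "fscale RW_scale c (- F) = - fscale RW_scale c F"
  by (auto simp: fscale_RW_scale fun_eq_iff algebra_simps pointwise)

lemma RW_bracket_zero [simp]: "RW_bracket r s 0 y = 0" "RW_bracket r s x 0 = 0"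
  by (simp_all add: RW_bracket_def pointwise)

lemma RW_bracket_sg:
  assumes "x \<in> RW_carrier r s" "y \<in> RW_carrier r s"
  shows "RW_bracket r s (sg n x) y = sg n (RW_bracket r s x y)"
    "RW_bracket r s x (sg n y) = sg n (RW_bracket r s x y)"
  using RW_bracket_scale_left[OF assms, of "- 1"] RW_bracket_scale_right[OF assms, of "- 1"]
  by (auto simp: sg_def RW_scale_minus1 fscale_RW_scale_simps)

lemma RW_mon_carrier: "adm r s K \<Longrightarrow> i \<in> {1..r+s} \<Longrightarrow> RW_mon K i \<in> RW_carrier r s"
  using RW_mon_parity[of r s K i "mpar r K + par r i"] by (auto intro: RW_parity_carrier)

lemma RW_gen_carrier: "i \<in> {1..r+s} \<Longrightarrow> RW_gen i \<in> RW_carrier r s"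
  by (simp add: RW_gen_eq_mon RW_mon_carrier)

lemma RW_bracket_mon:
  assumes "i \<in> {1..r+s}" "j \<in> {1..r+s}"
  shows "RW_bracket r s (RW_mon K i) (RW_mon L j) = RW_mon_bracket r s K i L j"
proof (intro ext)
  fix J M m
  have "RW_bracket r s (RW_mon K i) (RW_mon L j) J M m = (\<Sum>K'\<in>{K}. \<Sum>i'\<in>{1..r+s}. \<Sum>L'\<in>{L}. \<Sum>j'\<in>{1..r+s}.
    RW_mon K i K' i' * RW_mon L j L' j' * RW_mon_bracket r s K' i' L' j' J M m)"
    by (rule RW_bracket_apply) (auto simp: RW_mon_def fun_eq_iff pointwise)
  also have "\<dots> = (\<Sum>i'\<in>{1..r+s}. \<Sum>j'\<in>{1..r+s}. if j' = j then (if i' = i then RW_mon_bracket r s K i L j J M m else 0) else 0)"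
    by (simp only: sum.insert sum.empty finite.emptyI finite.insertI empty_iff add_0_right not_False_eq_True)
      (intro sum.cong refl, auto simp: RW_mon_def pointwise)
  also have "\<dots> = RW_mon_bracket r s K i L j J M m"
    using assms by simp
  finally show "RW_bracket r s (RW_mon K i) (RW_mon L j) J M m = RW_mon_bracket r s K i L j J M m" .
qed

section \<open>Sesquilinearity of the bracket\<close>

lemma additive_fscale_RW_scale: "additive_map (fscale RW_scale c)"
  by (simp add: additive_map_def fscale_RW_scale_simps)

lemma lmul_fscale: "lmul r s k (fscale RW_scale c F) = fscale RW_scale c (lmul r s k F)"
  by (auto simp: lmul_def fscale_def fun_eq_iff sg_def pointwise)

lemma lmul_RW_scale: "lmul r s k (RW_scale c x) = RW_scale c (lmul r s k x)"
  by (auto simp: lmul_def RW_scale_def fun_eq_iff sg_def pointwise)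

lemma lift_lmul_fscale: "lift r k (lmul r s k) (fscale RW_scale c F) = fscale RW_scale c (lift r k (lmul r s k) F)"
  by (auto simp: lift_def fscale_def fun_eq_iff sg_def pointwise lmul_RW_scale)

text \<open>By bilinearity both arguments may be basis elements. There the bracket starts with the
  product \<open>(-\<lambda>)\<^sub>K\<close>, and a further \<open>-\<lambda>\<^sub>k\<close> is
  inserted into it with the same sign and the same zeros with which
  \<open>\<partial>\<^sub>k\<close> is inserted into \<open>\<partial>\<^sub>K\<close>.\<close>

lemma RW_bracket_lmul_left:
  fixes x y :: "'f::field rw"
  assumes x: "x \<in> RW_carrier r s" and y: "y \<in> RW_carrier r s" and k: "k \<in> {1..r+s}"
  shows "RW_bracket r s (lmul r s k x) y = - lmul r s k (RW_bracket r s x y)"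
  using x
proof (induction rule: RW_linear_induct)
  case zero
  then show ?case by (simp add: additive_mapD(2)[OF additive_lmul])
next
  case (add x x')
  then show ?case
    using y by (simp add: additive_mapD(1)[OF additive_lmul] RW_bracket_add_left RW_carrier_lmul)
next
  case (scale c x)
  then show ?case using y by (simp add: lmul_RW_scale RW_bracket_scale_left RW_carrier_lmul lmul_fscale fscale_RW_scale_simps)
next
  case (mon K i)
  note K = mon
  show ?case
    using y
  proof (induction rule: RW_linear_induct)
    case zero
    then show ?case by (simp add: additive_mapD(2)[OF additive_lmul])
  next
    case (add x x')
    then show ?case
      using K by (simp add: additive_mapD(1)[OF additive_lmul] RW_bracket_add_right RW_carrier_lmul RW_mon_carrier)
  next
    case (scale c x)
    then show ?case using K by (simp add: RW_bracket_scale_right RW_carrier_lmul RW_mon_carrier lmul_fscale fscale_RW_scale_simps)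
  next
    case (mon L j)
    have "RW_bracket r s (lmul r s k (RW_mon K i)) (RW_mon L j)
        = (if adm r s (add_mset k K) then sg (inv_cnt r {#k#} K) (RW_mon_bracket r s (add_mset k K) i L j) else 0)"
      using K mon by (simp add: lmul_RW_mon RW_bracket_sg RW_mon_carrier RW_bracket_mon)
    moreover have "- lmul r s k (RW_mon_bracket r s K i L j :: mono \<Rightarrow> 'f rw)
        = (if adm r s (add_mset k K) then sg (inv_cnt r {#k#} K) (RW_mon_bracket r s (add_mset k K) i L j) else 0)"
    proof -
      let ?Y = "ops (\<lambda>k F. lift r k (lmul r s k) F + lmul r s k F) L (RW_gen_bracket r s i j) :: mono \<Rightarrow> 'f rw"
      have "- lmul r s k (ops (\<lambda>k F. - lmul r s k F) K ?Y) = (if adm r s (add_mset k K)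
          then sg (inv_cnt r {#k#} K) (ops (\<lambda>k F. - lmul r s k F) (add_mset k K) ?Y) else 0)"
        using K k ops_insert[OF super_family_neg_lmul, where i = k and K = K and x = ?Y] by (simp add: adm_add_mset_iff)
      then show ?thesis
        unfolding RW_mon_bracket_def
        by (simp only: additive_mapD(4)[OF additive_lmul] sg_minus[symmetric]) (simp add: add.commute[where 'a = nat])
    qed
    ultimately show ?case using K mon by (simp add: RW_bracket_mon)
  qed
qed

text \<open>On basis elements the operator \<open>\<partial>\<^sub>k + \<lambda>\<^sub>k\<close> has
  to cross \<open>(-\<lambda>)\<^sub>K\<close> to join the product indexed by \<open>L\<close>,
  which costs the parities of \<open>k\<close> and \<open>K\<close>; the prefactor of
  \<open>RW_mon_bracket\<close> changes by those of \<open>k\<close> and \<open>i\<close>. Together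
  this is the sign of \<open>par r k * p\<close>, because \<open>mpar r K + par r i\<close> is
  congruent to \<open>p\<close>.\<close>

lemma RW_bracket_lmul_right:
  fixes x y :: "'f::field rw"
  assumes x: "x \<in> RW_parity r s p" and y: "y \<in> RW_carrier r s" and k: "k \<in> {1..r+s}"
  shows "RW_bracket r s x (lmul r s k y) =
    sg (par r k * p) (lift r k (lmul r s k) (RW_bracket r s x y) + lmul r s k (RW_bracket r s x y))"
  using x
proof (induction rule: RW_mon_induct)
  case zero
  then show ?case
    by (simp add: additive_mapD(2)[OF additive_lmul] additive_mapD(2)[OF super_familyD(1)[OF super_family_lift_lmul]])
next
  case (add x x')
  then show ?case
    using y by (simp add: additive_mapD(1)[OF super_familyD(1)[OF super_family_shift]] RW_bracket_add_left
      RW_carrier_lmul RW_parity_carrier sg_add)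
next
  case (scale c x)
  then show ?case
    using y by (simp add: RW_bracket_scale_left RW_carrier_lmul RW_parity_carrier lmul_fscale lift_lmul_fscale
      additive_mapD(1,4)[OF additive_fscale_RW_scale])
next
  case (mon K i)
  note K = mon
  show ?case
    using y
  proof (induction rule: RW_linear_induct)
    case zero
    then show ?case by (simp add: additive_mapD(2)[OF additive_lmul] additive_mapD(2)[OF additive_lmul] additive_mapD(2)[OF super_familyD(1)[OF super_family_lift_lmul]])
  next
    case (add x x')
    then show ?case
      using K by (simp add: additive_mapD(1)[OF super_familyD(1)[OF super_family_lift_lmul]] additive_mapD(1)[OF additive_lmul] RW_bracket_add_right
        RW_carrier_lmul RW_mon_carrier sg_add)
  next
    case (scale c x)
    then show ?case
      using K by (simp add: RW_bracket_scale_right lmul_RW_scale RW_carrier_lmul RW_mon_carrier lmul_fscale lift_lmul_fscale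
      additive_mapD(1,4)[OF additive_fscale_RW_scale])
  next
    case (mon L j)
    let ?T = "\<lambda>k F. - lmul r s k F" and ?U = "\<lambda>k F. lift r k (lmul r s k) F + lmul r s k F"
    let ?X = "RW_gen_bracket r s i j :: mono \<Rightarrow> 'f rw"
    note addT = additive_mapD[OF ops_additive[OF super_familyD(1)[OF super_family_neg_lmul]]]
    note addU = additive_mapD[OF super_familyD(1)[OF super_family_shift]]
    have "RW_bracket r s (RW_mon K i) (lmul r s k (RW_mon L j))
        = (if adm r s (add_mset k L) then sg (inv_cnt r {#k#} L) (RW_mon_bracket r s K i (add_mset k L) j) else 0)"
      using K mon by (simp add: lmul_RW_mon RW_bracket_sg RW_mon_carrier RW_bracket_mon)
    moreover have "sg (par r k * p) (?U k (RW_mon_bracket r s K i L j :: mono \<Rightarrow> 'f rw))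
        = (if adm r s (add_mset k L) then sg (inv_cnt r {#k#} L) (RW_mon_bracket r s K i (add_mset k L) j) else 0)"
    proof -
      have "?U k (RW_mon_bracket r s K i L j) = sg (mpar r L * par r i) (?U k (ops ?T K (ops ?U L ?X)))"
        unfolding RW_mon_bracket_def by (rule addU(4))
      also have "?U k (ops ?T K (ops ?U L ?X)) = sg (par r k * mpar r K) (ops ?T K (?U k (ops ?U L ?X)))"
        by (rule ops_supercommute[OF super_familyD(1)[OF super_family_neg_lmul] supercommute_shift_neg_lmul])
      also have "?U k (ops ?U L ?X) = (if adm r s (add_mset k L) then sg (inv_cnt r {#k#} L) (ops ?U (add_mset k L) ?X) else 0)"
        using mon k ops_insert[OF super_family_shift, where i = k and K = L and x = ?X] by (simp add: adm_add_mset_iff)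
      finally have eq: "?U k (RW_mon_bracket r s K i L j) = sg (mpar r L * par r i) (sg (par r k * mpar r K)
          (ops ?T K (if adm r s (add_mset k L) then sg (inv_cnt r {#k#} L) (ops ?U (add_mset k L) ?X) else 0)))" .
      show ?thesis
        unfolding eq using K by (auto simp: RW_mon_bracket_def addT intro!: sg_eqI)
    qed
    ultimately show ?case using K mon by (simp add: RW_bracket_mon)
  qed
qed

section \<open>The bimodule structure\<close>

lemma RW_dright_hom: "x \<in> RW_parity r s p \<Longrightarrow> RW_dright r s i x = sg (par r i * p) (lmul r s i x)"
proof -
  assume x: "x \<in> RW_parity r s p"
  have "(\<lambda>K j. sg (par r i * (mpar r K + par r j)) (x K j)) = sg (par r i * p) x"
  proof (intro ext)
    fix K j
    show "sg (par r i * (mpar r K + par r j)) (x K j) = sg (par r i * p) x K j"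
      using x by (cases "x K j = 0") (auto simp: sg_apply RW_parity_iff intro!: sg_eqI)
  qed
  then show ?thesis by (simp add: RW_dright_def additive_mapD(4)[OF additive_lmul])
qed

lemma additive_RW_dright: "additive_map (RW_dright r s i)"
proof -
  have "(\<lambda>K j. sg (par r i * (mpar r K + par r j)) ((x + y) K j)) =
      (\<lambda>K j. sg (par r i * (mpar r K + par r j)) (x K j)) + (\<lambda>K j. sg (par r i * (mpar r K + par r j)) (y K j))"
    for x y :: "'a rw"
    by (simp add: fun_eq_iff pointwise sg_add)
  then show ?thesis by (simp add: additive_map_def RW_dright_def additive_mapD(1)[OF additive_lmul])
qed

lemma RW_dright_scale: "RW_dright r s i (RW_scale c x) = RW_scale c (RW_dright r s i x)"
  by (auto simp: RW_dright_def lmul_def RW_scale_def fun_eq_iff sg_def pointwise)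

lemma RW_parity_lmul': "x \<in> RW_parity r s p \<Longrightarrow> lmul r s k x \<in> RW_parity r s (p + par r k)"
  using RW_parity_lmul[of x r s p k] by (simp add: add.commute)

lemma super_bimodule_RW: "super_bimodule r s (RW r s :: ('f::{field, ring_char_0}, 'f rw) lcs)"
proof -
  have "x = 0" if "x \<in> RW_parity r s 0" "x \<in> RW_parity r s 1" for x :: "'f rw"
  proof (intro ext)
    fix K j
    have "x K j \<noteq> 0 \<Longrightarrow> even (mpar r K + par r j + 0) \<and> even (mpar r K + par r j + 1)"
      using that by (simp only: RW_parity_iff) blast
    then show "x K j = 0 K j" by (auto simp: zero_fun_apply)
  qed
  then have space: "super_space (RW r s :: ('f, 'f rw) lcs)"
    unfolding super_space_def
    by (simp add: vector_space_RW subspace_RW_iff RW_parity_add RW_parity_scale) (auto simp: subsetI)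
  have comm: "lmul r s i (lmul r s j x) = sg (par r i * par r j) (lmul r s j (lmul r s i x)) \<and>
     RW_dright r s j (RW_dright r s i x) = sg (par r i * par r j) (RW_dright r s i (RW_dright r s j x)) \<and>
     RW_dright r s j (lmul r s i x) = lmul r s i (RW_dright r s j x)"
    if "x \<in> RW_carrier r s" for i j and x :: "'f rw"
    using that
  proof (induction rule: RW_carrier_induct)
    case (add x y)
    then show ?case
      by (simp add: additive_mapD(1)[OF additive_RW_dright] additive_mapD(1)[OF additive_lmul] sg_add)
  next
    case (hom p x)
    note lm = RW_parity_lmul'[OF hom]
    note hom' = RW_dright_hom[OF hom] RW_dright_hom[OF lm] RW_dright_hom[OF RW_parity_sg[OF lm]]
    have c: "lmul r s i (lmul r s j x) = sg (par r i * par r j) (lmul r s j (lmul r s i x))"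
      by (rule supercommuteD[OF supercommute_lmul])
    show ?case
      by (simp only: hom' c additive_mapD(4)[OF additive_lmul] sg_sg) (auto intro!: sg_eqI)
  qed
  have hom: "lmul r s i x \<in> RW_parity r s (p + par r i) \<and> RW_dright r s i x \<in> RW_parity r s (p + par r i) \<and>
      RW_dright r s i x = sg (par r i * p) (lmul r s i x)" if "x \<in> RW_parity r s p" for i p and x :: "'f rw"
    using that by (simp add: RW_parity_lmul' RW_dright_hom RW_parity_sg)
  have lin: "linear_on_set (RW_carrier r s) RW_scale RW_scale (lmul r s i :: 'f rw \<Rightarrow> _) \<and>
      linear_on_set (RW_carrier r s) RW_scale RW_scale (RW_dright r s i :: 'f rw \<Rightarrow> _)" for i
    by (simp add: linear_on_set_def additive_mapD(1)[OF additive_RW_dright] additive_mapD(1)[OF additive_lmul]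
      RW_dright_scale lmul_RW_scale)
  show ?thesis
    unfolding super_bimodule_def RW_simps carr_RW hom_part_RW
    by (intro conjI ballI allI space; use comm hom lin in blast)
qed

section \<open>Homogeneous polynomials and the parity of the bracket\<close>

definition RW_poly :: "nat \<Rightarrow> nat \<Rightarrow> nat \<Rightarrow> (mono \<Rightarrow> 'f::field rw) set" where
  "RW_poly r s p = {F. finite {K. F K \<noteq> 0} \<and> (\<forall>K. \<not> adm r s K \<longrightarrow> F K = 0) \<and> (\<forall>K. F K \<in> RW_parity r s (p + mpar r K))}"

lemma RW_poly_cong: "F \<in> RW_poly r s p \<Longrightarrow> even (p + q) \<Longrightarrow> F \<in> RW_poly r s q"
  unfolding RW_poly_def using RW_parity_cong[of "p + mpar r K" "q + mpar r K" r s for K] by auto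

lemma RW_poly_zero [simp]: "0 \<in> RW_poly r s p"
  by (simp add: RW_poly_def zero_fun_apply)

lemma RW_poly_add: "F \<in> RW_poly r s p \<Longrightarrow> G \<in> RW_poly r s p \<Longrightarrow> F + G \<in> RW_poly r s p"
  using finite_supp_add[of F G] by (auto simp: RW_poly_def plus_fun_apply RW_parity_add)

lemma RW_poly_scale: "F \<in> RW_poly r s p \<Longrightarrow> fscale RW_scale c F \<in> RW_poly r s p"
  by (auto simp: RW_poly_def fscale_def RW_parity_scale additive_mapD(2)[OF additive_RW_scale] elim!: rev_finite_subset)

lemma RW_poly_sg: "F \<in> RW_poly r s p \<Longrightarrow> sg n F \<in> RW_poly r s p"
  by (auto simp: RW_poly_def sg_apply RW_parity_sg)

lemma RW_poly_minus: "F \<in> RW_poly r s p \<Longrightarrow> - F \<in> RW_poly r s p"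
  using RW_poly_sg[of F r s p 1] by (simp add: sg_def)

lemma RW_poly_const: "x \<in> RW_parity r s p \<Longrightarrow> const x \<in> RW_poly r s p"
  by (auto simp: RW_poly_def const_apply)

lemma RW_poly_lmul:
  assumes "F \<in> RW_poly r s p"
  shows "lmul r s k F \<in> RW_poly r s (par r k + p)"
proof -
  have "lmul r s k F K \<in> RW_parity r s (par r k + p + mpar r K)" for K
  proof (cases "k \<in># K \<and> adm r s K")
    case True
    then obtain L where K: "K = add_mset k L" by (metis insert_DiffM)
    have "F L \<in> RW_parity r s (p + mpar r L)" using assms by (simp add: RW_poly_def)
    moreover have "RW_parity r s (p + mpar r L) = (RW_parity r s (par r k + p + mpar r K) :: 'a rw set)"
      by (rule RW_parity_cong) (auto simp: K)
    ultimately have "F L \<in> RW_parity r s (par r k + p + mpar r K)" by simp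
    with True show ?thesis by (auto simp: K lmul_add_mset RW_parity_sg)
  qed (auto simp: lmul_def)
  then show ?thesis
    using assms finite_supp_lmul[of F r s k] by (auto simp: RW_poly_def lmul_def)
qed

lemma RW_poly_lift:
  assumes "F \<in> RW_poly r s p"
  shows "lift r k (lmul r s k) F \<in> RW_poly r s (par r k + p)"
proof -
  have "lift r k (lmul r s k) F K \<in> RW_parity r s (par r k + p + mpar r K)" for K
    using assms RW_parity_lmul[of "F K" r s "p + mpar r K" k]
    by (auto simp: RW_poly_def lift_def RW_parity_sg add.assoc)
  then show ?thesis
    using assms finite_supp_lift[of F "lmul r s k" r k]
    by (auto simp: RW_poly_def lift_def additive_mapD(2)[OF additive_lmul])
qed

lemma RW_poly_polys: "F \<in> RW_poly r s p \<Longrightarrow> F \<in> polys r s (RW_carrier r s)"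
  by (auto simp: RW_poly_def polys_def intro: RW_parity_carrier)

lemma RW_bracket_hom:
  assumes x: "x \<in> RW_parity r s p" and y: "y \<in> RW_parity r s q"
  shows "RW_bracket r s x y \<in> RW_poly r s (p + q)"
  using x
proof (induction rule: RW_hom_induct)
  case (cong q q' x)
  then show ?case by (auto elim!: RW_poly_cong)
next
  case (add q x x')
  then show ?case using y by (simp add: RW_bracket_add_left RW_parity_carrier RW_poly_add)
next
  case (scale q c x)
  then show ?case using y by (simp add: RW_bracket_scale_left RW_parity_carrier RW_poly_scale)
next
  case (lmul q k x)
  then show ?case
    using y RW_poly_minus[OF RW_poly_lmul] by (simp add: RW_bracket_lmul_left RW_parity_carrier add.assoc)
next
  case (gen i)
  note i = gen
  show ?case
    using y
  proof (induction rule: RW_hom_induct)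
    case (cong q q' x)
    then show ?case by (auto elim!: RW_poly_cong)
  next
    case (add q x x')
    then show ?case using i by (simp add: RW_bracket_add_right RW_parity_carrier RW_gen_carrier RW_poly_add)
  next
    case (scale q c x)
    then show ?case using i by (simp add: RW_bracket_scale_right RW_parity_carrier RW_gen_carrier RW_poly_scale)
  next
    case (lmul q k x)
    then have "RW_bracket r s (RW_gen i) (lmul r s k x) \<in> RW_poly r s (par r k + (par r i + q))"
      using i by (auto simp: RW_bracket_lmul_right[OF RW_gen_parity] RW_parity_carrier
        intro!: RW_poly_sg RW_poly_add RW_poly_lift RW_poly_lmul)
    then show ?case by (simp add: add.left_commute)
  next
    case (gen j)
    have "const (RW_gen j) \<in> RW_poly r s (par r j)" "const (RW_gen i) \<in> RW_poly r s (par r i)"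
      "const (lmul r s i (RW_gen j)) \<in> RW_poly r s (par r i + par r j)"
      using i gen by (auto intro!: RW_poly_const RW_gen_parity RW_parity_lmul)
    then show ?case
      using i gen
      by (auto simp: RW_bracket_gen RW_gen_bracket_def intro!: RW_poly_add RW_poly_lmul RW_poly_sg
          RW_poly_cong[OF RW_poly_lmul, of "const (RW_gen i)" r s "par r i" j])
  qed simp
qed simp

lemma RW_bracket_parity:
  "x \<in> RW_parity r s p \<Longrightarrow> y \<in> RW_parity r s q \<Longrightarrow> RW_bracket r s x y K \<in> RW_parity r s (p + q + mpar r K)"
  using RW_bracket_hom[of x r s p y q] by (simp add: RW_poly_def)

lemma RW_bracket_polys:
  assumes "x \<in> RW_carrier r s" "y \<in> RW_carrier r s"
  shows "RW_bracket r s x y \<in> polys r s (RW_carrier r s)"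
proof -
  have add: "F + G \<in> polys r s (RW_carrier r s)" if "F \<in> polys r s (RW_carrier r s)" "G \<in> polys r s (RW_carrier r s)"
    for F G :: "mono \<Rightarrow> 'a rw"
    using that finite_supp_add[of F G] by (auto simp: polys_def plus_fun_apply RW_carrier_add)
  show ?thesis
    using assms(1)
  proof (induction rule: RW_carrier_induct)
    case (add x x')
    then show ?case using assms(2) by (simp add: RW_bracket_add_left \<open>\<And>F G. F \<in> _ \<Longrightarrow> G \<in> _ \<Longrightarrow> F + G \<in> _\<close>)
  next
    case (hom p x)
    note x = hom
    show ?case
      using assms(2)
    proof (induction rule: RW_carrier_induct)
      case (add x x')
      then show ?case using x by (simp add: RW_bracket_add_right RW_parity_carrier \<open>\<And>F G. F \<in> _ \<Longrightarrow> G \<in> _ \<Longrightarrow> F + G \<in> _\<close>)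
    next
      case (hom q y)
      then show ?case using x by (intro RW_poly_polys[OF RW_bracket_hom])
    qed
  qed
qed

lemma bracket_bilinear_RW: "bracket_bilinear r s (RW r s :: ('f::field, 'f rw) lcs)"
  by (auto simp: bracket_bilinear_def linear_on_set_def RW_bracket_polys RW_bracket_add_left RW_bracket_add_right
      RW_bracket_scale_left RW_bracket_scale_right RW_bracket_parity)

lemma sesquilinear_RW: "sesquilinear r s (RW r s :: ('f::field, 'f rw) lcs)"
  unfolding sesquilinear_def
proof (intro ballI conjI allI)
  fix i p q and a b :: "'f rw"
  assume i: "i \<in> {1..r+s}" and ab: "a \<in> hom_part (RW r s) p" "b \<in> hom_part (RW r s) q"
  \<comment> \<open>The coefficient at \<open>K\<close> has parity \<open>p + q + mpar r K\<close>.
    The part of the sign coming from \<open>mpar r K\<close> is the one contained in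
    \<open>lift\<close>; the part from \<open>p + q\<close> stays in front.\<close>
  have "dright (RW r s) i (lbr (RW r s) a b K) = sg (par r i * (p + q)) (lift r i (lmul r s i) (RW_bracket r s a b) K)" for K
    using ab RW_bracket_hom[of a r s p b q] RW_dright_hom[of "RW_bracket r s a b K" r s "p + q + mpar r K" i]
    by (simp add: RW_poly_def lift_def distrib_left)
  then have *: "(\<lambda>K. dright (RW r s) i (lbr (RW r s) a b K)) = sg (par r i * (p + q)) (lift r i (lmul r s i) (RW_bracket r s a b))"
    by (simp add: sg_apply fun_eq_iff)
  have "RW_dright r s i b = sg (par r i * q) (lmul r s i b)"
    using ab by (simp add: RW_dright_hom)
  then show "lbr (RW r s) a (dright (RW r s) i b) = (\<lambda>K. dright (RW r s) i (lbr (RW r s) a b K)) +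
      sg (par r i * (p + q)) (lmul r s i (lbr (RW r s) a b))"
    unfolding * using i ab
    by (simp add: RW_bracket_sg RW_parity_carrier RW_carrier_lmul RW_bracket_lmul_right sg_add algebra_simps)
qed (simp add: RW_bracket_lmul_left)

lemma RW_bracket_finite:
  assumes "x \<in> RW_carrier r s" "y \<in> RW_carrier r s"
  shows "finite {K. RW_bracket r s x y K \<noteq> 0}" "\<not> adm r s K \<Longrightarrow> RW_bracket r s x y K = 0"
    "RW_bracket r s x y K \<in> RW_carrier r s"
  using RW_bracket_polys[OF assms] by (auto simp: polys_def)

section \<open>Skew-symmetry\<close>

lemma additive_const: "additive_map const"
  by (auto simp: additive_map_def const_def fun_eq_iff pointwise)

lemma subst_ops_zero [simp]: "subst_ops T g 0 = 0"
  by (simp add: subst_ops_def zero_fun_apply)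

lemma subst_ops_map:
  assumes T: "\<And>i. additive_map (T i)" and "additive_map S'" "finite {K. F K \<noteq> 0}" "S 0 = 0" "g 0 = 0"
    and "\<And>K. g (S (F K)) = S' (g (F K))" and TS: "\<And>i x. T i (S' x) = S' (T i x)"
  shows "subst_ops T g (\<lambda>K. S (F K)) = S' (subst_ops T g F)"
proof -
  have "foldr T xs (S' x) = S' (foldr T xs x)" for xs x
    by (induction xs) (auto simp: TS)
  then have "ops T K (S' x) = S' (ops T K x)" for K x
    by (simp add: ops_def)
  moreover have "subst_ops T g (\<lambda>K. S (F K)) = (\<Sum>K | F K \<noteq> 0. ops T K (g (S (F K))))"
    by (rule subst_ops_superset) (use assms in auto)
  ultimately show ?thesis
    by (simp add: assms subst_ops_def additive_mapD(5)[OF assms(2)])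
qed

lemma subst_ops_sg:
  assumes T: "\<And>i. additive_map (T i)" and "finite {K. F K \<noteq> 0}" "g 0 = 0" "\<And>K. g (sg n (F K)) = sg n (g (F K))"
  shows "subst_ops T g (sg n F) = sg n (subst_ops T g F)"
  unfolding sg_fun[of n F]
  by (rule subst_ops_map) (use assms in \<open>auto simp: additive_map_def sg_add additive_mapD(4)[OF T]\<close>)

text \<open>The operator \<open>-\<lambda>\<^sub>i - \<partial>\<^sub>i\<close>. Here
  \<open>lmul\<close> has two roles: by itself it multiplies by \<open>\<lambda>\<^sub>i\<close>,
  while under \<open>lift\<close> it is the action of \<open>\<partial>\<^sub>i\<close> on the
  coefficients, which are themselves stored as polynomials in \<open>\<partial>\<close>.\<close>

definition neg_shift :: "nat \<Rightarrow> nat \<Rightarrow> nat \<Rightarrow> (mono \<Rightarrow> 'f rw) \<Rightarrow> mono \<Rightarrow> 'f::field rw" where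
  "neg_shift r s i F = - lmul r s i F - lift r i (lmul r s i) F"

lemma super_family_neg_shift: "super_family r (neg_shift r s)"
proof -
  have eq: "neg_shift r s = (\<lambda>i F. - (lmul r s i F + lift r i (lmul r s i) F))"
    by (simp add: neg_shift_def fun_eq_iff pointwise)
  show ?thesis
    unfolding eq
    by (rule super_family_minus[OF super_family_plus[OF super_family_lmul super_family_lift_lmul supercommute_sym[OF supercommute_lift_lmul]]])
qed

lemma supercommute_lift_neg_shift: "supercommute r (\<lambda>i. lift r i (lmul r s i)) (neg_shift r s)"
proof -
  have eq: "neg_shift r s = (\<lambda>i F. - (lmul r s i F + lift r i (lmul r s i) F))"
    by (simp add: neg_shift_def fun_eq_iff pointwise)
  show ?thesis
    unfolding eq
    by (rule supercommute_minus[OF super_familyD(1)[OF super_family_lift_lmul]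
      supercommute_plus[OF super_familyD(1)[OF super_family_lift_lmul] supercommute_lift_lmul super_familyD(2)[OF super_family_lift_lmul]]])
qed

definition RW_neg :: "nat \<Rightarrow> nat \<Rightarrow> 'f rw \<Rightarrow> 'f rw \<Rightarrow> mono \<Rightarrow> 'f::field rw" where
  "RW_neg r s a b = subst_ops (neg_shift r s) const (RW_bracket r s a b)"

lemma bracket_neg_RW: "bracket_neg r s (RW r s) a b = RW_neg r s a b"
  by (simp add: bracket_neg_def RW_neg_def subst_ops_def neg_shift_def[abs_def])

lemma neg_shift_fscale: "neg_shift r s i (fscale RW_scale c F) = fscale RW_scale c (neg_shift r s i F)"
  by (simp add: neg_shift_def lmul_fscale lift_lmul_fscale additive_mapD(3,6)[OF additive_fscale_RW_scale])

lemma const_fscale: "const (RW_scale c x) = fscale RW_scale c (const x)"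
  by (auto simp: const_def fscale_def RW_scale_def fun_eq_iff pointwise)

lemma RW_neg_add:
  assumes "a \<in> RW_carrier r s" "b \<in> RW_carrier r s" "c \<in> RW_carrier r s"
  shows "RW_neg r s (a + b) c = RW_neg r s a c + RW_neg r s b c"
    "RW_neg r s c (a + b) = RW_neg r s c a + RW_neg r s c b"
  using assms
  by (auto simp: RW_neg_def RW_bracket_add_left RW_bracket_add_right RW_bracket_finite
      super_familyD(1)[OF super_family_neg_shift] additive_mapD[OF additive_const] intro!: subst_ops_add)

lemma RW_neg_scale:
  assumes "a \<in> RW_carrier r s" "b \<in> RW_carrier r s"
  shows "RW_neg r s (RW_scale c a) b = fscale RW_scale c (RW_neg r s a b)"
    "RW_neg r s a (RW_scale c b) = fscale RW_scale c (RW_neg r s a b)"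
proof -
  have *: "subst_ops (neg_shift r s) const (fscale RW_scale c (RW_bracket r s a b)) = fscale RW_scale c (RW_neg r s a b)"
    unfolding RW_neg_def
    by (subst fscale_def, rule subst_ops_map)
      (use assms in \<open>auto simp: super_familyD(1)[OF super_family_neg_shift] additive_fscale_RW_scale RW_bracket_finite
        additive_mapD(2)[OF additive_RW_scale] additive_mapD(2)[OF additive_const] const_fscale neg_shift_fscale\<close>)
  then show "RW_neg r s (RW_scale c a) b = fscale RW_scale c (RW_neg r s a b)"
    "RW_neg r s a (RW_scale c b) = fscale RW_scale c (RW_neg r s a b)"
    using assms by (simp_all add: RW_neg_def RW_bracket_scale_left RW_bracket_scale_right)
qed

lemma neg_subst_sg:
  assumes "finite {K. F K \<noteq> 0}"
  shows "subst_ops (neg_shift r s) const (sg n F) = sg n (subst_ops (neg_shift r s) const F)"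
  by (rule subst_ops_sg) (use assms in \<open>auto simp: super_familyD(1)[OF super_family_neg_shift] additive_mapD[OF additive_const]\<close>)

lemma neg_subst_lmul:
  assumes "finite {K. F K \<noteq> 0}" "\<And>K. \<not> adm r s K \<Longrightarrow> F K = 0" "i \<in> {1..r+s}"
  shows "subst_ops (neg_shift r s) const (lmul r s i F) = neg_shift r s i (subst_ops (neg_shift r s) const F)"
  by (rule subst_ops_lmul[OF super_family_neg_shift]) (use assms in \<open>auto simp: additive_mapD[OF additive_const]\<close>)

lemma neg_subst_lift:
  assumes "finite {K. F K \<noteq> 0}"
  shows "subst_ops (neg_shift r s) const (lift r i (lmul r s i) F) = lift r i (lmul r s i) (subst_ops (neg_shift r s) const F)"
  by (rule subst_ops_lift[where E = "\<lambda>i. lift r i (lmul r s i)"])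
    (use assms in \<open>auto simp: super_familyD(1)[OF super_family_neg_shift] super_familyD(1)[OF super_family_lift_lmul]
      additive_mapD[OF additive_const] additive_mapD(2)[OF additive_lmul] lift_const additive_lmul supercommute_lift_neg_shift\<close>)

lemma neg_subst_add:
  assumes "finite {K. F K \<noteq> 0}" "finite {K. G K \<noteq> 0}"
  shows "subst_ops (neg_shift r s) const (F + G) = subst_ops (neg_shift r s) const F + subst_ops (neg_shift r s) const G"
  by (rule subst_ops_add) (use assms in \<open>auto simp: super_familyD(1)[OF super_family_neg_shift] additive_mapD[OF additive_const]\<close>)

lemma neg_subst_const: "subst_ops (neg_shift r s) const (const v) = const v"
  by (rule subst_ops_const) (auto simp: super_familyD(1)[OF super_family_neg_shift] additive_mapD[OF additive_const])

text \<open>Under the substitution the factor \<open>-\<lambda>\<^sub>i\<close> of left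
  sesquilinearity becomes \<open>\<lambda>\<^sub>i + \<partial>\<^sub>i\<close>, the factor of right
  sesquilinearity. This is what skew-symmetry requires, as it exchanges the arguments.\<close>

lemma RW_neg_lmul_left:
  assumes "a \<in> RW_carrier r s" "b \<in> RW_carrier r s" "i \<in> {1..r+s}"
  shows "RW_neg r s (lmul r s i a) b = - neg_shift r s i (RW_neg r s a b)"
proof -
  have "RW_neg r s (lmul r s i a) b = subst_ops (neg_shift r s) const (sg 1 (lmul r s i (RW_bracket r s a b)))"
    using assms by (simp add: RW_neg_def RW_bracket_lmul_left) (simp add: sg_def)
  also have "\<dots> = sg 1 (neg_shift r s i (RW_neg r s a b))"
    using assms by (simp add: neg_subst_sg neg_subst_lmul finite_supp_lmul RW_bracket_finite RW_neg_def)
  finally show ?thesis by (simp add: sg_def)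
qed

text \<open>The converse exchange: \<open>\<partial>\<^sub>i\<close> is unaffected by the
  substitution and \<open>\<lambda>\<^sub>i\<close> becomes
  \<open>-\<lambda>\<^sub>i - \<partial>\<^sub>i\<close>, so
  \<open>\<partial>\<^sub>i + \<lambda>\<^sub>i\<close> turns into
  \<open>-\<lambda>\<^sub>i\<close>.\<close>

lemma RW_neg_lmul_right:
  assumes "a \<in> RW_parity r s p" "b \<in> RW_carrier r s" "i \<in> {1..r+s}"
  shows "RW_neg r s a (lmul r s i b) = sg (par r i * p) (- lmul r s i (RW_neg r s a b))"
proof -
  note fin = RW_bracket_finite[OF RW_parity_carrier[OF assms(1)] assms(2)]
  have "RW_neg r s a (lmul r s i b) = sg (par r i * p) (lift r i (lmul r s i) (RW_neg r s a b) + neg_shift r s i (RW_neg r s a b))"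
    using assms fin
    by (simp add: RW_neg_def RW_bracket_lmul_right neg_subst_sg neg_subst_add neg_subst_lmul neg_subst_lift
        finite_supp_lmul finite_supp_lift additive_mapD(2)[OF additive_lmul] finite_supp_add)
  then show ?thesis by (simp add: neg_shift_def)
qed

lemma RW_skew:
  assumes "a \<in> RW_parity r s p" "b \<in> RW_parity r s q"
  shows "RW_bracket r s b a = - sg (p * q) (RW_neg r s a b)"
  using assms
proof (induction arbitrary: b q rule: RW_hom_induct)
  case (cong p p' a)
  have "sg (p' * q) X = sg (p * q) X" for X :: "mono \<Rightarrow> 'a rw" using cong(1) by (auto intro!: sg_eqI)
  then show ?case using cong by metis
next
  case (zero p)
  then show ?case by (simp add: RW_neg_def)
next
  case (add p a a')
  then show ?case by (simp add: RW_bracket_add_right RW_neg_add RW_parity_carrier sg_add)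
next
  case (scale p c a)
  have "RW_bracket r s b a = - sg (p * q) (RW_neg r s a b)" using scale by blast
  then show ?case
    using scale(1,3)
    by (simp add: RW_bracket_scale_right RW_neg_scale RW_parity_carrier additive_mapD(3,4)[OF additive_fscale_RW_scale])
next
  case (lmul p k a)
  have IH: "RW_bracket r s b a = - sg (p * q) (RW_neg r s a b)" using lmul by blast
  have "RW_bracket r s b (lmul r s k a) = sg (par r k * q) (- neg_shift r s k (RW_bracket r s b a))"
    using lmul by (simp add: RW_bracket_lmul_right RW_parity_carrier neg_shift_def add.commute)
  also have "\<dots> = - sg ((par r k + p) * q) (RW_neg r s (lmul r s k a) b)"
    using lmul by (simp add: IH RW_neg_lmul_left RW_parity_carrier sg_minus distrib_right
      additive_mapD(3,4)[OF super_familyD(1)[OF super_family_neg_shift]])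
  finally show ?case .
next
  case (gen i)
  note i = gen(1)
  show ?case
    using gen(2)
  proof (induction rule: RW_hom_induct)
    case (cong p p' a)
    have "sg (par r i * p') X = sg (par r i * p) X" for X :: "mono \<Rightarrow> 'a rw" using cong(1) by (auto intro!: sg_eqI)
    then show ?case using cong by metis
  next
    case (zero p)
    then show ?case by (simp add: RW_neg_def)
  next
    case (add p a a')
    then show ?case using i by (simp add: RW_bracket_add_left RW_neg_add RW_parity_carrier RW_gen_carrier sg_add)
  next
    case (scale q c a)
    have "RW_bracket r s a (RW_gen i) = - sg (par r i * q) (RW_neg r s (RW_gen i) a)" using scale by blast
    then show ?case
      using scale(1) i
      by (simp add: RW_bracket_scale_left RW_neg_scale RW_parity_carrier RW_gen_carrier additive_mapD(3,4)[OF additive_fscale_RW_scale])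
  next
    case (lmul q k a)
    have IH: "RW_bracket r s a (RW_gen i) = - sg (par r i * q) (RW_neg r s (RW_gen i) a)" using lmul by blast
    have "RW_bracket r s (lmul r s k a) (RW_gen i) = - lmul r s k (RW_bracket r s a (RW_gen i))"
      using lmul i by (simp add: RW_bracket_lmul_left RW_parity_carrier RW_gen_carrier)
    also have "\<dots> = - sg (par r i * (par r k + q)) (RW_neg r s (RW_gen i) (lmul r s k a))"
      using lmul i by (simp add: IH RW_neg_lmul_right[OF RW_gen_parity] RW_parity_carrier sg_minus
        additive_mapD(3,4)[OF additive_lmul]) (auto intro!: sg_eqI)
    finally show ?case .
  next
    case (gen j)
    let ?X = "\<lambda>i j. lift r i (lmul r s i) (const (RW_gen j)) :: mono \<Rightarrow> 'a rw"
      and ?Y = "\<lambda>i j. lmul r s i (const (RW_gen j)) :: mono \<Rightarrow> 'a rw"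
    have fin: "finite {K. ?Y i j K \<noteq> 0}" "finite {K. sg n (?Y i j) K \<noteq> 0}" for i j n
      by (auto simp: finite_supp_sg finite_supp_lmul)
    have adm: "const (RW_gen j) K = (0 :: 'a rw)" if "\<not> adm r s K" for j K
      using that by (auto simp: const_apply)
    \<comment> \<open>The term \<open>\<partial>\<^sub>i a\<^sub>j\<close> cancels against the
      \<open>\<partial>\<^sub>i\<close> that the substitution creates from
      \<open>\<lambda>\<^sub>i a\<^sub>j\<close>; what is left is, up to sign, the bracket of the
      generators in the other order.\<close>
    have "RW_neg r s (RW_gen i) (RW_gen j) = ?X i j + neg_shift r s i (const (RW_gen j)) + sg (par r i * par r j) (neg_shift r s j (const (RW_gen i)))"
      using i gen
      by (simp add: RW_neg_def RW_bracket_gen RW_gen_bracket_def neg_subst_add fin finite_supp_add neg_subst_const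
         neg_subst_sg neg_subst_lmul adm lift_const additive_lmul)
    also have "\<dots> = - ?Y i j - sg (par r i * par r j) (?Y j i + ?X j i)"
      by (simp add: neg_shift_def sg_minus sg_diff sg_add)
    finally have "RW_neg r s (RW_gen i) (RW_gen j) = - ?Y i j - sg (par r i * par r j) (?Y j i + ?X j i)" .
    then show ?case
      using i gen
      by (simp add: RW_bracket_gen RW_gen_bracket_def lift_const additive_lmul sg_minus sg_diff sg_add mult.commute)
       (simp add: sg_def)
  qed
qed

lemma skew_symmetric_RW: "skew_symmetric r s (RW r s :: ('f::field, 'f rw) lcs)"
  unfolding skew_symmetric_def by (simp add: RW_skew bracket_neg_RW)

section \<open>The Jacobi identity\<close>

text \<open>Extends a bracket by an element of parity \<open>p\<close>, with parameter
  \<open>\<lambda>\<close>, to polynomials in \<open>\<mu>\<close>. The monomial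
  \<open>\<mu>\<^sub>L\<close> first leaves the bracket, crossing that element, and is then put to
  the right of \<open>\<lambda>\<^sub>K\<close>; hence the two summands in the sign.\<close>

definition outer_lift :: "nat \<Rightarrow> nat \<Rightarrow> ('v \<Rightarrow> mono \<Rightarrow> 'w) \<Rightarrow> (mono \<Rightarrow> 'v) \<Rightarrow> mono \<Rightarrow> mono \<Rightarrow> 'w::ab_group_add" where
  "outer_lift r p A F = (\<lambda>K L. sg (mpar r L * (p + mpar r K)) (A (F L) K))"

definition inner_lift :: "nat \<Rightarrow> nat \<Rightarrow> ('v \<Rightarrow> mono \<Rightarrow> 'w) \<Rightarrow> (mono \<Rightarrow> 'v) \<Rightarrow> mono \<Rightarrow> mono \<Rightarrow> 'w::ab_group_add" where
  "inner_lift r q A F = (\<lambda>K L. sg (mpar r K * q) (A (F K) L))"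

text \<open>The number of lifts is the number of tensor factors passed over. On
  \<open>\<And>[\<lambda>] \<otimes> \<And>[\<mu>] \<otimes> RW\<close> the operators
  \<open>lmul\<close>, \<open>lift_lmul\<close>, \<open>lift2_lmul\<close> are
  \<open>\<lambda>\<^sub>k\<close>, \<open>\<mu>\<^sub>k\<close> and
  \<open>\<partial>\<^sub>k\<close>; on polynomials in one set of variables a single lift is already
  \<open>\<partial>\<^sub>k\<close>.\<close>

abbreviation lift_lmul :: "nat \<Rightarrow> nat \<Rightarrow> nat \<Rightarrow> (mono \<Rightarrow> mono \<Rightarrow> 'v) \<Rightarrow> mono \<Rightarrow> mono \<Rightarrow> 'v::ab_group_add" where
  "lift_lmul r s k \<equiv> lift r k (lmul r s k)"

abbreviation lift2_lmul :: "nat \<Rightarrow> nat \<Rightarrow> nat \<Rightarrow> (mono \<Rightarrow> mono \<Rightarrow> mono \<Rightarrow> 'v) \<Rightarrow> mono \<Rightarrow> mono \<Rightarrow> mono \<Rightarrow> 'v::ab_group_add" where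
  "lift2_lmul r s k \<equiv> lift r k (lift r k (lmul r s k))"

text \<open>Inside the bracket \<open>lmul\<close> is multiplication by
  \<open>\<mu>\<^sub>k\<close>, since \<open>F\<close> depends on \<open>\<mu>\<close> only; outside
  it reappears as \<open>lift_lmul\<close>, with the sign for crossing \<open>a\<close>.\<close>

lemma outer_lift_lmul:
  assumes "a \<in> RW_carrier r s" "\<And>L. F L \<in> RW_carrier r s"
  shows "outer_lift r p (RW_bracket r s a) (lmul r s k F) =
    sg (par r k * p) (lift_lmul r s k (outer_lift r p (RW_bracket r s a) F))"
proof (rule ext, rule ext)
  fix K L
  show "outer_lift r p (RW_bracket r s a) (lmul r s k F) K L =
    sg (par r k * p) (lift_lmul r s k (outer_lift r p (RW_bracket r s a) F)) K L"
  proof (cases "k \<in># L")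
    case True
    then obtain L' where L: "L = add_mset k L'" by (metis insert_DiffM)
    show ?thesis
      using assms
      by (auto simp: L outer_lift_def lift_def lmul_add_mset sg_apply RW_bracket_sg zero_fun_apply intro!: sg_eqI)
  qed (simp add: outer_lift_def lift_def lmul_notin sg_apply zero_fun_apply)
qed

lemma plus_fun_apply2:
  fixes X Y :: "mono \<Rightarrow> mono \<Rightarrow> 'v::ab_group_add"
  shows "(X + Y) K L = X K L + Y K L"
  by (simp only: plus_fun_apply)

text \<open>By right sesquilinearity a \<open>\<partial>\<^sub>k\<close> on the coefficients leaves
  the bracket with parameter \<open>\<lambda>\<close> as
  \<open>\<partial>\<^sub>k + \<lambda>\<^sub>k\<close>. In \<open>inner_lift_lift\<close> the
  parameter is \<open>\<mu>\<close>, and the result is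
  \<open>\<partial>\<^sub>k + \<mu>\<^sub>k\<close>.\<close>

lemma outer_lift_lift:
  assumes a: "a \<in> RW_parity r s p" and F: "\<And>L. F L \<in> RW_carrier r s" and k: "k \<in> {1..r+s}"
  shows "outer_lift r p (RW_bracket r s a) (lift r k (lmul r s k) F) =
    sg (par r k * p) (lift2_lmul r s k (outer_lift r p (RW_bracket r s a) F) + lmul r s k (outer_lift r p (RW_bracket r s a) F))"
proof (rule ext, rule ext)
  fix K L :: mono
  let ?O = "outer_lift r p (RW_bracket r s a) F"
  have "RW_bracket r s a (lift r k (lmul r s k) F L) K = sg (par r k * mpar r L + par r k * p)
      (sg (par r k * mpar r K) (lmul r s k (RW_bracket r s a (F L) K)) + lmul r s k (RW_bracket r s a (F L)) K)"
    using assms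
    by (simp add: lift_def[of r k "lmul r s k" F] RW_bracket_sg RW_parity_carrier RW_carrier_lmul RW_bracket_lmul_right)
      (simp add: lift_def sg_apply plus_fun_apply)
  then have "outer_lift r p (RW_bracket r s a) (lift r k (lmul r s k) F) K L =
      sg (mpar r L * (p + mpar r K) + par r k * mpar r L + par r k * p + par r k * mpar r K) (lmul r s k (RW_bracket r s a (F L) K))
      + sg (mpar r L * (p + mpar r K) + par r k * mpar r L + par r k * p) (lmul r s k (RW_bracket r s a (F L)) K)"
    by (simp add: outer_lift_def sg_add add.assoc)
  also have "sg (mpar r L * (p + mpar r K) + par r k * mpar r L + par r k * p + par r k * mpar r K) (lmul r s k (RW_bracket r s a (F L) K))
      = sg (par r k * p) (lift2_lmul r s k ?O) K L"
    by (auto simp: outer_lift_def lift_def sg_apply additive_mapD(4)[OF additive_lmul] intro!: sg_eqI)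
  also have "sg (mpar r L * (p + mpar r K) + par r k * mpar r L + par r k * p) (lmul r s k (RW_bracket r s a (F L)) K)
      = sg (par r k * p) (lmul r s k ?O) K L"
  proof (cases "k \<in># K")
    case True
    then obtain K' where K: "K = add_mset k K'" by (metis insert_DiffM)
    show ?thesis
      by (auto simp: K outer_lift_def lmul_add_mset sg_apply zero_fun_apply intro!: sg_eqI)
  qed (simp add: lmul_notin sg_apply zero_fun_apply)
  finally show "outer_lift r p (RW_bracket r s a) (lift r k (lmul r s k) F) K L =
    sg (par r k * p) (lift2_lmul r s k ?O + lmul r s k ?O) K L"
    unfolding sg_add by (simp only: plus_fun_apply2)
qed

lemma inner_lift_lmul:
  assumes "b \<in> RW_carrier r s" "\<And>L. F L \<in> RW_carrier r s"
  shows "inner_lift r q (RW_bracket r s b) (lmul r s k F) =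
    sg (par r k * q) (lmul r s k (inner_lift r q (RW_bracket r s b) F))"
proof (rule ext, rule ext)
  fix K L
  show "inner_lift r q (RW_bracket r s b) (lmul r s k F) K L =
    sg (par r k * q) (lmul r s k (inner_lift r q (RW_bracket r s b) F)) K L"
  proof (cases "k \<in># K")
    case True
    then obtain K' where K: "K = add_mset k K'" by (metis insert_DiffM)
    show ?thesis
      using assms
      by (auto simp: K inner_lift_def lmul_add_mset sg_apply RW_bracket_sg zero_fun_apply intro!: sg_eqI)
  qed (simp add: inner_lift_def lmul_notin sg_apply zero_fun_apply)
qed

lemma inner_lift_lift:
  assumes b: "b \<in> RW_parity r s q" and F: "\<And>L. F L \<in> RW_carrier r s" and k: "k \<in> {1..r+s}"
  shows "inner_lift r q (RW_bracket r s b) (lift r k (lmul r s k) F) =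
    sg (par r k * q) (lift2_lmul r s k (inner_lift r q (RW_bracket r s b) F) + lift_lmul r s k (inner_lift r q (RW_bracket r s b) F))"
proof (rule ext, rule ext)
  fix K L :: mono
  let ?O = "inner_lift r q (RW_bracket r s b) F"
  have "RW_bracket r s b (lift r k (lmul r s k) F K) L = sg (par r k * mpar r K + par r k * q)
      (sg (par r k * mpar r L) (lmul r s k (RW_bracket r s b (F K) L)) + lmul r s k (RW_bracket r s b (F K)) L)"
    using assms
    by (simp add: lift_def[of r k "lmul r s k" F] RW_bracket_sg RW_parity_carrier RW_carrier_lmul RW_bracket_lmul_right)
      (simp add: lift_def sg_apply plus_fun_apply)
  then have "inner_lift r q (RW_bracket r s b) (lift r k (lmul r s k) F) K L =
      sg (mpar r K * q + par r k * mpar r K + par r k * q + par r k * mpar r L) (lmul r s k (RW_bracket r s b (F K) L))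
      + sg (mpar r K * q + par r k * mpar r K + par r k * q) (lmul r s k (RW_bracket r s b (F K)) L)"
    by (simp add: inner_lift_def sg_add add.assoc)
  also have "sg (mpar r K * q + par r k * mpar r K + par r k * q + par r k * mpar r L) (lmul r s k (RW_bracket r s b (F K) L))
      = sg (par r k * q) (lift2_lmul r s k ?O) K L"
    by (auto simp: inner_lift_def lift_def sg_apply additive_mapD(4)[OF additive_lmul] intro!: sg_eqI)
  also have "sg (mpar r K * q + par r k * mpar r K + par r k * q) (lmul r s k (RW_bracket r s b (F K)) L)
      = sg (par r k * q) (lift_lmul r s k ?O) K L"
  proof -
    have "?O K = sg (mpar r K * q) (RW_bracket r s b (F K))"
      by (simp add: inner_lift_def sg_apply fun_eq_iff)
    then show ?thesis
      by (auto simp: lift_def sg_apply additive_mapD(4)[OF additive_lmul] intro!: sg_eqI)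
  qed
  finally show "inner_lift r q (RW_bracket r s b) (lift r k (lmul r s k) F) K L =
    sg (par r k * q) (lift2_lmul r s k ?O + lift_lmul r s k ?O) K L"
    unfolding sg_add by (simp only: plus_fun_apply2)
qed

section \<open>The parameter lambda + mu and the double bracket\<close>

definition plus_shift :: "nat \<Rightarrow> nat \<Rightarrow> nat \<Rightarrow> (mono \<Rightarrow> mono \<Rightarrow> 'v) \<Rightarrow> mono \<Rightarrow> mono \<Rightarrow> 'v::ab_group_add" where
  "plus_shift r s i F = lmul r s i F + lift r i (lmul r s i) F"

lemma plus_shift_eq: "plus_shift r s = (\<lambda>i F. lmul r s i F + lift r i (lmul r s i) F)"
  by (simp add: plus_shift_def fun_eq_iff)

lemma super_family_plus_shift: "super_family r (plus_shift r s)"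
  unfolding plus_shift_eq
  by (rule super_family_plus[OF super_family_lmul super_family_lift_lmul supercommute_sym[OF supercommute_lift_lmul]])

lemma super_family_lift2_lmul: "super_family r (lift2_lmul r s)"
  by (rule super_family_lift[OF super_family_lift_lmul])

lemma supercommute_lift2_lmul: "supercommute r (lift2_lmul r s) (lmul r s)"
  by (rule supercommute_sym[OF supercommute_lmul_lift[OF super_familyD(1)[OF super_family_lift_lmul]]])

lemma supercommute_lift2_lift: "supercommute r (lift2_lmul r s) (lift_lmul r s)"
  by (rule supercommute_lift[OF super_familyD(1)[OF super_family_lift_lmul] additive_lmul supercommute_lift_lmul])

lemma supercommute_lift2_plus_shift: "supercommute r (lift2_lmul r s) (plus_shift r s)"
  unfolding plus_shift_eq
  by (rule supercommute_plus[OF super_familyD(1)[OF super_family_lift2_lmul] supercommute_lift2_lmul supercommute_lift2_lift])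

lemma supercommute_plus_shift_lmul: "supercommute r (plus_shift r s) (lmul r s)"
  unfolding plus_shift_eq
  by (rule supercommute_sym[OF supercommute_plus[OF additive_lmul supercommute_lmul supercommute_sym[OF supercommute_lift_lmul]]])

definition RW_plus :: "nat \<Rightarrow> nat \<Rightarrow> 'f rw \<Rightarrow> 'f rw \<Rightarrow> mono \<Rightarrow> mono \<Rightarrow> 'f::field rw" where
  "RW_plus r s x c = subst_ops (plus_shift r s) (\<lambda>v. const (const v)) (RW_bracket r s x c)"

lemma bracket_plus_RW: "bracket_plus r s (RW r s) x c = RW_plus r s x c"
  by (simp add: bracket_plus_def RW_plus_def subst_ops_def plus_shift_def[abs_def])

lemma additive_const_const: "additive_map (\<lambda>v. const (const v))"
  by (simp add: additive_map_def additive_mapD(1)[OF additive_const])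

lemmas plus_additive = super_familyD(1)[OF super_family_plus_shift] additive_mapD[OF additive_const_const]

lemma RW_plus_add:
  assumes "x \<in> RW_carrier r s" "y \<in> RW_carrier r s" "c \<in> RW_carrier r s"
  shows "RW_plus r s (x + y) c = RW_plus r s x c + RW_plus r s y c"
    "RW_plus r s c (x + y) = RW_plus r s c x + RW_plus r s c y"
  using assms
  by (auto simp: RW_plus_def RW_bracket_add_left RW_bracket_add_right RW_bracket_finite plus_additive intro!: subst_ops_add)

abbreviation "fscale2 \<equiv> fscale (fscale RW_scale)"

lemma additive_fscale2: "additive_map (fscale2 c)"
  by (simp add: additive_map_def fscale_def RW_scale_def fun_eq_iff algebra_simps pointwise)

lemma lift_lmul_fscale2: "lift_lmul r s k (fscale2 c F) = fscale2 c (lift_lmul r s k F)"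
  by (auto simp: lift_def fscale_def[of "fscale RW_scale"] fun_eq_iff sg_def fscale_RW_scale_simps lmul_fscale)

lemma lmul_fscale2: "lmul r s k (fscale2 c F) = fscale2 c (lmul r s k F)"
  by (auto simp: lmul_def fscale_def[of "fscale RW_scale"] fun_eq_iff sg_def fscale_RW_scale_simps)

lemma const_const_fscale: "const (const (RW_scale c x)) = fscale2 c (const (const x))"
  by (auto simp: const_def fscale_def RW_scale_def fun_eq_iff pointwise)

lemma plus_shift_fscale2: "plus_shift r s i (fscale2 c F) = fscale2 c (plus_shift r s i F)"
  by (simp add: plus_shift_def lmul_fscale2 lift_lmul_fscale2 additive_mapD(1)[OF additive_fscale2])

lemma RW_plus_scale:
  assumes "x \<in> RW_carrier r s" "y \<in> RW_carrier r s"
  shows "RW_plus r s (RW_scale c x) y = fscale2 c (RW_plus r s x y)"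
    "RW_plus r s x (RW_scale c y) = fscale2 c (RW_plus r s x y)"
proof -
  have *: "subst_ops (plus_shift r s) (\<lambda>v. const (const v)) (fscale RW_scale c (RW_bracket r s x y)) = fscale2 c (RW_plus r s x y)"
    unfolding RW_plus_def
    by (subst fscale_def, rule subst_ops_map)
      (use assms in \<open>auto simp: plus_additive RW_bracket_finite additive_fscale2
        additive_mapD(2)[OF additive_RW_scale] const_const_fscale plus_shift_fscale2\<close>)
  then show "RW_plus r s (RW_scale c x) y = fscale2 c (RW_plus r s x y)"
    "RW_plus r s x (RW_scale c y) = fscale2 c (RW_plus r s x y)"
    using assms by (simp_all add: RW_plus_def RW_bracket_scale_left RW_bracket_scale_right)
qed

lemma RW_plus_zero [simp]: "RW_plus r s 0 c = 0" "RW_plus r s x 0 = 0"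
  by (simp_all add: RW_plus_def)

lemma fscale2_minus1: "fscale2 (- 1) F = - F"
  by (simp add: fscale_def RW_scale_def fun_eq_iff pointwise)

lemma RW_plus_sg:
  assumes "x \<in> RW_carrier r s" "y \<in> RW_carrier r s"
  shows "RW_plus r s (sg n x) y = sg n (RW_plus r s x y)"
  using RW_plus_scale[OF assms, of "- 1"] by (auto simp: sg_def RW_scale_minus1 fscale2_minus1)

lemma plus_subst_sg:
  assumes "finite {K. F K \<noteq> 0}"
  shows "subst_ops (plus_shift r s) (\<lambda>v. const (const v)) (sg n F) = sg n (subst_ops (plus_shift r s) (\<lambda>v. const (const v)) F)"
  by (rule subst_ops_sg) (use assms in \<open>auto simp: plus_additive\<close>)

lemma plus_subst_lmul:
  assumes "finite {K. F K \<noteq> 0}" "\<And>K. \<not> adm r s K \<Longrightarrow> F K = 0" "i \<in> {1..r+s}"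
  shows "subst_ops (plus_shift r s) (\<lambda>v. const (const v)) (lmul r s i F)
    = plus_shift r s i (subst_ops (plus_shift r s) (\<lambda>v. const (const v)) F)"
  by (rule subst_ops_lmul[OF super_family_plus_shift]) (use assms in \<open>auto simp: plus_additive\<close>)

lemma plus_subst_lift:
  assumes "finite {K. F K \<noteq> 0}"
  shows "subst_ops (plus_shift r s) (\<lambda>v. const (const v)) (lift r i (lmul r s i) F)
    = lift2_lmul r s i (subst_ops (plus_shift r s) (\<lambda>v. const (const v)) F)"
  by (rule subst_ops_lift[where E = "lift2_lmul r s"])
    (use assms in \<open>auto simp: plus_additive super_familyD(1)[OF super_family_lift2_lmul]
      additive_mapD(2)[OF additive_lmul] lift_const additive_lmul super_familyD(1)[OF super_family_lift_lmul] supercommute_lift2_plus_shift\<close>)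

lemma plus_subst_add:
  assumes "finite {K. F K \<noteq> 0}" "finite {K. G K \<noteq> 0}"
  shows "subst_ops (plus_shift r s) (\<lambda>v. const (const v)) (F + G)
    = subst_ops (plus_shift r s) (\<lambda>v. const (const v)) F + subst_ops (plus_shift r s) (\<lambda>v. const (const v)) G"
  by (rule subst_ops_add) (use assms in \<open>auto simp: plus_additive\<close>)

lemma plus_subst_const: "subst_ops (plus_shift r s) (\<lambda>v. const (const v)) (const v) = const (const v)"
  by (rule subst_ops_const) (auto simp: plus_additive)

lemma RW_plus_lmul_left:
  assumes "a \<in> RW_carrier r s" "b \<in> RW_carrier r s" "i \<in> {1..r+s}"
  shows "RW_plus r s (lmul r s i a) b = - plus_shift r s i (RW_plus r s a b)"
proof -
  have "RW_plus r s (lmul r s i a) b = subst_ops (plus_shift r s) (\<lambda>v. const (const v)) (sg 1 (lmul r s i (RW_bracket r s a b)))"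
    using assms by (simp add: RW_plus_def RW_bracket_lmul_left) (simp add: sg_def)
  also have "\<dots> = sg 1 (plus_shift r s i (RW_plus r s a b))"
    using assms by (simp add: plus_subst_sg plus_subst_lmul finite_supp_lmul RW_bracket_finite RW_plus_def)
  finally show ?thesis by (simp add: sg_def)
qed

lemma RW_plus_lmul_right:
  assumes "a \<in> RW_parity r s p" "b \<in> RW_carrier r s" "i \<in> {1..r+s}"
  shows "RW_plus r s a (lmul r s i b) = sg (par r i * p) (lift2_lmul r s i (RW_plus r s a b) + plus_shift r s i (RW_plus r s a b))"
proof -
  note fin = RW_bracket_finite[OF RW_parity_carrier[OF assms(1)] assms(2)]
  show ?thesis
    using assms fin
    by (simp add: RW_plus_def RW_bracket_lmul_right plus_subst_sg plus_subst_add plus_subst_lmul plus_subst_lift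
        finite_supp_lmul finite_supp_lift additive_mapD(2)[OF additive_lmul] finite_supp_add)
qed

text \<open>The bracket of \<open>[a\<^sub>\<lambda> b]\<close> with \<open>c\<close> at parameter
  \<open>\<lambda> + \<mu>\<close>: the monomials of \<open>[a\<^sub>\<lambda> b]\<close> remain,
  and each coefficient is replaced by its bracket with \<open>c\<close>. The substituted map is thus
  itself the result of a substitution.\<close>

definition RW_jac :: "nat \<Rightarrow> nat \<Rightarrow> 'f rw \<Rightarrow> 'f rw \<Rightarrow> 'f rw \<Rightarrow> mono \<Rightarrow> mono \<Rightarrow> 'f::field rw" where
  "RW_jac r s a b c = subst_ops (lmul r s) (\<lambda>x. RW_plus r s x c) (RW_bracket r s a b)"

lemma jac_ab_c_RW: "jac_ab_c r s (RW r s) a b c = RW_jac r s a b c"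
  by (simp add: jac_ab_c_def RW_jac_def subst_ops_def bracket_plus_RW)

lemma jac_subst_add:
  assumes "F \<in> polys r s (RW_carrier r s)" "G \<in> polys r s (RW_carrier r s)" "c \<in> RW_carrier r s"
  shows "subst_ops (lmul r s) (\<lambda>x. RW_plus r s x c) (F + G)
    = subst_ops (lmul r s) (\<lambda>x. RW_plus r s x c) F + subst_ops (lmul r s) (\<lambda>x. RW_plus r s x c) G"
  by (rule subst_ops_add) (use assms in \<open>auto simp: polys_def additive_lmul RW_plus_add\<close>)

lemma jac_subst_scale:
  assumes "F \<in> polys r s (RW_carrier r s)" "c \<in> RW_carrier r s"
  shows "subst_ops (lmul r s) (\<lambda>x. RW_plus r s x c) (fscale RW_scale d F)
    = fscale2 d (subst_ops (lmul r s) (\<lambda>x. RW_plus r s x c) F)"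
  by (subst fscale_def, rule subst_ops_map)
    (use assms in \<open>auto simp: polys_def additive_lmul RW_plus_scale additive_fscale2 additive_mapD(2)[OF additive_RW_scale] lmul_fscale2\<close>)

lemma jac_subst_sg:
  assumes "F \<in> polys r s (RW_carrier r s)" "c \<in> RW_carrier r s"
  shows "subst_ops (lmul r s) (\<lambda>x. RW_plus r s x c) (sg n F) = sg n (subst_ops (lmul r s) (\<lambda>x. RW_plus r s x c) F)"
  by (rule subst_ops_sg) (use assms in \<open>auto simp: polys_def additive_lmul RW_plus_sg\<close>)

lemma jac_subst_lmul:
  assumes "F \<in> polys r s (RW_carrier r s)" "c \<in> RW_carrier r s" "k \<in> {1..r+s}"
  shows "subst_ops (lmul r s) (\<lambda>x. RW_plus r s x c) (lmul r s k F) = lmul r s k (subst_ops (lmul r s) (\<lambda>x. RW_plus r s x c) F)"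
  by (rule subst_ops_lmul[OF super_family_lmul]) (use assms in \<open>auto simp: polys_def RW_plus_sg\<close>)

text \<open>A \<open>\<partial>\<^sub>k\<close> on a coefficient of the inner bracket stands in the
  left slot of the outer one, so left sesquilinearity turns it into
  \<open>-(\<lambda>\<^sub>k + \<mu>\<^sub>k)\<close>.\<close>

lemma jac_subst_lift:
  assumes "F \<in> polys r s (RW_carrier r s)" "c \<in> RW_carrier r s" "k \<in> {1..r+s}"
  shows "subst_ops (lmul r s) (\<lambda>x. RW_plus r s x c) (lift r k (lmul r s k) F)
    = - plus_shift r s k (subst_ops (lmul r s) (\<lambda>x. RW_plus r s x c) F)"
proof -
  note add = super_familyD(1)[OF super_family_plus_shift]
  have "supercommute r (\<lambda>k F. - plus_shift r s k F) (lmul r s)"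
    by (rule supercommute_sym[OF supercommute_minus[OF additive_lmul supercommute_sym[OF supercommute_plus_shift_lmul]]])
  then show ?thesis
    by (intro subst_ops_lift[where E = "\<lambda>k F. - plus_shift r s k F"])
      (use assms in \<open>auto simp: polys_def RW_plus_lmul_left additive_mapD(2)[OF additive_lmul] RW_plus_sg RW_carrier_lmul
        additive_lmul intro!: additive_map_minus add\<close>)
qed

lemma polys_RW_lmul:
  assumes "F \<in> polys r s (RW_carrier r s)"
  shows "lmul r s k F \<in> polys r s (RW_carrier r s)"
  using assms finite_supp_lmul[of F r s k] by (auto simp: polys_def lmul_def RW_carrier_sg)

lemma polys_RW_lift:
  assumes "F \<in> polys r s (RW_carrier r s)"
  shows "lift r k (lmul r s k) F \<in> polys r s (RW_carrier r s)"
  using assms finite_supp_lift[of F "lmul r s k" r k]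
  by (auto simp: polys_def lift_def RW_carrier_sg RW_carrier_lmul additive_mapD(2)[OF additive_lmul])

lemma polys_RW_add:
  "F \<in> polys r s (RW_carrier r s) \<Longrightarrow> G \<in> polys r s (RW_carrier r s) \<Longrightarrow> F + G \<in> polys r s (RW_carrier r s)"
  using finite_supp_add[of F G] by (auto simp: polys_def plus_fun_apply RW_carrier_add)

text \<open>Up to sign the three factors are \<open>-\<lambda>\<^sub>k\<close>, then
  \<open>\<lambda>\<^sub>k - (\<lambda>\<^sub>k + \<mu>\<^sub>k) = -\<mu>\<^sub>k\<close>, and
  \<open>\<partial>\<^sub>k + \<lambda>\<^sub>k + \<mu>\<^sub>k\<close>. The other two terms of the
  Jacobi identity acquire the same factors, so the difference of the two sides can be treated as a
  whole.\<close>

lemma RW_jac_lmul: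
  assumes a: "a \<in> RW_parity r s p" and b: "b \<in> RW_parity r s q" and c: "c \<in> RW_carrier r s" and k: "k \<in> {1..r+s}"
  shows "RW_jac r s (lmul r s k a) b c = - lmul r s k (RW_jac r s a b c)"
    "RW_jac r s a (lmul r s k b) c = - sg (par r k * p) (lift_lmul r s k (RW_jac r s a b c))"
    "RW_jac r s a b (lmul r s k c) = sg (par r k * (p + q))
      (lift2_lmul r s k (RW_jac r s a b c) + lmul r s k (RW_jac r s a b c) + lift_lmul r s k (RW_jac r s a b c))"
proof -
  note car = RW_parity_carrier[OF a] RW_parity_carrier[OF b]
  note pol = RW_bracket_polys[OF car]
  have "RW_jac r s (lmul r s k a) b c = subst_ops (lmul r s) (\<lambda>x. RW_plus r s x c) (sg 1 (lmul r s k (RW_bracket r s a b)))"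
    using car k by (simp add: RW_jac_def RW_bracket_lmul_left) (simp add: sg_def)
  also have "\<dots> = sg 1 (lmul r s k (RW_jac r s a b c))"
    using pol c k by (simp add: jac_subst_sg jac_subst_lmul polys_RW_lmul RW_jac_def)
  finally show "RW_jac r s (lmul r s k a) b c = - lmul r s k (RW_jac r s a b c)" by (simp add: sg_def)
  have "RW_jac r s a (lmul r s k b) c = sg (par r k * p) (- plus_shift r s k (RW_jac r s a b c) + lmul r s k (RW_jac r s a b c))"
    using pol c k by (simp add: RW_jac_def RW_bracket_lmul_right[OF a car(2) k] jac_subst_sg jac_subst_add jac_subst_lmul jac_subst_lift
        polys_RW_lmul polys_RW_lift polys_RW_add)
  then show "RW_jac r s a (lmul r s k b) c = - sg (par r k * p) (lift_lmul r s k (RW_jac r s a b c))"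
    by (simp add: plus_shift_def sg_minus)
  let ?E = "\<lambda>k F. lift2_lmul r s k F + plus_shift r s k F"
  have comm: "supercommute r ?E (lmul r s)"
    by (rule supercommute_sym[OF supercommute_plus[OF additive_lmul supercommute_sym[OF supercommute_lift2_lmul] supercommute_sym[OF supercommute_plus_shift_lmul]]])
  have addE: "additive_map (?E k)"
    by (intro additive_map_plus super_familyD(1)[OF super_family_lift2_lmul] super_familyD(1)[OF super_family_plus_shift])
  note add' = additive_mapD[OF ops_additive[OF additive_lmul]]
  \<comment> \<open>Here \<open>c\<close> is part of the substituted map, so the operator is
    extracted from each summand: the share of \<open>mpar r K\<close> in its sign cancels against
    the sign for crossing \<open>\<lambda>\<^sub>K\<close>.\<close>
  have "RW_jac r s a b (lmul r s k c) =
      (\<Sum>K | RW_bracket r s a b K \<noteq> 0. sg (par r k * (p + q)) (?E k (ops (lmul r s) K (RW_plus r s (RW_bracket r s a b K) c))))"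
    unfolding RW_jac_def subst_ops_def
  proof (rule sum.cong[OF refl])
    fix K
    have "RW_plus r s (RW_bracket r s a b K) (lmul r s k c)
        = sg (par r k * (p + q + mpar r K)) (?E k (RW_plus r s (RW_bracket r s a b K) c))"
      by (rule RW_plus_lmul_right[OF RW_bracket_parity[OF a b] c k])
    then show "ops (lmul r s) K (RW_plus r s (RW_bracket r s a b K) (lmul r s k c))
        = sg (par r k * (p + q)) (?E k (ops (lmul r s) K (RW_plus r s (RW_bracket r s a b K) c)))"
      unfolding ops_supercommute[OF additive_lmul comm]
      by (simp only: add') (auto intro!: sg_eqI)
  qed
  also have "\<dots> = sg (par r k * (p + q)) (?E k (RW_jac r s a b c))"
    unfolding RW_jac_def subst_ops_def by (simp only: sg_sum additive_mapD(5)[OF addE])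
  finally show "RW_jac r s a b (lmul r s k c) = sg (par r k * (p + q))
      (lift2_lmul r s k (RW_jac r s a b c) + lmul r s k (RW_jac r s a b c) + lift_lmul r s k (RW_jac r s a b c))"
    by (simp add: plus_shift_def add.assoc)
qed

lemma RW_jac_add:
  assumes "a \<in> RW_carrier r s" "a' \<in> RW_carrier r s" "b \<in> RW_carrier r s" "c \<in> RW_carrier r s"
  shows "RW_jac r s (a + a') b c = RW_jac r s a b c + RW_jac r s a' b c"
    "RW_jac r s b (a + a') c = RW_jac r s b a c + RW_jac r s b a' c"
    "RW_jac r s b c (a + a') = RW_jac r s b c a + RW_jac r s b c a'"
proof -
  show "RW_jac r s (a + a') b c = RW_jac r s a b c + RW_jac r s a' b c"
    "RW_jac r s b (a + a') c = RW_jac r s b a c + RW_jac r s b a' c"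
    using assms by (simp_all add: RW_jac_def RW_bracket_add_left RW_bracket_add_right jac_subst_add RW_bracket_polys)
  show "RW_jac r s b c (a + a') = RW_jac r s b c a + RW_jac r s b c a'"
    using assms by (simp add: RW_jac_def subst_ops_def RW_plus_add RW_bracket_finite
      additive_mapD(1)[OF ops_additive[OF additive_lmul]] sum.distrib)
qed

lemma ops_lmul_fscale2: "ops (lmul r s) K (fscale2 d F) = fscale2 d (ops (lmul r s) K F)"
proof -
  have "foldr (lmul r s) xs (fscale2 d F) = fscale2 d (foldr (lmul r s) xs F)" for xs
    by (induction xs) (auto simp: lmul_fscale2)
  then show ?thesis by (simp add: ops_def)
qed

lemma RW_jac_scale:
  assumes "a \<in> RW_carrier r s" "b \<in> RW_carrier r s" "c \<in> RW_carrier r s"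
  shows "RW_jac r s (RW_scale d a) b c = fscale2 d (RW_jac r s a b c)"
    "RW_jac r s a (RW_scale d b) c = fscale2 d (RW_jac r s a b c)"
    "RW_jac r s a b (RW_scale d c) = fscale2 d (RW_jac r s a b c)"
proof -
  show "RW_jac r s (RW_scale d a) b c = fscale2 d (RW_jac r s a b c)"
    "RW_jac r s a (RW_scale d b) c = fscale2 d (RW_jac r s a b c)"
    using assms by (simp_all add: RW_jac_def RW_bracket_scale_left RW_bracket_scale_right jac_subst_scale RW_bracket_polys)
  show "RW_jac r s a b (RW_scale d c) = fscale2 d (RW_jac r s a b c)"
    using assms by (simp add: RW_jac_def subst_ops_def RW_plus_scale RW_bracket_finite ops_lmul_fscale2
      additive_mapD(5)[OF additive_fscale2])
qed

text \<open>The Jacobi identity of three generators in abstract form: \<open>L\<close>,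
  \<open>M\<close>, \<open>D\<close> play the roles of \<open>\<lambda>\<close>,
  \<open>\<mu>\<close>, \<open>\<partial>\<close>, and \<open>e k\<close> that of the constant
  \<open>a\<^sub>k\<close>. \<open>X\<close>, \<open>Z\<close>, \<open>H\<close> are the generator
  brackets with parameters \<open>\<lambda>\<close>, \<open>\<mu>\<close> and
  \<open>\<lambda> + \<mu>\<close>. Only additivity and supercommutation enter, so what remains is a
  check over the parities of the three indices.\<close>

lemma jacobi_generators:
  fixes L M D :: "nat \<Rightarrow> 'v \<Rightarrow> 'v::ab_group_add" and e :: "nat \<Rightarrow> 'v"
  assumes add: "\<And>i. additive_map (L i)" "\<And>i. additive_map (M i)" "\<And>i. additive_map (D i)"
    and comm_LL: "supercommute r L L" and comm_MM: "supercommute r M M" and comm_DD: "supercommute r D D"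
    and comm_ML: "supercommute r M L" and comm_DL: "supercommute r D L" and comm_DM: "supercommute r D M"
  defines "X \<equiv> \<lambda>i k. D i (e k) + L i (e k) + sg (par r i * par r k) (L k (e i))"
    and "Z \<equiv> \<lambda>j k. D j (e k) + M j (e k) + sg (par r j * par r k) (M k (e j))"
    and "H \<equiv> \<lambda>j k. D j (e k) + (L j (e k) + M j (e k)) + sg (par r j * par r k) (L k (e j) + M k (e j))"
  shows "sg (par r j * par r i) (D j (X i k) + L j (X i k)) + sg (par r j * par r i) (M j (X i k))
      + sg (par r j * par r k) (sg (par r k * par r i) (M k (X i j)))
    = - (L i (H j k) + M i (H j k)) + L i (H j k) + sg (par r i * par r j) (L j (H i k))
      + sg (par r i * par r j) (sg (par r i * par r j) (D i (Z j k) + M i (Z j k))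
          + sg (par r i * par r j) (L i (Z j k)) + sg (par r i * par r k) (sg (par r k * par r j) (L k (Z j i))))"
proof -
  note a = additive_mapD(1,3,4,6)[OF add(1)] additive_mapD(1,3,4,6)[OF add(2)] additive_mapD(1,3,4,6)[OF add(3)]
  note sw = supercommuteD[OF comm_LL] supercommuteD[OF comm_MM] supercommuteD[OF comm_DD] supercommuteD[OF comm_ML] supercommuteD[OF comm_DL] supercommuteD[OF comm_DM]
    supercommuteD[OF supercommute_sym[OF comm_ML]] supercommuteD[OF supercommute_sym[OF comm_DL]] supercommuteD[OF supercommute_sym[OF comm_DM]]
  \<comment> \<open>The exchange rules are instantiated for three ordered pairs of indices only.
    Rewriting therefore terminates, with the operator of index \<open>i\<close> outermost and that
    of index \<open>k\<close> innermost, and matching terms become identical.\<close>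
  note swap = sw[of j i] sw[of k i] sw[of k j]
  consider "par r i = 0" | "par r i = 1" by (metis par_cases)
  then show ?thesis
  proof cases
    case i: 1
    consider "par r j = 0" | "par r j = 1" by (metis par_cases)
    then show ?thesis
    proof cases
      case j: 1
      \<comment> \<open>With \<open>i\<close> and \<open>j\<close> even every sign is trivial,
        whatever the parity of \<open>k\<close>.\<close>
      then show ?thesis using i by (simp add: X_def Z_def H_def a swap)
    next
      case j: 2
      consider "par r k = 0" | "par r k = 1" by (metis par_cases)
      then show ?thesis using i j by cases (simp_all add: X_def Z_def H_def a swap sg_def algebra_simps del: par_odd_iff)
    qed
  next
    case i: 2
    consider "par r j = 0" | "par r j = 1" by (metis par_cases)
    then show ?thesis
    proof cases
      case j: 1
      consider "par r k = 0" | "par r k = 1" by (metis par_cases)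
      then show ?thesis using i j by cases (simp_all add: X_def Z_def H_def a swap sg_def algebra_simps del: par_odd_iff)
    next
      case j: 2
      consider "par r k = 0" | "par r k = 1" by (metis par_cases)
      then show ?thesis using i j by cases (simp_all add: X_def Z_def H_def a swap sg_def algebra_simps del: par_odd_iff)
    qed
  qed
qed

text \<open>The difference of the two sides of the Jacobi identity. A
  \<open>\<partial>\<^sub>k\<close> in an argument acts on it by one additive operator, so its
  vanishing propagates from the generators.\<close>

definition RW_defect :: "nat \<Rightarrow> nat \<Rightarrow> nat \<Rightarrow> nat \<Rightarrow> 'f rw \<Rightarrow> 'f rw \<Rightarrow> 'f rw \<Rightarrow> mono \<Rightarrow> mono \<Rightarrow> 'f::field rw" where
  "RW_defect r s p q a b c = outer_lift r p (RW_bracket r s a) (RW_bracket r s b c) - RW_jac r s a b c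
     - sg (p * q) (inner_lift r q (RW_bracket r s b) (RW_bracket r s a c))"

lemma RW_defect_cong: "even (p + p') \<Longrightarrow> even (q + q') \<Longrightarrow> RW_defect r s p q a b c = RW_defect r s p' q' a b c"
proof -
  assume "even (p + p')" "even (q + q')"
  then have "outer_lift r p A F = outer_lift r p' A F" "inner_lift r q A F = inner_lift r q' A F"
    "sg (p * q) G = sg (p' * q') G" for A :: "'a rw \<Rightarrow> mono \<Rightarrow> 'a rw" and F and G :: "mono \<Rightarrow> mono \<Rightarrow> 'a rw"
    by (auto simp: outer_lift_def inner_lift_def fun_eq_iff intro!: sg_eqI arg_cong2[where f = sg] fun_cong[where f = "sg _ _"])
      (auto simp: sg_def)
  then show ?thesis by (simp add: RW_defect_def)
qed

lemma outer_lift_add_fun: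
  assumes "a \<in> RW_carrier r s" "a' \<in> RW_carrier r s" "\<And>L. F L \<in> RW_carrier r s"
  shows "outer_lift r p (RW_bracket r s (a + a')) F = outer_lift r p (RW_bracket r s a) F + outer_lift r p (RW_bracket r s a') F"
  using assms by (simp add: outer_lift_def RW_bracket_add_left fun_eq_iff sg_add plus_fun_apply)

lemma outer_lift_add:
  assumes "a \<in> RW_carrier r s" "\<And>L. F L \<in> RW_carrier r s" "\<And>L. G L \<in> RW_carrier r s"
  shows "outer_lift r p (RW_bracket r s a) (F + G) = outer_lift r p (RW_bracket r s a) F + outer_lift r p (RW_bracket r s a) G"
  using assms by (simp add: outer_lift_def RW_bracket_add_right fun_eq_iff sg_add plus_fun_apply)

lemma inner_lift_add_fun:
  assumes "a \<in> RW_carrier r s" "a' \<in> RW_carrier r s" "\<And>L. F L \<in> RW_carrier r s"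
  shows "inner_lift r p (RW_bracket r s (a + a')) F = inner_lift r p (RW_bracket r s a) F + inner_lift r p (RW_bracket r s a') F"
  using assms by (simp add: inner_lift_def RW_bracket_add_left fun_eq_iff sg_add plus_fun_apply)

lemma inner_lift_add:
  assumes "a \<in> RW_carrier r s" "\<And>L. F L \<in> RW_carrier r s" "\<And>L. G L \<in> RW_carrier r s"
  shows "inner_lift r p (RW_bracket r s a) (F + G) = inner_lift r p (RW_bracket r s a) F + inner_lift r p (RW_bracket r s a) G"
  using assms by (simp add: inner_lift_def RW_bracket_add_right fun_eq_iff sg_add plus_fun_apply)

lemma outer_lift_scale_fun:
  assumes "a \<in> RW_carrier r s" "\<And>L. F L \<in> RW_carrier r s"
  shows "outer_lift r p (RW_bracket r s (RW_scale d a)) F = fscale2 d (outer_lift r p (RW_bracket r s a) F)"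
  using assms by (simp add: outer_lift_def RW_bracket_scale_left fscale_def fun_eq_iff additive_mapD(4)[OF additive_RW_scale])

lemma outer_lift_scale:
  assumes "a \<in> RW_carrier r s" "\<And>L. F L \<in> RW_carrier r s"
  shows "outer_lift r p (RW_bracket r s a) (fscale RW_scale d F) = fscale2 d (outer_lift r p (RW_bracket r s a) F)"
  using assms by (simp add: outer_lift_def RW_bracket_scale_right fscale_def fun_eq_iff additive_mapD(4)[OF additive_RW_scale])

lemma inner_lift_scale_fun:
  assumes "a \<in> RW_carrier r s" "\<And>L. F L \<in> RW_carrier r s"
  shows "inner_lift r p (RW_bracket r s (RW_scale d a)) F = fscale2 d (inner_lift r p (RW_bracket r s a) F)"
  using assms by (simp add: inner_lift_def RW_bracket_scale_left fscale_def fun_eq_iff additive_mapD(4)[OF additive_RW_scale])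

lemma inner_lift_scale:
  assumes "a \<in> RW_carrier r s" "\<And>L. F L \<in> RW_carrier r s"
  shows "inner_lift r p (RW_bracket r s a) (fscale RW_scale d F) = fscale2 d (inner_lift r p (RW_bracket r s a) F)"
  using assms by (simp add: inner_lift_def RW_bracket_scale_right fscale_def fun_eq_iff additive_mapD(4)[OF additive_RW_scale])

lemma RW_defect_add:
  assumes "a \<in> RW_carrier r s" "a' \<in> RW_carrier r s" "b \<in> RW_carrier r s" "c \<in> RW_carrier r s"
  shows "RW_defect r s p q (a + a') b c = RW_defect r s p q a b c + RW_defect r s p q a' b c"
    "RW_defect r s p q b (a + a') c = RW_defect r s p q b a c + RW_defect r s p q b a' c"
    "RW_defect r s p q b c (a + a') = RW_defect r s p q b c a + RW_defect r s p q b c a'"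
  using assms
  by (simp_all add: RW_defect_def RW_jac_add RW_bracket_add_left RW_bracket_add_right RW_bracket_finite
      outer_lift_add_fun outer_lift_add inner_lift_add_fun inner_lift_add sg_add)

lemma RW_defect_scale:
  assumes "a \<in> RW_carrier r s" "b \<in> RW_carrier r s" "c \<in> RW_carrier r s"
  shows "RW_defect r s p q (RW_scale d a) b c = fscale2 d (RW_defect r s p q a b c)"
    "RW_defect r s p q a (RW_scale d b) c = fscale2 d (RW_defect r s p q a b c)"
    "RW_defect r s p q a b (RW_scale d c) = fscale2 d (RW_defect r s p q a b c)"
  using assms
  by (simp_all add: RW_defect_def RW_jac_scale RW_bracket_scale_left RW_bracket_scale_right RW_bracket_finite
      outer_lift_scale_fun outer_lift_scale inner_lift_scale_fun inner_lift_scale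
      additive_mapD(4,6)[OF additive_fscale2])

text \<open>Raising the parity from \<open>p\<close> to \<open>par r k + p\<close> and multiplying
  by one more \<open>\<lambda>\<^sub>k\<close> contribute the same sign against
  \<open>\<mu>\<^sub>L\<close>, so the two cancel.\<close>

lemma outer_lift_neg_lmul_fun:
  assumes "a \<in> RW_carrier r s" "\<And>L. F L \<in> RW_carrier r s" "k \<in> {1..r+s}"
  shows "outer_lift r (par r k + p) (RW_bracket r s (lmul r s k a)) F = - lmul r s k (outer_lift r p (RW_bracket r s a) F)"
proof (rule ext, rule ext)
  fix K L
  show "outer_lift r (par r k + p) (RW_bracket r s (lmul r s k a)) F K L = (- lmul r s k (outer_lift r p (RW_bracket r s a) F)) K L"
  proof (cases "k \<in># K")
    case True
    then obtain K' where K: "K = add_mset k K'" by (metis insert_DiffM)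
    show ?thesis
      using assms
      by (auto simp: K outer_lift_def lmul_add_mset RW_bracket_lmul_left uminus_apply sg_minus sg_apply zero_fun_apply intro!: sg_eqI)
  qed (use assms in \<open>simp add: outer_lift_def lmul_notin RW_bracket_lmul_left uminus_apply zero_fun_apply\<close>)
qed

lemma inner_lift_neg_lmul_fun:
  assumes "b \<in> RW_carrier r s" "\<And>L. F L \<in> RW_carrier r s" "k \<in> {1..r+s}"
  shows "inner_lift r (par r k + q) (RW_bracket r s (lmul r s k b)) F = - lift_lmul r s k (inner_lift r q (RW_bracket r s b) F)"
proof (rule ext, rule ext)
  fix K L
  have "inner_lift r q (RW_bracket r s b) F K = sg (mpar r K * q) (RW_bracket r s b (F K))"
    by (simp add: inner_lift_def sg_apply fun_eq_iff)
  moreover have "inner_lift r (par r k + q) (RW_bracket r s (lmul r s k b)) F K = sg (mpar r K * (par r k + q)) (- lmul r s k (RW_bracket r s b (F K)))"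
    using assms by (simp add: inner_lift_def sg_apply fun_eq_iff RW_bracket_lmul_left)
  ultimately have "inner_lift r (par r k + q) (RW_bracket r s (lmul r s k b)) F K = - lift_lmul r s k (inner_lift r q (RW_bracket r s b) F) K"
    by (simp only: lift_def additive_mapD(4)[OF additive_lmul] sg_minus sg_sg)
      (auto intro!: sg_eqI)
  then show "inner_lift r (par r k + q) (RW_bracket r s (lmul r s k b)) F K L = (- lift_lmul r s k (inner_lift r q (RW_bracket r s b) F)) K L"
    by (simp only: uminus_apply)
qed

lemma lift_carrier: "(\<And>L. F L \<in> RW_carrier r s) \<Longrightarrow> lift r k (lmul r s k) F L \<in> RW_carrier r s"
  by (simp add: lift_def RW_carrier_sg RW_carrier_lmul)

lemma lmul_carrier: "(\<And>L. F L \<in> RW_carrier r s) \<Longrightarrow> lmul r s k F L \<in> RW_carrier r s"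
  by (simp add: lmul_def RW_carrier_sg)

lemma sg_carrier: "(\<And>L. F L \<in> RW_carrier r s) \<Longrightarrow> sg n F L \<in> RW_carrier r s"
  by (simp add: sg_apply RW_carrier_sg)

lemma add_carrier: "(\<And>L. F L \<in> RW_carrier r s) \<Longrightarrow> (\<And>L. G L \<in> RW_carrier r s) \<Longrightarrow> (F + G) L \<in> RW_carrier r s"
  by (simp add: plus_fun_apply RW_carrier_add)

lemma outer_lift_sg:
  assumes "a \<in> RW_carrier r s" "\<And>L. F L \<in> RW_carrier r s"
  shows "outer_lift r p (RW_bracket r s a) (sg n F) = sg n (outer_lift r p (RW_bracket r s a) F)"
  using assms by (auto simp: outer_lift_def sg_apply RW_bracket_sg fun_eq_iff add.commute)

lemma inner_lift_sg:
  assumes "a \<in> RW_carrier r s" "\<And>L. F L \<in> RW_carrier r s"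
  shows "inner_lift r p (RW_bracket r s a) (sg n F) = sg n (inner_lift r p (RW_bracket r s a) F)"
  using assms by (auto simp: inner_lift_def sg_apply RW_bracket_sg fun_eq_iff add.commute)

lemma minus_eq_sg: "- F = sg 1 F"
  by (simp add: sg_def)

lemma RW_defect_lmul:
  assumes a: "a \<in> RW_parity r s p" and b: "b \<in> RW_parity r s q" and c: "c \<in> RW_carrier r s" and k: "k \<in> {1..r+s}"
  shows "RW_defect r s (par r k + p) q (lmul r s k a) b c = - lmul r s k (RW_defect r s p q a b c)"
    "RW_defect r s p (par r k + q) a (lmul r s k b) c = - sg (par r k * p) (lift_lmul r s k (RW_defect r s p q a b c))"
    "RW_defect r s p q a b (lmul r s k c) = sg (par r k * (p + q))
      (lift2_lmul r s k (RW_defect r s p q a b c) + lmul r s k (RW_defect r s p q a b c) + lift_lmul r s k (RW_defect r s p q a b c))"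
proof -
  note car = RW_parity_carrier[OF a] RW_parity_carrier[OF b]
  note fin = RW_bracket_finite(3)[OF car(1) c] RW_bracket_finite(3)[OF car(2) c]
  note add = additive_lmul[of r s k] super_familyD(1)[OF super_family_lift_lmul, of r k s] super_familyD(1)[OF super_family_lift2_lmul, of r k s]
  note add' = additive_mapD(1,3,4,6)[OF add(1)] additive_mapD(1,3,4,6)[OF add(2)] additive_mapD(1,3,4,6)[OF add(3)]
  let ?O = "outer_lift r p (RW_bracket r s a) (RW_bracket r s b c)"
    and ?I = "inner_lift r q (RW_bracket r s b) (RW_bracket r s a c)"
  have "inner_lift r q (RW_bracket r s b) (RW_bracket r s (lmul r s k a) c) = - sg (par r k * q) (lmul r s k ?I)"
    using car c k fin by (simp add: RW_bracket_lmul_left minus_eq_sg inner_lift_sg inner_lift_lmul lmul_carrier add.commute)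
  then show "RW_defect r s (par r k + p) q (lmul r s k a) b c = - lmul r s k (RW_defect r s p q a b c)"
    using car c k fin
    by (simp add: RW_defect_def RW_jac_lmul[OF a b c k] outer_lift_neg_lmul_fun sg_minus add')
      (auto intro!: sg_eqI)
  have "outer_lift r p (RW_bracket r s a) (RW_bracket r s (lmul r s k b) c) = - sg (par r k * p) (lift_lmul r s k ?O)"
    using car c k fin by (simp add: RW_bracket_lmul_left minus_eq_sg outer_lift_sg outer_lift_lmul lmul_carrier add.commute)
  then show "RW_defect r s p (par r k + q) a (lmul r s k b) c = - sg (par r k * p) (lift_lmul r s k (RW_defect r s p q a b c))"
    using car c k fin
    by (simp add: RW_defect_def RW_jac_lmul[OF a b c k] inner_lift_neg_lmul_fun sg_minus sg_diff add')
      (auto intro!: sg_eqI)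
  have 1: "outer_lift r p (RW_bracket r s a) (RW_bracket r s b (lmul r s k c))
      = sg (par r k * (p + q)) (lift2_lmul r s k ?O + lmul r s k ?O + lift_lmul r s k ?O)"
    using car c k fin
    by (simp add: RW_bracket_lmul_right[OF b] outer_lift_sg outer_lift_add outer_lift_lmul outer_lift_lift[OF a]
        lmul_carrier lift_carrier sg_carrier add_carrier sg_add distrib_left add.commute[where 'a = nat])
  have 2: "inner_lift r q (RW_bracket r s b) (RW_bracket r s a (lmul r s k c))
      = sg (par r k * (p + q)) (lift2_lmul r s k ?I + lmul r s k ?I + lift_lmul r s k ?I)"
    using car c k fin
    by (simp add: RW_bracket_lmul_right[OF a] inner_lift_sg inner_lift_add inner_lift_lmul inner_lift_lift[OF b]
        lmul_carrier lift_carrier sg_carrier add_carrier sg_add distrib_left add.commute[where 'a = nat] ac_simps)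
  have alg: "sg n (A + B + C) - sg n (A' + B' + C') - sg m (sg n (A'' + B'' + C''))
      = sg n ((A - A' - sg m A'') + (B - B' - sg m B'') + (C - C' - sg m C''))"
    for n m and A B C A' B' C' A'' B'' C'' :: "mono \<Rightarrow> mono \<Rightarrow> 'a rw"
    by (auto simp: sg_def)
  show "RW_defect r s p q a b (lmul r s k c) = sg (par r k * (p + q))
      (lift2_lmul r s k (RW_defect r s p q a b c) + lmul r s k (RW_defect r s p q a b c) + lift_lmul r s k (RW_defect r s p q a b c))"
    unfolding RW_defect_def RW_jac_lmul[OF a b c k] 1 2 alg by (simp only: add')
qed

lemma RW_defect_gen:
  assumes "i \<in> {1..r+s}" "j \<in> {1..r+s}" "k \<in> {1..r+s}"
  shows "RW_defect r s (par r i) (par r j) (RW_gen i) (RW_gen j) (RW_gen k :: 'f::field rw) = 0"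
proof -
  let ?e = "\<lambda>k. const (const (RW_gen k)) :: mono \<Rightarrow> mono \<Rightarrow> 'f rw"
  let ?L = "lmul r s :: _ \<Rightarrow> (mono \<Rightarrow> mono \<Rightarrow> 'f rw) \<Rightarrow> _" and ?M = "lift_lmul r s :: _ \<Rightarrow> (mono \<Rightarrow> mono \<Rightarrow> 'f rw) \<Rightarrow> _"
    and ?D = "lift2_lmul r s :: _ \<Rightarrow> (mono \<Rightarrow> mono \<Rightarrow> 'f rw) \<Rightarrow> _"
  let ?X = "\<lambda>i k. ?D i (?e k) + ?L i (?e k) + sg (par r i * par r k) (?L k (?e i))"
  let ?Z = "\<lambda>j k. ?D j (?e k) + ?M j (?e k) + sg (par r j * par r k) (?M k (?e j))"
  let ?H = "\<lambda>j k. ?D j (?e k) + (?L j (?e k) + ?M j (?e k)) + sg (par r j * par r k) (?L k (?e j) + ?M k (?e j))"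
  let ?c = "\<lambda>k. const (RW_gen k) :: mono \<Rightarrow> 'f rw"
  have g: "RW_bracket r s (RW_gen i) (RW_gen j) = lift_lmul r s i (?c j) + lmul r s i (?c j) + sg (par r i * par r j) (lmul r s j (?c i))"
    if "i \<in> {1..r+s}" "j \<in> {1..r+s}" for i j
    using that by (simp add: RW_bracket_gen RW_gen_bracket_def lift_const additive_lmul)
  have car: "RW_gen i \<in> RW_carrier r s" "const (RW_gen i) K \<in> RW_carrier r s" if "i \<in> {1..r+s}" for i K
    using that by (auto simp: RW_gen_carrier const_apply)
  note cars = car lmul_carrier lift_carrier sg_carrier add_carrier
  \<comment> \<open>Applying \<open>const\<close> to every coefficient embeds polynomials in
    \<open>\<lambda>\<close> into polynomials in \<open>\<lambda>\<close> and \<open>\<mu>\<close>.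
    The variables stay outer ones, while the action of \<open>\<partial>\<close>, a single lift
    before, becomes a double lift.\<close>
  have iota: "(\<lambda>K. const ((F + G) K)) = (\<lambda>K. const (F K)) + (\<lambda>K. const (G K))"
    "(\<lambda>K. const (lmul r s i F K)) = ?L i (\<lambda>K. const (F K))"
    "(\<lambda>K. const (lift_lmul r s i F K)) = ?D i (\<lambda>K. const (F K))"
    "(\<lambda>K. const (sg n F K)) = sg n (\<lambda>K. const (F K))"
    "(\<lambda>K. const (const v K)) = const (const v)" for F G :: "mono \<Rightarrow> 'f rw" and i n v
    by (auto simp: lmul_def lift_def const_def fun_eq_iff sg_apply pointwise additive_mapD(2)[OF additive_lmul])
  have o0: "outer_lift r p (RW_bracket r s a) (const v) = (\<lambda>K. const (RW_bracket r s a v K))" for p and a v :: "'f rw"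
    by (auto simp: outer_lift_def const_def fun_eq_iff zero_fun_apply)
  have i0: "inner_lift r p (RW_bracket r s a) (const v) = const (RW_bracket r s a v)" for p and a v :: "'f rw"
    by (auto simp: inner_lift_def const_def fun_eq_iff zero_fun_apply)
  have X: "outer_lift r (par r i) (RW_bracket r s (RW_gen i)) (?c k) = ?X i k" if "i \<in> {1..r+s}" "k \<in> {1..r+s}" for i k
    using that by (simp add: o0 g iota)
  \<comment> \<open>The other embedding: with \<open>const\<close> on the outside the variables of
    \<open>F\<close> become the inner ones, so \<open>lmul\<close> turns into
    \<open>lift_lmul\<close>.\<close>
  have c1: "const (lmul r s i F) = lift_lmul r s i (const F)" "const (lift_lmul r s i F) = lift2_lmul r s i (const F)"
    for i and F :: "mono \<Rightarrow> 'f rw"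
    by (simp_all add: lift_const additive_lmul super_familyD(1)[OF super_family_lift_lmul])
  have Z: "inner_lift r (par r j) (RW_bracket r s (RW_gen j)) (?c k) = ?Z j k" if "j \<in> {1..r+s}" "k \<in> {1..r+s}" for j k
    using that by (simp add: i0 g additive_mapD(1,4)[OF additive_const] c1)
  have fin: "finite {K. lmul r s i (?c j) K \<noteq> 0}" "finite {K. lift_lmul r s i (?c j) K \<noteq> 0}" for i j
    by (auto simp: finite_supp_lmul finite_supp_lift additive_mapD(2)[OF additive_lmul])
  have adm: "const (RW_gen j) K = (0 :: 'f rw)" if "\<not> adm r s K" for j K
    using that by (auto simp: const_apply)
  have H: "RW_plus r s (RW_gen j) (RW_gen k) = ?H j k" if "j \<in> {1..r+s}" "k \<in> {1..r+s}" for j k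
    using that
    by (simp add: RW_plus_def g plus_subst_add plus_subst_lift plus_subst_lmul plus_subst_sg plus_subst_const fin finite_supp_add
      finite_supp_sg adm plus_shift_def)
  have pol: "?c i \<in> polys r s (RW_carrier r s)" if "i \<in> {1..r+s}" for i
    using that by (auto simp: polys_def const_apply RW_gen_carrier)
  have "sg n F \<in> polys r s (RW_carrier r s)" if "F \<in> polys r s (RW_carrier r s)" for n and F :: "mono \<Rightarrow> 'f rw"
    using that by (auto simp: polys_def sg_apply RW_carrier_sg)
  note pols = pol polys_RW_lmul polys_RW_lift polys_RW_add this
  have const_jac: "subst_ops (lmul r s) (\<lambda>x. RW_plus r s x (RW_gen k)) (?c j) = RW_plus r s (RW_gen j) (RW_gen k)" for j
    by (rule subst_ops_const) (auto simp: additive_lmul)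
  have JC: "RW_jac r s (RW_gen i) (RW_gen j) (RW_gen k) =
      - (?L i (?H j k) + ?M i (?H j k)) + ?L i (?H j k) + sg (par r i * par r j) (?L j (?H i k))"
    unfolding RW_jac_def g[OF assms(1,2)]
    using assms by (simp add: jac_subst_add jac_subst_lift jac_subst_lmul jac_subst_sg pols car const_jac H plus_shift_def)
  have JA: "outer_lift r (par r i) (RW_bracket r s (RW_gen i)) (RW_bracket r s (RW_gen j) (RW_gen k)) =
      sg (par r j * par r i) (?D j (?X i k) + ?L j (?X i k)) + sg (par r j * par r i) (?M j (?X i k))
      + sg (par r j * par r k) (sg (par r k * par r i) (?M k (?X i j)))"
    unfolding g[OF assms(2,3)]
    using assms by (simp only: outer_lift_add outer_lift_lift[OF RW_gen_parity] outer_lift_lmul outer_lift_sg cars X)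
  have JB: "inner_lift r (par r j) (RW_bracket r s (RW_gen j)) (RW_bracket r s (RW_gen i) (RW_gen k)) =
      sg (par r i * par r j) (?D i (?Z j k) + ?M i (?Z j k)) + sg (par r i * par r j) (?L i (?Z j k))
      + sg (par r i * par r k) (sg (par r k * par r j) (?L k (?Z j i)))"
    unfolding g[OF assms(1,3)]
    using assms by (simp only: inner_lift_add inner_lift_lift[OF RW_gen_parity] inner_lift_lmul inner_lift_sg cars Z)
  show ?thesis
    unfolding RW_defect_def JA JB JC
    using jacobi_generators[where L = ?L and M = ?M and D = ?D and e = ?e and i = i and j = j and k = k and r = r,
       OF additive_lmul super_familyD(1)[OF super_family_lift_lmul] super_familyD(1)[OF super_family_lift2_lmul]
         supercommute_lmul super_familyD(2)[OF super_family_lift_lmul] super_familyD(2)[OF super_family_lift2_lmul]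
         supercommute_lift_lmul supercommute_lift2_lmul supercommute_lift2_lift]
    by (simp only: diff_diff_eq right_minus_eq)
qed

lemma RW_defect_zero_arg [simp]: "RW_defect r s p q 0 b c = 0" "RW_defect r s p q a 0 c = 0" "RW_defect r s p q a b 0 = 0"
proof -
  have "RW_bracket r s 0 = (\<lambda>_. 0)" "RW_plus r s 0 = (\<lambda>_. 0)" by (auto simp: fun_eq_iff)
  then show "RW_defect r s p q 0 b c = 0" "RW_defect r s p q a 0 c = 0" "RW_defect r s p q a b 0 = 0"
    by (auto simp: RW_defect_def outer_lift_def inner_lift_def RW_jac_def subst_ops_def pointwise fun_eq_iff sg_apply
      additive_mapD(2)[OF ops_additive[OF additive_lmul]])
qed

text \<open>The induction treats \<open>c\<close>, then \<open>b\<close>, then \<open>a\<close>. At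
  each stage the arguments not yet treated are generators, and those already treated are
  arbitrary.\<close>

lemma RW_defect_eq_0:
  assumes "a \<in> RW_parity r s p" "b \<in> RW_parity r s q" "c \<in> RW_carrier r s"
  shows "RW_defect r s p q a b c = 0"
proof -
  note zeros = additive_mapD(2)[OF additive_fscale2] additive_mapD(2)[OF additive_lmul]
    additive_mapD(2)[OF super_familyD(1)[OF super_family_lift_lmul]] additive_mapD(2)[OF super_familyD(1)[OF super_family_lift2_lmul]]
  have gc: "RW_defect r s (par r i) (par r j) (RW_gen i) (RW_gen j) c = 0"
    if "i \<in> {1..r+s}" "j \<in> {1..r+s}" for i j
    using assms(3)
  proof (induction rule: RW_carrier_induct)
    case (add x y)
    then show ?case using that by (simp add: RW_defect_add RW_gen_carrier)
  next
    case (hom p x)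
    then show ?case
    proof (induction rule: RW_hom_induct)
      case (lmul q k x)
      then show ?case
        using that by (simp add: RW_defect_lmul(3)[OF RW_gen_parity RW_gen_parity] RW_parity_carrier zeros)
    qed (use that in \<open>simp_all add: RW_defect_add RW_defect_scale RW_parity_carrier RW_gen_carrier RW_defect_gen zeros\<close>)
  qed
  have gb: "RW_defect r s (par r i) q (RW_gen i) b c = 0" if i: "i \<in> {1..r+s}" for i
    using assms(2)
  proof (induction rule: RW_hom_induct)
    case (cong q q' x)
    have "RW_defect r s (par r i) q' (RW_gen i) x c = RW_defect r s (par r i) q (RW_gen i) x c"
      by (rule RW_defect_cong) (use cong in auto)
    with cong show ?case by simp
  next
    case (lmul q k x)
    then show ?case
      using i assms by (simp add: RW_defect_lmul(2)[OF RW_gen_parity] zeros)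
  qed (use i assms in \<open>simp_all add: RW_defect_add RW_defect_scale RW_parity_carrier RW_gen_carrier gc zeros\<close>)
  show ?thesis
    using assms(1)
  proof (induction rule: RW_hom_induct)
    case (cong p p' x)
    have "RW_defect r s p' q x b c = RW_defect r s p q x b c"
      by (rule RW_defect_cong) (use cong in auto)
    with cong show ?case by simp
  next
    case (lmul q' k x)
    then show ?case
      using assms by (simp add: RW_defect_lmul(1)[OF _ assms(2)] zeros)
  qed (use assms in \<open>simp_all add: RW_defect_add RW_defect_scale RW_parity_carrier RW_gen_carrier gb zeros\<close>)
qed

lemma jacobi_RW: "jacobi r s (RW r s :: ('f::field, 'f rw) lcs)"
proof -
  have "jac_a_bc r (RW r s) p a b c = jac_ab_c r s (RW r s) a b c + sg (p * q) (jac_b_ac r (RW r s) q a b c)"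
    if "a \<in> RW_parity r s p" "b \<in> RW_parity r s q" "c \<in> RW_carrier r s" for p q and a b c :: "'f rw"
  proof -
    have "jac_a_bc r (RW r s) p a b c = outer_lift r p (RW_bracket r s a) (RW_bracket r s b c)"
      "jac_b_ac r (RW r s) q a b c = inner_lift r q (RW_bracket r s b) (RW_bracket r s a c)"
      by (simp_all add: jac_a_bc_def jac_b_ac_def outer_lift_def inner_lift_def)
    then show ?thesis
      using RW_defect_eq_0[OF that] by (simp add: RW_defect_def jac_ab_c_RW diff_diff_eq)
  qed
  then show ?thesis unfolding jacobi_def by simp
qed

theorem lie_conformal_superalgebra_RW:
  "lie_conformal_superalgebra r s (RW r s :: ('f::{field, ring_char_0}, 'f rw) lcs)"
  unfolding lie_conformal_superalgebra_def
  by (intro conjI super_bimodule_RW bracket_bilinear_RW sesquilinear_RW skew_symmetric_RW jacobi_RW)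

section \<open>Supercommutative power series\<close>

lemma finite_submultisets: "finite {M. M \<subseteq># (P :: 'a multiset)}"
proof (induction P)
  case (add x P)
  have "{M. M \<subseteq># add_mset x P} \<subseteq> {M. M \<subseteq># P} \<union> add_mset x ` {M. M \<subseteq># P}"
  proof
    fix M assume "M \<in> {M. M \<subseteq># add_mset x P}"
    then have M: "M \<subseteq># add_mset x P" by simp
    show "M \<in> {M. M \<subseteq># P} \<union> add_mset x ` {M. M \<subseteq># P}"
    proof (cases "x \<in># M")
      case True
      then obtain M' where "M = add_mset x M'" by (metis insert_DiffM)
      with M show ?thesis by auto
    next
      case False
      then have "M \<subseteq># P" using M by (metis diff_single_trivial subset_eq_diff_conv add_mset_remove_trivial add_mset_add_single)
      then show ?thesis by simp
    qed
  qed
  with add show ?case by (meson finite_UnI finite_imageI finite_subset)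
qed simp

text \<open>The sign produced when an element of parity \<open>p\<close> crosses the series, applied
  to each monomial, so that inhomogeneous series are covered too.\<close>

definition twist_series :: "nat \<Rightarrow> nat \<Rightarrow> (mono \<Rightarrow> 'f) \<Rightarrow> mono \<Rightarrow> 'f::ab_group_add" where
  "twist_series r p \<phi> = (\<lambda>M. sg (p * mpar r M) (\<phi> M))"

definition series_mult :: "nat \<Rightarrow> nat \<Rightarrow> (mono \<Rightarrow> 'f) \<Rightarrow> (mono \<Rightarrow> 'f) \<Rightarrow> mono \<Rightarrow> 'f::field" where
  "series_mult r s \<phi> \<psi> = (\<lambda>P. if adm r s P
     then (\<Sum>M | M \<subseteq># P. sg (inv_cnt r M (P - M)) (\<phi> M * \<psi> (P - M))) else 0)"

lemma additive_twist_series: "additive_map (twist_series r p)"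
  by (simp add: additive_map_def twist_series_def sg_add plus_fun_def)

lemma twist_series_twist [simp]: "twist_series r p (twist_series r q \<phi>) = twist_series r (p + q) \<phi>"
  by (simp add: twist_series_def algebra_simps)

lemma twist_series_cong: "even (p + q) \<Longrightarrow> twist_series r p \<phi> = twist_series r q \<phi>"
  by (auto simp: twist_series_def fun_eq_iff intro!: sg_eqI)

lemma additive_ldery: "additive_map (ldery r s i)"
  by (auto simp: additive_map_def ldery_def fun_eq_iff sg_add plus_fun_apply algebra_simps)

lemma additive_rdery: "additive_map (rdery r s i)"
proof -
  have "rdery r s i \<phi> = ldery r s i (twist_series r (par r i) \<phi>)" for \<phi> :: "mono \<Rightarrow> 'a"
    by (simp add: rdery_def twist_series_def)
  then show ?thesis
    by (simp add: additive_map_def additive_mapD(1)[OF additive_ldery] additive_mapD(1)[OF additive_twist_series])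
qed

lemma rdery_eq: "rdery r s i \<phi> = ldery r s i (twist_series r (par r i) \<phi>)"
  by (simp add: rdery_def twist_series_def)

lemma ldery_twist_series: "ldery r s i (twist_series r p \<phi>) = sg (p * par r i) (twist_series r p (ldery r s i \<phi>))"
proof
  fix P
  show "ldery r s i (twist_series r p \<phi>) P = sg (p * par r i) (twist_series r p (ldery r s i \<phi>)) P"
    unfolding sg_apply
    by (auto simp: ldery_def twist_series_def sg_mult(2)[symmetric] algebra_simps intro!: sg_eqI)
qed

lemma supercommute_ldery: "supercommute r (ldery r s) (ldery r s)"
  unfolding supercommute_def
proof (intro allI ext)
  fix i j and \<phi> :: "mono \<Rightarrow> 'a" and P
  show "ldery r s i (ldery r s j \<phi>) P = sg (par r i * par r j) (ldery r s j (ldery r s i \<phi>)) P"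
  proof (cases "adm r s (add_mset i (add_mset j P))")
    case True
    have adm: "adm r s (add_mset j (add_mset i P))" "adm r s (add_mset i P)" "adm r s (add_mset j P)"
      using True by (metis add_mset_commute, metis adm_add_msetD add_mset_commute, metis adm_add_msetD)
    show ?thesis
    proof (cases "i = j")
      case True
      then have "even (par r i * par r j)" using \<open>adm r s (add_mset i (add_mset j P))\<close> by (auto simp: adm_add_mset_iff)
      then show ?thesis using True by (simp add: sg_def)
    next
      case False
      have 1: "ldery r s i (ldery r s j \<phi>) P = of_nat ((count P i + 1) * (count P j + 1)) *
          sg (inv_cnt r {#i#} P + inv_cnt r {#j#} P + inv_cnt r {#j#} {#i#}) (\<phi> (add_mset i (add_mset j P)))"
        using True adm False by (simp add: ldery_def inv_cnt_simps add_mset_commute sg_mult(2)[symmetric] ac_simps) (simp add: algebra_simps)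
      have 2: "ldery r s j (ldery r s i \<phi>) P = of_nat ((count P i + 1) * (count P j + 1)) *
          sg (inv_cnt r {#i#} P + inv_cnt r {#j#} P + inv_cnt r {#i#} {#j#}) (\<phi> (add_mset i (add_mset j P)))"
        using True adm False by (simp add: ldery_def inv_cnt_simps add_mset_commute sg_mult(2)[symmetric] ac_simps) (simp add: algebra_simps)
      show ?thesis
        unfolding sg_apply 1 2 sg_mult(2) sg_sg
        using even_inv_cnt_single[OF False, of r] by (auto intro!: sg_eqI arg_cong2[where f = "(*)"])
    qed
  next
    case False
    then have "\<not> adm r s (add_mset j (add_mset i P))" by (metis add_mset_commute)
    with False show ?thesis by (simp add: ldery_def sg_apply)
  qed
qed

lemma ldery_square: "r < i \<Longrightarrow> ldery r s i (ldery r s i \<phi>) = 0"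
  by (auto simp: ldery_def fun_eq_iff adm_add_mset_iff zero_fun_apply)

text \<open>No sign appears: exchanging two left derivatives gives the product of the parities, and
  the twist inside the right derivative gives it a second time.\<close>

lemma rdery_ldery: "rdery r s i (ldery r s j \<phi>) = ldery r s j (rdery r s i \<phi>)"
proof -
  have "rdery r s i (ldery r s j \<phi>) = sg (par r i * par r j) (ldery r s i (ldery r s j (twist_series r (par r i) \<phi>)))"
    unfolding rdery_eq ldery_twist_series[of r s j "par r i" \<phi>] additive_mapD(4)[OF additive_ldery]
    by (simp add: sg_def)
  also have "\<dots> = ldery r s j (rdery r s i \<phi>)"
    unfolding rdery_eq supercommuteD[OF supercommute_ldery, of r s i j]
    by (simp add: sg_def)
  finally show ?thesis .
qed

lemma super_family_rdery: "super_family r (rdery r s)"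
proof -
  have tw: "rdery r s i (twist_series r p \<phi>) = sg (p * par r i) (twist_series r p (rdery r s i \<phi>))" for i p and \<phi> :: "mono \<Rightarrow> 'a"
    unfolding rdery_eq by (metis ldery_twist_series twist_series_twist add.commute)
  have comm: "rdery r s i (rdery r s j \<phi>) = sg (par r i * par r j) (rdery r s j (rdery r s i \<phi>))" for i j and \<phi> :: "mono \<Rightarrow> 'a"
  proof -
    have "rdery r s i (rdery r s j \<phi>) = ldery r s j (rdery r s i (twist_series r (par r j) \<phi>))"
      by (simp only: rdery_eq[of r s j] rdery_ldery)
    also have "\<dots> = sg (par r i * par r j) (rdery r s j (rdery r s i \<phi>))"
      unfolding tw rdery_eq[of r s j] additive_mapD(4)[OF additive_ldery] by (simp add: mult.commute)
    finally show ?thesis .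
  qed
  have "supercommute r (rdery r s) (rdery r s :: nat \<Rightarrow> (mono \<Rightarrow> 'a) \<Rightarrow> _)"
    unfolding supercommute_def using comm by blast
  moreover have "rdery r s i (rdery r s i \<phi>) = 0" if "r < i" for i and \<phi> :: "mono \<Rightarrow> 'a"
    unfolding rdery_eq ldery_twist_series[of r s i _ "ldery r s i _"] ldery_square[OF that]
      additive_mapD(2)[OF additive_twist_series] sg_zero ..
  ultimately show ?thesis
    by (simp add: super_family_def additive_rdery)
qed

lemma rderys_insert:
  "rderys r s J (rdery r s i \<phi>) = (if r < i \<and> i \<in># J then 0 else sg (inv_cnt r {#i#} J) (rderys r s (add_mset i J) \<phi>))"
  using fold_insort[OF super_family_rdery[of r s], where xs = "sorted_list_of_multiset J" and i = i and x = \<phi>]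
  by (simp add: rderys_def)

lemma additive_rderys: "additive_map (rderys r s J)"
  unfolding rderys_def[abs_def] by (rule fold_additive[OF additive_rdery])

text \<open>Each derivative shifts exponents and multiplies by a scalar that depends on the exponent
  but not on \<open>\<phi>\<close>. Evaluating at the function constantly 1 names this scalar
  without computing it. That function is nonzero off the admissible multisets too, but derivatives
  only read admissible exponents.\<close>

lemma rderys_apply:
  fixes \<phi> :: "mono \<Rightarrow> 'f::field"
  shows "rderys r s J \<phi> P = rderys r s J (\<lambda>_. 1) P * \<phi> (P + J)"
proof -
  have "fold (rdery r s) xs \<phi> P = fold (rdery r s) xs (\<lambda>_. 1) P * \<phi> (P + mset xs)" for xs
  proof (induction xs arbitrary: \<phi>)
    case (Cons x xs)
    have *: "rdery r s x \<phi> Q = rdery r s x (\<lambda>_. 1) Q * \<phi> (add_mset x Q)" for \<phi> Q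
      by (simp add: rdery_def ldery_def sg_def)
    have "fold (rdery r s) (x # xs) \<phi> P = fold (rdery r s) xs (\<lambda>_. 1) P * rdery r s x \<phi> (P + mset xs)"
      using Cons[of "rdery r s x \<phi>"] by simp
    also have "\<dots> = fold (rdery r s) xs (\<lambda>_. 1) P * rdery r s x (\<lambda>_. 1) (P + mset xs) * \<phi> (P + mset (x # xs))"
      by (subst *) simp
    also have "fold (rdery r s) xs (\<lambda>_. 1 :: 'f) P * rdery r s x (\<lambda>_. 1) (P + mset xs) = fold (rdery r s) (x # xs) (\<lambda>_. 1) P"
      using Cons[of "rdery r s x (\<lambda>_. 1)"] by (simp only: fold.simps comp_def)
    finally show ?case .
  qed simp
  from this[of "sorted_list_of_multiset J"] show ?thesis by (simp add: rderys_def)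
qed

lemma rderys_ldery: "rderys r s J (ldery r s i \<phi>) = ldery r s i (rderys r s J \<phi>)"
proof -
  have "fold (rdery r s) xs (ldery r s i \<phi>) = ldery r s i (fold (rdery r s) xs \<phi>)" for xs
    by (induction xs arbitrary: \<phi>) (auto simp: rdery_ldery)
  then show ?thesis by (simp add: rderys_def)
qed

lemma rderys_twist_series: "rderys r s J (twist_series r p \<phi>) = sg (p * mpar r J) (twist_series r p (rderys r s J \<phi>))"
proof
  fix P
  show "rderys r s J (twist_series r p \<phi>) P = sg (p * mpar r J) (twist_series r p (rderys r s J \<phi>)) P"
    unfolding sg_apply twist_series_def
    by (subst (1 2) rderys_apply) (auto simp: sg_mult(2)[symmetric] algebra_simps)
qed

lemma series_mult_add:
  "series_mult r s (\<phi> + \<phi>') \<psi> = series_mult r s \<phi> \<psi> + series_mult r s \<phi>' \<psi>"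
  "series_mult r s \<phi> (\<psi> + \<psi>') = series_mult r s \<phi> \<psi> + series_mult r s \<phi> \<psi>'"
  by (auto simp: series_mult_def fun_eq_iff plus_fun_apply algebra_simps sg_add sum.distrib)

lemma series_mult_sg:
  "series_mult r s (sg n \<phi>) \<psi> = sg n (series_mult r s \<phi> \<psi>)"
  "series_mult r s \<phi> (sg n \<psi>) = sg n (series_mult r s \<phi> \<psi>)"
  using additive_mapD(4)[of "\<lambda>\<phi>. series_mult r s \<phi> \<psi>" n \<phi>] additive_mapD(4)[of "series_mult r s \<phi>" n \<psi>]
  by (simp_all add: additive_map_def series_mult_add)

text \<open>The weight \<open>count M i\<close> kills submultisets without \<open>i\<close>, and the
  complementary weight kills those that use all copies of \<open>i\<close>. These are the two halves
  of the product rule.\<close>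

lemma sum_submultisets_add_mset:
  fixes f :: "'a multiset \<Rightarrow> 'b::field_char_0"
  shows "(\<Sum>M | M \<subseteq># add_mset i P. of_nat (count M i) * f M) = (\<Sum>M | M \<subseteq># P. of_nat (count M i + 1) * f (add_mset i M))"
    "(\<Sum>M | M \<subseteq># add_mset i P. of_nat (count (add_mset i P - M) i) * f M) = (\<Sum>M | M \<subseteq># P. of_nat (count (P - M) i + 1) * f M)"
proof -
  have "(\<Sum>M | M \<subseteq># add_mset i P. of_nat (count M i) * f M) = (\<Sum>M \<in> add_mset i ` {M. M \<subseteq># P}. of_nat (count M i) * f M)"
  proof (rule sum.mono_neutral_right)
    show "\<forall>M\<in>{M. M \<subseteq># add_mset i P} - add_mset i ` {M. M \<subseteq># P}. of_nat (count M i) * f M = 0"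
    proof
      fix M assume M: "M \<in> {M. M \<subseteq># add_mset i P} - add_mset i ` {M. M \<subseteq># P}"
      have "i \<notin># M"
      proof
        assume "i \<in># M"
        then obtain M' where "M = add_mset i M'" by (metis insert_DiffM)
        with M show False by auto
      qed
      then show "of_nat (count M i) * f M = 0" by (simp add: not_in_iff)
    qed
  qed (auto simp: finite_submultisets)
  then show "(\<Sum>M | M \<subseteq># add_mset i P. of_nat (count M i) * f M) = (\<Sum>M | M \<subseteq># P. of_nat (count M i + 1) * f (add_mset i M))"
    by (subst (asm) sum.reindex) (auto simp: inj_on_def)
  have "(\<Sum>M | M \<subseteq># add_mset i P. of_nat (count (add_mset i P - M) i) * f M) = (\<Sum>M | M \<subseteq># P. of_nat (count (add_mset i P - M) i) * f M)"
  proof (rule sum.mono_neutral_right)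
    show "\<forall>M\<in>{M. M \<subseteq># add_mset i P} - {M. M \<subseteq># P}. of_nat (count (add_mset i P - M) i) * f M = 0"
    proof
      fix M assume M: "M \<in> {M. M \<subseteq># add_mset i P} - {M. M \<subseteq># P}"
      then obtain j where "count M j > count P j" by (auto simp: subseteq_mset_def not_le)
      moreover have le: "count M j \<le> count (add_mset i P) j" for j using M by (intro mset_subset_eq_count) simp
      ultimately have "j = i" by (metis count_add_mset not_less)
      then have "count M i \<ge> Suc (count P i)" using \<open>count M j > count P j\<close> by simp
      then show "of_nat (count (add_mset i P - M) i) * f M = 0" by simp
    qed
  qed (auto simp: finite_submultisets intro: subset_mset.order_trans)
  also have "\<dots> = (\<Sum>M | M \<subseteq># P. of_nat (count (P - M) i + 1) * f M)"
    by (rule sum.cong) (auto simp: Suc_diff_le mset_subset_eq_count)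
  finally show "(\<Sum>M | M \<subseteq># add_mset i P. of_nat (count (add_mset i P - M) i) * f M) = (\<Sum>M | M \<subseteq># P. of_nat (count (P - M) i + 1) * f M)" .
qed

lemma ldery_series_mult:
  fixes \<phi> \<psi> :: "mono \<Rightarrow> 'f::field_char_0"
  shows "ldery r s i (series_mult r s \<phi> \<psi>) =
    series_mult r s (ldery r s i \<phi>) \<psi> + series_mult r s (twist_series r (par r i) \<phi>) (ldery r s i \<psi>)"
proof
  fix P
  define A where "A M = sg (inv_cnt r M (P - M)) (ldery r s i \<phi> M * \<psi> (P - M))" for M
  define B where "B M = sg (inv_cnt r M (P - M)) (twist_series r (par r i) \<phi> M * ldery r s i \<psi> (P - M))" for M
  have rhs: "(series_mult r s (ldery r s i \<phi>) \<psi> + series_mult r s (twist_series r (par r i) \<phi>) (ldery r s i \<psi>)) P =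
    (if adm r s P then (\<Sum>M | M \<subseteq># P. A M) + (\<Sum>M | M \<subseteq># P. B M) else 0)"
    by (simp add: plus_fun_apply series_mult_def A_def B_def)
  show "ldery r s i (series_mult r s \<phi> \<psi>) P =
      (series_mult r s (ldery r s i \<phi>) \<psi> + series_mult r s (twist_series r (par r i) \<phi>) (ldery r s i \<psi>)) P"
  proof (cases "adm r s (add_mset i P)")
    case True
    define Y where "Y M = sg (inv_cnt r {#i#} P + inv_cnt r M (add_mset i P - M)) (\<phi> M * \<psi> (add_mset i P - M))" for M
    have cnt: "count (add_mset i P) i = count M i + count (add_mset i P - M) i" if "M \<subseteq># add_mset i P" for M
      using mset_subset_eq_count[OF that, of i] by (simp only: count_diff)
    have "ldery r s i (series_mult r s \<phi> \<psi>) P = (\<Sum>M | M \<subseteq># add_mset i P. of_nat (count (add_mset i P) i) * Y M)"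
      using True by (simp add: ldery_def series_mult_def Y_def sg_sum sum_distrib_left add.commute)
    \<comment> \<open>The exponent of \<open>i\<close> in a product is the sum of its exponents in
      the two factors; this splits the derivative into the two Leibniz terms.\<close>
    also have "\<dots> = (\<Sum>M | M \<subseteq># add_mset i P. of_nat (count M i) * Y M) + (\<Sum>M | M \<subseteq># add_mset i P. of_nat (count (add_mset i P - M) i) * Y M)"
      unfolding sum.distrib[symmetric]
      by (rule sum.cong) (use cnt in \<open>auto simp: distrib_right[symmetric] of_nat_add[symmetric] simp del: of_nat_add count_add_mset\<close>)
    also have "\<dots> = (\<Sum>M | M \<subseteq># P. of_nat (count M i + 1) * Y (add_mset i M)) + (\<Sum>M | M \<subseteq># P. of_nat (count (P - M) i + 1) * Y M)"
      unfolding sum_submultisets_add_mset ..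
    also have "(\<Sum>M | M \<subseteq># P. of_nat (count M i + 1) * Y (add_mset i M)) = (\<Sum>M | M \<subseteq># P. A M)"
    proof (rule sum.cong)
      fix M assume "M \<in> {M. M \<subseteq># P}"
      then obtain N where P: "P = M + N" by (auto simp: subset_mset.le_iff_add)
      have adm: "adm r s (add_mset i M)" using True adm_subset[of r s "add_mset i P" "add_mset i M"] by (auto simp: P)
      show "of_nat (count M i + 1) * Y (add_mset i M) = A M"
        using adm by (auto simp: P Y_def A_def ldery_def inv_cnt_simps sg_mult(1)[symmetric] sg_mult(2)[symmetric] mult.assoc
            intro!: sg_eqI simp del: of_nat_add of_nat_Suc)
    qed simp
    also have "(\<Sum>M | M \<subseteq># P. of_nat (count (P - M) i + 1) * Y M) = (\<Sum>M | M \<subseteq># P. B M)"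
    proof (rule sum.cong)
      fix M assume "M \<in> {M. M \<subseteq># P}"
      then obtain N where P: "P = M + N" by (auto simp: subset_mset.le_iff_add)
      have adm: "adm r s (add_mset i N)" "adm r s (add_mset i M)"
        using True adm_subset[of r s "add_mset i P"] by (auto simp: P)
      have "even (inv_cnt r M {#i#}) \<longleftrightarrow> (even (inv_cnt r {#i#} M) \<longleftrightarrow> even (par r i * mpar r M))"
        using even_inv_cnt_swap[of r s "{#i#}" M] adm(2) by simp
      then show "of_nat (count (P - M) i + 1) * Y M = B M"
        using adm by (auto simp: P Y_def B_def ldery_def twist_series_def inv_cnt_simps
            sg_mult(1)[symmetric] sg_mult(2)[symmetric] mult.left_commute intro!: sg_eqI simp del: of_nat_add of_nat_Suc)
    qed simp
    finally show ?thesis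
      unfolding rhs using adm_add_msetD[OF True] by simp
  next
    case False
    show ?thesis
    proof (cases "adm r s P \<and> i \<in> {1..r+s}")
      case True
      \<comment> \<open>The left side is 0, but single terms on the right need not be. Since
        \<open>i\<close> is odd and already in \<open>P\<close>, the terms pair off: for
        \<open>P\<close> made of \<open>i\<close>, \<open>M\<close> and \<open>N\<close>, one term
        of each sum is the product of the coefficients at \<open>add_mset i M\<close> and
        \<open>add_mset i N\<close>, and the signs are opposite.\<close>
      then have i: "r < i" "i \<in># P" using False by (auto simp: adm_add_mset_iff)
      then obtain P' where P: "P = add_mset i P'" by (metis insert_DiffM)
      have iP': "i \<notin># P'" using True i by (auto simp: P adm_add_mset_iff)
      have sub: "i \<notin># M" if "M \<subseteq># P'" for M using that iP' by (meson mset_subset_eqD)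
      have "(\<Sum>M | M \<subseteq># P. A M) = (\<Sum>M | M \<subseteq># P'. A M)"
      proof (rule sum.mono_neutral_right)
        show "\<forall>M\<in>{M. M \<subseteq># P} - {M. M \<subseteq># P'}. A M = 0"
        proof
          fix M assume M: "M \<in> {M. M \<subseteq># P} - {M. M \<subseteq># P'}"
          then have "i \<in># M"
            by (metis (no_types, lifting) DiffE P mem_Collect_eq subset_eq_diff_conv add_mset_add_single diff_single_trivial)
          then have "\<not> adm r s (add_mset i M)" using i by (auto simp: adm_add_mset_iff)
          then show "A M = 0" by (simp add: A_def ldery_def)
        qed
      qed (auto simp: finite_submultisets P intro: subset_mset.order_trans)
      moreover have "(\<Sum>M | M \<subseteq># P. B M) = (\<Sum>M\<in>add_mset i ` {M. M \<subseteq># P'}. B M)"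
      proof (rule sum.mono_neutral_right)
        show "\<forall>M\<in>{M. M \<subseteq># P} - add_mset i ` {M. M \<subseteq># P'}. B M = 0"
        proof
          fix M assume M: "M \<in> {M. M \<subseteq># P} - add_mset i ` {M. M \<subseteq># P'}"
          have "i \<notin># M"
          proof
            assume "i \<in># M"
            then obtain M' where "M = add_mset i M'" by (metis insert_DiffM)
            with M P show False by auto
          qed
          then have "i \<in># P - M" using i by (simp add: in_diff_count not_in_iff)
          then have "\<not> adm r s (add_mset i (P - M))" using i by (auto simp: adm_add_mset_iff)
          then show "B M = 0" by (simp add: B_def ldery_def)
        qed
      qed (auto simp: finite_submultisets P)
      then have "(\<Sum>M | M \<subseteq># P. B M) = (\<Sum>M | M \<subseteq># P'. B (add_mset i M))"
        by (subst (asm) sum.reindex) (auto simp: inj_on_def)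
      moreover have "A M + B (add_mset i M) = 0" if M: "M \<subseteq># P'" for M
      proof -
        obtain N where P': "P' = M + N" using M by (auto simp: subset_mset.le_iff_add)
        have adm: "adm r s (add_mset i M)" "adm r s (add_mset i N)"
          using True adm_subset[of r s P] by (auto simp: P P')
        have cnt: "count M i = 0" "count N i = 0" using iP' by (auto simp: P' not_in_iff)
        have "even (inv_cnt r M {#i#}) \<longleftrightarrow> (even (inv_cnt r {#i#} M) \<longleftrightarrow> even (par r i * mpar r M))"
          using even_inv_cnt_swap[of r s "{#i#}" M] adm(1) by simp
        moreover have "A M = sg (inv_cnt r M {#i#} + inv_cnt r M N + inv_cnt r {#i#} M) (\<phi> (add_mset i M) * \<psi> (add_mset i N))"
          using adm cnt by (simp add: A_def P P' ldery_def inv_cnt_simps sg_mult(1)[symmetric])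
        moreover have "B (add_mset i M) = sg (inv_cnt r {#i#} N + inv_cnt r M N + par r i * (par r i + mpar r M) + inv_cnt r {#i#} N)
            (\<phi> (add_mset i M) * \<psi> (add_mset i N))"
          using adm cnt by (simp add: B_def P P' ldery_def twist_series_def inv_cnt_simps sg_mult(1)[symmetric] sg_mult(2)[symmetric] ac_simps)
        ultimately show ?thesis using i by (auto simp: sg_def)
      qed
      then have "(\<Sum>M | M \<subseteq># P'. A M + B (add_mset i M)) = 0" by (intro sum.neutral) simp
      ultimately show ?thesis
        unfolding rhs using False by (simp add: ldery_def sum.distrib)
    next
      case noti: False
      have "\<not> adm r s (add_mset i M)" if "adm r s P" for M using noti that by (auto simp: adm_add_mset_iff)
      then show ?thesis
        unfolding rhs using False noti by (auto simp: A_def B_def ldery_def)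
    qed
  qed
qed

lemma series_mult_unsupported: "\<not> adm r s P \<Longrightarrow> series_mult r s \<phi> \<psi> P = 0"
  by (simp add: series_mult_def)

lemma ldery_unsupported: "\<not> adm r s P \<Longrightarrow> ldery r s i \<phi> P = 0"
  by (auto simp: ldery_def dest: adm_add_msetD)

section \<open>The annihilation algebra of a Lie conformal superalgebra\<close>

text \<open>The quotient construction is carried out for any \<open>R\<close> with these properties.
  Characteristic 0 makes the factors \<open>f(J)\<close> invertible.\<close>

locale conformal_superalgebra =
  fixes r s :: nat and R :: "('f::field_char_0, 'v::ab_group_add) lcs"
  assumes bimodule: "super_bimodule r s R"
    and bilinear: "bracket_bilinear r s R"
    and sesqui: "sesquilinear r s R"
begin

lemma space: "super_space R"
  using bimodule by (simp add: super_bimodule_def)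

sublocale V: vector_space "scl R"
  using space by (simp add: super_space_def)

lemma subspace_hom: "V.subspace (hom_part R p)"
  using space by (simp add: super_space_def hom_part_def)

lemmas hom_zero = V.subspace_0[OF subspace_hom]
  and hom_add = V.subspace_add[OF subspace_hom]
  and hom_scl = V.subspace_scale[OF subspace_hom]
  and hom_minus = V.subspace_neg[OF subspace_hom]
  and hom_sum = V.subspace_sum[OF subspace_hom]

lemma hom_sg: "x \<in> hom_part R p \<Longrightarrow> sg n x \<in> hom_part R p"
  by (simp add: sg_def hom_minus)

lemma hom_cong: "even (p + q) \<Longrightarrow> hom_part R p = hom_part R q"
  by (simp add: hom_part_def)

lemma hom_carr: "x \<in> hom_part R p \<Longrightarrow> x \<in> carr R"
  using hom_zero[of 0] hom_zero[of 1] unfolding carr_def hom_part_def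
  by (auto split: if_splits intro: exI[of _ x] exI[of _ 0])

lemma carr_split:
  assumes "x \<in> carr R"
  obtains y z where "y \<in> hom_part R 0" "z \<in> hom_part R 1" "x = y + z"
  using assms by (auto simp: carr_def hom_part_def)

lemma subspace_carr: "V.subspace (carr R)"
proof (rule V.subspaceI)
  show "0 \<in> carr R" using hom_carr[OF hom_zero] .
  fix x y assume x: "x \<in> carr R" and y: "y \<in> carr R"
  obtain u v u' v' where *: "u \<in> hom_part R 0" "v \<in> hom_part R 1" "x = u + v" "u' \<in> hom_part R 0" "v' \<in> hom_part R 1" "y = u' + v'"
    using x y by (metis carr_split)
  then have "u + u' \<in> hom_part R 0" "v + v' \<in> hom_part R 1" "x + y = (u + u') + (v + v')"
    by (auto intro: hom_add)
  then show "x + y \<in> carr R" unfolding carr_def hom_part_def by auto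
next
  fix c x assume "x \<in> carr R"
  then obtain u v where "u \<in> hom_part R 0" "v \<in> hom_part R 1" "x = u + v" by (rule carr_split)
  then have "scl R c u \<in> hom_part R 0" "scl R c v \<in> hom_part R 1" "scl R c x = scl R c u + scl R c v"
    by (auto intro: hom_scl simp: V.scale_right_distrib)
  then show "scl R c x \<in> carr R" unfolding carr_def hom_part_def by auto
qed

lemmas carr_zero = V.subspace_0[OF subspace_carr]
  and carr_add = V.subspace_add[OF subspace_carr]
  and carr_scl = V.subspace_scale[OF subspace_carr]
  and carr_minus = V.subspace_neg[OF subspace_carr]
  and carr_sum = V.subspace_sum[OF subspace_carr]

lemma carr_sg: "x \<in> carr R \<Longrightarrow> sg n x \<in> carr R"
  by (simp add: sg_def carr_minus)

lemma scl_sg: "scl R c (sg n x) = sg n (scl R c x)" "scl R (sg n c) x = sg n (scl R c x)"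
  by (simp_all add: sg_def V.scale_minus_right V.scale_minus_left)

lemma hom_disjoint: "x \<in> hom_part R p \<Longrightarrow> x \<in> hom_part R q \<Longrightarrow> odd (p + q) \<Longrightarrow> x = 0"
  using space by (auto simp: super_space_def hom_part_def split: if_splits)

text \<open>The even and the odd part meet in 0, so the components of an element are unique and the
  description in \<open>twist\<close> denotes.\<close>

lemma twist_split:
  assumes "y \<in> hom_part R 0" "z \<in> hom_part R 1"
  shows "twist R n (y + z) = y + sg n z"
proof (cases "even n")
  case False
  have "(THE w. \<exists>u\<in>ev_part R. \<exists>v\<in>od_part R. y + z = u + v \<and> w = u - v) = y - z"
  proof (rule the_equality)
    show "\<exists>u\<in>ev_part R. \<exists>v\<in>od_part R. y + z = u + v \<and> y - z = u - v"
      using assms by (auto simp: hom_part_def)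
    fix w assume "\<exists>u\<in>ev_part R. \<exists>v\<in>od_part R. y + z = u + v \<and> w = u - v"
    then obtain u v where uv: "u \<in> hom_part R 0" "v \<in> hom_part R 1" "y + z = u + v" "w = u - v"
      by (auto simp: hom_part_def)
    have "y - u = v - z" using uv(3) by (simp add: algebra_simps)
    moreover have "y - u \<in> hom_part R 0" "v - z \<in> hom_part R 1"
      using assms uv by (auto intro: V.subspace_diff[OF subspace_hom])
    ultimately have "y - u = 0" using hom_disjoint[of "y - u" 0 1] by simp
    with uv show "w = y - z" by auto
  qed
  with False show ?thesis by (simp add: twist_def sg_def)
qed (simp add: twist_def sg_def)

lemma twist_hom: "x \<in> hom_part R p \<Longrightarrow> twist R n x = sg (n * p) x"
  using twist_split[of x 0 n] twist_split[of 0 x n] hom_zero[of 0] hom_zero[of 1] hom_cong[of p 0] hom_cong[of p 1]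
  by (cases "even p") (auto simp: sg_def)

lemma twist_add:
  assumes "x \<in> carr R" "y \<in> carr R"
  shows "twist R n (x + y) = twist R n x + twist R n y"
proof -
  obtain u v u' v' where *: "u \<in> hom_part R 0" "v \<in> hom_part R 1" "x = u + v" "u' \<in> hom_part R 0" "v' \<in> hom_part R 1" "y = u' + v'"
    using assms by (metis carr_split)
  then have "twist R n ((u + u') + (v + v')) = (u + u') + sg n (v + v')"
    by (intro twist_split hom_add)
  with * show ?thesis by (simp add: twist_split sg_add algebra_simps)
qed

lemma twist_scl:
  assumes "x \<in> carr R"
  shows "twist R n (scl R c x) = scl R c (twist R n x)"
proof -
  obtain u v where *: "u \<in> hom_part R 0" "v \<in> hom_part R 1" "x = u + v"
    using assms by (metis carr_split)
  then have "twist R n (scl R c u + scl R c v) = scl R c u + sg n (scl R c v)"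
    by (intro twist_split hom_scl)
  with * show ?thesis by (simp add: twist_split V.scale_right_distrib scl_sg)
qed

lemma twist_carr: "x \<in> carr R \<Longrightarrow> twist R n x \<in> carr R"
  by (erule carr_split) (auto simp: twist_split intro: carr_add hom_carr hom_sg)

lemma twist_zero [simp]: "twist R n 0 = 0"
  using twist_hom[OF hom_zero] by simp

lemma twist_sum: "(\<And>i. i \<in> A \<Longrightarrow> f i \<in> carr R) \<Longrightarrow> twist R n (\<Sum>i\<in>A. f i) = (\<Sum>i\<in>A. twist R n (f i))"
  by (induction A rule: infinite_finite_induct) (auto simp: twist_add carr_sum)

lemma twist_sg: "x \<in> carr R \<Longrightarrow> twist R n (sg m x) = sg m (twist R n x)"
  using twist_scl[of x n "- 1"] by (auto simp: sg_def)

lemma dleft_add: "i \<in> {1..r+s} \<Longrightarrow> x \<in> carr R \<Longrightarrow> y \<in> carr R \<Longrightarrow> dleft R i (x + y) = dleft R i x + dleft R i y"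
  and dleft_scl: "i \<in> {1..r+s} \<Longrightarrow> x \<in> carr R \<Longrightarrow> dleft R i (scl R c x) = scl R c (dleft R i x)"
  using bimodule by (auto simp: super_bimodule_def linear_on_set_def)

lemma dleft_hom: "i \<in> {1..r+s} \<Longrightarrow> x \<in> hom_part R p \<Longrightarrow> dleft R i x \<in> hom_part R (p + par r i)"
  and dright_hom_eq: "i \<in> {1..r+s} \<Longrightarrow> x \<in> hom_part R p \<Longrightarrow> dright R i x = sg (par r i * p) (dleft R i x)"
  using bimodule unfolding super_bimodule_def by blast+

lemma dleft_zero [simp]: "i \<in> {1..r+s} \<Longrightarrow> dleft R i 0 = 0"
  using dleft_scl[of i 0 0] carr_zero by simp

lemma dleft_carr: "i \<in> {1..r+s} \<Longrightarrow> x \<in> carr R \<Longrightarrow> dleft R i x \<in> carr R"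
proof (elim carr_split)
  fix y z assume "i \<in> {1..r+s}" and yz: "y \<in> hom_part R 0" "z \<in> hom_part R 1" "x = y + z"
  then have "dleft R i y \<in> carr R" "dleft R i z \<in> carr R" using dleft_hom hom_carr by blast+
  then show "dleft R i x \<in> carr R" using yz \<open>i \<in> _\<close> by (simp add: dleft_add hom_carr carr_add)
qed

lemma bracket_add_left: "a \<in> carr R \<Longrightarrow> a' \<in> carr R \<Longrightarrow> b \<in> carr R \<Longrightarrow> lbr R (a + a') b = lbr R a b + lbr R a' b"
  and bracket_add_right: "a \<in> carr R \<Longrightarrow> a' \<in> carr R \<Longrightarrow> b \<in> carr R \<Longrightarrow> lbr R b (a + a') = lbr R b a + lbr R b a'"
  and bracket_scl_left: "a \<in> carr R \<Longrightarrow> b \<in> carr R \<Longrightarrow> lbr R (scl R c a) b = fscale (scl R) c (lbr R a b)"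
  and bracket_scl_right: "a \<in> carr R \<Longrightarrow> b \<in> carr R \<Longrightarrow> lbr R a (scl R c b) = fscale (scl R) c (lbr R a b)"
  and bracket_finite: "a \<in> carr R \<Longrightarrow> b \<in> carr R \<Longrightarrow> finite {J. lbr R a b J \<noteq> 0}"
  and bracket_unsupported: "a \<in> carr R \<Longrightarrow> b \<in> carr R \<Longrightarrow> \<not> adm r s J \<Longrightarrow> lbr R a b J = 0"
  and bracket_carr: "a \<in> carr R \<Longrightarrow> b \<in> carr R \<Longrightarrow> lbr R a b J \<in> carr R"
  using bilinear by (auto simp: bracket_bilinear_def linear_on_set_def polys_def)

lemma bracket_hom: "a \<in> hom_part R p \<Longrightarrow> b \<in> hom_part R q \<Longrightarrow> lbr R a b J \<in> hom_part R (p + q + mpar r J)"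
  using bilinear unfolding bracket_bilinear_def by blast

lemma bracket_zero: "b \<in> carr R \<Longrightarrow> lbr R 0 b = 0" "b \<in> carr R \<Longrightarrow> lbr R b 0 = 0"
  using bracket_scl_left[of 0 b 0] bracket_scl_right[of b 0 0] carr_zero by (auto simp: fscale_def fun_eq_iff zero_fun_apply)

lemma bracket_sg: "a \<in> carr R \<Longrightarrow> b \<in> carr R \<Longrightarrow> lbr R (sg n a) b = sg n (lbr R a b)"
    "a \<in> carr R \<Longrightarrow> b \<in> carr R \<Longrightarrow> lbr R a (sg n b) = sg n (lbr R a b)"
  using bracket_scl_left[of a b "- 1"] bracket_scl_right[of a b "- 1"]
  by (auto simp: sg_def fscale_def fun_eq_iff uminus_apply)

lemma bracket_sum_left: "(\<And>i. i \<in> A \<Longrightarrow> f i \<in> carr R) \<Longrightarrow> b \<in> carr R \<Longrightarrow> lbr R (\<Sum>i\<in>A. f i) b = (\<Sum>i\<in>A. lbr R (f i) b)"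
  by (induction A rule: infinite_finite_induct) (auto simp: bracket_zero bracket_add_left carr_sum)

lemma bracket_sum_right: "(\<And>i. i \<in> A \<Longrightarrow> f i \<in> carr R) \<Longrightarrow> b \<in> carr R \<Longrightarrow> lbr R b (\<Sum>i\<in>A. f i) = (\<Sum>i\<in>A. lbr R b (f i))"
  by (induction A rule: infinite_finite_induct) (auto simp: bracket_zero bracket_add_right carr_sum)

lemma bracket_dleft: "i \<in> {1..r+s} \<Longrightarrow> a \<in> carr R \<Longrightarrow> b \<in> carr R \<Longrightarrow> lbr R (dleft R i a) b = - lmul r s i (lbr R a b)"
  using sesqui unfolding sesquilinear_def by blast

lemma bracket_dright: "i \<in> {1..r+s} \<Longrightarrow> a \<in> hom_part R p \<Longrightarrow> b \<in> hom_part R q \<Longrightarrow>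
    lbr R a (dright R i b) = (\<lambda>K. dright R i (lbr R a b K)) + sg (par r i * (p + q)) (lmul r s i (lbr R a b))"
  using sesqui unfolding sesquilinear_def by blast

section \<open>Finite sums of vectors times power series\<close>

definition tens :: "'v \<Rightarrow> (mono \<Rightarrow> 'f) \<Rightarrow> mono \<Rightarrow> 'v" where
  "tens b \<phi> = (\<lambda>M. scl R (\<phi> M) b)"

definition supported :: "(mono \<Rightarrow> 'f) \<Rightarrow> bool" where
  "supported \<phi> \<longleftrightarrow> (\<forall>M. \<not> adm r s M \<longrightarrow> \<phi> M = 0)"

lemma tens_add: "tens (b + b') \<phi> = tens b \<phi> + tens b' \<phi>" "tens b (\<phi> + \<phi>') = tens b \<phi> + tens b \<phi>'"
  by (simp_all add: tens_def fun_eq_iff plus_fun_apply V.scale_right_distrib V.scale_left_distrib)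

lemma tens_sg: "tens (sg n b) \<phi> = sg n (tens b \<phi>)" "tens b (sg n \<phi>) = sg n (tens b \<phi>)"
  by (simp_all add: tens_def fun_eq_iff sg_apply scl_sg)

lemma tens_zero [simp]: "tens 0 \<phi> = 0" "tens b 0 = 0"
  by (simp_all add: tens_def fun_eq_iff zero_fun_apply)

lemma tildeD:
  assumes "F \<in> tilde r s R"
  shows "F M \<in> carr R" "\<not> adm r s M \<Longrightarrow> F M = 0"
  using assms by (auto simp: tilde_def)

lemma tens_tilde: "b \<in> carr R \<Longrightarrow> supported \<phi> \<Longrightarrow> tens b \<phi> \<in> tilde r s R"
  by (auto simp: tilde_def tens_def supported_def intro: carr_scl V.span_scale V.span_base exI[of _ "{b}"])

lemma zero_tilde [simp]: "0 \<in> tilde r s R"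
  using tens_tilde[OF carr_zero, of "0"] by (simp add: supported_def zero_fun_apply)

lemma tilde_add:
  assumes "F \<in> tilde r s R" "G \<in> tilde r s R"
  shows "F + G \<in> tilde r s R"
proof -
  obtain B B' where *: "finite B" "B \<subseteq> carr R" "range F \<subseteq> V.span B" "finite B'" "B' \<subseteq> carr R" "range G \<subseteq> V.span B'"
    using assms by (auto simp: tilde_def)
  have "range (F + G) \<subseteq> V.span (B \<union> B')"
    using * V.span_mono[of B "B \<union> B'"] V.span_mono[of B' "B \<union> B'"] by (auto simp: plus_fun_apply intro!: V.span_add)
  then have "\<exists>B. finite B \<and> B \<subseteq> carr R \<and> range (F + G) \<subseteq> V.span B"
    using * by (intro exI[of _ "B \<union> B'"]) auto
  then show ?thesis using assms by (auto simp: tilde_def plus_fun_apply carr_add)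
qed

lemma tilde_scale: "F \<in> tilde r s R \<Longrightarrow> fscale (scl R) c F \<in> tilde r s R"
  by (auto simp: tilde_def fscale_def carr_scl V.span_scale image_subset_iff)

lemma fscale_minus1: "fscale (scl R) (- 1) F = - F"
  by (simp add: fscale_def fun_eq_iff uminus_apply)

lemma tilde_minus: "F \<in> tilde r s R \<Longrightarrow> - F \<in> tilde r s R"
  using tilde_scale[of F "- 1"] by (simp add: fscale_minus1)

lemma tilde_sg: "F \<in> tilde r s R \<Longrightarrow> sg n F \<in> tilde r s R"
  by (simp add: sg_def tilde_minus)

lemma tilde_sum: "(\<And>i. i \<in> A \<Longrightarrow> F i \<in> tilde r s R) \<Longrightarrow> (\<Sum>i\<in>A. F i) \<in> tilde r s R"
  by (rule sum_closed) (auto intro: tilde_add)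

text \<open>Splitting the vectors of a finite spanning set by parity gives a finite homogeneous one,
  and the coordinates as functions of the exponent are the series. They are cut off at inadmissible
  exponents: coordinates with respect to a spanning set are not unique and need not vanish where
  \<open>F\<close> does.\<close>

lemma tilde_expand:
  assumes "F \<in> tilde r s R"
  obtains B p \<phi> where "finite B" "\<And>b. b \<in> B \<Longrightarrow> b \<in> hom_part R (p b)" "\<And>b. b \<in> B \<Longrightarrow> supported (\<phi> b)"
    "F = (\<Sum>b\<in>B. tens b (\<phi> b))"
proof -
  obtain B0 where B0: "finite B0" "B0 \<subseteq> carr R" "range F \<subseteq> V.span B0" using assms by (auto simp: tilde_def)
  have "\<forall>b\<in>B0. \<exists>y z. y \<in> hom_part R 0 \<and> z \<in> hom_part R 1 \<and> b = y + z"
    using B0(2) by (metis carr_split subsetD)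
  then obtain y z where yz: "\<And>b. b \<in> B0 \<Longrightarrow> y b \<in> hom_part R 0 \<and> z b \<in> hom_part R 1 \<and> b = y b + z b"
    by metis
  define B where "B = y ` B0 \<union> z ` B0"
  have fin: "finite B" using B0 by (simp add: B_def)
  have "\<forall>b\<in>B. \<exists>p. b \<in> hom_part R p" using yz by (auto simp: B_def)
  then obtain p where p: "\<And>b. b \<in> B \<Longrightarrow> b \<in> hom_part R (p b)" by metis
  have "B0 \<subseteq> V.span B"
  proof
    fix b assume b: "b \<in> B0"
    then have "y b + z b \<in> V.span B" by (intro V.span_add V.span_base) (auto simp: B_def)
    then show "b \<in> V.span B" using yz[OF b] by simp
  qed
  then have "V.span B0 \<subseteq> V.span B" by (simp add: V.span_minimal V.subspace_span)
  then have "\<forall>M. \<exists>u. F M = (\<Sum>b\<in>B. scl R (u b) b)"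
    using B0(3) V.span_finite[OF fin] by (auto simp: image_subset_iff)
  then obtain u where u: "\<And>M. F M = (\<Sum>b\<in>B. scl R (u M b) b)" by metis
  define \<phi> where "\<phi> b M = (if adm r s M then u M b else 0)" for b M
  have "F = (\<Sum>b\<in>B. tens b (\<phi> b))"
  proof
    fix M show "F M = (\<Sum>b\<in>B. tens b (\<phi> b)) M"
      using u[of M] tildeD(2)[OF assms, of M] by (cases "adm r s M") (auto simp: \<phi>_def tens_def sum_apply)
  qed
  then show ?thesis using that[of B p \<phi>] fin p by (auto simp: supported_def \<phi>_def)
qed

lemma tilde_induct [consumes 1, case_names zero add tens]:
  assumes "F \<in> tilde r s R" and "P 0"
    and add: "\<And>F G. F \<in> tilde r s R \<Longrightarrow> G \<in> tilde r s R \<Longrightarrow> P F \<Longrightarrow> P G \<Longrightarrow> P (F + G)"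
    and tens: "\<And>b p \<phi>. b \<in> hom_part R p \<Longrightarrow> supported \<phi> \<Longrightarrow> P (tens b \<phi>)"
  shows "P F"
proof -
  obtain B p \<phi> where *: "finite B" "\<And>b. b \<in> B \<Longrightarrow> b \<in> hom_part R (p b)" "\<And>b. b \<in> B \<Longrightarrow> supported (\<phi> b)"
    "F = (\<Sum>b\<in>B. tens b (\<phi> b))" using tilde_expand[OF assms(1)] by blast
  have "(\<Sum>b\<in>B. tens b (\<phi> b)) \<in> {G \<in> tilde r s R. P G}"
  proof (rule sum_closed)
    fix b assume "b \<in> B"
    then show "tens b (\<phi> b) \<in> {G \<in> tilde r s R. P G}"
      using tens[OF *(2,3)] tens_tilde[OF hom_carr[OF *(2)] *(3)] by simp
  qed (use assms in \<open>auto intro: tilde_add\<close>)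
  then show ?thesis using * by simp
qed

text \<open>For \<open>F\<close> of parity \<open>q\<close> only exponents of the matching parity
  matter in the series attached to \<open>b\<close>. Dropping the others does not change
  \<open>F\<close>: at each exponent the dropped part has the wrong parity, yet it is a difference
  of two elements of the right parity, so it is 0.\<close>

lemma tilde_hom_induct [consumes 2, case_names zero add tens]:
  assumes F: "F \<in> tilde r s R" and hom: "\<And>M. F M \<in> hom_part R (q + mpar r M)" and "P 0"
    and add: "\<And>F G. F \<in> tilde r s R \<Longrightarrow> G \<in> tilde r s R \<Longrightarrow> P F \<Longrightarrow> P G \<Longrightarrow> P (F + G)"
    and tens: "\<And>b p \<phi>. b \<in> hom_part R p \<Longrightarrow> supported \<phi> \<Longrightarrow> (\<And>M. \<phi> M \<noteq> 0 \<Longrightarrow> even (p + q + mpar r M)) \<Longrightarrow> P (tens b \<phi>)"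
  shows "P F"
proof -
  obtain B p \<phi> where *: "finite B" "\<And>b. b \<in> B \<Longrightarrow> b \<in> hom_part R (p b)" "\<And>b. b \<in> B \<Longrightarrow> supported (\<phi> b)"
    "F = (\<Sum>b\<in>B. tens b (\<phi> b))" using tilde_expand[OF F] by blast
  define \<psi> where "\<psi> b M = (if even (p b + q + mpar r M) then \<phi> b M else 0)" for b M
  have F_eq: "F = (\<Sum>b\<in>B. tens b (\<psi> b))"
  proof
    fix M
    let ?h = "hom_part R (q + mpar r M)" and ?h' = "hom_part R (Suc (q + mpar r M))"
    have tm: "scl R (\<psi> b M) b \<in> ?h" "scl R (\<phi> b M) b - scl R (\<psi> b M) b \<in> ?h'" if "b \<in> B" for b
    proof -
      consider "even (p b + q + mpar r M)" | "odd (p b + q + mpar r M)" by blast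
      then show "scl R (\<psi> b M) b \<in> ?h" "scl R (\<phi> b M) b - scl R (\<psi> b M) b \<in> ?h'"
        using *(2)[OF that] hom_cong[of "p b" "q + mpar r M"] hom_cong[of "p b" "Suc (q + mpar r M)"]
        by (cases; auto simp: \<psi>_def intro: hom_scl hom_zero)+
    qed
    have d: "F M - (\<Sum>b\<in>B. scl R (\<psi> b M) b) = (\<Sum>b\<in>B. scl R (\<phi> b M) b - scl R (\<psi> b M) b)"
      by (simp add: *(4) sum_apply tens_def sum_subtractf)
    have "F M - (\<Sum>b\<in>B. scl R (\<psi> b M) b) \<in> ?h"
      using hom tm by (intro V.subspace_diff[OF subspace_hom] hom_sum) auto
    moreover have "F M - (\<Sum>b\<in>B. scl R (\<psi> b M) b) \<in> ?h'"
      unfolding d using tm by (intro hom_sum) auto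
    ultimately have "F M - (\<Sum>b\<in>B. scl R (\<psi> b M) b) = 0" by (rule hom_disjoint) simp
    then show "F M = (\<Sum>b\<in>B. tens b (\<psi> b)) M" by (simp add: sum_apply tens_def)
  qed
  have "(\<Sum>b\<in>B. tens b (\<psi> b)) \<in> {G \<in> tilde r s R. P G}"
  proof (rule sum_closed)
    fix b assume b: "b \<in> B"
    have "supported (\<psi> b)" using *(3)[OF b] by (simp add: supported_def \<psi>_def)
    moreover have "P (tens b (\<psi> b))"
      by (rule tens[OF *(2)[OF b] \<open>supported (\<psi> b)\<close>]) (simp add: \<psi>_def split: if_splits)
    ultimately show "tens b (\<psi> b) \<in> {G \<in> tilde r s R. P G}"
      using *(2)[OF b] by (auto intro: tens_tilde hom_carr)
  qed (use assms in \<open>auto intro: tilde_add\<close>)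
  then show ?thesis using F_eq by simp
qed

lemma dery_add: "F \<in> tilde r s R \<Longrightarrow> G \<in> tilde r s R \<Longrightarrow> dery r s R i (F + G) = dery r s R i F + dery r s R i G"
  by (auto simp: dery_def fun_eq_iff plus_fun_apply twist_add tildeD sg_add V.scale_right_distrib)

lemma dery_scale: "F \<in> tilde r s R \<Longrightarrow> dery r s R i (fscale (scl R) c F) = fscale (scl R) c (dery r s R i F)"
  by (auto simp: dery_def fun_eq_iff fscale_def twist_scl tildeD scl_sg mult.commute)

lemma dery_zero [simp]: "dery r s R i 0 = 0"
  by (simp add: dery_def fun_eq_iff zero_fun_apply)

lemma dery_tens: "b \<in> hom_part R p \<Longrightarrow> dery r s R i (tens b \<phi>) = tens (sg (par r i * p) b) (ldery r s i \<phi>)"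
proof
  fix P assume b: "b \<in> hom_part R p"
  show "dery r s R i (tens b \<phi>) P = tens (sg (par r i * p) b) (ldery r s i \<phi>) P"
    using b by (simp add: dery_def tens_def ldery_def twist_hom[OF hom_scl[OF b]] scl_sg add.commute sg_mult(2)[symmetric] del: sg_sg)
      (simp add: V.scale_scale[symmetric] scl_sg add.commute del: V.scale_scale)
qed

lemma supported_ldery: "supported (ldery r s i \<phi>)"
  by (simp add: supported_def ldery_unsupported)

lemma supported_series_mult: "supported (series_mult r s \<phi> \<psi>)"
  by (simp add: supported_def series_mult_unsupported)

lemma dery_tilde: "F \<in> tilde r s R \<Longrightarrow> dery r s R i F \<in> tilde r s R"
proof (induction rule: tilde_induct)
  case (add F G)
  then show ?case by (simp add: dery_add tilde_add)
next
  case (tens b p \<phi>)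
  then show ?case by (simp add: dery_tens tens_tilde hom_carr[OF hom_sg] supported_ldery)
qed simp

lemma dleft_tens: "i \<in> {1..r+s} \<Longrightarrow> b \<in> carr R \<Longrightarrow> (\<lambda>M. dleft R i (tens b \<phi> M)) = tens (dleft R i b) \<phi>"
  by (simp add: tens_def dleft_scl)

lemma dleft_fun_add: "i \<in> {1..r+s} \<Longrightarrow> F \<in> tilde r s R \<Longrightarrow> G \<in> tilde r s R \<Longrightarrow>
    (\<lambda>M. dleft R i ((F + G) M)) = (\<lambda>M. dleft R i (F M)) + (\<lambda>M. dleft R i (G M))"
  by (simp add: fun_eq_iff plus_fun_apply dleft_add tildeD)

lemma dleft_tilde:
  assumes i: "i \<in> {1..r+s}"
  shows "F \<in> tilde r s R \<Longrightarrow> (\<lambda>M. dleft R i (F M)) \<in> tilde r s R"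
proof (induction rule: tilde_induct)
  case zero
  then show ?case using i zero_tilde by (simp add: zero_fun_def)
next
  case (add F G)
  then show ?case using i by (simp only: dleft_fun_add tilde_add)
next
  case (tens b p \<phi>)
  then show ?case using i by (simp add: dleft_tens tens_tilde hom_carr dleft_carr)
qed

end

lemma fun_plusI: "(\<And>x. h x = f x + g x) \<Longrightarrow> h = f + g"
  by (auto simp: fun_eq_iff plus_fun_apply)

context conformal_superalgebra
begin

section \<open>The bracket on representatives, coefficient by coefficient\<close>

lemma sandwich_zero: "sandwich r s R \<phi> 0 \<psi> = 0"
  by (simp add: sandwich_def fun_eq_iff zero_fun_apply)

lemma sandwich_scl: "x \<in> carr R \<Longrightarrow> sandwich r s R \<phi> (scl R c x) \<psi> = fscale (scl R) c (sandwich r s R \<phi> x \<psi>)"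
  by (auto simp: sandwich_def fscale_def fun_eq_iff twist_scl scl_sg V.scale_sum_right mult.commute mult.left_commute)

text \<open>The factor \<open>f(J)\<close> in \<open>kprod\<close> cancels the denominator, being
  nonzero in characteristic 0; what remains are the plain coefficients of the
  \<open>\<lambda>\<close>-bracket.\<close>

lemma mono_bracket_eq:
  assumes "a \<in> carr R" "b \<in> carr R" "finite S" "\<And>J. J \<notin> S \<Longrightarrow> lbr R a b J = 0"
  shows "mono_bracket r s R M a b N = (\<Sum>J\<in>S. sandwich r s R (rderys r s J (ymono M)) (lbr R a b J) (ymono N))"
proof -
  have "(\<Prod>i\<in>set_mset J. fact (count J i) :: nat) \<noteq> 0" for J :: mono
    by simp
  then have "of_nat (\<Prod>i\<in>set_mset J. fact (count J i)) \<noteq> (0 :: 'f)" for J :: mono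
    by (metis of_nat_eq_0_iff)
  then have "mono_bracket r s R M a b N = (\<Sum>J | lbr R a b J \<noteq> 0. sandwich r s R (rderys r s J (ymono M)) (lbr R a b J) (ymono N))"
    unfolding mono_bracket_def kprod_def
    by (intro sum.cong refl) (simp add: sandwich_scl bracket_carr[OF assms(1,2)], simp add: fscale_def)
  also have "\<dots> = (\<Sum>J\<in>S. sandwich r s R (rderys r s J (ymono M)) (lbr R a b J) (ymono N))"
    by (rule sum.mono_neutral_left) (use assms in \<open>auto simp: sandwich_zero\<close>)
  finally show ?thesis .
qed

text \<open>A contribution to the coefficient at \<open>P\<close> is fixed by a \<open>J\<close>
  from the finite set \<open>S\<close> and by the part \<open>M\<close> of \<open>P\<close> that
  comes from the first series. Then \<open>F\<close> is read at \<open>M + J\<close>, since the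
  derivative removes \<open>J\<close>, and \<open>G\<close> at \<open>P - M\<close>. So
  \<open>Sum_any\<close> is a genuine finite sum.\<close>

lemma tilde_bracket_eq:
  assumes F: "F \<in> tilde r s R" and G: "G \<in> tilde r s R" and S: "finite S"
    and supp: "\<And>M N J. J \<notin> S \<Longrightarrow> lbr R (twist R (mpar r M) (F M)) (G N) J = 0"
  shows "tilde_bracket r s R F G P = (if adm r s P then (\<Sum>M | M \<subseteq># P. \<Sum>J\<in>S.
     scl R (rderys r s J (\<lambda>_. 1) M) (sg (inv_cnt r M (P - M))
       (twist R (mpar r M) (lbr R (twist R (mpar r (M + J)) (F (M + J))) (G (P - M)) J)))) else 0)"
proof (cases "adm r s P")
  case False
  then have "mono_bracket r s R M (twist R (mpar r M) (F M)) (G N) N P = 0" for M N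
    by (simp add: mono_bracket_eq[OF twist_carr[OF tildeD(1)[OF F]] tildeD(1)[OF G] S supp] sum_apply sandwich_def)
  then have "(\<lambda>(M, N). mono_bracket r s R M (twist R (mpar r M) (F M)) (G N) N P) = (\<lambda>_. 0)"
    by auto
  with False show ?thesis by (simp add: tilde_bracket_def)
next
  case True
  define t where "t M J = scl R (rderys r s J (\<lambda>_. 1) M) (sg (inv_cnt r M (P - M))
       (twist R (mpar r M) (lbr R (twist R (mpar r (M + J)) (F (M + J))) (G (P - M)) J)))" for M J
  define D where "D = {M. M \<subseteq># P} \<times> S"
  define h where "h = (\<lambda>(M, J). (M + J, P - M))"
  define f where "f = (\<lambda>(M, N). mono_bracket r s R M (twist R (mpar r M) (F M)) (G N) N P)"
  have finD: "finite D" by (simp add: D_def S finite_submultisets)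
  have f_eq: "f x = (\<Sum>d\<in>D. if h d = x then t (fst d) (snd d) else 0)" for x
  proof -
    obtain M N where x: "x = (M, N)" by (cases x)
    have "f x = (\<Sum>J\<in>S. \<Sum>M' | M' \<subseteq># P. if M' + J = M \<and> P - M' = N then t M' J else 0)"
      by (simp add: x f_def mono_bracket_eq[OF twist_carr[OF tildeD(1)[OF F]] tildeD(1)[OF G] S supp] sum_apply
        sandwich_def True)
        (intro sum.cong refl, subst rderys_apply, auto simp: ymono_def t_def)
    also have "\<dots> = (\<Sum>M' | M' \<subseteq># P. \<Sum>J\<in>S. if M' + J = M \<and> P - M' = N then t M' J else 0)"
      by (rule sum.swap)
    also have "\<dots> = (\<Sum>d\<in>D. if h d = x then t (fst d) (snd d) else 0)"
      unfolding D_def sum.cartesian_product by (rule sum.cong) (auto simp: h_def x split: if_splits)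
    finally show ?thesis .
  qed
  have "Sum_any f = sum f (h ` D)"
  proof (rule Sum_any.expand_superset)
    show "{a. f a \<noteq> 0} \<subseteq> h ` D"
    proof
      fix x assume "x \<in> {a. f a \<noteq> 0}"
      then obtain d where "d \<in> D" "(if h d = x then t (fst d) (snd d) else 0) \<noteq> 0"
        unfolding f_eq by (auto elim: sum.not_neutral_contains_not_neutral)
      then show "x \<in> h ` D" by (auto split: if_splits)
    qed
  qed (simp add: finD)
  also have "\<dots> = (\<Sum>x\<in>h ` D. \<Sum>d\<in>D. if h d = x then t (fst d) (snd d) else 0)"
    by (simp add: f_eq)
  also have "\<dots> = (\<Sum>d\<in>D. \<Sum>x\<in>h ` D. if h d = x then t (fst d) (snd d) else 0)"
    by (rule sum.swap)
  also have "\<dots> = (\<Sum>d\<in>D. t (fst d) (snd d))"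
    by (rule sum.cong) (auto simp: finD)
  also have "\<dots> = (\<Sum>M | M \<subseteq># P. \<Sum>J\<in>S. t M J)"
    by (simp add: D_def sum.cartesian_product case_prod_beta)
  finally show ?thesis using True by (simp add: tilde_bracket_def f_def t_def)
qed

text \<open>Finitely many vectors span the values of \<open>F\<close> and \<open>G\<close>, and each
  pair of them has a bracket of finite support; the union of these supports serves all exponents at
  once.\<close>

lemma tilde_bracket_support:
  assumes "F \<in> tilde r s R" "G \<in> tilde r s R"
  obtains S where "finite S" "\<And>n M N J. J \<notin> S \<Longrightarrow> lbr R (twist R n (F M)) (G N) J = 0"
proof -
  obtain B p \<phi> where B: "finite B" "\<And>b. b \<in> B \<Longrightarrow> b \<in> hom_part R (p b)" "F = (\<Sum>b\<in>B. tens b (\<phi> b))"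
    using tilde_expand[OF assms(1)] by metis
  obtain C q \<psi> where C: "finite C" "\<And>b. b \<in> C \<Longrightarrow> b \<in> hom_part R (q b)" "G = (\<Sum>b\<in>C. tens b (\<psi> b))"
    using tilde_expand[OF assms(2)] by metis
  note carB = hom_carr[OF B(2)] and carC = hom_carr[OF C(2)]
  define S where "S = (\<Union>b\<in>B. \<Union>c\<in>C. {J. lbr R b c J \<noteq> 0})"
  have "finite S" using B(1) C(1) by (auto simp: S_def intro!: bracket_finite intro: carB carC)
  moreover have "lbr R (twist R n (F M)) (G N) J = 0" if "J \<notin> S" for n M N J
  proof -
    have "twist R n (F M) = (\<Sum>b\<in>B. scl R (\<phi> b M) (sg (n * p b) b))"
      using B by (simp add: sum_apply tens_def twist_sum carr_scl carB twist_scl twist_hom[OF B(2)])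
    moreover have "G N = (\<Sum>c\<in>C. scl R (\<psi> c N) c)" using C by (simp add: sum_apply tens_def)
    ultimately have "lbr R (twist R n (F M)) (G N) J =
        (\<Sum>c\<in>C. \<Sum>b\<in>B. scl R (\<psi> c N) (scl R (\<phi> b M) (sg (n * p b) (lbr R b c J))))"
      using carB carC
      by (simp add: bracket_sum_left bracket_sum_right carr_scl carr_sg carr_sum bracket_scl_left bracket_scl_right
        bracket_sg sum_apply sg_apply fscale_def V.scale_sum_right scl_sg)
    also have "\<dots> = 0" using that by (intro sum.neutral ballI) (auto simp: S_def)
    finally show ?thesis .
  qed
  ultimately show ?thesis using that by blast
qed

lemma tilde_bracket_add_left:
  assumes "F \<in> tilde r s R" "F' \<in> tilde r s R" "G \<in> tilde r s R"
  shows "tilde_bracket r s R (F + F') G = tilde_bracket r s R F G + tilde_bracket r s R F' G"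
proof (rule fun_plusI)
  fix P
  obtain S where S: "finite S" "\<And>n M N J. J \<notin> S \<Longrightarrow> lbr R (twist R n (F M)) (G N) J = 0"
    using tilde_bracket_support assms(1,3) by metis
  obtain S' where S': "finite S'" "\<And>n M N J. J \<notin> S' \<Longrightarrow> lbr R (twist R n (F' M)) (G N) J = 0"
    using tilde_bracket_support assms(2,3) by metis
  note car = tildeD(1)[OF assms(1)] tildeD(1)[OF assms(2)] tildeD(1)[OF assms(3)]
  have br: "lbr R (twist R n ((F + F') M)) (G N) J = lbr R (twist R n (F M)) (G N) J + lbr R (twist R n (F' M)) (G N) J" for n M N J
    using car by (simp add: plus_fun_apply twist_add bracket_add_left twist_carr)
  have fin: "finite (S \<union> S')" using S S' by simp
  have eqs: "tilde_bracket r s R H G P = (if adm r s P then (\<Sum>M | M \<subseteq># P. \<Sum>J\<in>S \<union> S'.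
     scl R (rderys r s J (\<lambda>_. 1) M) (sg (inv_cnt r M (P - M))
       (twist R (mpar r M) (lbr R (twist R (mpar r (M + J)) (H (M + J))) (G (P - M)) J)))) else 0)" if "H \<in> {F, F', F + F'}" for H
    by (rule tilde_bracket_eq[OF _ assms(3) fin]) (use that assms S S' br in \<open>auto simp: tilde_add\<close>)
  show "tilde_bracket r s R (F + F') G P = tilde_bracket r s R F G P + tilde_bracket r s R F' G P"
    by (simp add: eqs br twist_add bracket_carr twist_carr car sg_add V.scale_right_distrib sum.distrib)
qed

lemma tilde_bracket_add_right:
  assumes "F \<in> tilde r s R" "F' \<in> tilde r s R" "G \<in> tilde r s R"
  shows "tilde_bracket r s R G (F + F') = tilde_bracket r s R G F + tilde_bracket r s R G F'"
proof (rule fun_plusI)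
  fix P
  obtain S where S: "finite S" "\<And>n M N J. J \<notin> S \<Longrightarrow> lbr R (twist R n (G M)) (F N) J = 0"
    using tilde_bracket_support assms(1,3) by metis
  obtain S' where S': "finite S'" "\<And>n M N J. J \<notin> S' \<Longrightarrow> lbr R (twist R n (G M)) (F' N) J = 0"
    using tilde_bracket_support assms(2,3) by metis
  note car = tildeD(1)[OF assms(1)] tildeD(1)[OF assms(2)] tildeD(1)[OF assms(3)]
  have br: "lbr R (twist R n (G M)) ((F + F') N) J = lbr R (twist R n (G M)) (F N) J + lbr R (twist R n (G M)) (F' N) J" for n M N J
    using car by (simp add: plus_fun_apply bracket_add_right twist_carr)
  have fin: "finite (S \<union> S')" using S S' by simp
  have eqs: "tilde_bracket r s R G H P = (if adm r s P then (\<Sum>M | M \<subseteq># P. \<Sum>J\<in>S \<union> S'.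
     scl R (rderys r s J (\<lambda>_. 1) M) (sg (inv_cnt r M (P - M))
       (twist R (mpar r M) (lbr R (twist R (mpar r (M + J)) (G (M + J))) (H (P - M)) J)))) else 0)" if "H \<in> {F, F', F + F'}" for H
    by (rule tilde_bracket_eq[OF assms(3) _ fin]) (use that assms S S' br in \<open>auto simp: tilde_add\<close>)
  show "tilde_bracket r s R G (F + F') P = tilde_bracket r s R G F P + tilde_bracket r s R G F' P"
    by (simp add: eqs br twist_add bracket_carr twist_carr car sg_add V.scale_right_distrib sum.distrib)
qed

lemma tilde_bracket_scale:
  assumes "F \<in> tilde r s R" "G \<in> tilde r s R"
  shows "tilde_bracket r s R (fscale (scl R) c F) G = fscale (scl R) c (tilde_bracket r s R F G)"
    "tilde_bracket r s R F (fscale (scl R) c G) = fscale (scl R) c (tilde_bracket r s R F G)"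
proof -
  obtain S where S: "finite S" "\<And>n M N J. J \<notin> S \<Longrightarrow> lbr R (twist R n (F M)) (G N) J = 0"
    using tilde_bracket_support assms by metis
  note car = tildeD(1)[OF assms(1)] tildeD(1)[OF assms(2)]
  have br: "lbr R (twist R n (fscale (scl R) c F M)) (G N) J = scl R c (lbr R (twist R n (F M)) (G N) J)"
    "lbr R (twist R n (F M)) (fscale (scl R) c G N) J = scl R c (lbr R (twist R n (F M)) (G N) J)" for n M N J
    using car by (simp_all add: fscale_def twist_scl bracket_scl_left bracket_scl_right twist_carr)
  have S0: "lbr R (twist R n (fscale (scl R) c F M)) (G N) J = 0" "lbr R (twist R n (F M)) (fscale (scl R) c G N) J = 0"
    if "J \<notin> S" for n M N J using S(2)[OF that] by (simp_all add: br)
  note eqs = tilde_bracket_eq[OF assms S] tilde_bracket_eq[OF tilde_scale[OF assms(1)] assms(2) S(1) S0(1)]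
    tilde_bracket_eq[OF assms(1) tilde_scale[OF assms(2)] S(1) S0(2)]
  show "tilde_bracket r s R (fscale (scl R) c F) G = fscale (scl R) c (tilde_bracket r s R F G)"
    "tilde_bracket r s R F (fscale (scl R) c G) = fscale (scl R) c (tilde_bracket r s R F G)"
    by (rule ext, simp add: fscale_def[of _ _ "tilde_bracket r s R F G"] eqs br,
      simp add: twist_scl bracket_carr twist_carr car scl_sg V.scale_sum_right mult.commute)+
qed

lemma tilde_bracket_zero:
  assumes "F \<in> tilde r s R"
  shows "tilde_bracket r s R F 0 = 0" "tilde_bracket r s R 0 F = 0"
  using tilde_bracket_add_left[OF zero_tilde zero_tilde assms] tilde_bracket_add_right[OF zero_tilde zero_tilde assms] by simp_all

lemma tilde_bracket_sg:
  assumes "F \<in> tilde r s R" "G \<in> tilde r s R"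
  shows "tilde_bracket r s R (sg n F) G = sg n (tilde_bracket r s R F G)" "tilde_bracket r s R F (sg n G) = sg n (tilde_bracket r s R F G)"
  using tilde_bracket_scale[OF assms, of "-1"] by (auto simp: sg_def fscale_minus1)

text \<open>The bracket of \<open>\<Phi> a\<close> and \<open>b \<psi>\<close>, where \<open>X\<close> is the \<open>\<lambda>\<close>-bracket of \<open>a\<close> and \<open>b\<close>, of total parity \<open>t\<close>.\<close>

definition series_bracket :: "nat \<Rightarrow> (mono \<Rightarrow> 'v) \<Rightarrow> (mono \<Rightarrow> 'f) \<Rightarrow> (mono \<Rightarrow> 'f) \<Rightarrow> mono \<Rightarrow> 'v" where
  "series_bracket t X \<Phi> \<psi> = (\<Sum>J | X J \<noteq> 0.
     tens (X J) (series_mult r s (twist_series r (t + mpar r J) (rderys r s J \<Phi>)) \<psi>))"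

text \<open>The first argument is rewritten with its series on the left, which twists
  \<open>\<phi>\<close> by \<open>p\<close>. The further twist inside \<open>series_bracket\<close>
  moves the coefficient of the \<open>\<lambda>\<close>-bracket, of parity
  \<open>p + q + mpar r J\<close>, back to the left of the derived series.\<close>

lemma tilde_bracket_tens:
  assumes b: "b \<in> hom_part R p" and c: "c \<in> hom_part R q" and supp: "supported \<phi>" "supported \<psi>"
  shows "tilde_bracket r s R (tens b \<phi>) (tens c \<psi>) = series_bracket (p + q) (lbr R b c) (twist_series r p \<phi>) \<psi>"
proof
  fix P
  let ?S = "{J. lbr R b c J \<noteq> 0}"
  note car = hom_carr[OF b] hom_carr[OF c]
  have S: "finite ?S" using car by (rule bracket_finite)
  have br: "lbr R (twist R n (tens b \<phi> M)) (tens c \<psi> N) J = scl R (\<phi> M * \<psi> N) (sg (n * p) (lbr R b c J))" for n M N J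
    using car by (simp add: tens_def twist_scl twist_hom[OF b] bracket_scl_left bracket_scl_right carr_scl carr_sg bracket_sg
      fscale_def sg_apply scl_sg mult.commute)
  have *: "tilde_bracket r s R (tens b \<phi>) (tens c \<psi>) P = (if adm r s P then (\<Sum>M | M \<subseteq># P. \<Sum>J\<in>?S.
     scl R (rderys r s J (\<lambda>_. 1) M) (sg (inv_cnt r M (P - M))
       (twist R (mpar r M) (lbr R (twist R (mpar r (M + J)) (tens b \<phi> (M + J))) (tens c \<psi> (P - M)) J)))) else 0)"
    by (rule tilde_bracket_eq[OF tens_tilde[OF car(1) supp(1)] tens_tilde[OF car(2) supp(2)] S]) (auto simp: br)
  have tm: "scl R (rderys r s J (\<lambda>_. 1) M) (sg (inv_cnt r M (P - M))
       (twist R (mpar r M) (lbr R (twist R (mpar r (M + J)) (tens b \<phi> (M + J))) (tens c \<psi> (P - M)) J)))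
     = scl R (sg (inv_cnt r M (P - M)) (twist_series r (p + q + mpar r J) (rderys r s J (twist_series r p \<phi>)) M * \<psi> (P - M))) (lbr R b c J)"
    for M J
  proof -
    have "twist R (mpar r M) (scl R (\<phi> (M + J) * \<psi> (P - M)) (sg (mpar r (M + J) * p) (lbr R b c J)))
       = scl R (\<phi> (M + J) * \<psi> (P - M)) (sg (mpar r (M + J) * p + mpar r M * (p + q + mpar r J)) (lbr R b c J))"
      using bracket_hom[OF b c, of J] by (simp add: twist_scl twist_sg hom_carr hom_sg carr_sg twist_hom)
    then show ?thesis
      unfolding br twist_series_def[of r "p + q + mpar r J"]
      by (subst rderys_apply)
        (simp add: scl_sg twist_series_def sg_mult(1)[symmetric] sg_mult(2)[symmetric] ac_simps)
  qed
  show "tilde_bracket r s R (tens b \<phi>) (tens c \<psi>) P = series_bracket (p + q) (lbr R b c) (twist_series r p \<phi>) \<psi> P"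
  proof (cases "adm r s P")
    case True
    have "tilde_bracket r s R (tens b \<phi>) (tens c \<psi>) P = (\<Sum>J\<in>?S. \<Sum>M | M \<subseteq># P.
        scl R (sg (inv_cnt r M (P - M)) (twist_series r (p + q + mpar r J) (rderys r s J (twist_series r p \<phi>)) M * \<psi> (P - M))) (lbr R b c J))"
      unfolding * tm using True by (simp add: sum.swap[of _ ?S])
    then show ?thesis
      using True by (simp add: series_bracket_def sum_apply tens_def series_mult_def V.scale_sum_left)
  next
    case False
    then show ?thesis unfolding * by (simp add: series_bracket_def sum_apply tens_def series_mult_def)
  qed
qed

lemma series_bracket_superset:
  assumes "finite S" "\<And>J. J \<notin> S \<Longrightarrow> X J = 0"
  shows "series_bracket t X \<Phi> \<psi> = (\<Sum>J\<in>S. tens (X J) (series_mult r s (twist_series r (t + mpar r J) (rderys r s J \<Phi>)) \<psi>))"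
  unfolding series_bracket_def by (rule sum.mono_neutral_left) (use assms in auto)

lemma series_bracket_add:
  assumes "finite {J. X J \<noteq> 0}" "finite {J. Y J \<noteq> 0}"
  shows "series_bracket t (X + Y) \<Phi> \<psi> = series_bracket t X \<Phi> \<psi> + series_bracket t Y \<Phi> \<psi>"
proof -
  let ?S = "{J. X J \<noteq> 0} \<union> {J. Y J \<noteq> 0}"
  have "series_bracket t Z \<Phi> \<psi> = (\<Sum>J\<in>?S. tens (Z J) (series_mult r s (twist_series r (t + mpar r J) (rderys r s J \<Phi>)) \<psi>))"
    if "Z \<in> {X, Y, X + Y}" for Z
    by (rule series_bracket_superset) (use assms that in \<open>auto simp: plus_fun_apply\<close>)
  then show ?thesis by (simp add: plus_fun_apply tens_add sum.distrib)
qed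

lemma series_bracket_sg: "series_bracket t (sg n X) \<Phi> \<psi> = sg n (series_bracket t X \<Phi> \<psi>)"
  by (simp add: series_bracket_def sg_apply tens_sg sg_sum)

lemma series_bracket_sg_series:
  "series_bracket t X (sg n \<Phi>) \<psi> = sg n (series_bracket t X \<Phi> \<psi>)"
  "series_bracket t X \<Phi> (sg n \<psi>) = sg n (series_bracket t X \<Phi> \<psi>)"
  by (simp_all add: series_bracket_def additive_mapD(4)[OF additive_rderys] additive_mapD(4)[OF additive_twist_series]
    series_mult_sg tens_sg sg_sum)

lemma series_bracket_tilde:
  assumes "\<And>J. X J \<in> carr R"
  shows "series_bracket t X \<Phi> \<psi> \<in> tilde r s R"
  unfolding series_bracket_def by (intro tilde_sum tens_tilde assms supported_series_mult)

lemma tilde_bracket_tilde: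
  assumes "F \<in> tilde r s R" "G \<in> tilde r s R"
  shows "tilde_bracket r s R F G \<in> tilde r s R"
  using assms(1)
proof (induction rule: tilde_induct)
  case (add F F')
  then show ?case using assms by (simp add: tilde_bracket_add_left tilde_add)
next
  case (tens b p \<phi>)
  note b = tens
  show ?case
    using assms(2)
  proof (induction rule: tilde_induct)
    case (add F F')
    then show ?case using b by (simp add: tilde_bracket_add_right tilde_add tens_tilde hom_carr)
  next
    case (tens c q \<psi>)
    with b show ?case
      by (simp add: tilde_bracket_tens) (intro series_bracket_tilde bracket_carr hom_carr; assumption)
  qed (use b in \<open>simp add: tilde_bracket_zero tens_tilde hom_carr\<close>)
qed (use assms in \<open>simp add: tilde_bracket_zero\<close>)

text \<open>In the annihilation algebra \<open>\<lambda>\<^sub>i\<close> acts as a right derivative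
  of the first series. The reordering signs and zeros of
  \<open>\<lambda>\<^sub>i \<lambda>\<^sub>J\<close> and of the derivatives agree by
  \<open>rderys_insert\<close>.\<close>

lemma series_bracket_lmul:
  assumes "finite {J. X J \<noteq> 0}" "\<And>J. \<not> adm r s J \<Longrightarrow> X J = 0" "i \<in> {1..r+s}"
  shows "series_bracket (par r i + t) (lmul r s i X) \<Phi> \<psi> = series_bracket t X (rdery r s i \<Phi>) \<psi>"
proof -
  have "series_bracket (par r i + t) (lmul r s i X) \<Phi> \<psi> = (\<Sum>J | X J \<noteq> 0. if adm r s (add_mset i J) then
      tens (sg (inv_cnt r {#i#} J) (X J)) (series_mult r s (twist_series r (par r i + t + mpar r (add_mset i J)) (rderys r s (add_mset i J) \<Phi>)) \<psi>) else 0)"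
    unfolding series_bracket_def by (rule sum_lmul) (use assms in auto)
  also have "\<dots> = series_bracket t X (rdery r s i \<Phi>) \<psi>"
    unfolding series_bracket_def
  proof (rule sum.cong)
    fix J assume "J \<in> {J. X J \<noteq> 0}"
    then have "adm r s J" using assms by blast
    then have adm: "adm r s (add_mset i J) \<longleftrightarrow> \<not> (r < i \<and> i \<in># J)" using assms(3) by (auto simp: adm_add_mset_iff)
    have tw: "twist_series r (par r i + t + mpar r (add_mset i J)) A = twist_series r (t + mpar r J) A" for A :: "mono \<Rightarrow> 'f"
      by (rule twist_series_cong) (simp, blast)
    show "(if adm r s (add_mset i J) then
      tens (sg (inv_cnt r {#i#} J) (X J)) (series_mult r s (twist_series r (par r i + t + mpar r (add_mset i J)) (rderys r s (add_mset i J) \<Phi>)) \<psi>) else 0)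
      = tens (X J) (series_mult r s (twist_series r (t + mpar r J) (rderys r s J (rdery r s i \<Phi>))) \<psi>)"
    proof (cases "adm r s (add_mset i J)")
      case True
      with adm have "rderys r s J (rdery r s i \<Phi>) = sg (inv_cnt r {#i#} J) (rderys r s (add_mset i J) \<Phi>)"
        unfolding rderys_insert by auto
      with True show ?thesis
        by (simp only: tw additive_mapD(4)[OF additive_twist_series] series_mult_sg tens_sg if_True)
    next
      case False
      with adm have 0: "rderys r s J (rdery r s i \<Phi>) = 0" unfolding rderys_insert by auto
      have "series_mult r s 0 \<psi> = 0" by (simp add: series_mult_def fun_eq_iff zero_fun_apply)
      with False 0 show ?thesis by (simp add: additive_mapD(2)[OF additive_twist_series])
    qed
  qed simp
  finally show ?thesis .
qed


lemma dery_sum: "(\<And>j. j \<in> A \<Longrightarrow> F j \<in> tilde r s R) \<Longrightarrow> dery r s R i (\<Sum>j\<in>A. F j) = (\<Sum>j\<in>A. dery r s R i (F j))"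
  by (induction A rule: infinite_finite_induct) (auto simp: dery_add tilde_sum)

lemma dleft_sum: "i \<in> {1..r+s} \<Longrightarrow> (\<And>j. j \<in> A \<Longrightarrow> f j \<in> carr R) \<Longrightarrow> dleft R i (\<Sum>j\<in>A. f j) = (\<Sum>j\<in>A. dleft R i (f j))"
  by (induction A rule: infinite_finite_induct) (auto simp: dleft_add carr_sum)

lemma dery_sg: "F \<in> tilde r s R \<Longrightarrow> dery r s R i (sg n F) = sg n (dery r s R i F)"
  using dery_scale[of F i "- 1"] by (auto simp: sg_def fscale_minus1)

text \<open>Left derivatives commute with the right derivatives in \<open>rderys\<close>, so the
  Leibniz rule applies summand by summand. In the first term the sign for crossing
  \<open>X J\<close> cancels completely; in the second only its share from \<open>t\<close>
  survives.\<close>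

lemma dery_series_bracket:
  assumes X: "\<And>J. X J \<in> hom_part R (t + mpar r J)"
  shows "dery r s R i (series_bracket t X \<Phi> \<psi>) = series_bracket t X (ldery r s i \<Phi>) \<psi> +
    sg (par r i * t) (series_bracket t X (twist_series r (par r i) \<Phi>) (ldery r s i \<psi>))"
proof -
  have "dery r s R i (tens (X J) (series_mult r s (twist_series r (t + mpar r J) (rderys r s J \<Phi>)) \<psi>)) =
      tens (X J) (series_mult r s (twist_series r (t + mpar r J) (rderys r s J (ldery r s i \<Phi>))) \<psi>) +
      sg (par r i * t) (tens (X J) (series_mult r s (twist_series r (t + mpar r J) (rderys r s J (twist_series r (par r i) \<Phi>))) (ldery r s i \<psi>)))" for J
  proof -
    have 1: "ldery r s i (twist_series r (t + mpar r J) (rderys r s J \<Phi>)) =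
        sg (par r i * (t + mpar r J)) (twist_series r (t + mpar r J) (rderys r s J (ldery r s i \<Phi>)))"
      by (simp add: ldery_twist_series rderys_ldery mult.commute)
    have 2: "twist_series r (par r i) (twist_series r (t + mpar r J) (rderys r s J \<Phi>)) =
        sg (par r i * mpar r J) (twist_series r (t + mpar r J) (rderys r s J (twist_series r (par r i) \<Phi>)))"
      by (simp add: rderys_twist_series additive_mapD(4)[OF additive_twist_series] add.commute add.left_commute)
        (simp add: sg_def)
    show ?thesis
      unfolding dery_tens[OF X] ldery_series_mult tens_add 1 2 series_mult_sg tens_sg sg_add sg_sg
      by (intro arg_cong2[where f = "(+)"]) (auto simp: sg_def)
  qed
  then show ?thesis
    unfolding series_bracket_def
    by (subst dery_sum) (auto simp: sum.distrib sg_sum intro!: tens_tilde hom_carr[OF X] supported_series_mult)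
qed

lemma twist_series_hom:
  assumes "\<And>M. \<phi> M \<noteq> 0 \<Longrightarrow> even (p + q + mpar r M)"
  shows "twist_series r n \<phi> = sg (n * (p + q)) \<phi>"
proof
  fix M
  show "twist_series r n \<phi> M = sg (n * (p + q)) \<phi> M"
    using assms[of M] by (cases "\<phi> M = 0") (auto simp: twist_series_def sg_apply intro!: sg_eqI)
qed

lemma dery_tilde_bracket:
  assumes F: "F \<in> tilde r s R" "\<And>M. F M \<in> hom_part R (Q + mpar r M)" and G: "G \<in> tilde r s R"
  shows "dery r s R i (tilde_bracket r s R F G) =
    tilde_bracket r s R (dery r s R i F) G + sg (par r i * Q) (tilde_bracket r s R F (dery r s R i G))"
  using F
proof (induction rule: tilde_hom_induct)
  case zero
  then show ?case using G by (simp add: tilde_bracket_zero dery_tilde)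
next
  case (add F F')
  then show ?case
    using G by (simp add: tilde_bracket_add_left dery_add tilde_bracket_tilde dery_tilde sg_add)
next
  case (tens b p \<phi>)
  note b = tens
  note bt = tens_tilde[OF hom_carr[OF b(1)] b(2)]
  show ?case
    using G
  proof (induction rule: tilde_induct)
    case zero
    then show ?case using bt by (simp add: tilde_bracket_zero dery_tilde)
  next
    case (add F F')
    then show ?case
      using bt by (simp add: tilde_bracket_add_right dery_add tilde_bracket_tilde dery_tilde sg_add)
  next
    case (tens c q \<psi>)
    note ct = tens_tilde[OF hom_carr[OF tens(1)] tens(2)]
    let ?X = "lbr R b c"
    have 1: "tilde_bracket r s R (dery r s R i (tens b \<phi>)) (tens c \<psi>) = series_bracket (p + q) ?X (ldery r s i (twist_series r p \<phi>)) \<psi>"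
      unfolding dery_tens[OF b(1)] tens_sg tilde_bracket_sg[OF tens_tilde[OF hom_carr[OF b(1)] supported_ldery] ct]
        tilde_bracket_tens[OF b(1) tens(1) supported_ldery tens(2)] ldery_twist_series series_bracket_sg_series
      by (simp add: mult.commute)
    have 2: "tilde_bracket r s R (tens b \<phi>) (dery r s R i (tens c \<psi>)) = sg (par r i * q) (series_bracket (p + q) ?X (twist_series r p \<phi>) (ldery r s i \<psi>))"
      unfolding dery_tens[OF tens(1)] tens_sg tilde_bracket_sg[OF bt tens_tilde[OF hom_carr[OF tens(1)] supported_ldery]]
        tilde_bracket_tens[OF b(1) tens(1) b(2) supported_ldery] ..
    \<comment> \<open>The series \<open>\<phi>\<close> has parity \<open>p + Q\<close>, so this
      twist is a single sign. Combined with the sign of \<open>p + q\<close> in the Leibniz rule it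
      leaves \<open>q + Q\<close>: the \<open>q\<close> is the one in step 2, the \<open>Q\<close>
      the one in the claim.\<close>
    have 3: "twist_series r (par r i) (twist_series r p \<phi>) = sg (par r i * (p + Q)) (twist_series r p \<phi>)"
    proof -
      have "twist_series r (par r i) \<phi> = sg (par r i * (p + Q)) \<phi>" by (rule twist_series_hom) (rule b(3))
      then have "twist_series r p (twist_series r (par r i) \<phi>) = sg (par r i * (p + Q)) (twist_series r p \<phi>)"
        by (simp only: additive_mapD(4)[OF additive_twist_series])
      then show ?thesis by (simp add: add.commute)
    qed
    show ?case
      unfolding tilde_bracket_tens[OF b(1) tens(1) b(2) tens(2)] 1 2 dery_series_bracket[OF bracket_hom[OF b(1) tens(1)]] 3
        series_bracket_sg_series sg_sg
      by (intro arg_cong2[where f = "(+)"]) (auto simp: sg_def)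
  qed
qed

section \<open>The null space is an ideal, stable under the derivations\<close>

definition null_op :: "nat \<Rightarrow> (mono \<Rightarrow> 'v) \<Rightarrow> mono \<Rightarrow> 'v" where
  "null_op i F = (\<lambda>M. dleft R i (F M)) + dery r s R i F"

lemma null_op_add: "i \<in> {1..r+s} \<Longrightarrow> F \<in> tilde r s R \<Longrightarrow> G \<in> tilde r s R \<Longrightarrow> null_op i (F + G) = null_op i F + null_op i G"
  by (simp only: null_op_def dleft_fun_add dery_add) simp

lemma null_op_scale: "i \<in> {1..r+s} \<Longrightarrow> F \<in> tilde r s R \<Longrightarrow> null_op i (fscale (scl R) c F) = fscale (scl R) c (null_op i F)"
  by (simp add: null_op_def dery_scale) (simp add: fscale_def fun_eq_iff plus_fun_apply dleft_scl tildeD V.scale_right_distrib)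

lemma null_op_zero [simp]: "i \<in> {1..r+s} \<Longrightarrow> null_op i 0 = 0"
  using null_op_add[of i 0 0] by simp

lemma null_op_tilde: "i \<in> {1..r+s} \<Longrightarrow> F \<in> tilde r s R \<Longrightarrow> null_op i F \<in> tilde r s R"
  by (simp add: null_op_def tilde_add dleft_tilde dery_tilde)

lemma null_op_sg: "i \<in> {1..r+s} \<Longrightarrow> F \<in> tilde r s R \<Longrightarrow> null_op i (sg n F) = sg n (null_op i F)"
  using null_op_scale[of i F "- 1"] by (auto simp: sg_def fscale_minus1)

lemma null_op_tens:
  "i \<in> {1..r+s} \<Longrightarrow> b \<in> hom_part R p \<Longrightarrow> null_op i (tens b \<phi>) = tens (dleft R i b) \<phi> + sg (par r i * p) (tens b (ldery r s i \<phi>))"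
  by (simp add: null_op_def dleft_tens hom_carr dery_tens tens_sg)

text \<open>The bracket is 0 already before passing to the quotient: left sesquilinearity makes
  \<open>\<partial>\<^sub>i b\<close> contribute minus a right derivative of the first series, which
  cancels the contribution of the derivative along \<open>y\<^sub>i\<close>.\<close>

lemma tilde_bracket_null_left:
  assumes i: "i \<in> {1..r+s}" and F: "F \<in> tilde r s R" and G: "G \<in> tilde r s R"
  shows "tilde_bracket r s R (null_op i F) G = 0"
  using F
proof (induction rule: tilde_induct)
  case zero
  then show ?case using i G by (simp add: tilde_bracket_zero)
next
  case (add F F')
  then show ?case using i G by (simp add: null_op_add tilde_bracket_add_left null_op_tilde)
next
  case (tens b p \<phi>)
  note b = tens
  note bt = tens_tilde[OF hom_carr[OF b(1)] b(2)]
  show ?case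
    using G
  proof (induction rule: tilde_induct)
    case zero
    then show ?case using i bt by (simp add: tilde_bracket_zero null_op_tilde)
  next
    case (add F F')
    then show ?case using i bt by (simp add: tilde_bracket_add_right null_op_tilde)
  next
    case (tens c q \<psi>)
    note c = tens
    note ct = tens_tilde[OF hom_carr[OF c(1)] c(2)]
    note dl = dleft_hom[OF i b(1)]
    let ?X = "lbr R b c"
    have fin: "finite {J. ?X J \<noteq> 0}" "\<And>J. \<not> adm r s J \<Longrightarrow> ?X J = 0"
      using b(1) c(1) by (auto simp: bracket_finite bracket_unsupported hom_carr)
    have lm: "series_bracket (par r i + (p + q)) (lmul r s i ?X) \<Phi>' \<psi>' = series_bracket (p + q) ?X (rdery r s i \<Phi>') \<psi>'"
      for \<Phi>' \<psi>' :: "mono \<Rightarrow> 'f"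
      by (rule series_bracket_lmul) (use fin i in auto)
    have tw: "rdery r s i (twist_series r (p + par r i) \<phi>) = sg (par r i * p) (twist_series r p (ldery r s i \<phi>))"
    proof -
      have "twist_series r (par r i + (p + par r i)) \<phi> = twist_series r p \<phi>"
        by (rule twist_series_cong) auto
      then show ?thesis by (simp add: rdery_eq ldery_twist_series mult.commute)
    qed
    have "tilde_bracket r s R (tens (dleft R i b) \<phi>) (tens c \<psi>)
        = series_bracket (p + par r i + q) (lbr R (dleft R i b) c) (twist_series r (p + par r i) \<phi>) \<psi>"
      by (rule tilde_bracket_tens[OF dl c(1) b(2) c(2)])
    also have "\<dots> = series_bracket (par r i + (p + q)) (sg 1 (lmul r s i ?X)) (twist_series r (p + par r i) \<phi>) \<psi>"
      using i b(1) c(1) by (simp add: bracket_dleft hom_carr ac_simps) (simp add: sg_def)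
    also have "\<dots> = sg 1 (series_bracket (p + q) ?X (sg (par r i * p) (twist_series r p (ldery r s i \<phi>))) \<psi>)"
      unfolding series_bracket_sg lm tw ..
    finally have 1: "tilde_bracket r s R (tens (dleft R i b) \<phi>) (tens c \<psi>)
        = - sg (par r i * p) (series_bracket (p + q) ?X (twist_series r p (ldery r s i \<phi>)) \<psi>)"
      unfolding series_bracket_sg_series by (simp add: sg_def)
    have 2: "tilde_bracket r s R (sg (par r i * p) (tens b (ldery r s i \<phi>))) (tens c \<psi>)
        = sg (par r i * p) (series_bracket (p + q) ?X (twist_series r p (ldery r s i \<phi>)) \<psi>)"
      unfolding tilde_bracket_sg[OF tens_tilde[OF hom_carr[OF b(1)] supported_ldery] ct]
        tilde_bracket_tens[OF b(1) c(1) supported_ldery c(2)] ..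
    show ?case
      unfolding null_op_tens[OF i b(1)]
        tilde_bracket_add_left[OF tens_tilde[OF hom_carr[OF dl] b(2)] tilde_sg[OF tens_tilde[OF hom_carr[OF b(1)] supported_ldery]] ct] 1 2
      by simp
  qed
qed

text \<open>Right sesquilinearity is phrased with the right action, so the left action on the
  coefficients is converted. The twist by \<open>par r i\<close> accounts for the changed parity of
  the coefficient that the series has to cross.\<close>

lemma dleft_series_bracket:
  assumes i: "i \<in> {1..r+s}" and X: "\<And>J. X J \<in> hom_part R (t + mpar r J)" and fin: "finite {J. X J \<noteq> 0}"
  shows "(\<lambda>M. dleft R i (series_bracket t X (twist_series r (par r i) \<Phi>) \<psi> M)) =
    sg (par r i * t) (series_bracket (t + par r i) (\<lambda>J. dright R i (X J)) \<Phi> \<psi>)"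
proof -
  have dr0: "dright R i 0 = 0" using dright_hom_eq[OF i hom_zero] i by simp
  have *: "(\<lambda>M. dleft R i (tens (X J) (series_mult r s (twist_series r (t + mpar r J) (rderys r s J (twist_series r (par r i) \<Phi>))) \<psi>) M)) =
     sg (par r i * t) (tens (dright R i (X J)) (series_mult r s (twist_series r (t + par r i + mpar r J) (rderys r s J \<Phi>)) \<psi>))" for J
    unfolding dleft_tens[OF i hom_carr[OF X]] dright_hom_eq[OF i X]
    unfolding tens_sg rderys_twist_series
      additive_mapD(4)[OF additive_twist_series] series_mult_sg twist_series_twist sg_sg
    by (rule sg_eqI) (auto simp: ac_simps)
  have "(\<lambda>M. dleft R i (series_bracket t X (twist_series r (par r i) \<Phi>) \<psi> M)) =
      (\<Sum>J | X J \<noteq> 0. (\<lambda>M. dleft R i (tens (X J) (series_mult r s (twist_series r (t + mpar r J) (rderys r s J (twist_series r (par r i) \<Phi>))) \<psi>) M)))"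
    unfolding series_bracket_def
    by (rule ext) (simp add: sum_apply dleft_sum[OF i] tens_def carr_scl hom_carr[OF X])
  also have "\<dots> = sg (par r i * t) (\<Sum>J | X J \<noteq> 0. tens (dright R i (X J)) (series_mult r s (twist_series r (t + par r i + mpar r J) (rderys r s J \<Phi>)) \<psi>))"
    unfolding * sg_sum ..
  also have "(\<Sum>J | X J \<noteq> 0. tens (dright R i (X J)) (series_mult r s (twist_series r (t + par r i + mpar r J) (rderys r s J \<Phi>)) \<psi>))
    = series_bracket (t + par r i) (\<lambda>J. dright R i (X J)) \<Phi> \<psi>"
    by (rule series_bracket_superset[symmetric]) (use fin dr0 in auto)
  finally show ?thesis .
qed

text \<open>Up to a sign and a twist of the first series, the witness for a pair of products is
  their own bracket. Right sesquilinearity supplies \<open>\<partial>\<^sub>i\<close> on the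
  coefficients and a \<open>\<lambda>\<^sub>i\<close>, that is, a derivative of the first series;
  together with the derivative of the second series they make up \<open>null_op\<close> of that
  bracket.\<close>

lemma tilde_bracket_null_right:
  assumes i: "i \<in> {1..r+s}" and F: "F \<in> tilde r s R" and G: "G \<in> tilde r s R"
  shows "\<exists>H\<in>tilde r s R. tilde_bracket r s R F (null_op i G) = null_op i H"
  using F
proof (induction rule: tilde_induct)
  case zero
  then show ?case using i G by (auto simp: tilde_bracket_zero null_op_tilde intro!: bexI[of _ 0])
next
  case (add F F')
  then obtain H H' where "H \<in> tilde r s R" "H' \<in> tilde r s R" "tilde_bracket r s R F (null_op i G) = null_op i H"
    "tilde_bracket r s R F' (null_op i G) = null_op i H'" by blast
  then show ?case using i G add by (auto simp: null_op_add tilde_bracket_add_left null_op_tilde tilde_add intro!: bexI[of _ "H + H'"])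
next
  case (tens b p \<phi>)
  note b = tens
  note bt = tens_tilde[OF hom_carr[OF b(1)] b(2)]
  show ?case
    using G
  proof (induction rule: tilde_induct)
    case zero
    then show ?case using i bt by (auto simp: tilde_bracket_zero intro!: bexI[of _ 0])
  next
    case (add G G')
    then obtain H H' where "H \<in> tilde r s R" "H' \<in> tilde r s R" "tilde_bracket r s R (tens b \<phi>) (null_op i G) = null_op i H"
      "tilde_bracket r s R (tens b \<phi>) (null_op i G') = null_op i H'" by blast
    then show ?case using i bt add by (auto simp: null_op_add tilde_bracket_add_right null_op_tilde tilde_add intro!: bexI[of _ "H + H'"])
  next
    case (tens c q \<psi>)
    note c = tens
    let ?X = "lbr R b c" and ?\<Phi> = "twist_series r p \<phi>" and ?t = "p + q"
    have X: "\<And>J. ?X J \<in> hom_part R (?t + mpar r J)" by (rule bracket_hom[OF b(1) c(1)])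
    have fin: "finite {J. ?X J \<noteq> 0}" "\<And>J. \<not> adm r s J \<Longrightarrow> ?X J = 0"
      using b(1) c(1) by (auto simp: bracket_finite bracket_unsupported hom_carr)
    have dr_hom: "dright R i c \<in> hom_part R (q + par r i)"
      using dleft_hom[OF i c(1)] by (simp add: dright_hom_eq[OF i c(1)] hom_sg)
    have dl_eq: "dleft R i c = sg (par r i * q) (dright R i c)"
      by (simp add: dright_hom_eq[OF i c(1)]) (simp add: sg_def)
    have dr0: "dright R i 0 = 0" using dright_hom_eq[OF i hom_zero] i by simp
    have lm: "series_bracket (par r i + (p + q)) (lmul r s i ?X) \<Phi>' \<psi>' = series_bracket (p + q) ?X (rdery r s i \<Phi>') \<psi>'"
      for \<Phi>' \<psi>' :: "mono \<Rightarrow> 'f"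
      by (rule series_bracket_lmul) (use fin i in auto)
    have fin': "finite {J. dright R i (?X J) \<noteq> 0}"
      by (rule finite_subset[OF _ fin(1)]) (use dr0 in auto)
    \<comment> \<open>The twist undoes the one that the Leibniz rule puts on the first series. The
      sign makes the common factor of all three terms equal to the sign of
      \<open>par r i * q\<close> found on the left-hand side.\<close>
    define H where "H = sg (par r i * q + par r i * ?t) (series_bracket ?t ?X (twist_series r (par r i) ?\<Phi>) \<psi>)"
    have sb_t: "series_bracket ?t ?X \<Phi>' \<psi>' \<in> tilde r s R" for \<Phi>' \<psi>'
      by (intro series_bracket_tilde hom_carr[OF X])
    have "tilde_bracket r s R (tens b \<phi>) (tens (dleft R i c) \<psi>) =
        sg (par r i * q) (series_bracket (p + (q + par r i)) (lbr R b (dright R i c)) ?\<Phi> \<psi>)"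
      unfolding dl_eq tens_sg tilde_bracket_sg[OF bt tens_tilde[OF hom_carr[OF dr_hom] c(2)]]
        tilde_bracket_tens[OF b(1) dr_hom b(2) c(2)] ..
    also have "series_bracket (p + (q + par r i)) (lbr R b (dright R i c)) ?\<Phi> \<psi> =
        series_bracket (?t + par r i) (\<lambda>J. dright R i (?X J)) ?\<Phi> \<psi> + sg (par r i * ?t) (series_bracket ?t ?X (rdery r s i ?\<Phi>) \<psi>)"
      unfolding bracket_dright[OF i b(1) c(1)] lm[symmetric]
      by (subst series_bracket_add) (auto simp: fin' finite_supp_sg finite_supp_lmul fin(1) series_bracket_sg ac_simps)
    finally have 1: "tilde_bracket r s R (tens b \<phi>) (tens (dleft R i c) \<psi>) = sg (par r i * q)
        (series_bracket (?t + par r i) (\<lambda>J. dright R i (?X J)) ?\<Phi> \<psi> + sg (par r i * ?t) (series_bracket ?t ?X (rdery r s i ?\<Phi>) \<psi>))" .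
    have 2: "tilde_bracket r s R (tens b \<phi>) (sg (par r i * q) (tens c (ldery r s i \<psi>))) =
        sg (par r i * q) (series_bracket ?t ?X ?\<Phi> (ldery r s i \<psi>))"
      unfolding tilde_bracket_sg[OF bt tens_tilde[OF hom_carr[OF c(1)] supported_ldery]]
        tilde_bracket_tens[OF b(1) c(1) b(2) supported_ldery] ..
    have lhs: "tilde_bracket r s R (tens b \<phi>) (null_op i (tens c \<psi>)) = sg (par r i * q)
        (series_bracket (?t + par r i) (\<lambda>J. dright R i (?X J)) ?\<Phi> \<psi> + sg (par r i * ?t) (series_bracket ?t ?X (rdery r s i ?\<Phi>) \<psi>)
          + series_bracket ?t ?X ?\<Phi> (ldery r s i \<psi>))"
      unfolding null_op_tens[OF i c(1)]
        tilde_bracket_add_right[OF tens_tilde[OF hom_carr[OF dleft_hom[OF i c(1)]] c(2)] tilde_sg[OF tens_tilde[OF hom_carr[OF c(1)] supported_ldery]] bt] 1 2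
      by (simp add: sg_add)
    have tw: "twist_series r (par r i) (twist_series r (par r i) ?\<Phi>) = ?\<Phi>"
      unfolding twist_series_twist by (rule twist_series_cong) auto
    have "null_op i (series_bracket ?t ?X (twist_series r (par r i) ?\<Phi>) \<psi>) =
        sg (par r i * ?t) (series_bracket (?t + par r i) (\<lambda>J. dright R i (?X J)) ?\<Phi> \<psi>) +
        (series_bracket ?t ?X (rdery r s i ?\<Phi>) \<psi> + sg (par r i * ?t) (series_bracket ?t ?X ?\<Phi> (ldery r s i \<psi>)))"
      unfolding null_op_def dleft_series_bracket[OF i X fin(1)] dery_series_bracket[OF X] tw rdery_eq ..
    then have "null_op i H = sg (par r i * q)
        (series_bracket (?t + par r i) (\<lambda>J. dright R i (?X J)) ?\<Phi> \<psi> + sg (par r i * ?t) (series_bracket ?t ?X (rdery r s i ?\<Phi>) \<psi>)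
          + series_bracket ?t ?X ?\<Phi> (ldery r s i \<psi>))"
      unfolding H_def null_op_sg[OF i sb_t] by (simp only: sg_add sg_sg) (simp add: sg_def algebra_simps)
    moreover have "H \<in> tilde r s R" by (simp add: H_def tilde_sg sb_t)
    ultimately show ?case using lhs by (intro bexI[of _ H]) simp_all
  qed
qed

lemma dery_null_op:
  assumes "F \<in> tilde r s R" and i: "i \<in> {1..r+s}"
  shows "dery r s R j (null_op i F) = sg (par r i * par r j) (null_op i (dery r s R j F))"
  using assms(1)
proof (induction rule: tilde_induct)
  case zero
  then show ?case using i by simp
next
  case (add F G)
  then show ?case using i by (simp add: null_op_add dery_add null_op_tilde dery_tilde sg_add)
next
  case (tens b p \<phi>)
  note dl = dleft_hom[OF i tens(1)]
  have "dery r s R j (null_op i (tens b \<phi>)) =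
     sg (par r j * (p + par r i)) (tens (dleft R i b) (ldery r s j \<phi>)) + sg (par r i * p + par r j * p) (tens b (ldery r s j (ldery r s i \<phi>)))"
    unfolding null_op_tens[OF i tens(1)]
      dery_add[OF tens_tilde[OF hom_carr[OF dl] tens(2)] tilde_sg[OF tens_tilde[OF hom_carr[OF tens(1)] supported_ldery]]]
      dery_sg[OF tens_tilde[OF hom_carr[OF tens(1)] supported_ldery]] dery_tens[OF tens(1)] dery_tens[OF dl] tens_sg
    by simp
  also have "\<dots> = sg (par r i * par r j) (null_op i (dery r s R j (tens b \<phi>)))"
    unfolding dery_tens[OF tens(1)] tens_sg null_op_sg[OF i tens_tilde[OF hom_carr[OF tens(1)] supported_ldery]] null_op_tens[OF i tens(1)]
      supercommuteD[OF supercommute_ldery, of r s j i] sg_add sg_sg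
    by (intro arg_cong2[where f = "(+)"] sg_eqI) (auto simp: sg_def)
  finally show ?case .
qed

lemma tilde_null_eq: "tilde_null r s R = {(\<Sum>i\<in>{1..r+s}. null_op i (F i)) | F. \<forall>i\<in>{1..r+s}. F i \<in> tilde r s R}"
  by (simp add: tilde_null_def null_op_def)

lemma null_op_null: "i \<in> {1..r+s} \<Longrightarrow> F \<in> tilde r s R \<Longrightarrow> null_op i F \<in> tilde_null r s R"
proof -
  assume i: "i \<in> {1..r+s}" and F: "F \<in> tilde r s R"
  have "(\<Sum>j\<in>{1..r+s}. null_op j (if j = i then F else 0)) = (\<Sum>j\<in>{1..r+s}. if j = i then null_op i F else 0)"
    by (rule sum.cong) auto
  also have "\<dots> = null_op i F" using i by (simp only: sum.delta finite_atLeastAtMost if_True)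
  finally show ?thesis
    unfolding tilde_null_eq using F by (intro CollectI exI[of _ "\<lambda>j. if j = i then F else 0"]) auto
qed

lemma null_add:
  assumes "F \<in> tilde_null r s R" "G \<in> tilde_null r s R"
  shows "F + G \<in> tilde_null r s R"
proof -
  obtain f g where "F = (\<Sum>i\<in>{1..r+s}. null_op i (f i))" "G = (\<Sum>i\<in>{1..r+s}. null_op i (g i))"
    "\<forall>i\<in>{1..r+s}. f i \<in> tilde r s R" "\<forall>i\<in>{1..r+s}. g i \<in> tilde r s R"
    using assms unfolding tilde_null_eq by blast
  then have "F + G = (\<Sum>i\<in>{1..r+s}. null_op i (f i + g i))" "\<forall>i\<in>{1..r+s}. f i + g i \<in> tilde r s R"
    by (auto simp: null_op_add sum.distrib tilde_add)
  then show ?thesis unfolding tilde_null_eq by (intro CollectI exI[of _ "\<lambda>i. f i + g i"]) auto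
qed

lemma null_zero [simp]: "0 \<in> tilde_null r s R"
  unfolding tilde_null_eq by (rule CollectI, rule exI[of _ "\<lambda>_. 0"]) simp

lemma fscale_sum: "fscale (scl R) c (\<Sum>i\<in>A. F i) = (\<Sum>i\<in>A. fscale (scl R) c (F i))"
  by (simp add: fscale_def fun_eq_iff sum_apply V.scale_sum_right)

lemma null_scale:
  assumes "F \<in> tilde_null r s R"
  shows "fscale (scl R) c F \<in> tilde_null r s R"
proof -
  obtain f where "F = (\<Sum>i\<in>{1..r+s}. null_op i (f i))" "\<forall>i\<in>{1..r+s}. f i \<in> tilde r s R"
    using assms unfolding tilde_null_eq by blast
  then have "fscale (scl R) c F = (\<Sum>i\<in>{1..r+s}. null_op i (fscale (scl R) c (f i)))" "\<forall>i\<in>{1..r+s}. fscale (scl R) c (f i) \<in> tilde r s R"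
    by (auto simp: fscale_sum null_op_scale tilde_scale)
  then show ?thesis unfolding tilde_null_eq by (intro CollectI exI[of _ "\<lambda>i. fscale (scl R) c (f i)"]) auto
qed

lemma null_minus: "F \<in> tilde_null r s R \<Longrightarrow> - F \<in> tilde_null r s R"
  using null_scale[of F "- 1"] by (simp add: fscale_minus1)

lemma null_diff: "F \<in> tilde_null r s R \<Longrightarrow> G \<in> tilde_null r s R \<Longrightarrow> F - G \<in> tilde_null r s R"
  using null_add[of F "- G"] null_minus[of G] by simp

lemma null_sg: "F \<in> tilde_null r s R \<Longrightarrow> sg n F \<in> tilde_null r s R"
  by (simp add: sg_def null_minus)

lemma null_sum: "(\<And>i. i \<in> A \<Longrightarrow> F i \<in> tilde_null r s R) \<Longrightarrow> (\<Sum>i\<in>A. F i) \<in> tilde_null r s R"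
  by (rule sum_closed) (auto intro: null_add)

lemma null_induct [consumes 1, case_names zero add op]:
  assumes "F \<in> tilde_null r s R" "P 0"
    "\<And>F G. F \<in> tilde_null r s R \<Longrightarrow> G \<in> tilde_null r s R \<Longrightarrow> P F \<Longrightarrow> P G \<Longrightarrow> P (F + G)"
    "\<And>i F. i \<in> {1..r+s} \<Longrightarrow> F \<in> tilde r s R \<Longrightarrow> P (null_op i F)"
  shows "P F"
proof -
  obtain f where f: "F = (\<Sum>i\<in>{1..r+s}. null_op i (f i))" "\<forall>i\<in>{1..r+s}. f i \<in> tilde r s R"
    using assms(1) unfolding tilde_null_eq by blast
  have "(\<Sum>i\<in>{1..r+s}. null_op i (f i)) \<in> {G \<in> tilde_null r s R. P G}"
    by (rule sum_closed) (use assms f in \<open>auto intro: null_add null_op_null\<close>)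
  then show ?thesis using f by simp
qed

lemma null_tilde: "F \<in> tilde_null r s R \<Longrightarrow> F \<in> tilde r s R"
  by (induction rule: null_induct) (auto intro: tilde_add null_op_tilde)

lemma tilde_bracket_null:
  assumes "N \<in> tilde_null r s R" "F \<in> tilde r s R"
  shows "tilde_bracket r s R N F = 0" "tilde_bracket r s R F N \<in> tilde_null r s R"
  using assms(1)
proof (induction rule: null_induct)
  case zero
  case 1 show ?case using assms by (simp add: tilde_bracket_zero)
  case 2 show ?case using assms by (simp add: tilde_bracket_zero)
next
  case (add G G')
  case 1 show ?case using assms add by (simp add: tilde_bracket_add_left null_tilde)
  case 2 show ?case using assms add by (simp add: tilde_bracket_add_right null_tilde null_add)
next
  case (op i G)
  case 1 show ?case using assms op by (simp add: tilde_bracket_null_left)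
  case 2 show ?case using tilde_bracket_null_right[OF op(1) assms(2) op(2)] null_op_null[OF op(1)] by auto
qed

lemma dery_null: "N \<in> tilde_null r s R \<Longrightarrow> dery r s R j N \<in> tilde_null r s R"
proof (induction rule: null_induct)
  case (add F G)
  then show ?case by (simp add: dery_add null_tilde null_add)
next
  case (op i F)
  then show ?case by (simp add: dery_null_op null_sg null_op_null dery_tilde)
qed simp


section \<open>Cosets and the operations on the quotient\<close>

lemma coset_eq_iff: "F +o tilde_null r s R = G +o tilde_null r s R \<longleftrightarrow> F - G \<in> tilde_null r s R"
proof
  assume "F +o tilde_null r s R = G +o tilde_null r s R"
  moreover have "F \<in> F +o tilde_null r s R"
    unfolding elt_set_plus_def using null_zero by (auto intro!: bexI[of _ 0])
  ultimately obtain n where "n \<in> tilde_null r s R" "F = G + n" by (auto simp: elt_set_plus_def)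
  then show "F - G \<in> tilde_null r s R" by simp
next
  assume d: "F - G \<in> tilde_null r s R"
  have "F + n = G + ((F - G) + n)" "G + n = F + (n - (F - G))" for n by simp_all
  then show "F +o tilde_null r s R = G +o tilde_null r s R"
    unfolding elt_set_plus_def using null_add[OF d] null_diff[OF _ d] by blast
qed

lemma coset_memD: "G \<in> F +o tilde_null r s R \<Longrightarrow> G - F \<in> tilde_null r s R"
  by (auto simp: elt_set_plus_def)

lemma coset_self: "F \<in> F +o tilde_null r s R"
  unfolding elt_set_plus_def using null_zero by (auto intro!: bexI[of _ 0])

lemma coset_tilde: "G \<in> F +o tilde_null r s R \<Longrightarrow> F \<in> tilde r s R \<Longrightarrow> G \<in> tilde r s R"
  by (auto simp: elt_set_plus_def intro: tilde_add null_tilde)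

lemma coset_add: "(F +o tilde_null r s R) + (G +o tilde_null r s R) = (F + G) +o tilde_null r s R"
proof -
  have "tilde_null r s R + tilde_null r s R = tilde_null r s R"
    using null_add null_zero by (auto simp: set_plus_def intro: exI[of _ 0] bexI[of _ 0])
  then show ?thesis by (simp add: set_plus_rearrange)
qed

lemma annI: "F \<in> tilde r s R \<Longrightarrow> F +o tilde_null r s R \<in> ann r s R"
  by (auto simp: ann_def)

text \<open>Operations on the quotient are unions over representatives; such a union collapses to
  one coset when the result does not depend on the representative.\<close>

lemma UN_coset:
  assumes "\<And>G. G \<in> F +o tilde_null r s R \<Longrightarrow> T G = C"
  shows "(\<Union>G\<in>F +o tilde_null r s R. T G) = C"
  using assms coset_self[of F] by auto

lemma quot_map_coset:
  assumes "F \<in> tilde r s R" and "\<And>G. G \<in> tilde r s R \<Longrightarrow> G - F \<in> tilde_null r s R \<Longrightarrow> T G - T F \<in> tilde_null r s R"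
  shows "quot_map r s R T (F +o tilde_null r s R) = T F +o tilde_null r s R"
  using assms coset_tilde[OF _ assms(1)]
  by (simp add: quot_map_def annI) (rule UN_coset, simp add: coset_eq_iff coset_memD)

lemma fscale_diff: "fscale (scl R) c (F - G) = fscale (scl R) c F - fscale (scl R) c G"
  by (simp add: fscale_def fun_eq_iff minus_apply V.scale_right_diff_distrib)

lemma ann_scale_coset: "F \<in> tilde r s R \<Longrightarrow> ann_scale r s R c (F +o tilde_null r s R) = fscale (scl R) c F +o tilde_null r s R"
  unfolding ann_scale_def by (rule quot_map_coset) (auto simp: fscale_diff[symmetric] null_scale)

lemma tilde_diff: "F \<in> tilde r s R \<Longrightarrow> G \<in> tilde r s R \<Longrightarrow> F - G \<in> tilde r s R"
  using tilde_add[of F "- G"] tilde_minus[of G] by simp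

lemma tilde_bracket_minus:
  assumes "F \<in> tilde r s R" "G \<in> tilde r s R"
  shows "tilde_bracket r s R (- F) G = - tilde_bracket r s R F G" "tilde_bracket r s R F (- G) = - tilde_bracket r s R F G"
  using tilde_bracket_sg[OF assms, of 1] by (simp_all add: sg_def)

lemma tilde_bracket_diff:
  assumes "F \<in> tilde r s R" "F' \<in> tilde r s R" "G \<in> tilde r s R"
  shows "tilde_bracket r s R (F - F') G = tilde_bracket r s R F G - tilde_bracket r s R F' G"
    "tilde_bracket r s R G (F - F') = tilde_bracket r s R G F - tilde_bracket r s R G F'"
  using tilde_bracket_add_left[OF assms(1) tilde_minus[OF assms(2)] assms(3)] tilde_bracket_add_right[OF assms(1) tilde_minus[OF assms(2)] assms(3)]
  by (simp_all add: tilde_bracket_minus assms)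

lemma ann_bracket_coset:
  assumes F: "F \<in> tilde r s R" and G: "G \<in> tilde r s R"
  shows "ann_bracket r s R (F +o tilde_null r s R) (G +o tilde_null r s R) = tilde_bracket r s R F G +o tilde_null r s R"
  unfolding ann_bracket_def
proof (intro UN_coset)
  fix F' G' assume mem: "F' \<in> F +o tilde_null r s R" "G' \<in> G +o tilde_null r s R"
  note t = coset_tilde[OF mem(1) F] coset_tilde[OF mem(2) G]
  have "tilde_bracket r s R F' G' - tilde_bracket r s R F G =
      tilde_bracket r s R (F' - F) G' + tilde_bracket r s R F (G' - G)"
    using t F G by (simp add: tilde_bracket_diff)
  also have "\<dots> \<in> tilde_null r s R"
    using tilde_bracket_null[OF coset_memD[OF mem(1)] t(2)] tilde_bracket_null[OF coset_memD[OF mem(2)] F] by simp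
  finally show "tilde_bracket r s R F' G' +o tilde_null r s R = tilde_bracket r s R F G +o tilde_null r s R"
    by (simp add: coset_eq_iff)
qed

section \<open>Combinations of the derivations along the variables y\<close>

definition dery_comb :: "(nat \<Rightarrow> 'f) \<Rightarrow> (mono \<Rightarrow> 'v) \<Rightarrow> mono \<Rightarrow> 'v" where
  "dery_comb c F = (\<Sum>i\<in>{1..r+s}. fscale (scl R) (c i) (dery r s R i F))"

lemma fscale_add: "fscale (scl R) c (F + G) = fscale (scl R) c F + fscale (scl R) c G"
  by (simp add: fscale_def fun_eq_iff plus_fun_apply V.scale_right_distrib)

lemma dery_comb_add: "F \<in> tilde r s R \<Longrightarrow> G \<in> tilde r s R \<Longrightarrow> dery_comb c (F + G) = dery_comb c F + dery_comb c G"
  by (simp add: dery_comb_def dery_add fscale_add sum.distrib)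

lemma fscale_fscale: "fscale (scl R) c (fscale (scl R) d F) = fscale (scl R) (c * d) F"
  by (simp add: fscale_def)

lemma dery_comb_scale: "F \<in> tilde r s R \<Longrightarrow> dery_comb c (fscale (scl R) d F) = fscale (scl R) d (dery_comb c F)"
  by (simp add: dery_comb_def dery_scale fscale_sum fscale_fscale mult.commute)

lemma dery_comb_tilde: "F \<in> tilde r s R \<Longrightarrow> dery_comb c F \<in> tilde r s R"
  unfolding dery_comb_def by (intro tilde_sum tilde_scale dery_tilde)

lemma dery_comb_null: "F \<in> tilde_null r s R \<Longrightarrow> dery_comb c F \<in> tilde_null r s R"
  unfolding dery_comb_def by (intro null_sum null_scale dery_null)

lemma dery_comb_diff:
  assumes "F \<in> tilde r s R" "G \<in> tilde r s R"
  shows "dery_comb c (F - G) = dery_comb c F - dery_comb c G"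
  using dery_comb_add[of F "- G" c] dery_comb_scale[of G c "- 1"] assms tilde_minus[of G] by (simp add: fscale_minus1)

lemma quot_dery_comb: "F \<in> tilde r s R \<Longrightarrow> quot_map r s R (dery_comb c) (F +o tilde_null r s R) = dery_comb c F +o tilde_null r s R"
  by (rule quot_map_coset) (auto simp: dery_comb_diff[symmetric] dery_comb_null)

lemma dery_hom:
  assumes "\<And>M. F M \<in> hom_part R (q + mpar r M)"
  shows "dery r s R i F M \<in> hom_part R (par r i + q + mpar r M)"
proof -
  have "F (M + {#i#}) \<in> hom_part R (q + mpar r (M + {#i#}))" by (rule assms)
  then have *: "F (add_mset i M) \<in> hom_part R (par r i + q + mpar r M)"
    by (simp add: ac_simps)
  show ?thesis
    unfolding dery_def by (auto intro!: hom_scl hom_sg hom_zero simp: twist_hom[OF *] *)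
qed

lemma dery_comb_hom:
  assumes "\<And>M. F M \<in> hom_part R (q + mpar r M)" and "\<And>i. c i \<noteq> 0 \<Longrightarrow> even (par r i + p)"
  shows "dery_comb c F M \<in> hom_part R (p + q + mpar r M)"
  unfolding dery_comb_def sum_apply
proof (rule hom_sum)
  fix i
  show "fscale (scl R) (c i) (dery r s R i F) M \<in> hom_part R (p + q + mpar r M)"
  proof (cases "c i = 0")
    case False
    then have "hom_part R (p + q + mpar r M) = hom_part R (par r i + q + mpar r M)"
      using assms(2)[OF False] by (intro hom_cong) auto
    then show ?thesis using dery_hom[OF assms(1)] by (simp add: fscale_def hom_scl)
  qed (simp add: fscale_def hom_zero)
qed

lemma dery_comb_bracket:
  assumes F: "F \<in> tilde r s R" "\<And>M. F M \<in> hom_part R (q + mpar r M)" and G: "G \<in> tilde r s R"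
    and c: "\<And>i. c i \<noteq> 0 \<Longrightarrow> even (par r i + p)"
  shows "dery_comb c (tilde_bracket r s R F G) =
    tilde_bracket r s R (dery_comb c F) G + sg (p * q) (tilde_bracket r s R F (dery_comb c G))"
proof -
  have sumL: "tilde_bracket r s R (\<Sum>i\<in>A. f i) G = (\<Sum>i\<in>A. tilde_bracket r s R (f i) G)"
    if "\<And>i. f i \<in> tilde r s R" for A :: "nat set" and f
    by (induction A rule: infinite_finite_induct) (auto simp: that G tilde_bracket_zero tilde_bracket_add_left tilde_sum)
  have sumR: "tilde_bracket r s R F (\<Sum>i\<in>A. f i) = (\<Sum>i\<in>A. tilde_bracket r s R F (f i))"
    if "\<And>i. f i \<in> tilde r s R" for A :: "nat set" and f
    by (induction A rule: infinite_finite_induct) (auto simp: that F tilde_bracket_zero tilde_bracket_add_right tilde_sum)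
  have "fscale (scl R) (c i) (sg (par r i * q) H) = sg (p * q) (fscale (scl R) (c i) H)" for i and H :: "mono \<Rightarrow> 'v"
  proof (cases "c i = 0")
    case False
    then have "sg (par r i * q) H = sg (p * q) H" using c[of i] by (intro sg_eqI) auto
    then show ?thesis by (simp add: fscale_def sg_fun scl_sg)
  qed (simp add: fscale_def sg_fun)
  then show ?thesis
    unfolding dery_comb_def
    using F G by (simp add: dery_tilde_bracket[OF F G] fscale_add sum.distrib sumL sumR tilde_scale dery_tilde tilde_bracket_scale sg_sum)
qed

lemma fscale_power_minus1: "fscale (scl R) ((- 1) ^ n) F = sg n F"
  by (cases "even n") (auto simp: sg_def fscale_minus1, simp add: fscale_def)

text \<open>Only indices of parity \<open>p\<close> carry a nonzero coefficient, so the combination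
  is homogeneous of parity \<open>p\<close> and the Leibniz signs of its summands coincide.\<close>

lemma ann_superder_dery_comb:
  assumes c: "\<And>i. c i \<noteq> 0 \<Longrightarrow> even (par r i + p)"
  shows "ann_superder r s R p (quot_map r s R (dery_comb c))"
  unfolding ann_superder_def
proof (intro conjI ballI allI)
  show "quot_map r s R (dery_comb c) \<in> ann r s R \<rightarrow>\<^sub>E ann r s R"
  proof
    fix X assume "X \<in> ann r s R"
    then show "quot_map r s R (dery_comb c) X \<in> ann r s R"
      by (auto simp: ann_def quot_dery_comb dery_comb_tilde)
  qed (simp add: quot_map_def)
next
  fix X Y assume "X \<in> ann r s R" "Y \<in> ann r s R"
  then show "quot_map r s R (dery_comb c) (X + Y) = quot_map r s R (dery_comb c) X + quot_map r s R (dery_comb c) Y"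
    by (auto simp: ann_def coset_add quot_dery_comb dery_comb_add tilde_add)
next
  fix d X assume "X \<in> ann r s R"
  then show "quot_map r s R (dery_comb c) (ann_scale r s R d X) = ann_scale r s R d (quot_map r s R (dery_comb c) X)"
    by (auto simp: ann_def ann_scale_coset quot_dery_comb dery_comb_scale tilde_scale dery_comb_tilde)
next
  fix q X assume "X \<in> ann_parity r s R q"
  then obtain F where F: "X = F +o tilde_null r s R" "F \<in> tilde r s R" "\<And>M. F M \<in> hom_part R (q + mpar r M)"
    by (auto simp: ann_parity_def)
  then show "quot_map r s R (dery_comb c) X \<in> ann_parity r s R (p + q)"
    using dery_comb_hom[OF F(3) c] dery_comb_tilde[OF F(2)] by (auto simp: ann_parity_def quot_dery_comb)
next
  fix q X Y assume "X \<in> ann_parity r s R q" "Y \<in> ann r s R"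
  then obtain F G where F: "X = F +o tilde_null r s R" "F \<in> tilde r s R" "\<And>M. F M \<in> hom_part R (q + mpar r M)"
    and G: "Y = G +o tilde_null r s R" "G \<in> tilde r s R"
    by (auto simp: ann_parity_def ann_def)
  then show "quot_map r s R (dery_comb c) (ann_bracket r s R X Y) = ann_bracket r s R (quot_map r s R (dery_comb c) X) Y +
      ann_scale r s R ((- 1) ^ (p * q)) (ann_bracket r s R X (quot_map r s R (dery_comb c) Y))"
    by (simp add: ann_bracket_coset quot_dery_comb tilde_bracket_tilde dery_comb_tilde ann_scale_coset coset_add
      fscale_power_minus1 dery_comb_bracket[OF F(2,3) G(2) c])
qed

lemma ann_D_eq: "ann_D r s R = range (\<lambda>c. quot_map r s R (dery_comb c))"
  by (auto simp: ann_D_def dery_comb_def[abs_def])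

lemma ann_D_subset_ann_der: "ann_D r s R \<subseteq> ann_der r s R"
proof
  fix \<delta> assume "\<delta> \<in> ann_D r s R"
  then obtain c where \<delta>: "\<delta> = quot_map r s R (dery_comb c)" by (auto simp: ann_D_eq)
  \<comment> \<open>Membership in \<open>ann_der\<close> asks for an even plus an odd
    superderivation, so the coefficients are separated by the parity of their index.\<close>
  define c0 c1 where "c0 i = (if i \<le> r then c i else 0)" and "c1 i = (if i \<le> r then 0 else c i)" for i
  have split: "dery_comb c F = dery_comb c0 F + dery_comb c1 F" for F
    unfolding dery_comb_def sum.distrib[symmetric]
    by (rule sum.cong) (auto simp: c0_def c1_def fscale_def fun_eq_iff plus_fun_apply)
  have "\<delta> = (\<lambda>X\<in>ann r s R. quot_map r s R (dery_comb c0) X + quot_map r s R (dery_comb c1) X)"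
  proof
    fix X
    show "\<delta> X = (\<lambda>X\<in>ann r s R. quot_map r s R (dery_comb c0) X + quot_map r s R (dery_comb c1) X) X"
    proof (cases "X \<in> ann r s R")
      case True
      then obtain F where "F \<in> tilde r s R" "X = F +o tilde_null r s R" by (auto simp: ann_def)
      with True show ?thesis by (simp add: \<delta> quot_dery_comb coset_add split)
    qed (simp add: \<delta> quot_map_def)
  qed
  moreover have "ann_superder r s R 0 (quot_map r s R (dery_comb c0))"
    by (rule ann_superder_dery_comb) (auto simp: c0_def split: if_splits)
  moreover have "ann_superder r s R 1 (quot_map r s R (dery_comb c1))"
    by (rule ann_superder_dery_comb) (auto simp: c1_def split: if_splits)
  ultimately show "\<delta> \<in> ann_der r s R" unfolding ann_der_def by blast
qed

end

section \<open>The gradation of \<open>RW(r, s)\<close>\<close>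

lemma conformal_superalgebra_RW: "conformal_superalgebra r s (RW r s :: ('f::field_char_0, 'f rw) lcs)"
  by unfold_locales (rule super_bimodule_RW bracket_bilinear_RW sesquilinear_RW)+

lemma RW_grade_iff: "x \<in> RW_grade r s d \<longleftrightarrow> x \<in> RW_carrier r s \<and> (\<forall>K j. x K j \<noteq> 0 \<longrightarrow> d = - 2 - 2 * int (size K))"
  by (auto simp: RW_grade_def fun_eq_iff zero_fun_apply)

lemma RW_grade_zero [simp]: "0 \<in> RW_grade r s d"
  by (simp add: RW_grade_iff zero_fun_apply)

lemma RW_grade_add: "x \<in> RW_grade r s d \<Longrightarrow> y \<in> RW_grade r s d \<Longrightarrow> x + y \<in> RW_grade r s d"
proof -
  assume x: "x \<in> RW_grade r s d" and y: "y \<in> RW_grade r s d"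
  have "x K j \<noteq> 0 \<or> y K j \<noteq> 0" if "(x + y) K j \<noteq> 0" for K j
    using that by (auto simp: plus_fun_apply)
  then show ?thesis
    using x y RW_carrier_add[of x r s y] unfolding RW_grade_iff by blast
qed

lemma RW_grade_scale: "x \<in> RW_grade r s d \<Longrightarrow> RW_scale c x \<in> RW_grade r s d"
  by (simp add: RW_grade_iff RW_carrier_scale RW_scale_apply)

lemma RW_grade_sg: "x \<in> RW_grade r s d \<Longrightarrow> sg n x \<in> RW_grade r s d"
  using RW_grade_scale[of x r s d "- 1"] by (simp add: sg_def RW_scale_minus1)

lemma RW_grade_lmul:
  assumes "x \<in> RW_grade r s d"
  shows "lmul r s i x \<in> RW_grade r s (d - 2)"
proof -
  have "d - 2 = - 2 - 2 * int (size K)" if "lmul r s i x K j \<noteq> 0" for K j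
  proof -
    have "i \<in># K" using that by (auto simp: lmul_def zero_fun_apply split: if_splits)
    then obtain L where K: "K = add_mset i L" by (metis insert_DiffM)
    have "x L j \<noteq> 0" using that by (auto simp: K lmul_add_mset sg_apply zero_fun_apply split: if_splits)
    then show ?thesis using assms by (auto simp: RW_grade_iff K)
  qed
  then show ?thesis using assms by (simp add: RW_grade_iff RW_carrier_lmul)
qed

lemma poly_grade_RW: "poly_grade r s (RW r s) (RW_grade r s) d =
    {F \<in> polys r s (RW_carrier r s). \<forall>K. F K \<in> RW_grade r s (d + 2 * int (size K))}"
  by (simp add: poly_grade_def)

lemma poly_grade_RW_add:
  "F \<in> poly_grade r s (RW r s) (RW_grade r s) d \<Longrightarrow> G \<in> poly_grade r s (RW r s) (RW_grade r s) d \<Longrightarrow>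
    F + G \<in> poly_grade r s (RW r s) (RW_grade r s) d"
  by (simp add: poly_grade_RW polys_RW_add plus_fun_apply RW_grade_add)

lemma poly_grade_RW_scale:
  "F \<in> poly_grade r s (RW r s) (RW_grade r s) d \<Longrightarrow> fscale RW_scale c F \<in> poly_grade r s (RW r s) (RW_grade r s) d"
  by (auto simp: poly_grade_RW polys_def fscale_def RW_grade_scale RW_carrier_scale additive_mapD(2)[OF additive_RW_scale]
      elim!: rev_finite_subset)

lemma poly_grade_RW_zero [simp]: "0 \<in> poly_grade r s (RW r s) (RW_grade r s) d"
  by (simp add: poly_grade_RW polys_def zero_fun_apply)

lemma poly_grade_RW_minus:
  "F \<in> poly_grade r s (RW r s) (RW_grade r s) d \<Longrightarrow> - F \<in> poly_grade r s (RW r s) (RW_grade r s) d"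
  using poly_grade_RW_scale[of F r s d "- 1"] by (simp add: fscale_RW_scale_simps)

lemma poly_grade_RW_sg:
  "F \<in> poly_grade r s (RW r s) (RW_grade r s) d \<Longrightarrow> sg n F \<in> poly_grade r s (RW r s) (RW_grade r s) d"
  by (simp add: sg_def poly_grade_RW_minus)

lemma poly_grade_RW_const: "x \<in> RW_grade r s d \<Longrightarrow> const x \<in> poly_grade r s (RW r s) (RW_grade r s) d"
  by (auto simp: poly_grade_RW polys_def const_apply RW_grade_iff zero_fun_apply)

lemma poly_grade_RW_lmul:
  assumes "F \<in> poly_grade r s (RW r s) (RW_grade r s) d"
  shows "lmul r s i F \<in> poly_grade r s (RW r s) (RW_grade r s) (d - 2)"
proof -
  have "lmul r s i F K \<in> RW_grade r s (d - 2 + 2 * int (size K))" for K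
  proof (cases "i \<in># K")
    case True
    then obtain L where K: "K = add_mset i L" by (metis insert_DiffM)
    have "F L \<in> RW_grade r s (d + 2 * int (size L))" using assms by (simp add: poly_grade_RW)
    then show ?thesis by (simp add: K lmul_add_mset RW_grade_sg)
  qed (simp add: lmul_notin)
  then show ?thesis using assms by (simp add: poly_grade_RW polys_RW_lmul)
qed

lemma poly_grade_RW_lift:
  assumes "F \<in> poly_grade r s (RW r s) (RW_grade r s) d"
  shows "lift r i (lmul r s i) F \<in> poly_grade r s (RW r s) (RW_grade r s) (d - 2)"
proof -
  have "lift r i (lmul r s i) F K \<in> RW_grade r s (d - 2 + 2 * int (size K))" for K
    using assms RW_grade_lmul[of "F K" r s "d + 2 * int (size K)" i]
    by (simp add: poly_grade_RW lift_def RW_grade_sg algebra_simps)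
  then show ?thesis using assms by (simp add: poly_grade_RW polys_RW_lift)
qed

lemma ops_degree:
  assumes "\<And>d i F. F \<in> S d \<Longrightarrow> T i F \<in> S (d - 2)" and "F \<in> S (d :: int)"
  shows "ops T K F \<in> S (d - 2 * int (size K))"
proof -
  have "foldr T xs F \<in> S (d - 2 * int (length xs))" for xs
  proof (induction xs)
    case (Cons x xs)
    then show ?case using assms(1)[of "foldr T xs F" "d - 2 * int (length xs)" x] by (simp add: algebra_simps)
  qed (simp add: assms(2))
  from this[of "sorted_list_of_multiset K"] show ?thesis
    by (simp add: ops_def) (metis mset_sorted_list_of_multiset size_mset)
qed

lemma RW_gen_grade: "i \<in> {1..r+s} \<Longrightarrow> RW_gen i \<in> RW_grade r s (- 2)"
  by (auto simp: RW_grade_iff RW_gen_carrier) (auto simp: RW_gen_def const_def zero_fun_apply split: if_splits)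

lemma RW_mon_bracket_grade:
  assumes "i \<in> {1..r+s}" "j \<in> {1..r+s}"
  shows "RW_mon_bracket r s K i L j \<in> poly_grade r s (RW r s) (RW_grade r s) (- 4 - 2 * int (size L) - 2 * int (size K))"
proof -
  have "RW_gen_bracket r s i j \<in> poly_grade r s (RW r s) (RW_grade r s) (- 4)"
    unfolding RW_gen_bracket_def
    using poly_grade_RW_const[OF RW_grade_lmul[OF RW_gen_grade[OF assms(2)], of i]]
      poly_grade_RW_lmul[OF poly_grade_RW_const[OF RW_gen_grade[OF assms(2)]], of i]
      poly_grade_RW_lmul[OF poly_grade_RW_const[OF RW_gen_grade[OF assms(1)]], of j]
    by (intro poly_grade_RW_add poly_grade_RW_sg) simp_all
  then show ?thesis
    unfolding RW_mon_bracket_def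
    by (intro poly_grade_RW_sg ops_degree poly_grade_RW_minus poly_grade_RW_lmul poly_grade_RW_add poly_grade_RW_lift)
qed

lemma RW_bracket_grade:
  fixes x y :: "'f::field rw"
  assumes x: "x \<in> RW_grade r s d" and y: "y \<in> RW_grade r s e"
  shows "RW_bracket r s x y \<in> poly_grade r s (RW r s) (RW_grade r s) (d + e)"
proof -
  let ?S = "poly_grade r s (RW r s) (RW_grade r s) (d + e)"
  have tm: "fscale RW_scale (x K i * y L j) (RW_mon_bracket r s K i L j) \<in> ?S"
    if "i \<in> {1..r+s}" "j \<in> {1..r+s}" for K i L j
  proof (cases "x K i = 0 \<or> y L j = 0")
    case True
    then show ?thesis by (auto simp: fscale_RW_scale_simps)
  next
    case False
    then have "d + e = - 4 - 2 * int (size L) - 2 * int (size K)" using x y unfolding RW_grade_iff by fastforce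
    then show ?thesis using RW_mon_bracket_grade[OF that, of K L] by (intro poly_grade_RW_scale) simp
  qed
  have "finite {K. x K \<noteq> 0}" "finite {K. y K \<noteq> 0}" using x y by (auto simp: RW_grade_def RW_carrier_finite)
  then have "RW_bracket r s x y = (\<Sum>K | x K \<noteq> 0. \<Sum>i\<in>{1..r+s}. \<Sum>L | y L \<noteq> 0. \<Sum>j\<in>{1..r+s}.
    fscale RW_scale (x K i * y L j) (RW_mon_bracket r s K i L j))"
    by (intro RW_bracket_superset) auto
  also have "\<dots> \<in> ?S"
    using tm by (intro sum_closed poly_grade_RW_zero poly_grade_RW_add)
  finally show ?thesis .
qed

lemma vector_space_fscale_RW: "vector_space (fscale RW_scale :: 'f::field \<Rightarrow> _)"
  by standard (auto simp: fscale_def RW_scale_def fun_eq_iff algebra_simps plus_fun_apply)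

lemma subspace_fscale_RW_iff:
  "module.subspace (fscale RW_scale :: 'f::field \<Rightarrow> _) S \<longleftrightarrow> 0 \<in> S \<and> (\<forall>x\<in>S. \<forall>y\<in>S. x + y \<in> S) \<and> (\<forall>c. \<forall>x\<in>S. fscale RW_scale c x \<in> S)"
  by (rule module.subspace_def[OF vector_space_fscale_RW[folded module_iff_vector_space]])

lemma direct_decomp_RW:
  "direct_decomp (fscale RW_scale) (polys r s (RW_carrier r s)) (poly_grade r s (RW r s :: ('f::field, 'f rw) lcs) (RW_grade r s))"
  unfolding direct_decomp_def
proof (intro conjI allI ballI)
  fix d
  show "module.subspace (fscale RW_scale) (poly_grade r s (RW r s :: ('f, 'f rw) lcs) (RW_grade r s) d)"
    by (simp add: subspace_fscale_RW_iff poly_grade_RW_add poly_grade_RW_scale)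
  show "poly_grade r s (RW r s :: ('f, 'f rw) lcs) (RW_grade r s) d \<subseteq> polys r s (RW_carrier r s)"
    by (auto simp: poly_grade_RW)
next
  fix F :: "mono \<Rightarrow> 'f rw" assume F: "F \<in> polys r s (RW_carrier r s)"
  \<comment> \<open>The degree of \<open>\<lambda>\<^sub>K \<partial>\<^sub>M a\<^sub>j\<close>.
    Every such monomial is homogeneous, so the components of \<open>F\<close> arise by selecting
    coefficients.\<close>
  define deg where "deg = (\<lambda>(K :: mono, M :: mono). - 2 - 2 * int (size M) - 2 * int (size K))"
  define f where "f d = (\<lambda>K M j. if d = deg (K, M) then F K M j else 0)" for d
  have FK: "F K \<in> RW_carrier r s" "\<not> adm r s K \<Longrightarrow> F K = 0" "finite {K. F K \<noteq> 0}" for K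
    using F by (auto simp: polys_def)
  have fK: "f d K \<in> RW_carrier r s" for d K
    using FK(1)[of K] unfolding RW_carrier_iff
    by (auto simp: f_def fun_eq_iff zero_fun_apply elim!: rev_finite_subset split: if_splits)
  have f_grade: "f d \<in> poly_grade r s (RW r s) (RW_grade r s) d" for d
  proof -
    have "finite {K. f d K \<noteq> 0}" by (rule finite_subset[OF _ FK(3)]) (auto simp: f_def fun_eq_iff zero_fun_apply)
    then show ?thesis
      using fK FK(2) by (auto simp: poly_grade_RW polys_def RW_grade_iff) (auto simp: f_def deg_def fun_eq_iff zero_fun_apply split: if_splits)
  qed
  have fin: "finite {d. f d \<noteq> 0}"
  proof (rule finite_subset)
    show "{d. f d \<noteq> 0} \<subseteq> deg ` (SIGMA K:{K. F K \<noteq> 0}. {M. F K M \<noteq> 0})"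
    proof
      fix d assume "d \<in> {d. f d \<noteq> 0}"
      then obtain K M j where "f d K M j \<noteq> 0" by (auto simp: fun_eq_iff zero_fun_apply)
      then have "d = deg (K, M)" "F K M j \<noteq> 0" by (auto simp: f_def split: if_splits)
      then show "d \<in> deg ` (SIGMA K:{K. F K \<noteq> 0}. {M. F K M \<noteq> 0})"
        by (intro image_eqI[of _ _ "(K, M)"]) (auto simp: fun_eq_iff zero_fun_apply)
    qed
    show "finite (deg ` (SIGMA K:{K. F K \<noteq> 0}. {M. F K M \<noteq> 0}))"
      using FK(3) RW_carrier_finite[OF FK(1)] by (intro finite_imageI finite_SigmaI)
  qed
  \<comment> \<open>In any decomposition only the component of degree \<open>deg (K, M)\<close> can
    be nonzero at \<open>K\<close>, \<open>M\<close>. Each coefficient of \<open>F\<close> thus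
    determines one coefficient of one component, which gives uniqueness.\<close>
  have comp: "F K M j = g (deg (K, M)) K M j"
    if g: "\<And>d. g d \<in> poly_grade r s (RW r s) (RW_grade r s) d" "finite {d. g d \<noteq> 0}" "F = Sum_any g" for g K M j
  proof -
    have "F K M j = (\<Sum>d | g d \<noteq> 0. g d K M j)" by (simp add: g(3) Sum_any.expand_set sum_apply)
    also have "\<dots> = (\<Sum>d | g d \<noteq> 0. if d = deg (K, M) then g (deg (K, M)) K M j else 0)"
    proof (rule sum.cong)
      fix d
      have "g d K \<in> RW_grade r s (d + 2 * int (size K))" using g(1)[of d] by (simp add: poly_grade_RW)
      then show "g d K M j = (if d = deg (K, M) then g (deg (K, M)) K M j else 0)"
        by (auto simp: RW_grade_iff deg_def)
    qed simp
    also have "\<dots> = g (deg (K, M)) K M j"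
      using g(2) by (auto simp: zero_fun_apply)
    finally show ?thesis .
  qed
  have F_sum: "F = Sum_any f"
  proof (intro ext)
    fix K M j
    have "Sum_any f K M j = (\<Sum>d | f d \<noteq> 0. if d = deg (K, M) then F K M j else 0)"
      by (simp add: Sum_any.expand_set sum_apply) (simp add: f_def)
    also have "\<dots> = F K M j"
      using fin by (auto simp: sum.delta) (simp add: f_def fun_eq_iff zero_fun_apply, metis)
    finally show "F K M j = Sum_any f K M j" ..
  qed
  show "\<exists>!f. (\<forall>d. f d \<in> poly_grade r s (RW r s) (RW_grade r s) d) \<and> finite {d. f d \<noteq> 0} \<and> F = Sum_any f"
  proof (intro ex1I[of _ f])
    show "(\<forall>d. f d \<in> poly_grade r s (RW r s) (RW_grade r s) d) \<and> finite {d. f d \<noteq> 0} \<and> F = Sum_any f"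
      using f_grade fin F_sum by simp
    fix g assume g: "(\<forall>d. g d \<in> poly_grade r s (RW r s) (RW_grade r s) d) \<and> finite {d. g d \<noteq> 0} \<and> F = Sum_any g"
    show "g = f"
    proof (intro ext)
      fix d K M j
      have "g d K \<in> RW_grade r s (d + 2 * int (size K))" using g by (simp add: poly_grade_RW)
      then show "g d K M j = f d K M j"
        using comp[of g K M j] g by (auto simp: f_def RW_grade_iff deg_def)
    qed
  qed
qed

lemma z_graded_RW: "z_graded r s (RW r s :: ('f::field, 'f rw) lcs) (RW_grade r s)"
proof -
  have split: "(RW_grade r s d :: 'f rw set) = {x + y | x y. x \<in> RW_grade r s d \<inter> RW_parity r s 0 \<and> y \<in> RW_grade r s d \<inter> RW_parity r s 1}"
    for d
  proof (intro equalityI subsetI)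
    fix x :: "'f rw" assume x: "x \<in> RW_grade r s d"
    let ?y = "(\<lambda>K j. if even (mpar r K + par r j) then x K j else 0) :: 'f rw"
    let ?z = "(\<lambda>K j. if even (mpar r K + par r j) then 0 else x K j) :: 'f rw"
    have car: "x \<in> RW_carrier r s" using x by (simp add: RW_grade_def)
    have "finite {K. ?y K \<noteq> 0}" "finite {K. ?z K \<noteq> 0}"
      by (rule finite_subset[OF _ RW_carrier_finite[OF car]]; auto simp: fun_eq_iff zero_fun_apply)+
    then have "?y \<in> RW_grade r s d \<inter> RW_parity r s 0" "?z \<in> RW_grade r s d \<inter> RW_parity r s 1"
      using x car by (auto simp: RW_grade_iff RW_parity_iff RW_carrier_iff split: if_splits)
    moreover have "x = ?y + ?z" by (auto simp: fun_eq_iff plus_fun_apply)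
    ultimately show "x \<in> {x + y | x y. x \<in> RW_grade r s d \<inter> RW_parity r s 0 \<and> y \<in> RW_grade r s d \<inter> RW_parity r s 1}"
      by blast
  qed (auto intro: RW_grade_add)
  show ?thesis
    unfolding z_graded_def RW_simps carr_RW
    using direct_decomp_RW split
    by (intro conjI allI ballI) (auto simp: subspace_RW_iff RW_grade_add RW_grade_scale RW_grade_lmul RW_bracket_grade)
qed

section \<open>The annihilation algebra of \<open>RW(r, s)\<close>\<close>

locale RW_superalgebra =
  fixes r s :: nat and R :: "('f::field_char_0, 'f rw) lcs"
  assumes R_def: "R = RW r s"

sublocale RW_superalgebra \<subseteq> conformal_superalgebra r s R
  by (simp add: R_def conformal_superalgebra_RW)

context RW_superalgebra
begin

lemma R_simps: "scl R = RW_scale" "carr R = RW_carrier r s" "hom_part R p = RW_parity r s p"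
  "dleft R = lmul r s" "lbr R = RW_bracket r s"
  by (simp_all add: R_def)

text \<open>The values of \<open>F\<close> lie in the span of finitely many vectors, and each of
  these involves only finitely many \<open>\<partial>\<^sub>K\<close>.\<close>

lemma tilde_finite_support:
  assumes "F \<in> tilde r s R"
  shows "finite {K. \<exists>M. F M K \<noteq> 0}"
proof -
  obtain B where B: "finite B" "B \<subseteq> carr R" "range F \<subseteq> V.span B" using assms by (auto simp: tilde_def)
  define S where "S = (\<Union>b\<in>B. {K. b K \<noteq> 0})"
  have "finite S" using B by (auto simp: S_def R_simps intro!: RW_carrier_finite)
  have "V.subspace {x. \<forall>K. K \<notin> S \<longrightarrow> x K = 0}"
    by (rule V.subspaceI) (auto simp: R_simps plus_fun_apply zero_fun_apply RW_scale_def fun_eq_iff)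
  then have "V.span B \<subseteq> {x. \<forall>K. K \<notin> S \<longrightarrow> x K = 0}"
    by (intro V.span_minimal) (auto simp: S_def)
  then have "{K. \<exists>M. F M K \<noteq> 0} \<subseteq> S" using B(3) by auto
  with \<open>finite S\<close> show ?thesis by (rule finite_subset[rotated])
qed

section \<open>Representatives built from the generators\<close>

lemma tilde_mon_expand:
  assumes "F \<in> tilde r s R"
  shows "F = (\<Sum>K | \<exists>M. F M K \<noteq> 0. \<Sum>j\<in>{1..r+s}. tens (RW_mon K j) (\<lambda>M. F M K j))"
proof (intro ext)
  fix M L l
  have car: "F M \<in> RW_carrier r s" for M using tildeD(1)[OF assms] by (simp add: R_simps)
  have "tens (RW_mon K j) (\<lambda>M. F M K j) M L l = (if j = l then (if K = L then F M K j else 0) else 0)" for K j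
    by (auto simp: tens_def R_simps RW_scale_def RW_mon_def)
  then have "(\<Sum>K | \<exists>M. F M K \<noteq> 0. \<Sum>j\<in>{1..r+s}. tens (RW_mon K j) (\<lambda>M. F M K j)) M L l =
    (\<Sum>K | \<exists>M. F M K \<noteq> 0. \<Sum>j\<in>{1..r+s}. if j = l then (if K = L then F M K j else 0) else 0)"
    by (simp only: sum_apply)
  also have "\<dots> = (\<Sum>K | \<exists>M. F M K \<noteq> 0. if K = L then (if l \<in> {1..r+s} then F M L l else 0) else 0)"
    by (intro sum.cong refl) (simp add: sum.delta)
  also have "\<dots> = F M L l"
  proof (cases "F M L l = 0")
    case False
    then have "l \<in> {1..r+s}" "F M L \<noteq> 0" using car[of M] by (auto simp: RW_carrier_iff zero_fun_apply fun_eq_iff)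
    then show ?thesis using tilde_finite_support[OF assms] by (subst sum.delta) auto
  qed (auto intro!: sum.neutral)
  finally show "F M L l = (\<Sum>K | \<exists>M. F M K \<noteq> 0. \<Sum>j\<in>{1..r+s}. tens (RW_mon K j) (\<lambda>M. F M K j)) M L l" ..
qed

text \<open>Modulo \<open>\<partial>\<^sub>i + \<partial>\<^bsub>y\<^sub>i\<^esub>\<close>, each \<open>\<partial>\<^sub>i\<close> in front of a generator is traded for \<open>-\<partial>\<^bsub>y\<^sub>i\<^esub>\<close> on the power series.\<close>

lemma tens_mon_reduce:
  assumes "adm r s K" "j \<in> {1..r+s}" "supported \<phi>"
  shows "\<exists>\<phi>'. supported \<phi>' \<and> tens (RW_mon K j) \<phi> - tens (RW_gen j) \<phi>' \<in> tilde_null r s R \<and>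
    (\<forall>M. \<phi>' M \<noteq> 0 \<longrightarrow> (\<exists>M'. \<phi> M' \<noteq> 0 \<and> size M' = size M + size K))"
  using assms(1,3)
proof (induction K arbitrary: \<phi>)
  case empty
  then show ?case by (intro exI[of _ \<phi>]) (auto simp: RW_gen_eq_mon)
next
  case (add k K)
  have adm: "adm r s K" and k: "k \<in> {1..r+s}" using add.prems(1) by (auto simp: adm_add_mset_iff)
  define p where "p = mpar r K + par r j"
  define n where "n = inv_cnt r {#k#} K"
  have hom: "RW_mon K j \<in> hom_part R p" by (simp only: R_simps p_def) (rule RW_mon_parity[OF adm assms(2)], simp)
  \<comment> \<open>The sign collects the reordering sign \<open>n\<close>, the crossing of the
    derivative over \<open>RW_mon K j\<close> of parity \<open>p\<close>, and the minus sign of the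
    trade.\<close>
  define \<phi>1 where "\<phi>1 = sg (n + par r k * p + 1) (ldery r s k \<phi>)"
  have supp: "supported \<phi>1" using supported_ldery by (simp add: supported_def \<phi>1_def sg_apply)
  obtain \<phi>' where \<phi>': "supported \<phi>'" "tens (RW_mon K j) \<phi>1 - tens (RW_gen j) \<phi>' \<in> tilde_null r s R"
    "\<And>M. \<phi>' M \<noteq> 0 \<Longrightarrow> \<exists>M'. \<phi>1 M' \<noteq> 0 \<and> size M' = size M + size K"
    using add.IH[OF adm supp] by blast
  have mon: "RW_mon (add_mset k K) j = sg n (dleft R k (RW_mon K j))"
    using add.prems(1) by (simp add: R_simps lmul_RW_mon n_def) (simp add: sg_def)
  have "null_op k (tens (RW_mon K j) (sg n \<phi>)) = tens (RW_mon (add_mset k K) j) \<phi> - tens (RW_mon K j) \<phi>1"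
    by (subst null_op_tens[OF k hom])
      (simp add: mon \<phi>1_def additive_mapD(4)[OF additive_ldery] tens_sg, auto simp: sg_def)
  moreover have "null_op k (tens (RW_mon K j) (sg n \<phi>)) \<in> tilde_null r s R"
    using add.prems(2) hom by (intro null_op_null[OF k] tens_tilde hom_carr) (auto simp: supported_def sg_apply)
  ultimately have "tens (RW_mon (add_mset k K) j) \<phi> - tens (RW_gen j) \<phi>' \<in> tilde_null r s R"
    using null_add[OF _ \<phi>'(2)] by fastforce
  \<comment> \<open>Each traded \<open>\<partial>\<^sub>k\<close> shortens the exponent of the
    series by one. Recording this shows that the reduction preserves degrees.\<close>
  moreover have "\<exists>M'. \<phi> M' \<noteq> 0 \<and> size M' = size M + size (add_mset k K)" if M: "\<phi>' M \<noteq> 0" for M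
  proof -
    obtain M' where M': "\<phi>1 M' \<noteq> 0" "size M' = size M + size K" using \<phi>'(3)[OF M] by blast
    then have "\<phi> (add_mset k M') \<noteq> 0" by (auto simp: \<phi>1_def sg_apply ldery_def split: if_splits)
    then show ?thesis using M'(2) by (intro exI[of _ "add_mset k M'"]) simp
  qed
  ultimately show ?case using \<phi>'(1) by blast
qed

lemma zero_rw_apply: "(0 :: mono \<Rightarrow> 'f rw) M = 0"
  by (rule zero_fun_apply)

lemma tens_sum_right: "tens b (\<Sum>i\<in>A. f i) = (\<Sum>i\<in>A. tens b (f i))"
  by (induction A rule: infinite_finite_induct) (auto simp: tens_add)

text \<open>The reduction lowers the lengths of the \<open>\<partial>\<close>-monomial and of the
  \<open>y\<close>-monomial by the same amount, so the degree is kept. The series attached to the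
  generators are therefore concentrated on exponents of one length, the one fixed by
  \<open>d\<close>.\<close>

lemma grade_reduce:
  assumes F: "F \<in> tilde r s R" and deg: "\<And>M. F M \<in> RW_grade r s (d - 2 * int (size M))"
  obtains \<phi> where "\<And>j. supported (\<phi> j)" "\<And>j M. \<phi> j M \<noteq> 0 \<Longrightarrow> d = - 2 + 2 * int (size M)"
    "F - (\<Sum>j\<in>{1..r+s}. tens (RW_gen j) (\<phi> j)) \<in> tilde_null r s R"
proof -
  let ?S = "{K. \<exists>M. F M K \<noteq> 0}"
  define Q where "Q K j \<phi>' \<longleftrightarrow> supported \<phi>' \<and> (\<forall>M. \<phi>' M \<noteq> 0 \<longrightarrow> d = - 2 + 2 * int (size M)) \<and>
     (K \<in> ?S \<longrightarrow> j \<in> {1..r+s} \<longrightarrow> tens (RW_mon K j) (\<lambda>M. F M K j) - tens (RW_gen j) \<phi>' \<in> tilde_null r s R)"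
    for K j \<phi>'
  have "\<exists>\<phi>'. Q K j \<phi>'" for K j
  proof (cases "K \<in> ?S \<and> j \<in> {1..r+s}")
    case True
    then obtain M where "F M K \<noteq> 0" by blast
    then have adm: "adm r s K" using tildeD(1)[OF F, of M] by (auto simp: R_simps RW_carrier_iff fun_eq_iff zero_fun_apply)
    have supp: "supported (\<lambda>M. F M K j)" using tildeD(2)[OF F] by (simp add: supported_def zero_fun_apply)
    obtain \<phi>' where \<phi>': "supported \<phi>'" "tens (RW_mon K j) (\<lambda>M. F M K j) - tens (RW_gen j) \<phi>' \<in> tilde_null r s R"
      "\<And>M. \<phi>' M \<noteq> 0 \<Longrightarrow> \<exists>M'. F M' K j \<noteq> 0 \<and> size M' = size M + size K"
      using tens_mon_reduce[OF adm _ supp] True by blast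
    have "d = - 2 + 2 * int (size M)" if M: "\<phi>' M \<noteq> 0" for M
    proof -
      obtain M' where M': "F M' K j \<noteq> 0" "size M' = size M + size K" using \<phi>'(3)[OF M] by blast
      then have "d - 2 * int (size M') = - 2 - 2 * int (size K)" using deg[of M'] by (auto simp: RW_grade_iff)
      then show ?thesis using M'(2) by simp
    qed
    then show ?thesis using \<phi>' unfolding Q_def by blast
  qed (auto intro!: exI[of _ 0] simp: Q_def supported_def zero_fun_apply)
  then obtain \<phi> where "\<And>K j. Q K j (\<phi> K j)" by metis
  then have \<phi>: "\<And>K j. supported (\<phi> K j)" "\<And>K j M. \<phi> K j M \<noteq> 0 \<Longrightarrow> d = - 2 + 2 * int (size M)"
    "\<And>K j. K \<in> ?S \<Longrightarrow> j \<in> {1..r+s} \<Longrightarrow> tens (RW_mon K j) (\<lambda>M. F M K j) - tens (RW_gen j) (\<phi> K j) \<in> tilde_null r s R"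
    unfolding Q_def by blast+
  define \<psi> where "\<psi> j = (\<Sum>K\<in>?S. \<phi> K j)" for j
  have supp: "supported (\<psi> j)" for j
    using \<phi>(1) by (auto simp: supported_def \<psi>_def sum_apply intro!: sum.neutral)
  have deg: "d = - 2 + 2 * int (size M)" if "\<psi> j M \<noteq> 0" for j M
    using that \<phi>(2) by (auto simp: \<psi>_def sum_apply elim!: sum.not_neutral_contains_not_neutral)
  have "(\<Sum>j\<in>{1..r+s}. tens (RW_gen j) (\<psi> j)) = (\<Sum>K\<in>?S. \<Sum>j\<in>{1..r+s}. tens (RW_gen j) (\<phi> K j))"
    unfolding \<psi>_def tens_sum_right by (rule sum.swap)
  then have "F - (\<Sum>j\<in>{1..r+s}. tens (RW_gen j) (\<psi> j)) =
      (\<Sum>K\<in>?S. \<Sum>j\<in>{1..r+s}. tens (RW_mon K j) (\<lambda>M. F M K j) - tens (RW_gen j) (\<phi> K j))"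
    by (subst tilde_mon_expand[OF F]) (simp add: sum_subtractf)
  also have "\<dots> \<in> tilde_null r s R" using \<phi>(3) by (intro null_sum)
  finally show ?thesis using that[of \<psi>] supp deg by blast
qed

lemma ann_grade_eq: "ann_grade r s R (RW_grade r s) d =
    {F +o tilde_null r s R | F. F \<in> tilde r s R \<and> (\<forall>M. F M \<in> RW_grade r s (d - 2 * int (size M)))}"
  by (simp add: ann_grade_def)

lemma null_coset: "F \<in> tilde_null r s R \<Longrightarrow> F +o tilde_null r s R = tilde_null r s R"
  using coset_eq_iff[of F 0] by simp

text \<open>A generator times a monomial in \<open>y\<close> has degree at least -2, so below -3 all
  series in the reduced representative are 0.\<close>

lemma depth_RW: "ann_depth_le r s R (RW_grade r s) 3"
  unfolding ann_depth_le_def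
proof (intro allI impI)
  fix d :: int assume d: "d < - 3"
  have "F \<in> tilde_null r s R" if F: "F \<in> tilde r s R" "\<And>M. F M \<in> RW_grade r s (d - 2 * int (size M))" for F
  proof -
    obtain \<phi> where \<phi>: "\<And>j M. \<phi> j M \<noteq> 0 \<Longrightarrow> d = - 2 + 2 * int (size M)"
      "F - (\<Sum>j\<in>{1..r+s}. tens (RW_gen j) (\<phi> j)) \<in> tilde_null r s R" by (rule grade_reduce[OF F]) blast
    have "\<phi> j M = 0" for j M using \<phi>(1)[of j M] d by fastforce
    then have "\<phi> j = 0" for j by (simp add: fun_eq_iff zero_fun_apply)
    with \<phi>(2) show ?thesis by simp
  qed
  then have "ann_grade r s R (RW_grade r s) d \<subseteq> {tilde_null r s R}"
    by (auto simp: ann_grade_eq null_coset)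
  moreover have "tilde_null r s R \<in> ann_grade r s R (RW_grade r s) d"
    unfolding ann_grade_eq using null_coset[OF null_zero] by (intro CollectI exI[of _ 0]) (simp add: zero_fun_apply)
  ultimately show "ann_grade r s R (RW_grade r s) d = {tilde_null r s R}" by auto
qed

text \<open>Generators, \<open>\<partial>\<close> and \<open>y\<close> all have even degree, so a
  component of odd degree is 0, and 0 belongs to every parity.\<close>

lemma purely_odd_RW:
  assumes "odd d"
  shows "ann_purely_odd r s R (RW_grade r s) d"
  unfolding ann_purely_odd_def
proof
  fix X assume "X \<in> ann_grade r s R (RW_grade r s) d"
  then obtain F where X: "X = F +o tilde_null r s R" and F: "F \<in> tilde r s R" "\<And>M. F M \<in> RW_grade r s (d - 2 * int (size M))"
    by (auto simp: ann_grade_eq)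
  have "F M K j = 0" for M K j
  proof (rule ccontr)
    assume "F M K j \<noteq> 0"
    then have "d - 2 * int (size M) = - 2 - 2 * int (size K)" using F(2)[of M] by (auto simp: RW_grade_iff)
    then have "d = 2 * (int (size M) - 1 - int (size K))" by simp
    with assms show False by simp
  qed
  then have "F M = 0" for M by (simp add: fun_eq_iff zero_fun_apply)
  then show "X \<in> ann_parity r s R 1"
    using F(1) hom_zero by (auto simp: X ann_parity_def)
qed

section \<open>Degree -2 and its adjoint action\<close>

definition gen_comb :: "(nat \<Rightarrow> 'f) \<Rightarrow> mono \<Rightarrow> 'f rw" where
  "gen_comb c = (\<Sum>j\<in>{1..r+s}. tens (RW_gen j) (\<lambda>M. if M = {#} then c j else 0))"

lemma gen_comb_tilde: "gen_comb c \<in> tilde r s R"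
  unfolding gen_comb_def
  by (intro tilde_sum tens_tilde) (auto simp: R_simps RW_gen_carrier supported_def)

lemma ann_grade_minus2: "ann_grade r s R (RW_grade r s) (- 2) = range (\<lambda>c. gen_comb c +o tilde_null r s R)"
proof (intro equalityI subsetI)
  fix X assume "X \<in> ann_grade r s R (RW_grade r s) (- 2)"
  then obtain F where X: "X = F +o tilde_null r s R" and F: "F \<in> tilde r s R" "\<And>M. F M \<in> RW_grade r s (- 2 - 2 * int (size M))"
    by (auto simp: ann_grade_eq)
  obtain \<phi> where \<phi>: "\<And>j M. \<phi> j M \<noteq> 0 \<Longrightarrow> - 2 = - 2 + 2 * int (size M)"
      "F - (\<Sum>j\<in>{1..r+s}. tens (RW_gen j) (\<phi> j)) \<in> tilde_null r s R" by (rule grade_reduce[OF F]) blast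
  have "\<phi> j = (\<lambda>M. if M = {#} then \<phi> j {#} else 0)" for j
  proof
    fix M show "\<phi> j M = (if M = {#} then \<phi> j {#} else 0)" using \<phi>(1)[of j M] by auto
  qed
  then have "(\<Sum>j\<in>{1..r+s}. tens (RW_gen j) (\<phi> j)) = gen_comb (\<lambda>j. \<phi> j {#})"
    unfolding gen_comb_def by (intro sum.cong refl arg_cong2[where f = tens])
  with \<phi>(2) show "X \<in> range (\<lambda>c. gen_comb c +o tilde_null r s R)"
    by (auto simp: X coset_eq_iff[symmetric])
next
  fix X assume "X \<in> range (\<lambda>c. gen_comb c +o tilde_null r s R)"
  then obtain c where X: "X = gen_comb c +o tilde_null r s R" by blast
  have "gen_comb c M \<in> RW_grade r s (- 2 - 2 * int (size M))" for M
  proof -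
    have eq: "gen_comb c M = (\<Sum>j\<in>{1..r+s}. scl R (if M = {#} then c j else 0) (RW_gen j))"
      by (intro ext) (simp add: gen_comb_def sum_apply tens_def)
    show ?thesis
      unfolding eq by (rule sum_closed) (auto simp: R_simps RW_gen_grade RW_grade_scale RW_grade_add)
  qed
  then show "X \<in> ann_grade r s R (RW_grade r s) (- 2)"
    using gen_comb_tilde by (auto simp: X ann_grade_eq)
qed

text \<open>On generators only \<open>\<partial>\<^sub>j a\<^sub>i\<close> is free of
  \<open>\<lambda>\<close>. For general \<open>y\<close>, right sesquilinearity at
  \<open>\<lambda> = 0\<close> says that the constant term supercommutes with every
  \<open>\<partial>\<^sub>k\<close>, as \<open>\<partial>\<^sub>j\<close> does.\<close>

lemma bracket_gen_const_term:
  assumes j: "j \<in> {1..r+s}" and y: "y \<in> RW_carrier r s"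
  shows "RW_bracket r s (RW_gen j) y {#} = (lmul r s j y :: 'f rw)"
  using y
proof (induction rule: RW_carrier_induct)
  case (add x y)
  then show ?case using j by (simp add: RW_bracket_add_right RW_gen_carrier plus_fun_apply[of _ _ "{#}"] additive_mapD(1)[OF additive_lmul])
next
  case (hom p x)
  then show ?case
  proof (induction rule: RW_hom_induct)
    case (zero q)
    then show ?case by (simp add: additive_mapD(2)[OF additive_lmul] zero_fun_apply[of "{#}"])
  next
    case (add q x y)
    then show ?case
      using j by (simp add: RW_bracket_add_right RW_gen_carrier RW_parity_carrier plus_fun_apply[of _ _ "{#}"] additive_mapD(1)[OF additive_lmul])
  next
    case (scale q c x)
    then show ?case using j by (simp add: RW_bracket_scale_right RW_gen_carrier RW_parity_carrier fscale_def lmul_RW_scale)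
  next
    case (gen i)
    then show ?case using j by (simp add: RW_bracket_gen RW_gen_bracket_def plus_fun_apply[of _ _ "{#}"] sg_apply lmul_notin const_apply)
  next
    case (lmul q k x)
    then have "RW_bracket r s (RW_gen j) (lmul r s k x) {#} = sg (par r k * par r j) (lmul r s k (lmul r s j x))"
      using j by (simp add: RW_bracket_lmul_right[OF RW_gen_parity] RW_parity_carrier sg_apply plus_fun_apply[of _ _ "{#}"] lmul_notin lift_def)
    also have "\<dots> = lmul r s j (lmul r s k x)"
      using supercommuteD[OF supercommute_lmul, of r s j k x] by (simp add: mult.commute)
    finally show ?case .
  qed
qed

lemma series_mult_const: "supported \<psi> \<Longrightarrow> series_mult r s (\<lambda>M. if M = {#} then c else 0) \<psi> = (\<lambda>P. c * \<psi> P)"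
proof
  fix P assume supp: "supported \<psi>"
  have "(\<Sum>M | M \<subseteq># P. sg (inv_cnt r M (P - M)) ((if M = {#} then c else 0) * \<psi> (P - M))) =
      (\<Sum>M | M \<subseteq># P. if M = {#} then c * \<psi> P else 0)"
    by (rule sum.cong) auto
  also have "\<dots> = c * \<psi> P" by (simp add: finite_submultisets)
  finally show "series_mult r s (\<lambda>M. if M = {#} then c else 0) \<psi> P = c * \<psi> P"
    using supp by (simp add: series_mult_def supported_def)
qed

text \<open>The first series is constant, so every term that differentiates it vanishes and only the
  constant term of the \<open>\<lambda>\<close>-bracket remains.\<close>

lemma tilde_bracket_gen:
  assumes j: "j \<in> {1..r+s}" and G: "G \<in> tilde r s R"
  shows "tilde_bracket r s R (tens (RW_gen j) (\<lambda>M. if M = {#} then c else 0)) G = fscale (scl R) c (\<lambda>M. dleft R j (G M))"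
  using G
proof (induction rule: tilde_induct)
  let ?\<delta> = "\<lambda>M :: mono. if M = {#} then c else 0"
  have supp: "supported ?\<delta>" by (simp add: supported_def)
  have gen: "RW_gen j \<in> hom_part R (par r j)" using j by (simp add: R_simps RW_gen_parity)
  note gt = tens_tilde[OF hom_carr[OF gen] supp]
  {
    case zero
    have "(\<lambda>M. dleft R j ((0 :: mono \<Rightarrow> 'f rw) M)) = 0"
      by (rule ext) (simp only: zero_rw_apply dleft_zero[OF j])
    moreover have "fscale (scl R) c (0 :: mono \<Rightarrow> 'f rw) = 0" by (rule ext) (simp add: fscale_def zero_rw_apply)
    ultimately show ?case by (simp only: tilde_bracket_zero[OF gt])
  next
    case (add F G)
    then show ?case using gt j by (simp only: tilde_bracket_add_right dleft_fun_add fscale_add)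
  next
    case (tens b p \<phi>)
    have tw: "twist_series r n ?\<delta> = ?\<delta>" for n by (auto simp: twist_series_def)
    have rd: "rderys r s J ?\<delta> = (if J = {#} then ?\<delta> else 0)" for J
    proof (cases "J = {#}")
      case False
      then show ?thesis by (intro ext, subst rderys_apply) (simp add: zero_fun_apply)
    qed (simp add: rderys_def)
    have sm0: "series_mult r s 0 \<phi> = 0" by (simp add: series_mult_def fun_eq_iff zero_fun_apply)
    have tm: "tens (lbr R (RW_gen j) b J) (series_mult r s (twist_series r (par r j + p + mpar r J) (rderys r s J ?\<delta>)) \<phi>) =
        (if J = {#} then tens (lbr R (RW_gen j) b {#}) (series_mult r s ?\<delta> \<phi>) else 0)" for J
      unfolding rd using tw by (cases "J = {#}") (simp_all add: additive_mapD(2)[OF additive_twist_series] sm0)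
    have "tilde_bracket r s R (tens (RW_gen j) ?\<delta>) (tens b \<phi>) = series_bracket (par r j + p) (lbr R (RW_gen j) b) ?\<delta> \<phi>"
      unfolding tilde_bracket_tens[OF gen tens(1) supp tens(2)] tw ..
    \<comment> \<open>The empty multiset is added because it need not lie in the support of the
      bracket.\<close>
    also have "\<dots> = (\<Sum>J\<in>insert {#} {J. lbr R (RW_gen j) b J \<noteq> 0}. if J = {#} then tens (lbr R (RW_gen j) b {#}) (series_mult r s ?\<delta> \<phi>) else 0)"
      unfolding tm[symmetric]
      by (rule series_bracket_superset) (use bracket_finite[OF hom_carr[OF gen] hom_carr[OF tens(1)]] in auto)
    also have "\<dots> = tens (dleft R j b) (\<lambda>P. c * \<phi> P)"
      using bracket_finite[OF hom_carr[OF gen] hom_carr[OF tens(1)]] hom_carr[OF tens(1)] j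
      by (simp add: series_mult_const[OF tens(2)] R_simps bracket_gen_const_term)
    also have "\<dots> = fscale (scl R) c (\<lambda>M. dleft R j (tens b \<phi> M))"
      unfolding dleft_tens[OF j hom_carr[OF tens(1)]] by (simp add: tens_def fscale_def)
    finally show ?case .
  }
qed

lemma ann_ad_gen_comb: "ann_ad r s R (gen_comb c +o tilde_null r s R) = quot_map r s R (dery_comb (\<lambda>j. - c j))"
proof
  fix Y
  show "ann_ad r s R (gen_comb c +o tilde_null r s R) Y = quot_map r s R (dery_comb (\<lambda>j. - c j)) Y"
  proof (cases "Y \<in> ann r s R")
    case True
    then obtain G where G: "G \<in> tilde r s R" and Y: "Y = G +o tilde_null r s R" by (auto simp: ann_def)
    have gt: "tens (RW_gen j) (\<lambda>M. if M = {#} then c j else 0) \<in> tilde r s R" if "j \<in> {1..r+s}" for j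
      using that by (intro tens_tilde) (auto simp: R_simps RW_gen_carrier supported_def)
    have sumL: "tilde_bracket r s R (\<Sum>j\<in>A. f j) G = (\<Sum>j\<in>A. tilde_bracket r s R (f j) G)"
      if "\<And>j. j \<in> A \<Longrightarrow> f j \<in> tilde r s R" for A :: "nat set" and f
      using that by (induction A rule: infinite_finite_induct) (auto simp: G tilde_bracket_zero tilde_bracket_add_left tilde_sum)
    have "tilde_bracket r s R (gen_comb c) G = (\<Sum>j\<in>{1..r+s}. fscale (scl R) (c j) (\<lambda>M. dleft R j (G M)))"
      unfolding gen_comb_def by (subst sumL) (auto simp: gt tilde_bracket_gen G)
    also have "\<dots> = (\<Sum>j\<in>{1..r+s}. fscale (scl R) (c j) (null_op j G) + fscale (scl R) (- c j) (dery r s R j G))"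
      by (rule sum.cong) (simp_all add: null_op_def fscale_def fun_eq_iff plus_fun_apply V.scale_right_distrib V.scale_minus_left)
    also have "\<dots> = (\<Sum>j\<in>{1..r+s}. fscale (scl R) (c j) (null_op j G)) + dery_comb (\<lambda>j. - c j) G"
      by (simp add: dery_comb_def sum.distrib)
    finally have "tilde_bracket r s R (gen_comb c) G - dery_comb (\<lambda>j. - c j) G = (\<Sum>j\<in>{1..r+s}. fscale (scl R) (c j) (null_op j G))"
      by simp
    also have "\<dots> \<in> tilde_null r s R" by (intro null_sum null_scale null_op_null G)
    finally have "ann_bracket r s R (gen_comb c +o tilde_null r s R) Y = dery_comb (\<lambda>j. - c j) G +o tilde_null r s R"
      by (simp add: Y ann_bracket_coset[OF gen_comb_tilde G] coset_eq_iff)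
    then show ?thesis using True by (simp add: ann_ad_def) (simp add: Y quot_dery_comb[OF G])
  qed (simp add: ann_ad_def quot_map_def)
qed

text \<open>The functional \<open>F \<mapsto> \<Sum>\<^sub>K w\<^sub>K F\<^bsub>K,K,i\<^esub>\<close> reads off the coefficient of \<open>a\<^sub>i\<close> after all \<open>\<partial>\<^sub>K\<close> have been
  traded for derivatives, so it vanishes on \<open>tilde_null\<close>; the recursion below determines the weights.\<close>

definition weight :: "nat \<Rightarrow> mono \<Rightarrow> 'f" where
  "weight i K = sg (size K + mpar r K * par r i + (mpar r K choose 2)) (\<Prod>m\<in>{1..r+s}. of_nat (fact (count K m)))"

lemma weight_empty [simp]: "weight i {#} = 1"
  by (simp add: weight_def sg_def numeral_2_eq_2)

text \<open>Since \<open>mpar r K\<close> counts the odd entries of \<open>K\<close>, adding an odd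
  index raises \<open>mpar r K choose 2\<close> by \<open>mpar r K\<close>; this accumulates the
  signs of the pairs of odd indices. The factorials supply \<open>count K k + 1\<close>, and
  \<open>size K\<close> the minus sign.\<close>

lemma weight_add_mset:
  assumes "k \<in> {1..r+s}"
  shows "weight i (add_mset k K) = - sg (par r k * (mpar r K + par r i)) (of_nat (count K k + 1) * weight i K)"
proof -
  have "(\<Prod>m\<in>{1..r+s}. of_nat (fact (count (add_mset k K) m)) :: 'f) =
      (\<Prod>m\<in>{1..r+s}. (if m = k then of_nat (count K k + 1) else 1) * of_nat (fact (count K m)))"
    by (rule prod.cong) auto
  also have "\<dots> = of_nat (count K k + 1) * (\<Prod>m\<in>{1..r+s}. of_nat (fact (count K m)))"
    using assms by (subst prod.distrib) simp
  finally have prod: "(\<Prod>m\<in>{1..r+s}. of_nat (fact (count (add_mset k K) m)) :: 'f) =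
      of_nat (count K k + 1) * (\<Prod>m\<in>{1..r+s}. of_nat (fact (count K m)))" .
  have choose: "mpar r (add_mset k K) choose 2 = par r k * mpar r K + (mpar r K choose 2)"
    by (simp add: par_def numeral_2_eq_2)
  have "weight i (add_mset k K) = sg (size K + 1 + (par r k + mpar r K) * par r i + (par r k * mpar r K + (mpar r K choose 2)))
      (of_nat (count K k + 1) * (\<Prod>m\<in>{1..r+s}. of_nat (fact (count K m))))"
    unfolding weight_def prod choose by simp
  also have "\<dots> = sg (1 + (par r k * (mpar r K + par r i) + (size K + mpar r K * par r i + (mpar r K choose 2))))
      (of_nat (count K k + 1) * (\<Prod>m\<in>{1..r+s}. of_nat (fact (count K m))))"
    by (rule arg_cong2[where f = sg]) (simp_all add: algebra_simps)
  also have "\<dots> = - sg (par r k * (mpar r K + par r i)) (of_nat (count K k + 1) * weight i K)"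
    unfolding weight_def sg_sg[symmetric] sg_mult(2)[symmetric] by (simp add: sg_def)
  finally show ?thesis .
qed

text \<open>Trading \<open>\<partial>\<^sub>K\<close> for derivatives leaves a constant term only
  from \<open>y\<^sub>K\<close>, hence the diagonal. On \<open>tilde\<close> the sum is finite,
  because only finitely many \<open>\<partial>\<^sub>K\<close> occur.\<close>

definition gen_coeff :: "nat \<Rightarrow> (mono \<Rightarrow> 'f rw) \<Rightarrow> 'f" where
  "gen_coeff i F = Sum_any (\<lambda>K. weight i K * F K K i)"

lemma gen_coeff_finite:
  assumes "F \<in> tilde r s R"
  shows "finite {K. weight i K * F K K i \<noteq> 0}"
  by (rule finite_subset[OF _ tilde_finite_support[OF assms]]) (auto simp: fun_eq_iff zero_fun_apply)

lemma gen_coeff_add: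
  assumes "F \<in> tilde r s R" "G \<in> tilde r s R"
  shows "gen_coeff i (F + G) = gen_coeff i F + gen_coeff i G"
  unfolding gen_coeff_def
  by (subst Sum_any.distrib[symmetric]) (use gen_coeff_finite assms in \<open>auto simp: plus_fun_apply algebra_simps\<close>)

lemma twist_RW:
  assumes "x \<in> RW_carrier r s"
  shows "twist R n x K j = sg (n * (mpar r K + par r j)) (x K j)"
proof -
  obtain y z where yz: "y \<in> RW_parity r s 0" "z \<in> RW_parity r s 1" "x = y + z"
    using RW_split[OF assms] by blast
  have "twist R n x = y + sg n z" using yz by (simp add: twist_split R_simps)
  moreover have "y K j = sg (n * (mpar r K + par r j)) (y K j)"
    using yz(1) by (cases "y K j = 0") (auto simp: RW_parity_iff sg_def)
  moreover have "sg n (z K j) = sg (n * (mpar r K + par r j)) (z K j)"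
    using yz(2) by (cases "z K j = 0") (auto simp: RW_parity_iff intro!: sg_eqI)
  ultimately show ?thesis by (simp add: yz(3) plus_fun_apply sg_apply sg_add)
qed

text \<open>The term of \<open>\<partial>\<^sub>k H\<close> at \<open>add_mset k K\<close> and the
  term of the derivative along \<open>y\<^sub>k\<close> at \<open>K\<close> both read the
  coefficient of \<open>H\<close> at exponent \<open>add_mset k K\<close> and basis element
  \<open>\<partial>\<^sub>K a\<^sub>i\<close>. The recursion for the weights makes their factors
  opposite.\<close>

lemma gen_coeff_null_op:
  assumes k: "k \<in> {1..r+s}" and H: "H \<in> tilde r s R"
  shows "gen_coeff i (null_op k H) = 0"
proof -
  define A B where "A = (\<lambda>K. weight i K * dleft R k (H K) K i)" and "B = (\<lambda>K. weight i K * dery r s R k H K K i)"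
  have AB: "A (add_mset k K) = - B K" for K
  proof (cases "adm r s (add_mset k K)")
    case True
    have tw: "twist R (par r k) (H (add_mset k K)) K i = sg (par r k * (mpar r K + par r i)) (H (add_mset k K) K i)"
      using tildeD(1)[OF H] by (intro twist_RW) (simp add: R_simps)
    have "B K = weight i K * (of_nat (count K k + 1) * sg (inv_cnt r {#k#} K) (sg (par r k * (mpar r K + par r i)) (H (add_mset k K) K i)))"
      using True by (simp add: B_def dery_def R_simps RW_scale_apply sg_apply tw del: sg_sg)
    moreover have "A (add_mset k K) = weight i (add_mset k K) * sg (inv_cnt r {#k#} K) (H (add_mset k K) K i)"
      using True by (simp add: A_def R_simps lmul_add_mset sg_apply)
    ultimately show ?thesis
      unfolding weight_add_mset[OF k] by (simp add: sg_def)
  next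
    case False
    then show ?thesis by (simp add: A_def B_def R_simps lmul_add_mset dery_def zero_fun_apply)
  qed
  have A0: "A K = 0" if "k \<notin># K" for K using that by (simp add: A_def R_simps lmul_notin zero_fun_apply)
  have finA: "finite {K. A K \<noteq> 0}" and finB: "finite {K. B K \<noteq> 0}"
    using gen_coeff_finite[OF dleft_tilde[OF k H]] gen_coeff_finite[OF dery_tilde[OF H]] by (simp_all add: A_def B_def)
  have "Sum_any A = sum A (add_mset k ` {K. B K \<noteq> 0})"
  proof (rule Sum_any.expand_superset)
    show "{K. A K \<noteq> 0} \<subseteq> add_mset k ` {K. B K \<noteq> 0}"
    proof
      fix K assume "K \<in> {K. A K \<noteq> 0}"
      then have "A K \<noteq> 0" by simp
      then have "k \<in># K" using A0 by blast
      then obtain L where "K = add_mset k L" by (metis insert_DiffM)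
      with \<open>A K \<noteq> 0\<close> show "K \<in> add_mset k ` {K. B K \<noteq> 0}" by (auto simp: AB)
    qed
  qed (use finB in simp)
  also have "\<dots> = (\<Sum>K | B K \<noteq> 0. - B K)" by (subst sum.reindex) (auto simp: inj_on_def AB)
  also have "\<dots> = - Sum_any B" by (simp add: Sum_any.expand_set sum_negf)
  finally show ?thesis
    unfolding null_op_def gen_coeff_add[OF dleft_tilde[OF k H] dery_tilde[OF H]] by (simp add: gen_coeff_def A_def B_def)
qed

lemma gen_coeff_null: "F \<in> tilde_null r s R \<Longrightarrow> gen_coeff i F = 0"
proof (induction rule: null_induct)
  case (add F G)
  then show ?case by (simp add: gen_coeff_add null_tilde)
qed (simp_all add: gen_coeff_null_op, simp add: gen_coeff_def zero_fun_apply)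

lemma inj_ad: "inj_on (ann_ad r s R) (ann_grade r s R (RW_grade r s) (- 2))"
proof (rule inj_onI)
  fix X Y assume "X \<in> ann_grade r s R (RW_grade r s) (- 2)" "Y \<in> ann_grade r s R (RW_grade r s) (- 2)"
    and eq: "ann_ad r s R X = ann_ad r s R Y"
  then obtain c d where X: "X = gen_comb c +o tilde_null r s R" and Y: "Y = gen_comb d +o tilde_null r s R"
    unfolding ann_grade_minus2 by blast
  have "c i = d i" if i: "i \<in> {1..r+s}" for i
  proof -
    define G where "G = tens (RW_gen i) (ymono {#i#})"
    have gen: "RW_gen i \<in> hom_part R (par r i)" using i by (simp add: R_simps RW_gen_parity)
    have G: "G \<in> tilde r s R"
      unfolding G_def using i by (intro tens_tilde hom_carr[OF gen]) (auto simp: supported_def ymono_def adm_single)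
    \<comment> \<open>Among the derivatives of \<open>y\<^sub>i\<close> only the one along
      \<open>y\<^sub>i\<close> itself is nonzero, with value 1, so the result is a multiple of
      \<open>a\<^sub>i\<close> whose factor \<open>gen_coeff i\<close> returns. The sign comes from
      the derivative crossing \<open>a\<^sub>i\<close>.\<close>
    have comb: "gen_coeff i (dery_comb (\<lambda>j. - e j) G) = - sg (par r i * par r i) (e i)" for e
    proof -
      have ld: "ldery r s k (ymono {#i#}) = (\<lambda>P. if k = i \<and> P = {#} then 1 else 0 :: 'f)" for k
        using i by (auto simp: ldery_def ymono_def fun_eq_iff adm_single add_eq_conv_ex)
      have "dery_comb (\<lambda>j. - e j) G = (\<Sum>k\<in>{1..r+s}. if k = i
          then fscale (scl R) (- e i) (tens (sg (par r i * par r i) (RW_gen i)) (\<lambda>P. if P = {#} then 1 else 0)) else 0)"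
        unfolding dery_comb_def G_def dery_tens[OF gen] ld
        by (rule sum.cong) (auto simp: tens_def fscale_def fun_eq_iff zero_fun_apply)
      then have *: "dery_comb (\<lambda>j. - e j) G K K i = (if K = {#} then - sg (par r i * par r i) (e i) else 0)" for K
        using i by (auto simp: fscale_def tens_def R_simps RW_scale_apply sg_apply RW_gen_def const_def zero_fun_apply)
          (auto simp: sg_def)
      then have eq: "(\<lambda>K. weight i K * dery_comb (\<lambda>j. - e j) G K K i) = (\<lambda>K. if K = {#} then - sg (par r i * par r i) (e i) else 0)"
        by auto
      show ?thesis unfolding gen_coeff_def eq by (rule Sum_any.delta)
    qed
    have "quot_map r s R (dery_comb (\<lambda>j. - c j)) (G +o tilde_null r s R) = quot_map r s R (dery_comb (\<lambda>j. - d j)) (G +o tilde_null r s R)"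
      using eq by (simp add: X Y ann_ad_gen_comb)
    then have "dery_comb (\<lambda>j. - c j) G - dery_comb (\<lambda>j. - d j) G \<in> tilde_null r s R"
      by (simp add: quot_dery_comb[OF G] coset_eq_iff)
    then have null: "gen_coeff i (dery_comb (\<lambda>j. - c j) G - dery_comb (\<lambda>j. - d j) G) = 0"
      by (rule gen_coeff_null)
    have "gen_coeff i (dery_comb (\<lambda>j. - c j) G) =
        gen_coeff i (dery_comb (\<lambda>j. - c j) G - dery_comb (\<lambda>j. - d j) G) + gen_coeff i (dery_comb (\<lambda>j. - d j) G)"
      by (subst gen_coeff_add[symmetric]) (simp_all add: tilde_diff dery_comb_tilde G)
    then show ?thesis unfolding null comb by (simp add: sg_def split: if_splits)
  qed
  then have "gen_comb c = gen_comb d" unfolding gen_comb_def by (intro sum.cong refl) (simp cong: if_cong)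
  then show "X = Y" by (simp add: X Y)
qed

lemma ad_iso_D: "ann_ad_iso_D r s R (RW_grade r s)"
proof -
  have "ann_ad r s R ` ann_grade r s R (RW_grade r s) (- 2) = range (\<lambda>c. quot_map r s R (dery_comb (\<lambda>j. - c j)))"
    unfolding ann_grade_minus2 image_image ann_ad_gen_comb ..
  also have "\<dots> = ann_D r s R"
  proof -
    have "quot_map r s R (dery_comb c) \<in> range (\<lambda>c. quot_map r s R (dery_comb (\<lambda>j. - c j)))" for c
      by (rule range_eqI[of _ _ "\<lambda>j. - c j"]) simp
    then show ?thesis unfolding ann_D_eq by auto
  qed
  finally show ?thesis
    unfolding ann_ad_iso_D_def using inj_ad ann_D_subset_ann_der by simp
qed

end

theorem proposition4p2:
  fixes r s :: nat
    and R :: "('f::{alg_closed_field, field_char_0}, 'f rw) lcs"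
  assumes "R = RW r s"
  shows "lie_conformal_superalgebra r s R \<and>
    z_graded r s R (RW_grade r s) \<and>
    ann_depth_le r s R (RW_grade r s) 3 \<and>
    ann_purely_odd r s R (RW_grade r s) (-1) \<and>
    ann_purely_odd r s R (RW_grade r s) (-3) \<and>
    ann_ad_iso_D r s R (RW_grade r s)"
proof -
  interpret RW_superalgebra r s R by unfold_locales (rule assms)
  have "lie_conformal_superalgebra r s R" "z_graded r s R (RW_grade r s)"
    unfolding assms by (rule lie_conformal_superalgebra_RW z_graded_RW)+
  then show ?thesis
    using depth_RW purely_odd_RW[of "-1"] purely_odd_RW[of "-3"] ad_iso_D by simp
qed

end
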